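(* Let $b=a_0+\varphi b_0+\pi a_1\in\mathcal O_3^\times$ with $a_0\in\mu_{q^2-1}(\mathcal O_E)$, $b_0,a_1\in\mu_{q^2-1}(\mathcal O_E)\cup\{0\}$. Let $i=(\zeta,\tilde\mu)\in(\mathcal O_F/\pi^2)^\times\simeq\mathbb F_q^\times\times\mathbb F_q$ and $j=(x_0,y_0)\in\mathcal S^i_{00}$; put $ib={\rm Nrd}_{D/F}(b)^{-1}i$ and $jb=(x_0\bar a_0^{-1},y_0\bar a_0^{-1})\in\mathcal S^{ib}_{00}$. Then the right action of $b$ on $\mathcal X(\pi^2)$ induces the morphism $$b:X^i_j\to X^{ib}_{jb},\qquad (a,z_1)\mapsto\Bigl(\bar a_0^{-(q+1)}\bigl(a-(\bar b_0/\bar a_0)\zeta z_1+(\bar a_1/\bar a_0)\zeta\bigr),\ \bar a_0^{\,q-1}\bigl(z_1-(\bar b_0/\bar a_0)^q\bigr)\Bigr).$$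
   Context: **Lubin–Tate space.** $F$ is a non-archimedean local field with ring of integers $\mathcal O_F$, uniformizer $\pi$, residue field $\mathbb F_q$ of characteristic $p\ne2$; $\mathbf C$ is the completion of an algebraic closure of $F$, with ring of integers $\mathcal O_{\mathbf C}$, residue field $k^{\rm ac}$ and valuation $v$, $v(\pi)=1$; a bar denotes reduction. If ${\rm char}\,F=0$ let $f(X)=\sum_{k\ge 0}b_kX^{q^k}\in F[[u,X]]$ with $b_0=1$, $b_{-1}=0$, $\pi b_k=b_{k-1}u^{q^{k-1}}+b_{k-2}$ ($k\ge1$), and $X+_uY=f^{-1}(f(X)+f(Y))$, $[a]_u(X)=f^{-1}(af(X))$ (coefficients in $\mathcal O_F[[u]]$). If ${\rm char}\,F=p$, $F=\mathbb F_q((\pi))$, let $X+_uY=X+Y$, $[\zeta]_u(X)=\zeta X$ ($\zeta\in\mathbb F_q$), $[\pi]_u(X)=\pi X+uX^q+X^{q^2}$. For $u\in\mathbf C$, $v(u)>0$, this gives a formal $\mathcal O_F$-module $\mathcal F_u$ over $\mathcal O_{\mathbf C}$. $\mathcal X(\pi^2)$ is the Lubin–Tate curve whose $\mathbf C$-points are triples $(X_2,Y_2,u)$ with $v(u)>0$ and $(X_2,Y_2)$ a basis of the free $\mathcal O_F/\pi^2$-module $\mathcal F_u[\pi^2]$. The reduction of an affinoid over $\mathbf C$ is ${\rm Spec}$ of power-bounded functions modulo topologically nilpotent ones. **Action of $\mathcal O_D^\times$.** $\Sigma$ is the reduction of $\mathcal F_0$ over $k^{\rm ac}$, $\mathcal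 O_D={\rm End}(\Sigma)$ the maximal order of the quaternion division algebra $D/F$; $E/F$ is the unramified quadratic extension, $\mathcal O_D=\mathcal O_E\oplus\varphi\mathcal O_E$, $\varphi^2=\pi$, where $\varphi$ is $X\mapsto X^q$ and $\zeta\in\mu_{q^2-1}(\mathcal O_E)$ is $X\mapsto\bar\zeta X$. $b\in\mathcal O_D^\times$ acts on the right by $(X_2,Y_2,u)\mapsto(h(X_2),h(Y_2),u')$, where $u'$ and the isomorphism $h:\mathcal F_u\to\mathcal F_{u'}$ over $\mathcal O_{\mathbf C}$ are the unique ones with $h$ reducing to $b^{-1}$. The action on the curves below factors through $\mathcal O_3^\times=\mathcal O_D^\times/(1+\varphi^3\mathcal O_D)$. **The curves $X^i_j$.** $\mathbf Y_{2,2}=\{v(u)\ge q/(q+1)\}$. Fix $\kappa_1$ with $\kappa_1^{q^3(q^2-1)}=\pi$; put $\kappa=\kappa_1^q$, $\gamma=\kappa^{(q-1)(q^2-1)}$ (fractional powers of $\gamma$ being the corresponding powers of $\kappa_1$), $x=X_2/\kappa$, $y=Y_2/\kappa$. Fix $\gamma_0,\tilde\gamma_0,\tilde\gamma_1$ with $\gamma_0^q-\gamma^q\gamma_0=1$, $\tilde\gamma_0^q=\gamma_0$, $\tilde\gamma_1^q+\tilde\gamma_0+\gamma^{1/q}\tilde\gamma_1=0$. Identify $(\mathcal O_F/\pi^2)^\times\simeq\mathbb F_q^\times\times\mathbb F_q$ by $a_0+a_1\pi\mapsto(\bar a_0,\bar a_1/\bar a_0)$, $a_0\in\mu_{q-1}(\mathcal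 O_F)$, $a_1\in\mu_{q-1}(\mathcal O_F)\cup\{0\}$. For $i=(\zeta,\tilde\mu)$ write $[\zeta]\in\mu_{q-1}(\mathcal O_F)$ for the Teichmüller lift. The geometric connected component $\mathbf Y^i_{2,2}$ is the one on which $x^qy-xy^q$ reduces to $\zeta$ and, with $\mathcal Z=(x^qy-xy^q)^q-\gamma(x^{q^3}y-xy^{q^3})$ and $f_1(X,Y)=(X^q-Y^q-(X-Y)^q)/\pi$, the function $\gamma^{-q/(q-1)}([\zeta]\gamma_0-\mathcal Z)+f_1(x^{q^2}y^q,x^qy^{q^2})$ reduces to $\tilde\mu\zeta$. $\mathcal S^i_{00}=\{(x_0,y_0)\in((k^{\rm ac})^\times)^2:x_0^qy_0-x_0y_0^q=\zeta,\ x_0^{q^2-1}=y_0^{q^2-1}=-1\}$. For $j=(x_0,y_0)\in\mathcal S^i_{00}$ let $\hat y_0$ be the lift of $y_0$ with $\hat y_0^{q^2-1}=-\tilde\gamma_0^{q-1}$, $w=\gamma^{1/(q(q-1))}$, $w_1=\hat y_0^q\gamma^{1/(q^2-1)}$, and let $\mathbf X^i_j$ be the affinoid of points of $\mathbf Y^i_{2,2}$ with $(\bar x,\bar y)=j$ and $v(y-\hat y_0)\ge v(w_1)=\frac1{q^2(q+1)}$. On it define functions $Z_1,a,z_1$ by $x^qy-xy^q=[\zeta]\tilde\gamma_0+\gamma^{1/q}Z_1$, $Z_1=[\zeta]\tilde\gamma_1+wa$, $y=\hat y_0+w_1z_1$. $X^i_j$ is the reduction of $\mathbf X^i_j$; it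 is the curve with coordinates (the reductions of) $a,z_1$ and equation $a^q+a=\zeta z_1^{q+1}-c_0$ with $c_0=\tilde\mu\zeta-\bar f_1(x_0^{q^2}y_0^q,x_0^qy_0^{q^2})$. The same conventions define coordinates on $X^{ib}_{jb}$. *)

theory Defs
  imports
    "HOL-Analysis.Analysis"
    "HOL-Computational_Algebra.Formal_Power_Series"
    "HOL-Computational_Algebra.Polynomial"
    "HOL-Algebra.QuotRing"
begin

section \<open>Local fields and the field \<open>\<^bold>C\<close>\<close>

text \<open>
  The type \<open>'c\<close> is the field \<open>\<^bold>C\<close>, the type \<open>'k\<close> its residue field, and the local field
  \<open>F\<close> is a subset of \<open>'c\<close>.  The last four record fields are the auxiliary
  elements \<open>\<kappa>\<^sub>1\<close>, \<open>\<gamma>\<^sub>0\<close>, \<open>\<gamma>\<^sub>0~\<close>, \<open>\<gamma>\<^sub>1~\<close> of \<open>\<^bold>C\<close> fixed once and for all.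
\<close>

record ('c, 'k) lt_data =
  base :: "'c set"
  unif :: 'c
  val :: "'c \<Rightarrow> ereal"
  redn :: "'c \<Rightarrow> 'k"
  kap1 :: 'c
  gam0 :: 'c
  gamt0 :: 'c
  gamt1 :: 'c

definition subfield_set :: "'c::field set \<Rightarrow> bool" where
  "subfield_set K \<longleftrightarrow> 1 \<in> K \<and> (\<forall>x\<in>K. \<forall>y\<in>K. x - y \<in> K \<and> x * y \<in> K) \<and> (\<forall>x\<in>K. inverse x \<in> K)"

definition algebraic_over :: "'c::field set \<Rightarrow> 'c set" where
  "algebraic_over K = {x. \<exists>p. p \<noteq> 0 \<and> (\<forall>n. coeff p n \<in> K) \<and> poly p x = 0}"

definition OC :: "('c, 'k) lt_data \<Rightarrow> 'c set" where
  "OC L = {x. 0 \<le> val L x}"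

definition mC :: "('c, 'k) lt_data \<Rightarrow> 'c set" where
  "mC L = {x. 0 < val L x}"

definition OF_ring :: "('c, 'k) lt_data \<Rightarrow> 'c set" where
  "OF_ring L = base L \<inter> OC L"

definition qF :: "('c, 'k) lt_data \<Rightarrow> nat" where
  "qF L = card (redn L ` OF_ring L)"

definition lt_setup :: "('c::{field, complete_space}, 'k::field) lt_data \<Rightarrow> bool" where
  "lt_setup L \<longleftrightarrow>
    \<comment> \<open>\<open>v\<close> is a valuation on \<open>\<^bold>C\<close> and the metric of the (complete) type is the one it defines\<close>
    (\<forall>x. val L x = \<infinity> \<longleftrightarrow> x = 0) \<and> (\<forall>x. val L x \<noteq> - \<infinity>) \<and>
    (\<forall>x y. val L (x * y) = val L x + val L y) \<and>
    (\<forall>x y. min (val L x) (val L y) \<le> val L (x + y)) \<and>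
    (\<forall>x y. x \<noteq> y \<longrightarrow> dist x y = real (qF L) powr (- real_of_ereal (val L (x - y)))) \<and>
    \<comment> \<open>\<open>'k\<close> is the residue field of \<open>\<^bold>C\<close>\<close>
    redn L ` OC L = UNIV \<and> redn L 1 = 1 \<and>
    (\<forall>x\<in>OC L. \<forall>y\<in>OC L. redn L (x + y) = redn L x + redn L y \<and> redn L (x * y) = redn L x * redn L y) \<and>
    (\<forall>x\<in>OC L. redn L x = 0 \<longleftrightarrow> x \<in> mC L) \<and>
    \<comment> \<open>\<open>F\<close> is complete and discretely valued with finite residue field of characteristic \<open>\<noteq> 2\<close>\<close>
    subfield_set (base L) \<and> complete (base L) \<and>
    unif L \<in> base L \<and> val L (unif L) = 1 \<and>
    (\<forall>x\<in>base L. x \<noteq> 0 \<longrightarrow> (\<exists>n::int. val L x = ereal (of_int n))) \<and>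
    finite (redn L ` OF_ring L) \<and> CHAR('k) \<noteq> 2 \<and>
    \<comment> \<open>\<open>\<^bold>C\<close> is the completion of an algebraic closure of \<open>F\<close>\<close>
    (\<forall>p. (\<forall>n. coeff p n \<in> algebraic_over (base L)) \<and> degree p > 0 \<longrightarrow>
        (\<exists>x\<in>algebraic_over (base L). poly p x = 0)) \<and>
    closure (algebraic_over (base L)) = UNIV"

text \<open>
  The unramified quadratic extension \<open>E\<close> of \<open>F\<close> in \<open>\<^bold>C\<close>, generated by the roots of unity of order
  dividing \<open>q\<^sup>2 - 1\<close>.
\<close>

definition E_field :: "('c::field, 'k) lt_data \<Rightarrow> 'c set" where
  "E_field L = \<Inter>{K. subfield_set K \<and> base L \<subseteq> K \<and> {x. x ^ ((qF L)\<^sup>2 - 1) = 1} \<subseteq> K}"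

definition OE_ring :: "('c::field, 'k) lt_data \<Rightarrow> 'c set" where
  "OE_ring L = E_field L \<inter> OC L"

definition muE :: "('c::field, 'k) lt_data \<Rightarrow> 'c set" where
  "muE L = {x \<in> OE_ring L. x ^ ((qF L)\<^sup>2 - 1) = 1}"

definition teich :: "('c::field, 'k) lt_data \<Rightarrow> 'k \<Rightarrow> 'c" where
  "teich L c = (THE t. t \<in> base L \<and> t ^ qF L = t \<and> redn L t = c)"


section \<open>Formal groups\<close>

text \<open>
  A power series in \<open>X, Y\<close> is an element of \<open>'r fps fps\<close>, the outer variable being \<open>Y\<close>: the
  coefficient of \<open>X\<^sup>iY\<^sup>j\<close> in \<open>G\<close> is \<open>fps_nth (fps_nth G j) i\<close>.  All substitutions below are
  only meaningful for substituted series with vanishing constant term; this is what makes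
  the finite ranges of summation correct.
\<close>

definition in_X :: "'r::comm_ring_1 fps \<Rightarrow> 'r fps fps" where
  "in_X s = fps_const s"

definition in_Y :: "'r::comm_ring_1 fps \<Rightarrow> 'r fps fps" where
  "in_Y s = Abs_fps (\<lambda>j. fps_const (fps_nth s j))"

\<comment> \<open>\<open>s(G(X,Y))\<close>\<close>
definition subst1 :: "'r::comm_ring_1 fps \<Rightarrow> 'r fps fps \<Rightarrow> 'r fps fps" where
  "subst1 s G = Abs_fps (\<lambda>j. Abs_fps (\<lambda>i.
      \<Sum>n\<le>i + j. fps_nth s n * fps_nth (fps_nth (G ^ n) j) i))"

\<comment> \<open>\<open>G(s(X), t(Y))\<close>\<close>
definition subst2 :: "'r::comm_ring_1 fps fps \<Rightarrow> 'r fps \<Rightarrow> 'r fps \<Rightarrow> 'r fps fps" where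
  "subst2 G s t = Abs_fps (\<lambda>j. Abs_fps (\<lambda>i.
      \<Sum>m\<le>i. \<Sum>n\<le>j. fps_nth (fps_nth G n) m * fps_nth (s ^ m) i * fps_nth (t ^ n) j))"

\<comment> \<open>\<open>G(s(X), t(X))\<close>\<close>
definition subst_diag :: "'r::comm_ring_1 fps fps \<Rightarrow> 'r fps \<Rightarrow> 'r fps \<Rightarrow> 'r fps" where
  "subst_diag G s t = Abs_fps (\<lambda>d.
      \<Sum>m\<le>d. \<Sum>n\<le>d. fps_nth (fps_nth G n) m * fps_nth (s ^ m * t ^ n) d)"

text \<open>Homomorphisms from the formal module \<open>(G, m)\<close> to \<open>(G', m')\<close> with scalars in \<open>A\<close>.\<close>

definition formal_hom ::
  "'s set \<Rightarrow> 'r::comm_ring_1 fps fps \<Rightarrow> ('s \<Rightarrow> 'r fps) \<Rightarrow> 'r fps fps \<Rightarrow> ('s \<Rightarrow> 'r fps) \<Rightarrow> 'r fps \<Rightarrow> bool" where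
  "formal_hom A G m G' m' s \<longleftrightarrow> fps_nth s 0 = 0 \<and> subst1 s G = subst2 G' s s \<and>
     (\<forall>a\<in>A. s oo m a = m' a oo s)"

definition fps_redn :: "('c, 'k) lt_data \<Rightarrow> 'c fps \<Rightarrow> 'k fps" where
  "fps_redn L s = Abs_fps (\<lambda>n. redn L (fps_nth s n))"


section \<open>The formal modules \<open>\<F>\<^sub>u\<close>\<close>

fun bcoef :: "('c::field, 'k) lt_data \<Rightarrow> 'c \<Rightarrow> nat \<Rightarrow> 'c" where
  "bcoef L u 0 = 1"
| "bcoef L u (Suc 0) = u / unif L"
| "bcoef L u (Suc (Suc k)) = (bcoef L u (Suc k) * u ^ (qF L ^ Suc k) + bcoef L u k) / unif L"

definition flog :: "('c::field, 'k) lt_data \<Rightarrow> 'c \<Rightarrow> 'c fps" where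
  "flog L u = Abs_fps (\<lambda>n. \<Sum>k | qF L ^ k = n. bcoef L u k)"

definition pi_series :: "('c::field, 'k) lt_data \<Rightarrow> 'c \<Rightarrow> 'c fps" where
  "pi_series L u = fps_const (unif L) * fps_X + fps_const u * fps_X ^ qF L + fps_X ^ ((qF L)\<^sup>2)"

text \<open>
  Used in equal characteristic only: the expansion \<open>a = \<Sum> c\<^sub>k \<pi>\<^sup>k\<close> of \<open>a \<in> \<O>\<^sub>E\<close> with digits in the
  field with \<open>q\<^sup>2\<close> elements.  The digits of \<open>a \<in> \<O>\<^sub>F\<close> lie in the field with \<open>q\<close> elements.
\<close>

definition digits :: "('c::{field, complete_space}, 'k) lt_data \<Rightarrow> 'c \<Rightarrow> nat \<Rightarrow> 'c" where
  "digits L a = (THE c. (\<forall>k. c k ^ ((qF L)\<^sup>2) = c k) \<and> (\<lambda>k. c k * unif L ^ k) sums a)"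

text \<open>
  \<open>fmult L u a\<close> is \<open>[a]\<^sub>u\<close>.  It is used for \<open>a \<in> \<O>\<^sub>F\<close> and, if \<open>u = 0\<close>, also for \<open>a \<in> \<O>\<^sub>E\<close>:
  \<open>\<F>\<^sub>0\<close> is a formal \<open>\<O>\<^sub>E\<close>-module.  In equal characteristic,
  \<open>[a]\<^sub>u = \<Sum> c\<^sub>k [\<pi>]\<^sub>u\<^sup>k\<close> (compositional powers), the sum converging coefficientwise.
\<close>

definition fmult :: "('c::{field, complete_space}, 'k) lt_data \<Rightarrow> 'c \<Rightarrow> 'c \<Rightarrow> 'c fps" where
  "fmult L u a =
    (if CHAR('c) = 0 then fps_inv (flog L u) oo (fps_const a * flog L u)
     else Abs_fps (\<lambda>n. \<Sum>k. digits L a k * fps_nth (((\<lambda>s. pi_series L u oo s) ^^ k) fps_X) n))"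

definition fadd :: "('c::field, 'k) lt_data \<Rightarrow> 'c \<Rightarrow> 'c fps fps" where
  "fadd L u =
    (if CHAR('c) = 0 then subst1 (fps_inv (flog L u)) (in_X (flog L u) + in_Y (flog L u))
     else in_X fps_X + in_Y fps_X)"

definition OC_hom :: "('c::{field, complete_space}, 'k) lt_data \<Rightarrow> 'c \<Rightarrow> 'c \<Rightarrow> 'c fps \<Rightarrow> bool" where
  "OC_hom L u u' h \<longleftrightarrow> (\<forall>n. fps_nth h n \<in> OC L) \<and>
     formal_hom (OF_ring L) (fadd L u) (fmult L u) (fadd L u') (fmult L u') h"

definition OC_iso :: "('c::{field, complete_space}, 'k) lt_data \<Rightarrow> 'c \<Rightarrow> 'c \<Rightarrow> 'c fps \<Rightarrow> bool" where
  "OC_iso L u u' h \<longleftrightarrow> OC_hom L u u' h \<and>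
     (\<exists>g. OC_hom L u' u g \<and> h oo g = fps_X \<and> g oo h = fps_X)"

definition peval :: "'c::{field, complete_space} fps \<Rightarrow> 'c \<Rightarrow> 'c" where
  "peval s x = (\<Sum>n. fps_nth s n * x ^ n)"

definition peval2 :: "'c::{field, complete_space} fps fps \<Rightarrow> 'c \<Rightarrow> 'c \<Rightarrow> 'c" where
  "peval2 G x y = (\<Sum>j. peval (fps_nth G j) x * y ^ j)"

definition tors2 :: "('c::{field, complete_space}, 'k) lt_data \<Rightarrow> 'c \<Rightarrow> 'c set" where
  "tors2 L u = {x \<in> mC L. peval (fmult L u ((unif L)\<^sup>2)) x = 0}"

definition lin_comb ::
  "('c::{field, complete_space}, 'k) lt_data \<Rightarrow> 'c \<Rightarrow> 'c \<Rightarrow> 'c \<Rightarrow> 'c \<Rightarrow> 'c \<Rightarrow> 'c" where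
  "lin_comb L u a x b y = peval2 (fadd L u) (peval (fmult L u a) x) (peval (fmult L u b) y)"

definition tors2_basis :: "('c::{field, complete_space}, 'k) lt_data \<Rightarrow> 'c \<Rightarrow> 'c \<Rightarrow> 'c \<Rightarrow> bool" where
  "tors2_basis L u x y \<longleftrightarrow> x \<in> tors2 L u \<and> y \<in> tors2 L u \<and>
     (\<forall>z\<in>tors2 L u. \<exists>a\<in>OF_ring L. \<exists>b\<in>OF_ring L. z = lin_comb L u a x b y) \<and>
     (\<forall>a\<in>OF_ring L. \<forall>b\<in>OF_ring L. lin_comb L u a x b y = 0 \<longrightarrow>
        a / (unif L)\<^sup>2 \<in> OF_ring L \<and> b / (unif L)\<^sup>2 \<in> OF_ring L)"

definition LT_curve :: "('c::{field, complete_space}, 'k) lt_data \<Rightarrow> ('c \<times> 'c \<times> 'c) set" where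
  "LT_curve L = {(X2, Y2, u). u \<in> mC L \<and> tors2_basis L u X2 Y2}"


section \<open>The quaternionic order \<open>\<O>\<^sub>D = End(\<Sigma>)\<close> and its action\<close>

definition Sigma_add :: "('c::field, 'k) lt_data \<Rightarrow> 'k fps fps" where
  "Sigma_add L = Abs_fps (\<lambda>j. fps_redn L (fps_nth (fadd L 0) j))"

definition Sigma_mult :: "('c::{field, complete_space}, 'k) lt_data \<Rightarrow> 'c \<Rightarrow> 'k fps" where
  "Sigma_mult L a = fps_redn L (fmult L 0 a)"

definition OD :: "('c::{field, complete_space}, 'k::field) lt_data \<Rightarrow> 'k fps set" where
  "OD L = {s. formal_hom (OF_ring L) (Sigma_add L) (Sigma_mult L) (Sigma_add L) (Sigma_mult L) s}"

definition OD_add :: "('c::field, 'k::field) lt_data \<Rightarrow> 'k fps \<Rightarrow> 'k fps \<Rightarrow> 'k fps" where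
  "OD_add L s t = subst_diag (Sigma_add L) s t"

definition OD_units :: "('c::{field, complete_space}, 'k::field) lt_data \<Rightarrow> 'k fps set" where
  "OD_units L = {b \<in> OD L. \<exists>c\<in>OD L. b oo c = fps_X \<and> c oo b = fps_X}"

text \<open>
  \<open>\<O>\<^sub>E\<close> is embedded in \<open>\<O>\<^sub>D\<close> by \<open>\<alpha> \<mapsto>\<close> the reduction of \<open>[\<alpha>]\<^sub>0\<close>, which is \<open>Sigma_mult L \<alpha>\<close>; it sends
  \<open>\<zeta> \<in> muE L\<close> to \<open>fps_const (redn L \<zeta>) * fps_X\<close>, and \<open>\<pi>\<close> to \<open>phiD L oo phiD L\<close>.
  Multiplication in \<open>\<O>\<^sub>D\<close> is composition of power series.
\<close>

definition phiD :: "('c, 'k::field) lt_data \<Rightarrow> 'k fps" where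
  "phiD L = fps_X ^ qF L"

definition OD_elem :: "('c::{field, complete_space}, 'k::field) lt_data \<Rightarrow> 'c \<Rightarrow> 'c \<Rightarrow> 'c \<Rightarrow> 'k fps" where
  "OD_elem L a0 b0 a1 =
     OD_add L (OD_add L (fps_const (redn L a0) * fps_X) (phiD L oo (fps_const (redn L b0) * fps_X)))
       (Sigma_mult L (unif L) oo (fps_const (redn L a1) * fps_X))"

\<comment> \<open>equality of the classes of \<open>b\<close> and \<open>c\<close> modulo \<open>1 + \<phi>\<^sup>3\<O>\<^sub>D\<close>\<close>
definition eq_mod_phi3 :: "('c::{field, complete_space}, 'k::field) lt_data \<Rightarrow> 'k fps \<Rightarrow> 'k fps \<Rightarrow> bool" where
  "eq_mod_phi3 L b c \<longleftrightarrow>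
     (\<exists>d\<in>OD L. b = c oo OD_add L fps_X (phiD L oo (phiD L oo (phiD L oo d))))"

text \<open>
  The reduced norm of \<open>b\<close> is the determinant of left multiplication by \<open>b\<close> on the right
  \<open>E\<close>-vector space \<open>D\<close>, here with respect to the basis \<open>1, \<phi>\<close> of \<open>\<O>\<^sub>D = \<O>\<^sub>E \<oplus> \<phi>\<O>\<^sub>E\<close>.
\<close>

definition Nrd :: "('c::{field, complete_space}, 'k::field) lt_data \<Rightarrow> 'k fps \<Rightarrow> 'c" where
  "Nrd L b = (THE n. \<exists>\<alpha>\<in>OE_ring L. \<exists>\<beta>\<in>OE_ring L. \<exists>\<alpha>'\<in>OE_ring L. \<exists>\<beta>'\<in>OE_ring L.
      b = OD_add L (Sigma_mult L \<alpha>) (phiD L oo Sigma_mult L \<beta>) \<and>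
      b oo phiD L = OD_add L (Sigma_mult L \<alpha>') (phiD L oo Sigma_mult L \<beta>') \<and>
      n = \<alpha> * \<beta>' - \<alpha>' * \<beta>)"

definition actD ::
  "('c::{field, complete_space}, 'k::field) lt_data \<Rightarrow> 'k fps \<Rightarrow> 'c \<times> 'c \<times> 'c \<Rightarrow> 'c \<times> 'c \<times> 'c" where
  "actD L b = (\<lambda>(X2, Y2, u).
     let (h, u') = (THE (h, u'). u' \<in> mC L \<and> OC_iso L u u' h \<and> fps_redn L h = fps_inv b)
     in (peval h X2, peval h Y2, u'))"


section \<open>The affinoids \<open>\<^bold>X\<close>\<close>

definition kap :: "('c::field, 'k) lt_data \<Rightarrow> 'c" where
  "kap L = kap1 L ^ qF L"

definition gam :: "('c::field, 'k) lt_data \<Rightarrow> 'c" where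
  "gam L = kap L ^ ((qF L - 1) * ((qF L)\<^sup>2 - 1))"

text \<open>
  Since \<open>\<gamma>\<close> is \<open>\<kappa>\<^sub>1\<close> to the power \<open>q(q-1)(q\<^sup>2-1)\<close>, the fractional powers of \<open>\<gamma>\<close> with exponents
  \<open>1/q\<close>, \<open>q/(q-1)\<close>, \<open>1/(q(q-1))\<close> and \<open>1/(q\<^sup>2-1)\<close> are the following powers of \<open>\<kappa>\<^sub>1\<close>.
\<close>

definition gam_1_q :: "('c::field, 'k) lt_data \<Rightarrow> 'c" where
  "gam_1_q L = kap1 L ^ ((qF L - 1) * ((qF L)\<^sup>2 - 1))"

definition gam_q_q1 :: "('c::field, 'k) lt_data \<Rightarrow> 'c" where
  "gam_q_q1 L = kap1 L ^ ((qF L)\<^sup>2 * ((qF L)\<^sup>2 - 1))"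

definition gam_1_qq1 :: "('c::field, 'k) lt_data \<Rightarrow> 'c" where
  "gam_1_qq1 L = kap1 L ^ ((qF L)\<^sup>2 - 1)"

definition gam_1_q21 :: "('c::field, 'k) lt_data \<Rightarrow> 'c" where
  "gam_1_q21 L = kap1 L ^ (qF L * (qF L - 1))"

definition lt_choices :: "('c::field, 'k) lt_data \<Rightarrow> bool" where
  "lt_choices L \<longleftrightarrow>
     kap1 L ^ (qF L ^ 3 * ((qF L)\<^sup>2 - 1)) = unif L \<and>
     gam0 L ^ qF L - gam L ^ qF L * gam0 L = 1 \<and>
     gamt0 L ^ qF L = gam0 L \<and>
     gamt1 L ^ qF L + gamt0 L + gam_1_q L * gamt1 L = 0"

text \<open>The units of \<open>\<O>\<^sub>F/\<pi>\<^sup>2\<close> in the coordinates \<open>(\<zeta>, \<mu>~)\<close>, and the coordinates of a unit of \<open>\<O>\<^sub>F\<close>.\<close>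

definition comp_index :: "('c, 'k::field) lt_data \<Rightarrow> ('k \<times> 'k) set" where
  "comp_index L = {(z, m). z ^ qF L = z \<and> z \<noteq> 0 \<and> m ^ qF L = m}"

definition unit_coords :: "('c::field, 'k::field) lt_data \<Rightarrow> 'c \<Rightarrow> 'k \<times> 'k" where
  "unit_coords L t = (redn L t, redn L ((t - teich L (redn L t)) / unif L) / redn L t)"

definition unit_lift :: "('c::field, 'k::field) lt_data \<Rightarrow> 'k \<times> 'k \<Rightarrow> 'c" where
  "unit_lift L i = teich L (fst i) + teich L (fst i * snd i) * unif L"

definition act_index ::
  "('c::{field, complete_space}, 'k::field) lt_data \<Rightarrow> 'k fps \<Rightarrow> 'k \<times> 'k \<Rightarrow> 'k \<times> 'k" where
  "act_index L b i = unit_coords L (inverse (Nrd L b) * unit_lift L i)"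

definition S00 :: "('c, 'k::field) lt_data \<Rightarrow> 'k \<times> 'k \<Rightarrow> ('k \<times> 'k) set" where
  "S00 L i = {(x0, y0). x0 \<noteq> 0 \<and> y0 \<noteq> 0 \<and> x0 ^ qF L * y0 - x0 * y0 ^ qF L = fst i \<and>
      x0 ^ ((qF L)\<^sup>2 - 1) = -1 \<and> y0 ^ ((qF L)\<^sup>2 - 1) = -1}"

definition reduces_to :: "('c, 'k) lt_data \<Rightarrow> 'c \<Rightarrow> 'k \<Rightarrow> bool" where
  "reduces_to L t c \<longleftrightarrow> t \<in> OC L \<and> redn L t = c"

definition Y22 :: "('c::{field, complete_space}, 'k) lt_data \<Rightarrow> ('c \<times> 'c \<times> 'c) set" where
  "Y22 L = {(X2, Y2, u) \<in> LT_curve L. ereal (real (qF L) / (real (qF L) + 1)) \<le> val L u}"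

definition fx :: "('c::field, 'k) lt_data \<Rightarrow> 'c \<times> 'c \<times> 'c \<Rightarrow> 'c" where
  "fx L P = fst P / kap L"

definition fy :: "('c::field, 'k) lt_data \<Rightarrow> 'c \<times> 'c \<times> 'c \<Rightarrow> 'c" where
  "fy L P = fst (snd P) / kap L"

definition fW :: "('c::field, 'k) lt_data \<Rightarrow> 'c \<times> 'c \<times> 'c \<Rightarrow> 'c" where
  "fW L P = fx L P ^ qF L * fy L P - fx L P * fy L P ^ qF L"

definition fZ :: "('c::field, 'k) lt_data \<Rightarrow> 'c \<times> 'c \<times> 'c \<Rightarrow> 'c" where
  "fZ L P = fW L P ^ qF L -
     gam L * (fx L P ^ (qF L ^ 3) * fy L P - fx L P * fy L P ^ (qF L ^ 3))"

definition poly_f1 :: "('c::field, 'k) lt_data \<Rightarrow> 'c \<Rightarrow> 'c \<Rightarrow> 'c" where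
  "poly_f1 L X Y = (X ^ qF L - Y ^ qF L - (X - Y) ^ qF L) / unif L"

definition Y22_comp ::
  "('c::{field, complete_space}, 'k::field) lt_data \<Rightarrow> 'k \<times> 'k \<Rightarrow> ('c \<times> 'c \<times> 'c) set" where
  "Y22_comp L i = {P \<in> Y22 L. reduces_to L (fW L P) (fst i) \<and>
     reduces_to L
       ((teich L (fst i) * gam0 L - fZ L P) / gam_q_q1 L +
        poly_f1 L (fx L P ^ ((qF L)\<^sup>2) * fy L P ^ qF L) (fx L P ^ qF L * fy L P ^ ((qF L)\<^sup>2)))
       (snd i * fst i)}"

definition yhat :: "('c::field, 'k) lt_data \<Rightarrow> 'k \<times> 'k \<Rightarrow> 'c" where
  "yhat L j = (THE t. reduces_to L t (snd j) \<and>
     t ^ ((qF L)\<^sup>2 - 1) = - (gamt0 L ^ (qF L - 1)))"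

definition w1 :: "('c::field, 'k) lt_data \<Rightarrow> 'k \<times> 'k \<Rightarrow> 'c" where
  "w1 L j = yhat L j ^ qF L * gam_1_q21 L"

definition Xaff ::
  "('c::{field, complete_space}, 'k::field) lt_data \<Rightarrow> 'k \<times> 'k \<Rightarrow> 'k \<times> 'k \<Rightarrow> ('c \<times> 'c \<times> 'c) set" where
  "Xaff L i j = {P \<in> Y22_comp L i. reduces_to L (fx L P) (fst j) \<and> reduces_to L (fy L P) (snd j) \<and>
     val L (w1 L j) \<le> val L (fy L P - yhat L j)}"

definition coord_a :: "('c::field, 'k) lt_data \<Rightarrow> 'k \<times> 'k \<Rightarrow> 'c \<times> 'c \<times> 'c \<Rightarrow> 'c" where
  "coord_a L i P =
     (let Z1 = (fW L P - teich L (fst i) * gamt0 L) / gam_1_q L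
      in (Z1 - teich L (fst i) * gamt1 L) / gam_1_qq1 L)"

definition coord_z1 :: "('c::field, 'k) lt_data \<Rightarrow> 'k \<times> 'k \<Rightarrow> 'c \<times> 'c \<times> 'c \<Rightarrow> 'c" where
  "coord_z1 L j P = (fy L P - yhat L j) / w1 L j"


section \<open>Reductions of affinoids\<close>

text \<open>
  An affinoid is represented by its set \<open>S\<close> of \<open>\<^bold>C\<close>-points \<open>(X\<^sub>2, Y\<^sub>2, u)\<close>.
  Over a closed disc in \<open>u\<close>, the ring of functions on the curve is generated over the functions on
  the disc by \<open>X\<^sub>2, Y\<^sub>2\<close>, and the affinoids considered here are unions of connected components of
  Weierstrass subdomains of such a (reduced) affinoid.  Hence polynomials in \<open>X\<^sub>2, Y\<^sub>2, u\<close> are dense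
  in their rings of functions for the supremum norm, and these rings are the uniform closures of the
  polynomial functions.  They are realised as rings of functions that are \<open>undefined\<close> outside \<open>S\<close>.
\<close>

inductive_set poly_funs :: "('c::field \<times> 'c \<times> 'c \<Rightarrow> 'c) set" where
  const: "(\<lambda>_. c) \<in> poly_funs"
| X2: "(\<lambda>(X2, Y2, u). X2) \<in> poly_funs"
| Y2: "(\<lambda>(X2, Y2, u). Y2) \<in> poly_funs"
| u: "(\<lambda>(X2, Y2, u). u) \<in> poly_funs"
| add: "f \<in> poly_funs \<Longrightarrow> g \<in> poly_funs \<Longrightarrow> (\<lambda>P. f P + g P) \<in> poly_funs"
| mult: "f \<in> poly_funs \<Longrightarrow> g \<in> poly_funs \<Longrightarrow> (\<lambda>P. f P * g P) \<in> poly_funs"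

type_synonym 'c pointset = "('c \<times> 'c \<times> 'c) set"
type_synonym 'c fun3 = "'c \<times> 'c \<times> 'c \<Rightarrow> 'c"

definition affinoid_funs :: "'c::{field, complete_space} pointset \<Rightarrow> 'c fun3 set" where
  "affinoid_funs S = {f \<in> extensional S.
     \<exists>p. (\<forall>n. p n \<in> poly_funs) \<and> uniform_limit S p f sequentially}"

definition power_bounded :: "'c::{field, complete_space} pointset \<Rightarrow> 'c fun3 set" where
  "power_bounded S = {f \<in> affinoid_funs S. \<exists>B. \<forall>n. \<forall>P\<in>S. dist (f P ^ n) 0 \<le> B}"

definition top_nilpotent :: "'c::{field, complete_space} pointset \<Rightarrow> 'c fun3 set" where
  "top_nilpotent S = {f \<in> affinoid_funs S. uniform_limit S (\<lambda>n P. f P ^ n) (\<lambda>_. 0) sequentially}"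

definition power_bounded_ring :: "'c::{field, complete_space} pointset \<Rightarrow> 'c fun3 ring" where
  "power_bounded_ring S =
     \<lparr>carrier = power_bounded S,
      mult = (\<lambda>f g. \<lambda>P\<in>S. f P * g P), one = (\<lambda>P\<in>S. 1),
      zero = (\<lambda>P\<in>S. 0), add = (\<lambda>f g. \<lambda>P\<in>S. f P + g P)\<rparr>"

text \<open>The coordinate ring of the reduction (an affine scheme over the residue field of \<open>\<^bold>C\<close>).\<close>

definition reduction :: "'c::{field, complete_space} pointset \<Rightarrow> 'c fun3 set ring" where
  "reduction S = power_bounded_ring S Quot top_nilpotent S"

definition red_class :: "'c::{field, complete_space} pointset \<Rightarrow> 'c fun3 \<Rightarrow> 'c fun3 set" where
  "red_class S f = top_nilpotent S +>\<^bsub>power_bounded_ring S\<^esub> (restrict f S)"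

\<comment> \<open>the structure map from the residue field to the coordinate ring of the reduction\<close>
definition red_const ::
  "('c::{field, complete_space}, 'k) lt_data \<Rightarrow> 'c pointset \<Rightarrow> 'k \<Rightarrow> 'c fun3 set" where
  "red_const L S c = red_class S (\<lambda>_. SOME t. reduces_to L t c)"

text \<open>
  The map \<open>g\<close> on points is a morphism of affinoids from \<open>S\<close> to \<open>T\<close>, and \<open>\<Phi>\<close> is the ring homomorphism
  (from the coordinate ring of the reduction of \<open>T\<close> to that of \<open>S\<close>) that corresponds to the morphism
  between the reductions induced by \<open>g\<close>.
\<close>

definition induces_on_reduction ::
  "('c::{field, complete_space} \<times> 'c \<times> 'c \<Rightarrow> 'c \<times> 'c \<times> 'c) \<Rightarrow> 'c pointset \<Rightarrow> 'c pointset \<Rightarrow>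
   ('c fun3 set \<Rightarrow> 'c fun3 set) \<Rightarrow> bool" where
  "induces_on_reduction g S T \<Phi> \<longleftrightarrow>
     g ` S \<subseteq> T \<and>
     (\<forall>f\<in>affinoid_funs T. restrict (f \<circ> g) S \<in> affinoid_funs S) \<and>
     \<Phi> \<in> ring_hom (reduction T) (reduction S) \<and>
     (\<forall>f\<in>power_bounded T. \<Phi> (red_class T f) = red_class S (f \<circ> g))"

end

theory Submission
  imports Defs "HOL-Algebra.Exponent"
begin

unbundle no vec_syntax and fps_syntax
notation (input) iff (infixr "<->" 25)

text \<open>All series are controlled through the logarithm \<open>f\<^sub>u\<close>. The endomorphisms of \<open>\<Sigma>\<close> are the
 reductions of the series with logarithm \<open>\<alpha> f\<^sub>0(X) + \<beta> f\<^sub>0(X\<^sup>q)\<close>, where \<open>\<alpha>\<close>, \<open>\<beta>\<close> are integral in \<open>E\<close>.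
 Modulo a bounded error \<open>f\<^sub>u\<close> is \<open>\<Phi>\<^sub>0(u) f\<^sub>0(X) + \<Phi>\<^sub>1(u) f\<^sub>0(X\<^sup>q)\<close>, and \<open>u\<close> is determined by the quotient
 \<open>\<Phi>\<^sub>1(u) / \<Phi>\<^sub>0(u)\<close> (the Gross--Hopkins coordinate). Hence the lift of an automorphism exists over the \<open>u'\<close> given
 by a Moebius transformation in \<open>\<alpha>\<close>, \<open>\<beta>\<close> of this quotient, and is
 \<open>\<alpha> X + \<beta> X\<^sup>q\<close> plus a multiple of the \<open>q\<^sup>2\<close>-th power of \<open>X\<close> up to terms that do not matter on the
 affinoid. Inserting this into the definitions of the coordinates, with congruences modulo powers of \<open>\<kappa>\<^sub>1\<close>, gives the
 formulas; a morphism of reductions results because the lifted series are uniform limits of polynomials.\<close>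

section \<open>Filtered rings and perturbation of logarithms\<close>

text \<open>One recursion for the coefficients of the logarithm serves both characteristics: in
  equal characteristic its denominators are pi - pi^(q^k), again of valuation 1. The constant 3/4
  (\<open>th\<close>) balances two demands. As q >= 3, q/(q+1) >= 3/4, so every point of
  \<open>Y22\<close> has v(u) >= 3/4. On this disc Phi1 may have valuation 3/4 - 1 = -1/4, so a
  congruence modulo pi that is multiplied by it holds to level 1 - 1/4 = 3/4, and the affinoid asks
  for no more than that (\<open>4 * nE <= 3 * no\<close>). Passing between series and logarithms
  preserves congruences of level at least 1/2: a q^k-th power gains k, while the k-th coefficient of
  the logarithm loses at most k/2. Uniqueness of the lift rests on the opposite fact that the
  denominators are unbounded: two logarithms at bounded distance have the same growth, hence the
  same Gross--Hopkins coordinate. At the precision of the affinoid b matters only through the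
  coefficients of X, X^q and X^(q^2) of its inverse, and these depend only on the class modulo
  phi^3.\<close>

locale filt = fixes N :: "real => 'a::comm_ring_1 => bool" assumes N_0: "N r 0"
  and N_add: "N r x ==> N r y ==> N r (x + y)"
  and N_uminus: "N r x ==> N r (- x)"
  and N_mult: "N r x ==> N s y ==> N (r + s) (x * y)" and N_1: "N 0 1"
  and N_mono: "N r x ==> s <= r ==> N s x"
begin

lemma N_diff: "N r x ==> N r y ==> N r (x - y)"
 using N_add[of r x "- y"] N_uminus[of r y] by simp
lemma N_diff_commute: "N r (x - y) ==> N r (y - x)" using N_uminus[of r "x - y"] by simp
lemma N_trans: "N r (x - y) ==> N r (y - z) ==> N r (x - z)"
 using N_add[of r "x - y" "y - z"] by simp
lemma N_sum: "(!!i. i \<in> A ==> N r (f i)) ==> N r (sum f A)"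
 by (induction A rule: infinite_finite_induct) (auto intro: N_0 N_add)

lemma N_power: "N r x ==> N (real n * r) (x ^ n)"
proof (induction n)
 case (Suc n)
 have "N (r + real n * r) (x * x ^ n)" using Suc by (intro N_mult) auto
 thus ?case by (simp add: algebra_simps)
qed (simp add: N_1)

lemma N_power0: "N 0 x ==> N 0 (x ^ n)" using N_power[of 0 x n] by simp
lemma N_mult_left: "N 0 x ==> N r y ==> N r (x * y)"
 using N_mult[of 0 x r y] by simp
lemma N_mult_right: "N r x ==> N 0 y ==> N r (x * y)"
 using N_mult[of r x 0 y] by simp
lemma N_mult_le: "N r x ==> N s y ==> t <= r + s ==> N t (x * y)"
 using N_mult N_mono by blast
lemma N_power_le: "N r x ==> t <= real n * r ==> N t (x ^ n)"
 using N_power N_mono by blast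
lemma N_of_nat: "N 0 (of_nat n)" by (induction n) (auto intro: N_0 N_1 N_add)

lemma N_mult_diff:
 "N r (x - x') ==> N r (y - y') ==> N 0 x' ==> N 0 y ==> N r (x * y - x' * y')"
 using N_add[OF N_mult_right[of r "x - x'" y] N_mult_left[of x' r "y - y'"]] by (simp add: algebra_simps)

lemma N_power_diff: "N 0 x ==> N 0 y ==> N r (x - y) ==> N r (x ^ n - y ^ n)"
 by (induction n) (auto intro!: N_mult_diff N_power0 simp: N_0)

end

text \<open>Filtrations are predicates because a series whose coefficients have unbounded
  denominators has no valuation. Applying \<open>fN\<close> twice covers series in two variables,
  with every lemma on \<open>filt\<close> and \<open>filtq\<close> at hand.\<close>

definition fN :: "(real => 'a::comm_ring_1 => bool) => real => 'a fps => bool" where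
 "fN N r s <-> (\<forall>n. N r (s $ n))"

lemma filt_fN: assumes "filt N" shows "filt (fN N)"
proof -
 interpret filt N by fact
 show ?thesis
 proof
  fix r t :: real and x y :: "'a fps"
  assume x: "fN N r x" and y: "fN N t y"
  show "fN N (r + t) (x * y)"
   unfolding fN_def fps_mult_nth using x y by (auto simp: fN_def intro!: N_sum N_mult)
 qed (auto simp: fN_def intro: N_0 N_add N_uminus N_1 N_mono)
qed

text \<open>The condition on binomials is what remains of q being a power of the residue
  characteristic; q >= 3 makes a q-th power gain enough, and q odd lets signs pass through
  it.\<close>

locale filtq = filt N for N :: "real => 'a::comm_ring_1 => bool" + fixes q :: nat
 assumes q3: "3 <= q" and q_odd: "odd q"
  and N_binom: "0 < i ==> i < q ==> N 1 (of_nat (q choose i))"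

lemma filtq_fN: assumes "filtq N q" shows "filtq (fN N) q"
proof -
 interpret filtq N q by fact
 interpret F: filt "fN N" by (rule filt_fN) unfold_locales
 show ?thesis
 proof
  fix i assume i: "0 < i" "i < q"
  show "fN N 1 (of_nat (q choose i))"
   unfolding fN_def fps_of_nat[symmetric] using i by (auto intro: N_0 N_binom)
 qed (auto simp: q3 q_odd)
qed

lemma fps_power_nth_cong_below: assumes "!!i. i < n ==> Z $ i = Z' $ i" and "j < n"
 shows "(Z ^ m) $ j = (Z' ^ m) $ j" using assms(2)
proof (induction m arbitrary: j)
 case (Suc m)
 thus ?case unfolding power_Suc fps_mult_nth by (intro sum.cong) (auto simp: assms(1))
qed simp

text \<open>With zero constant terms, a product of at least two factors reaches degree n only
  through coefficients of degree below n. This makes equations for a logarithm solvable coefficient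
  by coefficient.\<close>

lemma fps_power_nth_cong: assumes eq: "!!i. i < n ==> Z $ i = Z' $ i" and m: "2 <= m"
  and Z0: "Z $ 0 = (0::'a::comm_ring_1)" "Z' $ 0 = 0" shows "(Z ^ m) $ n = (Z' ^ m) $ n"
proof -
 obtain l where l: "m = Suc l" "0 < l" using m by (cases m) auto
 have z: "(Z ^ l) $ 0 = 0" "(Z' ^ l) $ 0 = 0" using l Z0 by (simp_all add: startsby_zero_power)
 show ?thesis unfolding l power_Suc fps_mult_nth
 proof (intro sum.cong refl)
  fix i assume i: "i \<in> {0..n}"
  consider "i = 0" | "i = n" | "0 < i" "i < n" using i by (auto simp: le_less)
  thus "Z $ i * (Z ^ l) $ (n - i) = Z' $ i * (Z' ^ l) $ (n - i)"
  proof cases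
   case 3
   thus ?thesis using eq fps_power_nth_cong_below[of n Z Z' "n - i" l] by simp
  qed (use Z0 z in auto)
 qed
qed

section \<open>Logarithms supported in q-power degrees\<close>

definition elog :: "nat => (nat => 'a::comm_ring_1) => 'a fps" where
 "elog q v = Abs_fps (%n. \<Sum>k | q ^ k = n. v k)"

lemma less_power_self: "2 <= q ==> k < q ^ k" for k q :: nat
 using less_exp[of k] power_mono[of 2 q k] by linarith

lemma elog_nth: assumes "2 <= q"
 shows "elog q v $ n = (\<Sum>k\<le>n. if q ^ k = n then v k else 0)"
proof -
 have "{k. q ^ k = n} = {k \<in> {..n}. q ^ k = n}"
  using less_power_self[OF assms] by (auto intro: less_imp_le)
 hence "elog q v $ n = (\<Sum>k | k \<in> {..n} & q ^ k = n. v k)"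
  unfolding elog_def fps_nth_Abs_fps by (rule arg_cong)
 also have "... = (\<Sum>k\<in>{..n}. if q ^ k = n then v k else 0)" by (rule sum.inter_filter) simp
 finally show ?thesis .
qed

lemma elog_nth_power: assumes "2 <= q" shows "elog q v $ (q ^ k) = v k"
proof -
 have "{j. q ^ j = q ^ k} = {k}" using assms by auto
 thus ?thesis unfolding elog_def by simp
qed

lemma elog_nth_0 [simp]: "2 <= q ==> elog q v $ 0 = 0" by (simp add: elog_nth)
lemma elog_nth_1: "2 <= q ==> elog q v $ Suc 0 = v 0"
 using elog_nth_power[of q v 0] by simp

lemma elog_compose_nth: assumes q: "2 <= q" and Z: "Z $ 0 = 0"
 shows "(elog q v oo Z) $ n = (\<Sum>k\<le>n. v k * (Z ^ q ^ k) $ n)"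
proof -
 have 1: "elog q v $ i = (\<Sum>k\<le>n. if q ^ k = i then v k else 0)" if "i <= n" for i
 proof -
  have "q ^ k ~= i" if "i < k" for k using less_power_self[OF q, of k] that by auto
  thus ?thesis unfolding elog_nth[OF q] using that by (intro sum.mono_neutral_left) auto
 qed
 have "(elog q v oo Z) $ n = (\<Sum>i=0..n. \<Sum>k\<le>n. if q ^ k = i then v k * (Z ^ i) $ n else 0)"
  unfolding fps_compose_nth by (intro sum.cong refl) (auto simp: 1 sum_distrib_right intro!: sum.cong)
 also have "... = (\<Sum>k\<le>n. \<Sum>i=0..n. if q ^ k = i then v k * (Z ^ i) $ n else 0)"
  by (rule sum.swap)
 also have "... = (\<Sum>k\<le>n. v k * (Z ^ q ^ k) $ n)"
 proof (intro sum.cong refl)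
  fix k
  show "(\<Sum>i=0..n. if q ^ k = i then v k * (Z ^ i) $ n else 0) = v k * (Z ^ q ^ k) $ n"
   using startsby_zero_power_prefix[OF Z, of "q ^ k"] by simp
 qed
 finally show ?thesis .
qed

text \<open>The term k = 0 is split off because it alone contains \<open>Z $ n\<close>; all others
  depend on lower coefficients of Z.\<close>

lemma elog_compose_nth': assumes q: "2 <= q" and Z: "Z $ 0 = 0"
 shows "(elog q v oo Z) $ n = v 0 * Z $ n + (\<Sum>k=1..n. v k * (Z ^ q ^ k) $ n)"
proof -
 have "{..n} = insert 0 {1..n}" by auto
 thus ?thesis unfolding elog_compose_nth[OF assms] by simp
qed

lemma elog_add: "elog q (%k. v k + v' k) = elog q v + elog q v'"
 by (simp add: elog_def fps_eq_iff sum.distrib)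
lemma elog_cmult: "elog q (%k. c * v k) = fps_const c * elog q v"
 by (simp add: elog_def fps_eq_iff sum_distrib_left)

context filtq
begin

lemma q2: "2 <= q" using q3 by simp

text \<open>In the binomial expansion the mixed terms gain 1 from the binomial coefficient on top of
  rh from E, and the pure term E^q has level q * rh.\<close>

lemma N_power_q_diff:
 assumes B: "N 0 B" and E: "N rh E" and rh: "0 <= rh" and r: "r <= real q * rh" "r <= rh + 1"
 shows "N r ((B + E) ^ q - B ^ q)"
proof -
 have "(B + E) ^ q = (\<Sum>k\<le>q. of_nat (q choose k) * B ^ k * E ^ (q - k))" by (rule binomial_ring)
 also have "... = B ^ q + (\<Sum>k<q. of_nat (q choose k) * B ^ k * E ^ (q - k))"
  by (simp add: lessThan_Suc_atMost[symmetric])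
 finally have "(B + E) ^ q - B ^ q = (\<Sum>k<q. of_nat (q choose k) * B ^ k * E ^ (q - k))" by simp
 moreover have "N r (of_nat (q choose k) * B ^ k * E ^ (q - k))" if "k < q" for k
 proof (cases "k = 0")
  case True
  thus ?thesis using N_power_le[OF E r(1)] by simp
 next
  case False
  have "N 1 (of_nat (q choose k) * B ^ k)" using False that by (intro N_mult_right N_binom N_power0 B) auto
  moreover have "N rh (E ^ (q - k))"
   using that rh by (intro N_power_le[OF E]) (auto simp: mult_le_cancel_right1)
  ultimately show ?thesis using r(2) N_mult_le by (metis add.commute)
 qed
 ultimately show ?thesis by (auto intro!: N_sum)
qed

text \<open>Each q-th power gains 1. The condition rh >= 1/2 is the case k = 0 of 3 * (rh + k) >= rh
  + k + 1.\<close>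

lemma N_power_q_iter: assumes B: "N 0 B" and E: "N rh (A - B)" and rh: "1/2 <= rh"
 shows "N (rh + real k) (A ^ q ^ k - B ^ q ^ k)"
proof (induction k)
 case (Suc k)
 have "rh + real (Suc k) <= real q * (rh + real k)"
 proof -
  have "3 * (rh + real k) <= real q * (rh + real k)" using q3 rh by (intro mult_right_mono) auto
  thus ?thesis using rh by simp
 qed
 hence "N (rh + real (Suc k)) ((B ^ q ^ k + (A ^ q ^ k - B ^ q ^ k)) ^ q - (B ^ q ^ k) ^ q)"
  using rh by (intro N_power_q_diff[where rh = "rh + real k"] N_power0 B Suc) auto
 thus ?case by (simp add: power_mult[symmetric] mult.commute)
qed (use E in simp)

lemma N_frob_add: assumes "N 0 A" "N 0 B" shows "N 1 ((A + B) ^ q - (A ^ q + B ^ q))"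
proof -
 have "(A + B) ^ q = (\<Sum>k\<le>q. of_nat (q choose k) * A ^ k * B ^ (q - k))" by (rule binomial_ring)
 also have "{..q} = insert 0 (insert q {0<..<q})" by auto
 finally have "(A + B) ^ q - (A ^ q + B ^ q)
   = (\<Sum>k\<in>{0<..<q}. of_nat (q choose k) * A ^ k * B ^ (q - k))" using q3 by (simp add: algebra_simps)
 moreover have "N 1 (of_nat (q choose k) * A ^ k * B ^ (q - k))" if "k \<in> {0<..<q}" for k
  using that by (intro N_mult_right N_binom N_power0 assms) auto
 ultimately show ?thesis by (auto intro!: N_sum)
qed

lemma N_frob_add_iter: assumes "N 0 A" "N 0 B" shows "N 1 ((A + B) ^ q ^ k - (A ^ q ^ k + B ^ q ^ k))"
proof (induction k)
 case (Suc k)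
 have "N 1 (((A + B) ^ q ^ k) ^ q - (A ^ q ^ k + B ^ q ^ k) ^ q)"
  using assms by (intro N_power_diff Suc N_power0 N_add)
 moreover have "N 1 ((A ^ q ^ k + B ^ q ^ k) ^ q - ((A ^ q ^ k) ^ q + (B ^ q ^ k) ^ q))"
  using assms by (intro N_frob_add N_power0)
 ultimately show ?case using N_trans by (fastforce simp: power_mult[symmetric] mult.commute)
qed (simp add: N_0)

text \<open>In degree n the terms with k >= 1 see only lower coefficients, which already agree to
  level rh; their q^k-th powers agree to level rh + k, and this outweighs the denominators of
  \<open>v k\<close>. So only the linear term can contribute to the difference.\<close>

lemma elog_perturb_step:
 assumes v0: "v 0 = 1" and v: "!!k. N (- real k / 2) (v k)" and rh: "1/2 <= rh"
  and Z: "fN N 0 Z" and Z0: "Z $ 0 = 0" "Z' $ 0 = 0"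
  and less: "!!j. j < n ==> N rh ((Z' - Z) $ j)"
 shows "N rh ((Z' - Z) $ n - ((elog q v oo Z') - (elog q v oo Z)) $ n)"
proof -
 interpret F: filtq "fN N" q by (rule filtq_fN) unfold_locales
 \<comment> \<open>Y has the coefficients of Z' below n and those of Z from n on: it is close to Z
   in all degrees and still gives the n-th coefficients of the powers of Z'.\<close>
 define Y where "Y = Z + fps_cutoff n (Z' - Z)"
 have Y: "fN N rh (Y - Z)" using less by (auto simp: Y_def fN_def N_0)
 have YZ: "(Z' ^ q ^ k) $ n = (Y ^ q ^ k) $ n" if "1 <= k" for k
 proof (rule fps_power_nth_cong)
  show "2 <= q ^ k" using q2 that power_increasing[of 1 k q] by simp
  show "Y $ 0 = 0" using Z0 by (cases n) (simp_all add: Y_def)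
 qed (use Z0 in "simp_all add: Y_def")
 have e: "(Z' - Z) $ n - ((elog q v oo Z') - (elog q v oo Z)) $ n
   = - (\<Sum>k=1..n. v k * (Y ^ q ^ k - Z ^ q ^ k) $ n)"
  unfolding fps_sub_nth elog_compose_nth'[OF q2 Z0(1)] elog_compose_nth'[OF q2 Z0(2)]
  by (simp add: v0 YZ right_diff_distrib sum_subtractf)
 have "N rh (v k * (Y ^ q ^ k - Z ^ q ^ k) $ n)" if "1 <= k" for k
 proof -
  have "fN N (rh + real k) (Y ^ q ^ k - Z ^ q ^ k)" by (rule F.N_power_q_iter[OF Z Y rh])
  thus ?thesis by (intro N_mult_le[OF v[of k], where s = "rh + real k"]) (auto simp: fN_def)
 qed
 thus ?thesis unfolding e by (intro N_uminus N_sum) auto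
qed

text \<open>Induction on the degree with \<open>elog_perturb_step\<close>. Series, such as a lift
  and its explicit approximation, are compared below through their logarithms in this way.\<close>

lemma elog_perturb:
 assumes v: "v 0 = 1" "!!k. N (- real k / 2) (v k)" and rh: "1/2 <= rh"
  and Z: "fN N 0 Z" "Z $ 0 = 0" "Z' $ 0 = 0"
  and E: "fN N rh ((elog q v oo Z') - (elog q v oo Z))" shows "fN N rh (Z' - Z)"
 unfolding fN_def
proof
 fix n
 show "N rh ((Z' - Z) $ n)"
 proof (induction n rule: less_induct)
  case (less n)
  have "N rh ((Z' - Z) $ n - ((elog q v oo Z') - (elog q v oo Z)) $ n)"
   by (rule elog_perturb_step[OF v rh Z less])
  moreover have "N rh (((elog q v oo Z') - (elog q v oo Z)) $ n)" using E by (simp only: fN_def)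
  ultimately have "N rh ((Z' - Z) $ n - ((elog q v oo Z') - (elog q v oo Z)) $ n
    + ((elog q v oo Z') - (elog q v oo Z)) $ n)" by (rule N_add)
  thus ?case by simp
 qed
qed

lemma elog_congruence: assumes v: "!!k. N (- real k) (v k)" and rh: "1/2 <= rh"
  and Z: "fN N 0 Z" and Z0: "Z $ 0 = 0" "Z' $ 0 = 0" and E: "fN N rh (Z' - Z)"
 shows "fN N rh ((elog q v oo Z') - (elog q v oo Z))"
proof -
 interpret F: filtq "fN N" q by (rule filtq_fN) unfold_locales
 have "N rh (v k * (Z' ^ q ^ k - Z ^ q ^ k) $ n)" for k n
 proof -
  have "fN N (rh + real k) (Z' ^ q ^ k - Z ^ q ^ k)" by (rule F.N_power_q_iter[OF Z E rh])
  thus ?thesis by (intro N_mult_le[OF v[of k], where s = "rh + real k"]) (auto simp: fN_def)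
 qed
 thus ?thesis unfolding fN_def fps_sub_nth elog_compose_nth[OF q2 Z0(1)] elog_compose_nth[OF q2 Z0(2)]
  by (auto simp: sum_subtractf[symmetric] right_diff_distrib[symmetric] intro!: N_sum)
qed

lemma elog_small: assumes dt: "!!k. N rh (dt k)" and Z: "fN N 0 Z" and Z0: "Z $ 0 = 0"
 shows "fN N rh (elog q dt oo Z)"
proof -
 interpret F: filt "fN N" by (rule filt_fN) unfold_locales
 show ?thesis unfolding fN_def elog_compose_nth[OF q2 Z0]
  using F.N_power0[OF Z] dt by (auto simp: fN_def intro!: N_sum N_mult_right)
qed

end

section \<open>Frobenius lifts and the functional equation\<close>

definition fR :: "('a => bool) => 'a::comm_ring_1 fps => bool" where
 "fR R s <-> (\<forall>n. R (s $ n))"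

definition fmap :: "('a => 'b) => 'a::comm_ring_1 fps => 'b::comm_ring_1 fps" where
 "fmap g s = Abs_fps (%n. g (s $ n))"

lemma fmap_nth [simp]: "fmap g s $ n = g (s $ n)" by (simp add: fmap_def)

lemma fps_compose_X_power_nth: assumes "0 < Q"
 shows "(s oo fps_X ^ Q) $ n = (if Q dvd n then s $ (n div Q) else (0::'a::comm_ring_1))"
proof -
 have "(s oo fps_X ^ Q) $ n = (\<Sum>i=0..n. if i * Q = n then s $ i else 0)"
  unfolding fps_compose_nth power_mult[symmetric]
  by (intro sum.cong) (auto simp: fps_X_power_nth mult.commute)
 also have "... = (if Q dvd n then s $ (n div Q) else 0)"
 proof (cases "Q dvd n")
  case True
  then obtain l where l: "n = l * Q" by (metis dvd_div_mult_self)
  have "(\<Sum>i=0..n. if i * Q = n then s $ i else 0) = (\<Sum>i=0..n. if i = l then s $ i else 0)"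
   using assms by (intro sum.cong) (auto simp: l)
  thus ?thesis using l by auto
 qed (auto intro!: sum.neutral)
 finally show ?thesis .
qed

text \<open>Monomials are adjoined one at a time. Their supports are disjoint, so \<open>sg\<close>
  only has to fix 0, which admits maps like x -> x^(q^2) that are not additive.\<close>

lemma (in filtq) frob_fps_general: fixes sg :: "'a => 'a"
 assumes sg_0: "sg 0 = 0" and s: "fN N 0 s" and m_pos: "0 < m"
  and frob: "!!n. N 1 ((s $ n) ^ q ^ m - sg (s $ n))"
 shows "fN N 1 (s ^ q ^ m - (fmap sg s oo fps_X ^ q ^ m))"
proof -
 interpret F: filtq "fN N" q by (rule filtq_fN) unfold_locales
 have qm_pos: "0 < q ^ m" using q2 by simp
 let ?f = "%s. fmap sg s oo fps_X ^ q ^ m"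
 have f_nth: "(?f s) $ n = (if q ^ m dvd n then sg (s $ (n div q ^ m)) else 0)" for s n
  unfolding fps_compose_X_power_nth[OF qm_pos] by simp
 have I: "fN N 0 (fps_cutoff n s)" for n using s by (auto simp: fN_def N_0)
 have cut: "fN N 1 (fps_cutoff n s ^ q ^ m - ?f (fps_cutoff n s))" for n
 proof (induction n)
  case 0
  have "?f 0 = 0" by (rule fps_ext) (simp add: f_nth sg_0)
  thus ?case by (simp add: fN_def N_0 zero_power[OF qm_pos])
 next
  case (Suc n)
  define a where "a = s $ n"
  define B where "B = fps_const a * fps_X ^ n"
  have a: "N 0 a" using s by (auto simp: a_def fN_def)
  have eq: "fps_cutoff (Suc n) s = fps_cutoff n s + B"
   by (rule fps_ext) (auto simp: B_def a_def fps_X_power_nth less_Suc_eq)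
  have B: "fN N 0 B" using a by (auto simp: B_def fN_def N_0)
  have fadd: "?f (fps_cutoff n s + B) = ?f (fps_cutoff n s) + ?f B"
   by (rule fps_ext) (auto simp: f_nth B_def fps_X_power_nth sg_0)
  have "?f B = fps_const (sg a) * fps_X ^ (n * q ^ m)"
   using qm_pos m_pos by (intro fps_ext) (auto simp: f_nth B_def fps_X_power_nth sg_0)
  moreover have "B ^ q ^ m = fps_const (a ^ q ^ m) * fps_X ^ (n * q ^ m)"
   by (simp add: B_def power_mult_distrib power_mult)
  ultimately have "B ^ q ^ m - ?f B = fps_const (a ^ q ^ m - sg a) * fps_X ^ (n * q ^ m)"
   by (simp add: left_diff_distrib fps_const_sub[symmetric] del: fps_const_sub)
  hence b: "fN N 1 (B ^ q ^ m - ?f B)" using frob[of n] by (simp add: fN_def N_0 a_def)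
  have "fN N 1 ((fps_cutoff n s + B) ^ q ^ m - (fps_cutoff n s ^ q ^ m + B ^ q ^ m))"
   by (rule F.N_frob_add_iter[OF I B])
  from F.N_add[OF F.N_add[OF this Suc] b]
  show ?case unfolding eq fadd by (simp add: algebra_simps)
 qed
 have "N 1 ((s ^ q ^ m - ?f s) $ n)" for n
 proof -
  have "(s ^ q ^ m) $ n = (fps_cutoff (Suc n) s ^ q ^ m) $ n"
   by (rule fps_power_nth_cong_below[of "Suc n"]) auto
  moreover have "(?f s) $ n = (?f (fps_cutoff (Suc n) s)) $ n"
   by (auto simp: f_nth less_Suc_eq_le)
  ultimately show ?thesis using cut[of "Suc n"] by (simp add: fN_def)
 qed
 thus ?thesis by (simp add: fN_def)
qed

text \<open>\<open>sg\<close> lifts the q^m-th power map on a subring R. The cases are R = F with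
  the identity and m = 1, R = E with the identity and m = 2, and R = E with the conjugation and m =
  1. R is a predicate because \<open>sg\<close> is meaningful only on a subfield of the ambient
  field.\<close>

locale frobr = filtq N q for N :: "real => 'a::idom => bool" and q +
 fixes R :: "'a => bool" and sg :: "'a => 'a" and m :: nat
 assumes R_0: "R 0" and R_1: "R 1" and R_add: "R x ==> R y ==> R (x + y)"
  and R_uminus: "R x ==> R (- x)" and R_mult: "R x ==> R y ==> R (x * y)"
  and sg_R: "R x ==> R (sg x)" and sg_1: "sg 1 = 1"
  and sg_add: "R x ==> R y ==> sg (x + y) = sg x + sg y"
  and sg_mult: "R x ==> R y ==> sg (x * y) = sg x * sg y"
  and m_pos: "0 < m" and frob: "R x ==> N 0 x ==> N 1 (x ^ q ^ m - sg x)"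
begin

lemma sg_0: "sg 0 = 0" using sg_add[OF R_0 R_0] by (metis add.right_neutral add_left_imp_eq)
lemma R_diff: "R x ==> R y ==> R (x - y)" using R_add[of x "-y"] R_uminus by simp
lemma sg_uminus: "R x ==> sg (- x) = - sg x"
 using sg_add[of x "-x"] R_uminus sg_0 by (simp add: eq_neg_iff_add_eq_0 add.commute)
lemma sg_diff: "R x ==> R y ==> sg (x - y) = sg x - sg y"
 using sg_add[of x "-y"] R_uminus sg_uminus by simp
lemma R_sum: "(!!i. i \<in> A ==> R (f i)) ==> R (sum f A)"
 by (induction A rule: infinite_finite_induct) (auto intro: R_0 R_add)
lemma sg_sum: "(!!i. i \<in> A ==> R (f i)) ==> sg (sum f A) = (\<Sum>i\<in>A. sg (f i))"
 by (induction A rule: infinite_finite_induct) (auto simp: sg_0 sg_add R_sum)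
lemma fR_mult: "fR R s ==> fR R t ==> fR R (s * t)"
 by (auto simp: fR_def fps_mult_nth intro!: R_sum R_mult)
lemma fR_1: "fR R 1" by (auto simp: fR_def intro: R_0 R_1)
lemma fR_power: "fR R s ==> fR R (s ^ n)" by (induction n) (auto intro: fR_1 fR_mult)

lemma qm_pos: "0 < q ^ m" using q2 by simp

text \<open>The extension of \<open>sg\<close> to series that sends X to X^(q^m). With it, series
  over R are again an instance of \<open>frobr\<close>, so the construction iterates to two
  variables.\<close>

definition sigf :: "'a fps => 'a fps" where "sigf s = fmap sg s oo fps_X ^ q ^ m"

lemma sigf_nth: "sigf s $ n = (if q ^ m dvd n then sg (s $ (n div q ^ m)) else 0)"
 unfolding sigf_def fps_compose_X_power_nth[OF qm_pos] by simp
lemma sigf_nth_0: "s $ 0 = 0 ==> sigf s $ 0 = 0" by (simp add: sigf_nth sg_0)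
lemma sigf_add: "fR R s ==> fR R t ==> sigf (s + t) = sigf s + sigf t"
 by (rule fps_ext) (auto simp: sigf_nth sg_add fR_def)

lemma sigf_mult: "fR R s ==> fR R t ==> sigf (s * t) = sigf s * sigf t"
proof -
 assume st: "fR R s" "fR R t"
 have "fmap sg (s * t) = fmap sg s * fmap sg t" using st by (intro fps_ext)
   (auto simp: fps_mult_nth fR_def sg_mult R_mult sg_sum intro!: sum.cong)
 moreover have "(fps_X ^ q ^ m :: 'a fps) $ 0 = 0" using qm_pos by simp
 ultimately show ?thesis unfolding sigf_def by (simp add: fps_compose_mult_distrib)
qed

lemma sigf_1: "sigf 1 = 1"
 by (auto intro!: fps_ext simp: sigf_nth sg_1 sg_0 dvd_div_eq_0_iff)
lemma sigf_power: "fR R s ==> sigf (s ^ n) = sigf s ^ n"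
 by (induction n) (auto simp: sigf_1 sigf_mult fR_power)
lemma fR_sigf: "fR R s ==> fR R (sigf s)" by (auto simp: fR_def sigf_nth sg_R R_0)
lemma frob_fps: assumes s: "fR R s" "fN N 0 s" shows "fN N 1 (s ^ q ^ m - sigf s)" unfolding sigf_def
 by (rule frob_fps_general) (use s m_pos in "auto simp: sg_0 fR_def fN_def intro: frob")

lemma frobr_fps: "frobr (fN N) q (fR R) sigf m"
proof -
 interpret F: filtq "fN N" q by (rule filtq_fN) unfold_locales
 show ?thesis
 proof unfold_locales
  show "fR R 0" by (simp add: fR_def R_0)
  show "fR R (x + y)" if "fR R x" "fR R y" for x y using that by (simp add: fR_def R_add)
  show "fR R (- x)" if "fR R x" for x using that by (simp add: fR_def R_uminus)
 qed (auto simp: sigf_add sigf_mult sigf_1 fR_sigf fR_mult fR_1 m_pos frob_fps)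
qed

lemma fR_elog: assumes v: "!!k. R (v k)" and g: "fR R g" "g $ 0 = 0"
 shows "fR R (elog q v oo g)" unfolding fR_def elog_compose_nth[OF q2 g(2)]
 using fR_power[OF g(1)] v by (auto simp: fR_def intro!: R_sum R_mult)

text \<open>The linear coefficient of the logarithm is 1, so its equation determines
  \<open>g $ n\<close> over R from lower coefficients.\<close>

lemma fR_elog_inv:
 assumes v: "!!k. R (v k)" "v 0 = 1" and g: "g $ 0 = 0" and G: "fR R (elog q v oo g)"
 shows "fR R g"
proof -
 have "R (g $ n)" for n
 proof (induction n rule: less_induct)
  case (less n)
  have c: "fR R (fps_cutoff n g)" using less by (auto simp: fR_def R_0)
  have e: "(g ^ q ^ k) $ n = (fps_cutoff n g ^ q ^ k) $ n" if "1 <= k" for k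
  proof (rule fps_power_nth_cong)
   show "2 <= q ^ k" using q2 that power_increasing[of 1 k q] by simp
  qed (use g in auto)
  have "g $ n = (elog q v oo g) $ n - (\<Sum>k=1..n. v k * (fps_cutoff n g ^ q ^ k) $ n)"
   unfolding elog_compose_nth'[OF q2 g] v by (simp add: e)
  moreover have "R ..." using G v fR_power[OF c] by (intro R_diff R_sum R_mult) (auto simp: fR_def)
  ultimately show ?case by simp
 qed
 thus ?thesis by (simp add: fR_def)
qed

lemma sigf_elog:
 assumes v: "!!k. R (v k)" "!!k. sg (v k) = v k" and g: "fR R g" "g $ 0 = 0"
 shows "sigf (elog q v oo g) = elog q v oo sigf g"
proof (rule fps_ext)
 fix n
 define l where "l = n div q ^ m"
 have l: "l <= n" by (simp add: l_def)
 have g': "sigf g $ 0 = 0" by (rule sigf_nth_0) fact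
 have *: "(sigf g ^ j) $ n = (if q ^ m dvd n then sg ((g ^ j) $ l) else 0)" for j
  unfolding sigf_power[OF g(1), symmetric] sigf_nth l_def by simp
 show "sigf (elog q v oo g) $ n = (elog q v oo sigf g) $ n"
 proof (cases "q ^ m dvd n")
  case True
  have "sigf (elog q v oo g) $ n = (\<Sum>k\<le>l. v k * sg ((g ^ q ^ k) $ l))"
   using True fR_power[OF g(1)] v
   by (simp add: sigf_nth l_def[symmetric] elog_compose_nth[OF q2 g(2)] sg_sum sg_mult R_mult fR_def)
  \<comment> \<open>The two sums end at l = n div q^m and at n; the extra terms vanish because l <
    q^k there.\<close>
  also have "... = (\<Sum>k\<le>n. v k * sg ((g ^ q ^ k) $ l))"
  proof (rule sum.mono_neutral_left)
   show "\<forall>k\<in>{..n} - {..l}. v k * sg ((g ^ q ^ k) $ l) = 0"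
   proof
    fix k assume "k \<in> {..n} - {..l}"
    hence "l < q ^ k" using less_power_self[OF q2, of k] by auto
    thus "v k * sg ((g ^ q ^ k) $ l) = 0"
     using startsby_zero_power_prefix[OF g(2), of "q ^ k"] by (simp add: sg_0)
   qed
  qed (use l in auto)
  finally show ?thesis using True unfolding elog_compose_nth[OF q2 g'] * by simp
 next
  case False
  thus ?thesis unfolding elog_compose_nth[OF q2 g'] * by (simp add: sigf_nth)
 qed
qed

end

text \<open>Hazewinkel's setting with \<open>io\<close> in the role of 1/pi: the recursion says f(X)
  = X + f(X^(q^2)) / pi, which is the case u = 0 in characteristic 0.\<close>

locale lubin_tate = frobr N q R sg 2 for N :: "real => 'a::idom => bool" and q R sg +
 fixes io :: 'a and v :: "nat => 'a"
 assumes N_io: "N r x ==> N (r - 1) (io * x)" and R_io: "R io" and sg_io: "sg io = io"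
  and v_0: "v 0 = 1" and v_1: "v (Suc 0) = 0" and v_SS: "v (Suc (Suc k)) = io * v k"
begin

lemma v_facts: "R (v k) & sg (v k) = v k & N (- real k / 2) (v k)"
proof (induction k rule: less_induct)
 case (less k)
 consider "k = 0" | "k = 1" | l where "k = Suc (Suc l)" by (metis One_nat_def not0_implies_Suc)
 thus ?case
 proof cases
  case (3 l)
  have l: "R (v l)" "sg (v l) = v l" "N (- real l / 2) (v l)" using less[of l] 3 by auto
  show ?thesis using N_io[OF l(3)] l R_io sg_io
   by (simp add: 3 v_SS R_mult sg_mult diff_divide_distrib algebra_simps)
 qed (auto simp: v_0 v_1 R_0 R_1 sg_0 sg_1 N_0 N_1)
qed

lemma elog_functional: assumes Z: "Z $ 0 = 0"
 shows "elog q v oo Z = Z + fps_const io * (elog q v oo Z ^ q ^ 2)"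
proof (rule fps_ext)
 fix n
 have Z': "(Z ^ q ^ 2) $ 0 = 0" using Z q2 by simp
 have van: "(Z ^ q ^ k) $ n = 0" if "n < k" for k
  using startsby_zero_power_prefix[OF Z, of "q ^ k"] less_power_self[OF q2, of k] that by simp
 have "(elog q v oo Z) $ n = (\<Sum>k\<le>Suc (Suc n). v k * (Z ^ q ^ k) $ n)"
  unfolding elog_compose_nth[OF q2 Z] using van[of "Suc n"] van[of "Suc (Suc n)"] by simp
 also have "... = Z $ n + (\<Sum>k\<le>n. io * (v k * (Z ^ q ^ Suc (Suc k)) $ n))"
  by (simp only: sum.atMost_Suc_shift) (simp add: v_0 v_1 v_SS mult.assoc)
 also have "... = (Z + fps_const io * (elog q v oo Z ^ q ^ 2)) $ n"
 proof -
  have "Z ^ q ^ Suc (Suc k) = (Z ^ q ^ 2) ^ q ^ k" for k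
   by (simp add: power_mult[symmetric] power2_eq_square mult.assoc)
  thus ?thesis by (simp only: fps_add_nth fps_mult_left_const_nth elog_compose_nth[OF q2 Z'] sum_distrib_left)
 qed
 finally show "(elog q v oo Z) $ n = (Z + fps_const io * (elog q v oo Z ^ q ^ 2)) $ n" .
qed

text \<open>In f(g) = g + io * f(g^(q^2)) the power g^(q^2) may be replaced by the Frobenius twist
  of g: the two agree modulo pi, f preserves this congruence, and the gain of 1 absorbs the factor
  \<open>io\<close>.\<close>

lemma functional_equation_integral: assumes g: "fR R g" "fN N 0 g" "g $ 0 = 0"
 shows "fN N 0 ((elog q v oo g) - fps_const io * sigf (elog q v oo g))"
proof -
 interpret F: filtq "fN N" q by (rule filtq_fN) unfold_locales
 have g1: "(g ^ q ^ 2) $ 0 = 0" using g q2 by simp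
 have "fN N 1 ((elog q v oo g ^ q ^ 2) - (elog q v oo sigf g))"
 proof (rule elog_congruence)
  show "N (- real k) (v k)" for k using v_facts[of k] N_mono by fastforce
  show "fN N 0 (sigf g)"
  proof -
   have "fN N 0 (g ^ q ^ 2 - sigf g)" by (rule F.N_mono[OF frob_fps[OF g(1,2)]]) simp
   from F.N_diff[OF F.N_power0[OF g(2), of "q ^ 2"] this] show ?thesis by simp
  qed
  show "fN N 1 (g ^ q ^ 2 - sigf g)" by (rule frob_fps[OF g(1,2)])
 qed (auto simp: g1 sigf_nth_0 g)
 hence "fN N 0 (fps_const io * ((elog q v oo g ^ q ^ 2) - (elog q v oo sigf g)))"
  using N_io[of 1] by (simp add: fN_def)
 from F.N_add[OF g(2) this] show ?thesis
  using v_facts g by (subst (1) elog_functional) (simp_all add: sigf_elog algebra_simps)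
qed

text \<open>Converse of the functional equation lemma. Truncating g below n changes its logarithm
  first in degree n, and there by \<open>g $ n\<close>; the twist contributes nothing, because it
  takes its coefficient from degree n div q^2 < n.\<close>

lemma integral_of_functional_equation: assumes g: "fR R g" "g $ 0 = 0"
  and G: "fN N 0 ((elog q v oo g) - fps_const io * sigf (elog q v oo g))" shows "fN N 0 g"
proof -
 interpret F: filtq "fN N" q by (rule filtq_fN) unfold_locales
 interpret FF: frobr "fN N" q "fR R" sigf 2 by (rule frobr_fps)
 have vR: "R (v k)" for k using v_facts by auto
 have "N 0 (g $ n)" for n
 proof (induction n rule: less_induct)
  case (less n)
  define h where "h = fps_cutoff n g"
  have h: "fR R h" "fN N 0 h" "h $ 0 = 0" using less g by (auto simp: h_def fR_def fN_def R_0 N_0)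
  define E where "E = (elog q v oo g) - (elog q v oo h)"
  have E: "E $ i = (if i = n then g $ n else 0)" if "i <= n" for i
  proof -
   have e: "(g ^ q ^ k) $ i = (h ^ q ^ k) $ i" if "1 <= k" for k
   proof (rule fps_power_nth_cong)
    show "2 <= q ^ k" using q2 that power_increasing[of 1 k q] by simp
   qed (use g h \<open>i <= n\<close> in "auto simp: h_def")
   thus ?thesis using that unfolding E_def fps_sub_nth
     elog_compose_nth'[OF q2 g(2)] elog_compose_nth'[OF q2 h(3)] by (simp add: v_0 h_def)
  qed
  have sE: "sigf E = sigf (elog q v oo g) - sigf (elog q v oo h)"
   unfolding E_def by (rule FF.sg_diff) (auto intro!: fR_elog vR g h)
  have eq: "E - fps_const io * sigf E = ((elog q v oo g) - fps_const io * sigf (elog q v oo g))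
    - ((elog q v oo h) - fps_const io * sigf (elog q v oo h))"
   unfolding sE by (simp add: E_def algebra_simps)
  have "fN N 0 (E - fps_const io * sigf E)" unfolding eq
   by (intro F.N_diff G functional_equation_integral h)
  hence "N 0 (E $ n - io * sigf E $ n)" by (simp add: fN_def)
  moreover have "sigf E $ n = 0"
  proof (cases "n = 0")
   case True
   thus ?thesis using E[of 0] g by (simp add: sigf_nth_0)
  next
   case False
   hence "n div q ^ 2 < n" using q3 by (intro div_less_dividend)
     (auto intro!: one_less_power simp del: One_nat_def)
   thus ?thesis using E[of "n div q ^ 2"] by (simp add: sigf_nth sg_0)
  qed
  ultimately show ?case using E[of n] by simp
 qed
 thus ?thesis by (simp add: fN_def)
qed

end

section \<open>Power series in two variables\<close>

text \<open>\<open>diagT G\<close> is \<open>G(XT, T)\<close> as a series in \<open>T\<close> over the power series in \<open>X\<close>, so that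
 substitution into \<open>G\<close> becomes composition of one-variable series.\<close>

definition diagT :: "'r::comm_ring_1 fps fps => 'r fps fps" where
 "diagT G = Abs_fps (%d. Abs_fps (%i. if i <= d then (G $ (d - i)) $ i else 0))"

text \<open>This is G(T,T), obtained from \<open>diagT G\<close> by setting X = 1.\<close>

definition diagS :: "'r::comm_ring_1 fps fps => 'r fps" where
 "diagS G = Abs_fps (%d. \<Sum>i\<le>d. (G $ (d - i)) $ i)"

lemma diagT_nth: "(diagT G $ d) $ i = (if i <= d then (G $ (d - i)) $ i else 0)" by (simp add: diagT_def)
lemma diagT_nth': "(diagT G $ (i + j)) $ i = (G $ j) $ i" by (simp add: diagT_nth)
lemma diagS_nth: "diagS G $ d = (\<Sum>i\<le>d. (diagT G $ d) $ i)" by (simp add: diagS_def diagT_def)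
lemma diagT_inj: "diagT G = diagT H <-> G = H" by (metis diagT_nth' fps_ext)
lemma diagT_add: "diagT (G + H) = diagT G + diagT H" by (intro fps_ext) (auto simp: diagT_nth)
lemma diagT_diff: "diagT (G - H) = diagT G - diagT H" by (intro fps_ext) (auto simp: diagT_nth)
lemma diagT_1: "diagT 1 = 1" by (intro fps_ext) (auto simp: diagT_nth fps_one_def)

lemma nth_nth_mult: "((G * H) $ j) $ i = (\<Sum>l\<le>i. \<Sum>k\<le>j. (G $ k) $ l * (H $ (j - k)) $ (i - l))"
proof -
 have "((G * H) $ j) $ i = (\<Sum>k=0..j. \<Sum>l=0..i. (G $ k) $ l * (H $ (j - k)) $ (i - l))"
  by (simp add: fps_mult_nth fps_sum_nth)
 also have "... = (\<Sum>l=0..i. \<Sum>k=0..j. (G $ k) $ l * (H $ (j - k)) $ (i - l))" by (rule sum.swap)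
 finally show ?thesis by (simp add: atLeast0AtMost)
qed

lemma diagT_mult: "diagT (G * H) = diagT G * diagT H"
proof (intro fps_ext)
 fix d i
 have "(\<Sum>k\<le>d. (diagT G $ k) $ l * (diagT H $ (d - k)) $ (i - l))
  = (if i <= d then (\<Sum>k\<le>d - i. (G $ k) $ l * (H $ (d - i - k)) $ (i - l)) else 0)"
  if l: "l <= i" for l
 proof -
  have "(\<Sum>k\<le>d. (diagT G $ k) $ l * (diagT H $ (d - k)) $ (i - l))
   = (\<Sum>k | l <= k & k + i <= d + l. (diagT G $ k) $ l * (diagT H $ (d - k)) $ (i - l))"
   using l by (intro sum.mono_neutral_right) (auto simp: diagT_nth)
  also have "... = (if i <= d then (\<Sum>k\<le>d - i. (G $ k) $ l * (H $ (d - i - k)) $ (i - l)) else 0)"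
  proof (cases "i <= d")
   case True
   have "(\<Sum>k | l <= k & k + i <= d + l. (diagT G $ k) $ l * (diagT H $ (d - k)) $ (i - l))
    = (\<Sum>k\<le>d - i. (G $ k) $ l * (H $ (d - i - k)) $ (i - l))"
    by (rule sum.reindex_bij_witness[where i = "%k. k + l" and j = "%k. k - l"])
     (use True l in "auto simp: diagT_nth algebra_simps")
   thus ?thesis using True by simp
  next
   case False
   hence "{k. l <= k & k + i <= d + l} = {}" by auto
   thus ?thesis using False by (simp only: sum.empty if_False)
  qed
  finally show ?thesis .
 qed
 hence "((diagT G * diagT H) $ d) $ i
  = (\<Sum>l\<le>i. if i <= d then (\<Sum>k\<le>d - i. (G $ k) $ l * (H $ (d - i - k)) $ (i - l)) else 0)"
  unfolding nth_nth_mult by (intro sum.cong) auto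
 thus "(diagT (G * H) $ d) $ i = ((diagT G * diagT H) $ d) $ i" by (simp add: diagT_nth nth_nth_mult)
qed

lemma diagT_power: "diagT (G ^ n) = diagT G ^ n" by (induction n) (auto simp: diagT_1 diagT_mult)

text \<open>Evaluation at X = 1 is multiplicative on polynomials. The coefficients of
  \<open>diagT G\<close> are polynomials in X, which makes \<open>diagS\<close>
  multiplicative.\<close>

lemma sum_coeff_mult: fixes a b :: "'r::comm_ring_1 fps"
 assumes a: "!!i. e < i ==> a $ i = 0" and b: "!!i. f < i ==> b $ i = 0"
 shows "(\<Sum>n\<le>e + f. (a * b) $ n) = (\<Sum>i\<le>e. a $ i) * (\<Sum>j\<le>f. b $ j)"
proof -
 have "(\<Sum>n\<le>e + f. (a * b) $ n) = (\<Sum>n\<le>e + f. \<Sum>i\<le>n. a $ i * b $ (n - i))"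
  by (simp add: fps_mult_nth atLeast0AtMost)
 also have "... = (\<Sum>(i, j)\<in>{(i, j). i + j <= e + f}. a $ i * b $ j)"
  by (rule sum.triangle_reindex_eq[symmetric])
 also have "... = (\<Sum>(i, j)\<in>{..e} \<times> {..f}. a $ i * b $ j)"
 proof (rule sum.mono_neutral_right)
  show "finite {(i, j). i + j <= e + f}" by (rule finite_subset[of _ "{..e + f} \<times> {..e + f}"]) auto
  show "\<forall>x\<in>{(i, j). i + j <= e + f} - {..e} \<times> {..f}. (case x of (i, j) => a $ i * b $ j) = 0"
   using a b by (auto simp: not_le) (metis mult_zero_left mult_zero_right not_le)+
 qed auto
 also have "... = (\<Sum>i\<le>e. a $ i) * (\<Sum>j\<le>f. b $ j)"
  by (simp add: sum_product sum.cartesian_product)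
 finally show ?thesis .
qed

lemma diagS_mult: "diagS (G * H) = diagS G * diagS H"
proof (rule fps_ext)
 fix d
 have "diagS (G * H) $ d = (\<Sum>n\<le>d. \<Sum>k\<le>d. (diagT G $ k * diagT H $ (d - k)) $ n)"
  by (simp add: diagS_nth diagT_mult fps_mult_nth[of "diagT G"] fps_sum_nth atLeast0AtMost)
 also have "... = (\<Sum>k\<le>d. \<Sum>n\<le>k + (d - k). (diagT G $ k * diagT H $ (d - k)) $ n)"
  by (subst sum.swap) (auto intro!: sum.cong)
 also have "... = (\<Sum>k\<le>d. diagS G $ k * diagS H $ (d - k))"
  unfolding diagS_nth by (intro sum.cong refl sum_coeff_mult) (auto simp: diagT_nth)
 finally show "diagS (G * H) $ d = (diagS G * diagS H) $ d" by (simp add: fps_mult_nth atLeast0AtMost)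
qed

lemma diagS_add: "diagS (G + H) = diagS G + diagS H" by (rule fps_ext) (simp add: diagS_def sum.distrib)

lemma diagS_1: "diagS 1 = 1"
proof -
 have "(\<Sum>i\<le>d. ((1 :: 'a fps fps) $ (d - i)) $ i) = (if d = 0 then 1 else 0)" for d
  by (cases "d = 0") (auto intro!: sum.neutral simp: fps_one_def)
 thus ?thesis by (intro fps_ext) (simp add: diagS_def)
qed

lemma diagS_power: "diagS (G ^ n) = diagS G ^ n" by (induction n) (auto simp: diagS_1 diagS_mult)
lemma in_Y_nth [simp]: "in_Y s $ j = fps_const (s $ j)" by (simp add: in_Y_def)

lemma in_Y_add: "in_Y (s + t) = in_Y s + in_Y t" by (rule fps_ext) simp
lemma fps_const_sum: "fps_const (sum f A) = (\<Sum>i\<in>A. fps_const (f i :: 'a::comm_ring_1))"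
 by (induction A rule: infinite_finite_induct) (auto simp: fps_const_add[symmetric] simp del: fps_const_add)

lemma in_Y_mult: "in_Y (s * t) = in_Y s * in_Y t"
 by (rule fps_ext) (simp add: fps_mult_nth fps_const_sum fps_const_mult[symmetric] del: fps_const_mult)
lemma in_Y_1: "in_Y 1 = 1" by (rule fps_ext) (auto simp: fps_one_def)
lemma in_Y_power: "in_Y (s ^ n) = in_Y s ^ n" by (induction n) (auto simp: in_Y_1 in_Y_mult)
lemma in_X_power: "in_X (s ^ n) = in_X s ^ n" by (simp add: in_X_def)

lemma in_Y_compose: "in_Y (s oo t) = in_Y s oo in_Y t"
 by (rule fps_ext) (simp add: fps_compose_nth in_Y_power[symmetric] fps_const_sum
   fps_const_mult[symmetric] del: fps_const_mult)

lemma in_Y_elog: "in_Y (elog q v) = elog q (%k. fps_const (v k))"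
 by (rule fps_ext) (simp add: elog_def fps_const_sum)
lemma subst1_nth: "(subst1 s G $ j) $ i = (\<Sum>n\<le>i + j. s $ n * ((G ^ n) $ j) $ i)"
 by (simp add: subst1_def)

lemma diagT_subst1: "diagT (subst1 s G) = in_Y s oo diagT G"
 by (intro fps_ext) (auto simp: diagT_nth subst1_nth fps_compose_nth fps_sum_nth
   diagT_power[symmetric] atLeast0AtMost)

lemma diagT_nth_0: "(G $ 0) $ 0 = 0 ==> diagT G $ 0 = 0" by (rule fps_ext) (simp add: diagT_nth)

lemma subst1_subst1: fixes G :: "'r::idom fps fps" assumes "s $ 0 = 0" "(G $ 0) $ 0 = 0"
 shows "subst1 r (subst1 s G) = subst1 (r oo s) G"
proof -
 have "in_Y r oo (in_Y s oo diagT G) = in_Y r oo in_Y s oo diagT G"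
  by (rule fps_compose_assoc) (simp_all add: diagT_nth_0 assms)
 hence "diagT (subst1 r (subst1 s G)) = diagT (subst1 (r oo s) G)" by (simp add: diagT_subst1 in_Y_compose)
 thus ?thesis by (simp add: diagT_inj)
qed

lemma subst1_X: assumes "(G $ 0) $ 0 = 0" shows "subst1 fps_X G = G"
proof (intro fps_ext)
 fix j i
 have "(\<Sum>n\<le>i + j. fps_X $ n * ((G ^ n) $ j) $ i)
  = (\<Sum>n\<le>i + j. if n = 1 then (G $ j) $ i else 0)" by (intro sum.cong) auto
 thus "(subst1 fps_X G $ j) $ i = (G $ j) $ i"
  using assms by (cases "i = 0 & j = 0") (auto simp: subst1_nth)
qed

lemma subst1_nth_0: "s $ 0 = 0 ==> (subst1 s G $ 0) $ 0 = 0" by (simp add: subst1_nth)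

lemma subst1_in_X: "subst1 s (in_X t) = in_X (s oo t)"
proof (intro fps_ext)
 fix j i
 show "(subst1 s (in_X t) $ j) $ i = (in_X (s oo t) $ j) $ i"
  by (cases "j = 0") (auto simp: subst1_nth in_X_power[symmetric] in_X_def fps_compose_nth atLeast0AtMost)
qed

lemma subst1_in_Y: "subst1 s (in_Y t) = in_Y (s oo t)"
proof (intro fps_ext)
 fix j i
 show "(subst1 s (in_Y t) $ j) $ i = (in_Y (s oo t) $ j) $ i"
  by (cases "i = 0") (auto simp: subst1_nth in_Y_power[symmetric] fps_compose_nth atLeast0AtMost)
qed

lemma subst2_nth: "(subst2 G s t $ j) $ i
  = (\<Sum>m\<le>i. \<Sum>n\<le>j. (G $ n) $ m * (s ^ m) $ i * (t ^ n) $ j)" by (simp add: subst2_def)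

text \<open>Substituting first in the coefficients and then for Y reduces multiplicativity to that
  of one-variable composition.\<close>

lemma subst2_eq_compose: "subst2 G s t = fmap (%g. g oo s) G oo in_Y t"
proof (intro fps_ext)
 fix j i
 have "((fmap (%g. g oo s) G oo in_Y t) $ j) $ i
   = (\<Sum>n\<le>j. (\<Sum>m\<le>i. (G $ n) $ m * (s ^ m) $ i) * (t ^ n) $ j)"
  by (simp add: fps_compose_nth fps_sum_nth in_Y_power[symmetric] atLeast0AtMost)
 also have "... = (subst2 G s t $ j) $ i"
  unfolding subst2_nth by (subst sum.swap) (simp add: sum_distrib_right)
 finally show "(subst2 G s t $ j) $ i = ((fmap (%g. g oo s) G oo in_Y t) $ j) $ i" ..
qed

lemma subst2_mult: fixes G H :: "'r::idom fps fps" assumes "s $ 0 = 0" "t $ 0 = 0"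
 shows "subst2 (G * H) s t = subst2 G s t * subst2 H s t"
proof -
 have "fmap (%g. g oo s) (G * H) = fmap (%g. g oo s) G * fmap (%g. g oo s) H"
  by (rule fps_ext) (simp add: fps_mult_nth fps_compose_sum_distrib fps_compose_mult_distrib assms)
 thus ?thesis unfolding subst2_eq_compose
  using fps_compose_mult_distrib[of "in_Y t" "fmap (%g. g oo s) G" "fmap (%g. g oo s) H"] assms by simp
qed

lemma subst2_add: "subst2 (G + H) s t = subst2 G s t + subst2 H s t"
 by (intro fps_ext) (simp add: subst2_nth distrib_right sum.distrib)

lemma subst2_1: "subst2 1 s t = 1"
proof -
 have "fmap (%g. g oo s) 1 = (1 :: 'a fps fps)" by (rule fps_ext) (auto simp: fps_one_nth)
 thus ?thesis by (simp add: subst2_eq_compose)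
qed

lemma subst2_power: fixes G :: "'r::idom fps fps" assumes "s $ 0 = 0" "t $ 0 = 0"
 shows "subst2 (G ^ n) s t = subst2 G s t ^ n" by (induction n) (auto simp: subst2_1 subst2_mult assms)

lemma subst2_in_X: "subst2 (in_X r) s t = in_X (r oo s)"
proof -
 have "fmap (%g. g oo s) (in_X r) = in_X (r oo s)" by (rule fps_ext) (simp add: in_X_def)
 thus ?thesis by (simp add: subst2_eq_compose in_X_def)
qed

lemma subst2_in_Y: "subst2 (in_Y r) s t = in_Y (r oo t)"
proof -
 have "fmap (%g. g oo s) (in_Y r) = in_Y r" by (rule fps_ext) simp
 thus ?thesis by (simp add: subst2_eq_compose in_Y_compose)
qed

lemma subst2_nth_0: "(G $ 0) $ 0 = 0 ==> (subst2 G s t $ 0) $ 0 = 0" by (simp add: subst2_nth)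

text \<open>Total degree in X and Y is degree in T for \<open>diagT\<close>, so the one-variable
  estimate for the order of a power applies.\<close>

lemma nth_nth_power_prefix: fixes G :: "'r::comm_ring_1 fps fps" assumes "(G $ 0) $ 0 = 0" and "i + j < n"
 shows "((G ^ n) $ j) $ i = 0"
proof -
 have "(diagT G ^ n) $ (i + j) = 0"
  using startsby_zero_power_prefix[OF diagT_nth_0[OF assms(1)], of n] assms(2) by auto
 thus ?thesis by (metis diagT_nth' diagT_power fps_zero_nth)
qed

lemma subst1_subst2: fixes G :: "'r::idom fps fps" assumes st: "s $ 0 = 0" "t $ 0 = 0" and G: "(G $ 0) $ 0 = 0"
 shows "subst1 r (subst2 G s t) = subst2 (subst1 r G) s t"
proof (intro fps_ext)
 fix j i
 have "(subst2 (subst1 r G) s t $ j) $ i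
  = (\<Sum>m\<le>i. \<Sum>l\<le>j. (\<Sum>n\<le>i + j. r $ n * ((G ^ n) $ l) $ m) * (s ^ m) $ i * (t ^ l) $ j)"
 proof -
  have "(\<Sum>n\<le>m + l. r $ n * ((G ^ n) $ l) $ m)
    = (\<Sum>n\<le>i + j. r $ n * ((G ^ n) $ l) $ m)" if "m <= i" "l <= j" for m l
   using nth_nth_power_prefix[OF G] that by (intro sum.mono_neutral_left) auto
  thus ?thesis unfolding subst2_nth subst1_nth by simp
 qed
 also have "... = (\<Sum>n\<le>i + j. r $ n * (subst2 (G ^ n) s t $ j) $ i)"
 proof -
  let ?f = "%m l n. r $ n * (((G ^ n) $ l) $ m * (s ^ m) $ i * (t ^ l) $ j)"
  have "(\<Sum>m\<le>i. \<Sum>l\<le>j. \<Sum>n\<le>i + j. ?f m l n) = (\<Sum>m\<le>i. \<Sum>n\<le>i + j. \<Sum>l\<le>j. ?f m l n)"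
   by (intro sum.cong refl sum.swap)
  also have "... = (\<Sum>n\<le>i + j. \<Sum>m\<le>i. \<Sum>l\<le>j. ?f m l n)" by (rule sum.swap)
  finally show ?thesis unfolding subst2_nth sum_distrib_left sum_distrib_right by (simp only: mult.assoc)
 qed
 finally show "(subst1 r (subst2 G s t) $ j) $ i = (subst2 (subst1 r G) s t $ j) $ i"
  by (simp add: subst1_nth subst2_power[OF st])
qed

lemma diagS_in_X: "diagS (in_X s) = s"
proof (rule fps_ext)
 fix d
 have "(\<Sum>i\<le>d. (in_X s $ (d - i)) $ i) = (\<Sum>i\<le>d. if i = d then s $ d else 0)"
  by (intro sum.cong) (auto simp: in_X_def)
 thus "diagS (in_X s) $ d = s $ d" by (simp add: diagS_def)
qed

lemma diagS_in_Y: "diagS (in_Y s) = s"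
proof (rule fps_ext)
 fix d
 have "(\<Sum>i\<le>d. (in_Y s $ (d - i)) $ i) = (\<Sum>i\<le>d. if i = 0 then s $ d else 0)"
  by (intro sum.cong) auto
 thus "diagS (in_Y s) $ d = s $ d" by (simp add: diagS_def)
qed

lemma diagS_subst1: "diagS (subst1 r G) = r oo diagS G"
proof (rule fps_ext)
 fix d
 have "diagS (subst1 r G) $ d = (\<Sum>i\<le>d. \<Sum>n\<le>d. r $ n * ((G ^ n) $ (d - i)) $ i)"
  by (simp add: diagS_def subst1_nth)
 also have "... = (\<Sum>n\<le>d. r $ n * diagS (G ^ n) $ d)"
  by (subst sum.swap) (simp add: diagS_def sum_distrib_left)
 finally show "diagS (subst1 r G) $ d = (r oo diagS G) $ d"
  by (simp add: fps_compose_nth diagS_power atLeast0AtMost)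
qed

lemma subst_diag_eq: assumes st: "s $ 0 = 0" "t $ 0 = 0" shows "subst_diag G s t = diagS (subst2 G s t)"
proof (rule fps_ext)
 fix d
 have "subst_diag G s t $ d = (\<Sum>m\<le>d. \<Sum>n\<le>d. \<Sum>i\<le>d. (G $ n) $ m * (s ^ m) $ i * (t ^ n) $ (d - i))"
  by (simp add: subst_diag_def fps_mult_nth sum_distrib_left atLeast0AtMost mult.assoc)
 also have "... = (\<Sum>m\<le>d. \<Sum>i\<le>d. \<Sum>n\<le>d. (G $ n) $ m * (s ^ m) $ i * (t ^ n) $ (d - i))"
  by (intro sum.cong refl sum.swap)
 also have "... = (\<Sum>i\<le>d. \<Sum>m\<le>d. \<Sum>n\<le>d. (G $ n) $ m * (s ^ m) $ i * (t ^ n) $ (d - i))"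
  by (rule sum.swap)
 also have "... = (\<Sum>i\<le>d. \<Sum>m\<le>i. \<Sum>n\<le>d - i. (G $ n) $ m * (s ^ m) $ i * (t ^ n) $ (d - i))"
 proof (rule sum.cong[OF refl])
  fix i assume i: "i \<in> {..d}"
  have *: "(\<Sum>n\<le>d. (G $ n) $ m * (s ^ m) $ i * (t ^ n) $ (d - i))
   = (\<Sum>n\<le>d - i. (G $ n) $ m * (s ^ m) $ i * (t ^ n) $ (d - i))" for m
   using startsby_zero_power_prefix[OF st(2)] by (intro sum.mono_neutral_right) auto
  show "(\<Sum>m\<le>d. \<Sum>n\<le>d. (G $ n) $ m * (s ^ m) $ i * (t ^ n) $ (d - i))
   = (\<Sum>m\<le>i. \<Sum>n\<le>d - i. (G $ n) $ m * (s ^ m) $ i * (t ^ n) $ (d - i))"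
   unfolding * using i startsby_zero_power_prefix[OF st(1)]
   by (intro sum.mono_neutral_right) (auto intro!: sum.neutral)
 qed
 finally show "subst_diag G s t $ d = diagS (subst2 G s t) $ d" by (simp add: diagS_def subst2_nth)
qed

lemma fN_diagT: assumes "filt N" shows "fN (fN N) r (diagT G) <-> fN (fN N) r G"
proof
 interpret filt N by fact
 show "fN (fN N) r (diagT G)" if "fN (fN N) r G" using that by (auto simp: fN_def diagT_nth N_0)
 show "fN (fN N) r G" if "fN (fN N) r (diagT G)" using that unfolding fN_def by (metis diagT_nth')
qed

section \<open>Finite subfields and additive exponents\<close>

text \<open>Write n = p^r * m with m prime to p. If m > 1, then n choose p^r is one of the given
  binomials, and it has the same p-adic valuation as m, namely 0.\<close>

lemma additive_exponent_prime_power: fixes p n :: nat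
 assumes p: "prime p" and n: "0 < n" and add: "!!i. 0 < i ==> i < n ==> p dvd (n choose i)"
 shows "\<exists>r. n = p ^ r"
proof -
 obtain m where m: "n = p ^ multiplicity p n * m" "~ p dvd m"
  using multiplicity_decompose'[of n p] n p by (metis neq0_conv not_prime_unit)
 define r where "r = multiplicity p n"
 have m0: "0 < m" using m n by (metis mult_0_right neq0_conv)
 show ?thesis
 proof (cases "m = 1")
  case True
  thus ?thesis using m by auto
 next
  case False
  have "0 < p ^ r" using p by (simp add: prime_gt_0_nat)
  moreover have "p ^ r * 1 < p ^ r * m" using calculation m0 False by (intro mult_strict_left_mono) auto
  ultimately have "p dvd (n choose p ^ r)" using add[of "p ^ r"] m(1) r_def by simp
  moreover have "multiplicity p (p ^ r * m choose p ^ r) = multiplicity p m" by (rule const_p_fac[OF m0 p])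
  moreover have "n choose p ^ r ~= 0"
   using \<open>p ^ r * 1 < p ^ r * m\<close> m(1) r_def by (simp add: binomial_eq_0_iff)
  ultimately have "p dvd m" using m(1) r_def p m0
   by (metis multiplicity_eq_zero_iff neq0_conv not_dvd_imp_multiplicity_0 not_prime_unit)
  thus ?thesis using m by simp
 qed
qed

text \<open>One step of Euclid's algorithm: p^r - 1 is congruent to p^(r-f) - 1 modulo p^f -
  1.\<close>

lemma prime_power_cong_1: fixes p :: nat assumes p: "2 <= p" and f: "0 < f" and d: "p ^ f - 1 dvd p ^ r - 1"
 shows "f dvd r" using d
proof (induction r rule: less_induct)
 case (less r)
 show ?case
 proof (cases "r < f")
  case True
  hence "p ^ r < p ^ f" using p by (intro power_strict_increasing) auto
  moreover have "1 <= p ^ r" using p by simp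
  ultimately have "p ^ r - 1 < p ^ f - 1" by linarith
  hence "p ^ r - 1 = 0" using less.prems by auto
  hence "p ^ r = 1" using \<open>1 <= p ^ r\<close> by linarith
  thus ?thesis using p by (auto simp: nat_power_eq_Suc_0_iff)
 next
  case False
  have 1: "1 <= p ^ (r - f)" "1 <= p ^ r" "1 <= p ^ f" using p by simp_all
  have "p ^ r = p ^ (r - f) * p ^ f" using False by (simp add: power_add[symmetric])
  hence "p ^ r - 1 = p ^ (r - f) * (p ^ f - 1) + (p ^ (r - f) - 1)"
   using 1 by (simp add: diff_mult_distrib2)
  hence "p ^ f - 1 dvd p ^ (r - f) - 1" using less.prems by (metis dvd_add_right_iff dvd_triv_right)
  moreover have "r - f < r" using f False by simp
  ultimately have "f dvd r - f" using less.IH by blast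
  thus ?thesis using False by (metis dvd_diffD dvd_refl not_le_imp_less order.strict_implies_order)
 qed
qed

text \<open>The residue fields of F and of E are subsets of the type \<open>'k\<close> and not
  types; this locale treats both.\<close>

locale finite_subring = fixes F :: "'k::field set" assumes fin: "finite F" and F_1: "1 \<in> F"
  and F_diff: "x \<in> F ==> y \<in> F ==> x - y \<in> F" and F_mult: "x \<in> F ==> y \<in> F ==> x * y \<in> F"
begin

lemma F_0: "0 \<in> F" using F_diff[OF F_1 F_1] by simp
lemma F_uminus: "x \<in> F ==> - x \<in> F" using F_diff[OF F_0, of x] by simp
lemma F_add: "x \<in> F ==> y \<in> F ==> x + y \<in> F" using F_diff[of x "- y"] F_uminus by simp
lemma F_of_nat: "of_nat n \<in> F" by (induction n) (auto simp: F_0 F_1 F_add)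

lemma card_ge_2: "2 <= card F"
proof -
 have "card {0, 1::'k} <= card F" using F_0 F_1 fin by (intro card_mono) auto
 thus ?thesis by simp
qed

text \<open>Lagrange's theorem in the form of Fermat: multiplication by x permutes the nonzero
  elements, so their product absorbs a power of x.\<close>

lemma power_card: assumes x: "x \<in> F" shows "x ^ card F = x"
proof (cases "x = 0")
 case True
 thus ?thesis using card_ge_2 by simp
next
 case False
 let ?G = "F - {0}"
 have inj: "inj_on ((*) x) ?G" using False by (auto intro: inj_onI)
 have "(*) x ` ?G = ?G"
  by (rule endo_inj_surj[OF _ _ inj]) (use x False fin in "auto intro: F_mult")
 hence "prod (%y. y) ?G = prod (%y. y) ((*) x ` ?G)" by (simp only:)
 also have "... = prod (%y. x * y) ?G" by (simp only: prod.reindex[OF inj] o_def)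
 also have "... = x ^ card ?G * prod (%y. y) ?G" by (simp only: prod.distrib prod_constant)
 finally have "x ^ card ?G * prod (%y. y) ?G = 1 * prod (%y. y) ?G" by simp
 moreover have "prod (%y. y) ?G ~= 0" using fin by (simp only: prod_zero_iff finite_Diff) simp
 ultimately have "x ^ card ?G = 1" using mult_right_cancel by blast
 moreover have "card F = Suc (card ?G)" using card.remove[OF fin F_0] .
 ultimately show ?thesis by (simp only: power_Suc mult_1_right)
qed

lemma fixed_iff: "x \<in> F <-> x ^ card F = x"
proof
 define P :: "'k poly" where "P = monom 1 (card F) - [:0, 1:]"
 have c: "2 <= card F" by (rule card_ge_2)
 have P: "P ~= 0"
 proof
  assume "P = 0"
  hence "coeff P (card F) = 0" by simp
  thus False using c by (simp add: P_def coeff_pCons split: nat.splits)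
 qed
 have deg: "degree P <= card F"
  unfolding P_def using c by (intro degree_diff_le) (auto simp: degree_monom_le)
 have roots: "{x. poly P x = 0} = {x. x ^ card F = x}" by (auto simp: P_def poly_monom)
 have "card {x::'k. x ^ card F = x} <= card F"
  using card_poly_roots_bound[OF P] deg unfolding roots by (rule order_trans)
 moreover have "F \<subseteq> {x. x ^ card F = x}" using power_card by auto
 moreover have "finite {x::'k. x ^ card F = x}" using poly_roots_finite[OF P] roots by simp
 ultimately have "F = {x. x ^ card F = x}" by (meson card_seteq)
 thus "x ^ card F = x ==> x \<in> F" by auto
qed (rule power_card)

lemma CHAR_pos: "0 < CHAR('k)"
proof -
 have "~ inj (of_nat :: nat => 'k)"
  using fin F_of_nat by (meson finite_subset image_subset_iff infinite_UNIV_nat finite_imageD)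
 then obtain m n where mn: "m < n" "(of_nat m :: 'k) = of_nat n" by (metis injI linorder_neqE_nat)
 hence "(of_nat (n - m) :: 'k) = 0" by simp
 thus ?thesis using mn(1) by (metis CHAR_pos_iff zero_less_diff)
qed

lemma prime_CHAR: "prime CHAR('k)" by (rule prime_CHAR_semidom[OF CHAR_pos])

text \<open>(1 + X)^q and 1 + X^q have the same coefficient in degree q and agree at the q elements
  of F, hence are equal as polynomials; the middle coefficients are the binomials.\<close>

lemma CHAR_dvd_binomial: assumes "0 < i" "i < card F" shows "CHAR('k) dvd (card F choose i)"
proof -
 define q where "q = card F"
 have q: "2 <= q" using card_ge_2 q_def by simp
 have "[:1, 1:] ^ q = monom 1 q + (1 :: 'k poly)"
 proof (rule poly_eqI_degree_lead_coeff[where A = F and n = q])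
  show "coeff ([:1, 1:] ^ q) q = coeff (monom 1 q + (1 :: 'k poly)) q"
   using q by (simp add: coeff_linear_poly_power)
  show "degree ([:1, 1:] ^ q :: 'k poly) <= q" using degree_power_le[of "[:1, 1::'k:]" q] by simp
  show "degree (monom 1 q + (1 :: 'k poly)) <= q" by (intro degree_add_le) (auto simp: degree_monom_le)
  show "poly ([:1, 1:] ^ q) z = poly (monom 1 q + 1) z" if "z \<in> F" for z
   using power_card[OF F_add[OF F_1 that]] power_card[OF that] by (simp add: q_def poly_monom)
 qed (simp add: q_def)
 hence "coeff ([:1, 1:] ^ q) i = coeff (monom 1 q + (1 :: 'k poly)) i" by simp
 hence "(of_nat (q choose i) :: 'k) = 0"
  using assms by (simp add: coeff_linear_poly_power q_def)
 thus ?thesis by (simp add: of_nat_eq_0_iff_char_dvd q_def)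
qed

lemma card_prime_power: "\<exists>f>0. card F = CHAR('k) ^ f"
proof -
 obtain f where "card F = CHAR('k) ^ f"
  using additive_exponent_prime_power[OF prime_CHAR _ CHAR_dvd_binomial] card_ge_2 by auto
 moreover have "f ~= 0" using calculation card_ge_2 by (intro notI) simp
 ultimately show ?thesis by auto
qed

end

section \<open>The valuation\<close>

locale lt = fixes L :: "('c::{field, complete_space}, 'k::field) lt_data" assumes lt_ax: "lt_setup L"
begin

abbreviation q :: nat where "q \<equiv> qF L"
abbreviation \<pi>' :: 'c where "\<pi>' \<equiv> unif L"
abbreviation rd :: "'c => 'k" where "rd \<equiv> redn L"

definition V :: "real => 'c => bool" where "V r x <-> ereal r <= val L x"

lemma val_infty: "val L x = \<infinity> <-> x = 0"
 and val_minfty: "val L x ~= - \<infinity>" and val_mult: "val L (x * y) = val L x + val L y"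
 and val_add: "min (val L x) (val L y) <= val L (x + y)"
 and dist_val: "x ~= y ==> dist x y = real q powr (- real_of_ereal (val L (x - y)))"
 and rd_surj: "rd ` OC L = UNIV" and rd_1: "rd 1 = 1"
 and base_subfield: "subfield_set (base L)" and base_complete: "complete (base L)"
 and unif_base: "\<pi>' \<in> base L" and val_unif: "val L \<pi>' = 1"
 and base_discrete: "x \<in> base L ==> x ~= 0 ==> \<exists>n::int. val L x = ereal (of_int n)"
 and fin_res: "finite (rd ` OF_ring L)" and CHAR_ne_2: "CHAR('k) ~= 2"
 using lt_ax unfolding lt_setup_def by auto

lemma rd_add: "V 0 x ==> V 0 y ==> rd (x + y) = rd x + rd y"
 and rd_mult: "V 0 x ==> V 0 y ==> rd (x * y) = rd x * rd y"
 and rd_0_iff_val: "V 0 x ==> rd x = 0 <-> 0 < val L x"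
 using lt_ax unfolding lt_setup_def OC_def mC_def V_def by (auto simp flip: zero_ereal_def)

lemma algebraic_root: "(!!n. coeff p n \<in> algebraic_over (base L)) ==> degree p > 0 ==> \<exists>x. poly p x = 0"
proof -
 have "\<forall>p. (\<forall>n. coeff p n \<in> algebraic_over (base L)) & degree p > 0 -->
   (\<exists>x\<in>algebraic_over (base L). poly p x = 0)" using lt_ax unfolding lt_setup_def by (elim conjE)
 thus "(!!n. coeff p n \<in> algebraic_over (base L)) ==> degree p > 0 ==> \<exists>x. poly p x = 0" by blast
qed

lemma val_real: assumes "x ~= 0" obtains r where "val L x = ereal r"
 using val_infty[of x] val_minfty[of x] assms by (cases "val L x") auto

declare zero_ereal_def [symmetric, simp] one_ereal_def [symmetric, simp]

lemma val_0 [simp]: "val L 0 = \<infinity>" using val_infty by simp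

lemma val_1 [simp]: "val L 1 = 0"
proof -
 obtain r where "val L 1 = ereal r" by (rule val_real[of 1]) auto
 thus ?thesis using val_mult[of 1 1] by simp
qed

lemma val_uminus [simp]: "val L (- x) = val L x"
proof -
 obtain r where r: "val L (- 1) = ereal r" by (rule val_real[of "- 1"]) auto
 have "val L (- 1) = 0" using val_mult[of "- 1" "- 1"] r by simp
 thus ?thesis using val_mult[of "- 1" x] by simp
qed

lemma val_power: "val L x = ereal r ==> val L (x ^ n) = ereal (real n * r)"
 by (induction n) (auto simp: val_mult algebra_simps)

lemma val_inverse: "val L x = ereal r ==> val L (inverse x) = ereal (- r)"
proof -
 assume x: "val L x = ereal r"
 hence nz: "x ~= 0" by auto
 obtain s where s: "val L (inverse x) = ereal s" by (rule val_real[of "inverse x"]) (use nz in auto)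
 have "val L (x * inverse x) = ereal (r + s)" by (simp add: val_mult x s)
 thus ?thesis using nz s by simp
qed

lemma V_0 [simp]: "V r 0" by (simp add: V_def)

sublocale filt V
proof
 show "V r (x + y)" if "V r x" "V r y" for r x y
  using that val_add[of x y] unfolding V_def by (metis min.bounded_iff order_trans)
 show "V (r + s) (x * y)" if "V r x" "V s y" for r s x y
  using that unfolding V_def val_mult plus_ereal.simps(1)[symmetric] by (rule add_mono)
 show "V s x" if "V r x" "s <= r" for r s x
  using that unfolding V_def by (meson ereal_less_eq(3) order_trans)
qed (auto simp: V_def)

lemma V_1: "V 0 1" by (rule N_1)
lemma V_mult_iff: "val L x = ereal s ==> V r (x * y) <-> V (r - s) y"
 unfolding V_def val_mult by (cases "val L y") auto
lemma V_divide_iff: assumes "val L x = ereal s" shows "V r (y / x) <-> V (r + s) y"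
 using V_mult_iff[OF val_inverse[OF assms], of r y] by (simp add: divide_inverse mult.commute)
lemma V_mult_unit: "val L x = 0 ==> V r (x * y) <-> V r y"
 using V_mult_iff[of x 0] by simp
lemma V_unif_mult: "V r (\<pi>' * y) <-> V (r - 1) y"
 using V_mult_iff[of \<pi>' 1] val_unif by simp
lemma V_unif_div: "V r (y / \<pi>') <-> V (r + 1) y"
 using V_divide_iff[of \<pi>' 1] val_unif by simp
lemma V_val: "val L x = ereal r ==> V s x <-> s <= r" by (simp add: V_def)
lemma unif_nz [simp]: "\<pi>' ~= 0" using val_unif by (metis val_0 PInfty_neq_ereal(2) one_ereal_def)

lemma val_add_eq: "val L x < val L y ==> val L (x + y) = val L x"
proof -
 assume a: "val L x < val L y"
 have "val L x <= val L (x + y)" using val_add[of x y] a by simp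
 moreover have "min (val L (x + y)) (val L y) <= val L x" using val_add[of "x + y" "- y"] by simp
 ultimately show ?thesis using a by (auto simp: min_def split: if_splits)
qed

lemma V_all_imp_0: assumes "!!r. V r x" shows "x = 0"
proof (rule ccontr)
 assume "x ~= 0"
 then obtain r where "val L x = ereal r" by (rule val_real)
 thus False using assms[of "r + 1"] by (simp add: V_def)
qed

lemma V_seq_imp_0: assumes "!!n. V (d + e * real n) x" "0 < e" shows "x = 0"
proof (rule V_all_imp_0)
 fix r
 obtain n where "(r - d) / e < real n" using reals_Archimedean2 by blast
 hence "r <= d + e * real n" using assms(2) by (simp add: field_simps)
 thus "V r x" using N_mono assms(1) by blast
qed

lemma OC_iff: "x \<in> OC L <-> V 0 x" by (simp add: OC_def V_def)

lemma mC_iff: "x \<in> mC L <-> (\<exists>r>0. V r x)"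
proof (cases "x = 0")
 case True
 thus ?thesis by (auto simp: mC_def intro: exI[of _ 1])
next
 case False
 then obtain r where "val L x = ereal r" by (rule val_real)
 thus ?thesis by (auto simp: mC_def V_def)
qed

lemma rd_0 [simp]: "rd 0 = 0" using rd_add[of 0 0] by (metis V_0 add.right_neutral add_left_imp_eq)
lemma rd_uminus: "V 0 x ==> rd (- x) = - rd x"
 using rd_add[of x "- x"] N_uminus by (simp add: eq_neg_iff_add_eq_0 add.commute)
lemma rd_diff: "V 0 x ==> V 0 y ==> rd (x - y) = rd x - rd y"
 using rd_add[of x "- y"] N_uminus rd_uminus by simp
lemma rd_power: "V 0 x ==> rd (x ^ n) = rd x ^ n"
 by (induction n) (auto simp: rd_1 rd_mult N_power0)
lemma rd_sum: "(!!i. i \<in> A ==> V 0 (f i)) ==> rd (sum f A) = (\<Sum>i\<in>A. rd (f i))"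
 by (induction A rule: infinite_finite_induct) (auto simp: rd_add N_sum)
lemma rd_of_nat: "rd (of_nat n) = of_nat n" by (induction n) (auto simp: rd_add V_1 N_of_nat rd_1)

lemma rd_0_iff: "V 0 x ==> rd x = 0 <-> x \<in> mC L" by (simp add: rd_0_iff_val mC_def)
lemma rd_eq_iff: "V 0 x ==> V 0 y ==> rd x = rd y <-> x - y \<in> mC L"
 using rd_0_iff[of "x - y"] by (simp add: rd_diff N_diff)
lemma rd_0I: "V r x ==> 0 < r ==> rd x = 0"
 using rd_0_iff[of x] mC_iff[of x] N_mono[of r x 0] by auto
lemma rd_eqI: "V r (x - y) ==> 0 < r ==> V 0 y ==> rd x = rd y"
 using rd_0I[of r "x - y"] rd_add[of "x - y" y] N_mono[of r "x - y" 0] by simp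
lemma V0_trans: "V r (x - y) ==> 0 <= r ==> V 0 y ==> V 0 x"
 using N_add[of 0 "x - y" y] N_mono[of r "x - y" 0] by simp

lemma val_unit_iff: "val L x = 0 <-> V 0 x & rd x ~= 0"
 using rd_0_iff_val[of x] by (auto simp: V_def)

lemma rd_inverse: "val L x = 0 ==> rd (inverse x) = inverse (rd x)"
proof -
 assume x: "val L x = 0"
 hence "x ~= 0" by auto
 moreover have "V 0 (inverse x)" using val_inverse[of x 0] x by (simp add: V_def)
 moreover have "V 0 x" using x val_unit_iff by simp
 ultimately have "rd x * rd (inverse x) = 1" using rd_mult[of x "inverse x"] rd_1 by simp
 thus ?thesis by (simp add: inverse_unique)
qed

lemma val_inverse_unit: "val L x = 0 ==> val L (inverse x) = 0" using val_inverse[of x 0] by simp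
lemma val_mult_unit: "val L x = 0 ==> val L y = 0 ==> val L (x * y) = 0"
 by (simp add: val_mult)
lemma val_power_unit: "val L x = 0 ==> val L (x ^ n) = 0" using val_power[of x 0] by simp

lemma rd_exists: obtains x where "V 0 x" "rd x = c" using rd_surj OC_iff by (metis UNIV_I imageE)

subsection \<open>The local field and its residue field\<close>

lemma base_1: "1 \<in> base L" and base_diff: "x \<in> base L ==> y \<in> base L ==> x - y \<in> base L"
 and base_mult: "x \<in> base L ==> y \<in> base L ==> x * y \<in> base L"
 and base_inverse: "x \<in> base L ==> inverse x \<in> base L"
 using base_subfield unfolding subfield_set_def by auto
lemma base_0: "0 \<in> base L" using base_diff[OF base_1 base_1] by simp
lemma base_uminus: "x \<in> base L ==> - x \<in> base L" using base_diff[OF base_0, of x] by simp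
lemma base_add: "x \<in> base L ==> y \<in> base L ==> x + y \<in> base L" using base_diff[of x "- y"] base_uminus by simp
lemma base_power: "x \<in> base L ==> x ^ n \<in> base L" by (induction n) (auto intro: base_1 base_mult)
lemma base_divide: "x \<in> base L ==> y \<in> base L ==> x / y \<in> base L"
 by (simp add: divide_inverse base_mult base_inverse)

lemma OF_iff: "x \<in> OF_ring L <-> x \<in> base L & V 0 x" by (simp add: OF_ring_def OC_iff)

text \<open>Valuations on F are integers, so a bound r may be raised to any integer below r +
  1.\<close>

lemma base_V_int: assumes "x \<in> base L" "V r x" "real_of_int m < r + 1" shows "V (real_of_int m) x"
proof (cases "x = 0")
 case False
 then obtain n :: int where n: "val L x = ereal (of_int n)" using base_discrete assms(1) by blast
 hence "r <= of_int n" using assms(2) by (simp add: V_def)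
 hence "real_of_int m < of_int n + 1" using assms(3) by linarith
 hence "m <= n" by linarith
 thus ?thesis using n by (simp add: V_def)
qed simp

lemma base_V_1: "x \<in> base L ==> V r x ==> 0 < r ==> V 1 x"
 using base_V_int[of x r 1] by simp

sublocale Fq: finite_subring "rd ` OF_ring L"
proof
 show "finite (rd ` OF_ring L)" by (rule fin_res)
 show "1 \<in> rd ` OF_ring L" using rd_1 base_1 V_1 OF_iff by (metis imageI)
 show "x - y \<in> rd ` OF_ring L" if "x \<in> rd ` OF_ring L" "y \<in> rd ` OF_ring L" for x y
  using that by (auto simp: OF_iff rd_diff[symmetric] intro!: base_diff N_diff)
 show "x * y \<in> rd ` OF_ring L" if "x \<in> rd ` OF_ring L" "y \<in> rd ` OF_ring L" for x y
  using that by (auto simp: OF_iff rd_mult[symmetric] intro!: base_mult N_mult_left)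
qed

lemma card_Fq: "card (rd ` OF_ring L) = q" by (simp add: qF_def)
lemma Fq_iff: "c \<in> rd ` OF_ring L <-> c ^ q = c" using Fq.fixed_iff[of c] card_Fq by simp
lemma base_of_nat: "of_nat n \<in> base L" by (induction n) (auto intro: base_0 base_1 base_add)

lemma V_1_of_nat: assumes "CHAR('k) dvd n" shows "V 1 (of_nat n)"
proof -
 have "rd (of_nat n) = 0" using assms by (simp add: rd_of_nat of_nat_eq_0_iff_char_dvd)
 then obtain r where "0 < r" "V r (of_nat n)" using rd_0_iff[OF N_of_nat] mC_iff by blast
 thus ?thesis using base_V_1[OF base_of_nat] by blast
qed

lemma q_prime_power: obtains f where "0 < f" "q = CHAR('k) ^ f" using Fq.card_prime_power card_Fq by auto

sublocale filtq V q
proof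
 obtain f where f: "0 < f" "q = CHAR('k) ^ f" by (rule q_prime_power)
 have "2 <= CHAR('k)" using Fq.prime_CHAR by (simp add: prime_ge_2_nat)
 hence "3 <= CHAR('k)" using CHAR_ne_2 by simp
 moreover have "CHAR('k) ^ 1 <= q" unfolding f(2) using f calculation by (intro power_increasing) auto
 ultimately show "3 <= q" by simp
 have "odd CHAR('k)" using Fq.prime_CHAR CHAR_ne_2 \<open>3 <= CHAR('k)\<close> by (simp add: prime_odd_nat)
 thus "odd q" by (simp add: f)
 show "V 1 (of_nat (q choose i))" if "0 < i" "i < q" for i
  by (rule V_1_of_nat) (use Fq.CHAR_dvd_binomial[of i] that card_Fq in simp)
qed

lemma rd_frob_add: "(a + b) ^ q ^ n = a ^ q ^ n + b ^ q ^ n" for a b :: 'k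
proof -
 obtain x y where x: "V 0 x" "rd x = a" and y: "V 0 y" "rd y = b" by (metis rd_exists)
 have "rd ((x + y) ^ q ^ n) = rd (x ^ q ^ n + y ^ q ^ n)" using N_frob_add_iter[OF x(1) y(1), of n] x y
  by (intro rd_eqI[where r = 1]) (auto intro: N_add N_power0)
 thus ?thesis using x y by (simp add: rd_power rd_add N_add N_power0)
qed

lemma q_powr: "1 < real q" using q3 by simp

lemma V_dist: "V r (x - y) <-> dist x y <= real q powr (- r)"
proof (cases "x = y")
 case False
 then obtain s where s: "val L (x - y) = ereal s" using val_real[of "x - y"] by auto
 show ?thesis using False s q_powr by (simp add: dist_val V_def)
qed simp

lemma tendsto_V: "s \<longlonglongrightarrow> l <-> (\<forall>r. \<forall>\<^sub>F n in sequentially. V r (s n - l))"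
proof
 assume s: "s \<longlonglongrightarrow> l"
 show "\<forall>r. \<forall>\<^sub>F n in sequentially. V r (s n - l)"
 proof
  fix r
  have "0 < real q powr (- r)" using q_powr by simp
  from tendstoD[OF s this] show "\<forall>\<^sub>F n in sequentially. V r (s n - l)"
   by eventually_elim (simp add: V_dist)
 qed
next
 assume V: "\<forall>r. \<forall>\<^sub>F n in sequentially. V r (s n - l)"
 show "s \<longlonglongrightarrow> l"
 proof (rule tendstoI)
  fix e :: real assume e: "0 < e"
  define r where "r = - log (real q) e + 1"
  have "real q powr (- r) < real q powr (log (real q) e)" using q_powr by (simp add: r_def)
  also have "... = e" using q_powr e by simp
  finally have "real q powr (- r) < e" .
  show "\<forall>\<^sub>F n in sequentially. dist (s n) l < e"
   using spec[OF V, of r] by eventually_elim (use \<open>real q powr (- r) < e\<close> in "simp add: V_dist")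
 qed
qed

lemma V_limit: assumes "s \<longlonglongrightarrow> l" and "\<forall>\<^sub>F n in sequentially. V r (s n)" shows "V r l"
proof -
 have "\<forall>\<^sub>F n in sequentially. V r (s n - l)" using assms(1) tendsto_V by blast
 with assms(2) have "\<forall>\<^sub>F n in sequentially. V r l"
 proof eventually_elim
  case (elim n)
  thus ?case using N_diff[of r "s n" "s n - l"] by simp
 qed
 thus ?thesis by simp
qed

lemma V_telescope: assumes "!!n. V (a n) (s (Suc n) - s n)" and "incseq a" and "m <= n"
 shows "V (a m) (s n - s m)" using assms(3)
proof (induction n rule: dec_induct)
 case (step n)
 have "V (a m) (s (Suc n) - s n)" using assms(1)[of n] assms(2) step(1) N_mono by (metis incseq_def)
 thus ?case using step(3) N_trans by blast
qed simp

lemma V_Cauchy_limit: assumes s: "!!n. V (d + e * real n) (s (Suc n) - s n)" and e: "0 < e"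
 obtains l where "s \<longlonglongrightarrow> l" "!!n. V (d + e * real n) (s n - l)"
proof -
 have inc: "incseq (%n. d + e * real n)" using e by (auto simp: incseq_def)
 note tel = V_telescope[OF s inc]
 have "Cauchy s"
 proof (rule metric_CauchyI)
  fix ep :: real assume ep: "0 < ep"
  define r where "r = - log (real q) ep + 1"
  have "real q powr (- r) < real q powr (log (real q) ep)" using q_powr by (simp add: r_def)
  also have "... = ep" using q_powr ep by simp
  finally have r: "real q powr (- r) < ep" .
  obtain M where "(r - d) / e < real M" using reals_Archimedean2 by blast
  hence M: "r <= d + e * real M" using e by (simp add: field_simps)
  show "\<exists>M. \<forall>m\<ge>M. \<forall>n\<ge>M. dist (s m) (s n) < ep"
  proof (intro exI[of _ M] allI impI)
   fix m n assume "M <= m" "M <= n"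
   hence "V r (s m - s M)" "V r (s n - s M)" using tel M N_mono by blast+
   hence "V r (s m - s n)" using N_trans N_diff_commute by blast
   thus "dist (s m) (s n) < ep" using r by (simp add: V_dist)
  qed
 qed
 then obtain l where l: "s \<longlonglongrightarrow> l" using Cauchy_convergent convergent_def by blast
 moreover have "V (d + e * real n) (s n - l)" for n
 proof -
  have "(%m. s n - s m) \<longlonglongrightarrow> s n - l" unfolding tendsto_V
  proof
   fix r
   from l have "\<forall>\<^sub>F m in sequentially. V r (s m - l)" unfolding tendsto_V ..
   thus "\<forall>\<^sub>F m in sequentially. V r (s n - s m - (s n - l))"
    by eventually_elim (use N_diff_commute in fastforce)
  qed
  moreover have "\<forall>\<^sub>F m in sequentially. V (d + e * real n) (s n - s m)"
   using tel N_diff_commute by (intro eventually_sequentiallyI[of n]) blast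
  ultimately show ?thesis by (rule V_limit)
 qed
 ultimately show thesis by (rule that)
qed

lemma base_closed: "(!!n. s n \<in> base L) ==> s \<longlonglongrightarrow> l ==> l \<in> base L"
 using complete_imp_closed[OF base_complete] closed_sequentially by blast

text \<open>The q^m-th power map is a contraction on integral elements. This drives the fixed point
  arguments for Teichmueller lifts and for \<open>yhat\<close>.\<close>

lemma pow_contract:
 assumes B: "V 0 B" and E: "V rh (A - B)" and e: "0 < e" "e <= 1" "e <= rh" and m: "0 < m"
 shows "V (rh + e) (A ^ q ^ m - B ^ q ^ m)" using m
proof (induction m)
 case (Suc m)
 have A: "V 0 A" using V0_trans[OF E] e B by simp
 show ?case
 proof (cases "m = 0")
  case True
  have "rh + e <= real q * rh"
  proof -
   have "3 * rh <= real q * rh" using q3 e by (intro mult_right_mono) auto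
   thus ?thesis using e by linarith
  qed
  hence "V (rh + e) ((B + (A - B)) ^ q - B ^ q)"
   using e E by (intro N_power_q_diff[OF B, where rh = rh]) auto
  thus ?thesis using True by simp
 next
  case False
  hence "V (rh + e) ((A ^ q ^ m) ^ q - (B ^ q ^ m) ^ q)"
   by (intro N_power_diff[where n = q] N_power0 A B Suc.IH) auto
  thus ?thesis by (simp add: power_mult[symmetric] mult.commute)
 qed
qed simp

text \<open>The power map gains a fixed amount while division by the unit A loses nothing, so a
  congruence between two solutions improves without end.\<close>

lemma frob_unique:
 assumes A: "V 0 A'" and x: "x ^ q ^ m = A * x" and y: "y ^ q ^ m = A * y" and AA: "A' * A = 1"
  and V: "V 0 y" "V e (x - y)" and e: "0 < e" and m: "0 < m" shows "x = y"
proof -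
 define d where "d = min e 1"
 have d: "0 < d" "d <= 1" using e by (auto simp: d_def)
 have "V (d + d * real n) (x - y)" for n
 proof (induction n)
  case 0
  thus ?case using V(2) N_mono by (auto simp: d_def)
 next
  case (Suc n)
  have "V (d + d * real n + d) (x ^ q ^ m - y ^ q ^ m)" using d m Suc by (intro pow_contract V) auto
  hence "V (d + d * real n + d) (A' * (A * (x - y)))"
   by (intro N_mult_left[OF A]) (simp add: x y algebra_simps)
  moreover have "A' * (A * (x - y)) = x - y" using AA by (metis mult.assoc mult_1)
  ultimately have "V (d + d * real n + d) (x - y)" by (simp only:)
  thus ?case by (simp add: algebra_simps)
 qed
 hence "x - y = 0" by (rule V_seq_imp_0) (rule d)
 thus ?thesis by simp
qed

text \<open>Iteration of T -> T^(q^m) / A. The sequence is a parameter so that the caller can follow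
  its terms, for instance to see that they stay in the closed subfield F or E.\<close>

lemma frob_solution: fixes T :: "nat => 'c"
 assumes A: "V 0 A" "V 0 A'" "A' * A = 1" and t: "V 0 (T 0)" "V e (T 0 ^ q ^ m - A * T 0)"
  and e: "0 < e" "e <= 1" and m: "0 < m" and T: "!!n. T (Suc n) = A' * T n ^ q ^ m"
 obtains t where "T \<longlonglongrightarrow> t" "t ^ q ^ m = A * t" "V e (t - T 0)"
proof -
 have "V (e + e * real n) (T (Suc n) - T n) & V 0 (T n)" for n
 proof (induction n)
  case 0
  have "T (Suc 0) - T 0 = A' * (T 0 ^ q ^ m - A * T 0)"
   by (simp add: T right_diff_distrib A(3))
  thus ?case using t A by (simp add: N_mult_left)
 next
  case (Suc n)
  have "V (e + e * real n + e) (T (Suc n) ^ q ^ m - T n ^ q ^ m)" using Suc e m by (intro pow_contract) auto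
  hence "V (e + e * real n + e) (T (Suc (Suc n)) - T (Suc n))"
   using A by (simp add: T[of "Suc n"] T[of n] right_diff_distrib[symmetric] N_mult_left)
  moreover have "V 0 (T (Suc n))" by (rule V0_trans[of "e + e * real n" _ "T n"]) (use Suc e in auto)
  ultimately show ?case by (simp add: algebra_simps)
 qed
 note * = this
 then obtain t where t': "T \<longlonglongrightarrow> t" "!!n. V (e + e * real n) (T n - t)"
  using V_Cauchy_limit[of e e T] e by blast
 have "V (e + e * real n) (t ^ q ^ m - A * t)" for n
 proof -
  have c: "V 0 t" using N_diff[of 0 "T 0" "T 0 - t"] t(1) t'(2)[of 0] e N_mono[of e "T 0 - t" 0] by simp
  have "V (e + e * real n) (t ^ q ^ m - T n ^ q ^ m)"
   using t'(2)[of n] * N_diff_commute by (intro N_power_diff c) blast+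
  moreover have "V (e + e * real n) (A * (T (Suc n) - t))"
   using t'(2)[of "Suc n"] e by (intro N_mult_left A) (auto elim!: N_mono simp: algebra_simps)
  moreover have "A * T (Suc n) = T n ^ q ^ m" using A(3) by (simp add: T mult.commute)
  ultimately show ?thesis using N_add by (fastforce simp: right_diff_distrib)
 qed
 hence "t ^ q ^ m - A * t = 0" by (rule V_seq_imp_0) (rule e)
 thus thesis using that t' N_diff_commute[of e "T 0" t] t'(2)[of 0] by simp
qed

lemma teichmuller_exists: assumes c: "c ^ q = c" obtains t where "t \<in> base L" "t ^ q = t" "rd t = c" "V 0 t"
proof -
 obtain t0 where t0: "t0 \<in> base L" "V 0 t0" "rd t0 = c"
 proof -
  have "c \<in> rd ` OF_ring L" using c Fq_iff by simp
  then obtain t0 where "t0 \<in> OF_ring L" "rd t0 = c" by blast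
  thus thesis using OF_iff that by blast
 qed
 define T where "T n = ((%x. x ^ q ^ 1) ^^ n) t0" for n
 have T: "T 0 = t0" "T (Suc n) = 1 * T n ^ q ^ 1" for n by (simp_all add: T_def)
 have "t0 ^ q - t0 \<in> base L" using t0 by (intro base_diff base_power)
 moreover have "rd (t0 ^ q - t0) = 0" using t0 c by (simp add: rd_diff rd_power N_power0)
 then obtain r where "0 < r" "V r (t0 ^ q - t0)"
  using rd_0_iff[of "t0 ^ q - t0"] mC_iff[of "t0 ^ q - t0"] N_diff[OF N_power0[OF t0(2)] t0(2)] by auto
 ultimately have 1: "V 1 (t0 ^ q - t0)" using base_V_1 by blast
 obtain t where t: "T \<longlonglongrightarrow> t" "t ^ q ^ 1 = 1 * t" "V 1 (t - T 0)"
  by (rule frob_solution[of 1 1 T 1 1]) (use 1 t0 T in "simp_all add: V_1")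
 have "T n \<in> base L" for n by (induction n) (auto simp: T t0 base_power)
 hence "t \<in> base L" using t base_closed by blast
 moreover have "rd t = c" using rd_eqI[of 1 t t0] t t0 by (simp add: T)
 moreover have "V 0 t" using V0_trans[of 1 t t0] t t0 by (simp add: T)
 ultimately show thesis using that t by simp
qed

lemma V0_of_power: assumes "V 0 (t ^ n)" "0 < n" shows "V 0 t"
proof (cases "t = 0")
 case False
 then obtain r where r: "val L t = ereal r" by (rule val_real)
 hence "0 <= real n * r" using assms val_power[OF r, of n] by (simp add: V_def)
 thus ?thesis using assms r by (simp add: V_def zero_le_mult_iff)
qed simp

lemma frob_fixed_V0: assumes "t ^ q ^ m = t" "0 < m" shows "V 0 t"
proof (cases "t = 0")
 case False
 have "1 < q ^ m" by (rule one_less_power) (use q2 assms in auto)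
 hence "t * t ^ (q ^ m - 1) = t * 1"
  using assms by (metis Suc_pred' less_trans mult_1_right power_Suc zero_less_one)
 hence "t ^ (q ^ m - 1) = 1" using False by (metis mult_left_cancel)
 thus ?thesis using V0_of_power[of t "q ^ m - 1"] V_1 \<open>1 < q ^ m\<close> by simp
qed simp

lemma frob_fixed_eq: assumes "x ^ q ^ m = x" "y ^ q ^ m = y" "rd x = rd y" "0 < m" shows "x = y"
proof -
 have V: "V 0 x" "V 0 y" using assms frob_fixed_V0 by blast+
 then obtain e where "0 < e" "V e (x - y)" using assms(3) rd_eq_iff mC_iff by blast
 thus ?thesis using frob_unique[of 1 x m 1 y e] assms V V_1 by simp
qed

lemma teich: assumes "c ^ q = c"
 shows "teich L c \<in> base L" "teich L c ^ q = teich L c" "rd (teich L c) = c" "V 0 (teich L c)"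
proof -
 obtain t where t: "t \<in> base L" "t ^ q = t" "rd t = c" by (rule teichmuller_exists[OF assms])
 have "teich L c = t" unfolding teich_def by (rule the_equality) (use t frob_fixed_eq[of _ 1] in auto)
 thus "teich L c \<in> base L" "teich L c ^ q = teich L c" "rd (teich L c) = c" "V 0 (teich L c)"
  using t frob_fixed_V0[of t 1] by auto
qed

lemma teich_eqI: "t ^ q = t ==> teich L (rd t) = t"
 using teich[of "rd t"] frob_fixed_eq[of "teich L (rd t)" 1 t] rd_power[of t q] frob_fixed_V0[of t 1] by simp

end

section \<open>The unramified quadratic extension\<close>

context lt
begin

lemma two_nz: "(2::'k) ~= 0"
proof
 assume "(2::'k) = 0"
 hence "(of_nat 2 :: 'k) = 0" by simp
 hence "CHAR('k) dvd 2" by (simp only: of_nat_eq_0_iff_char_dvd)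
 thus False using CHAR_ne_2 primes_dvd_imp_eq[OF Fq.prime_CHAR two_is_prime_nat] by blast
qed

text \<open>Squaring identifies 1 and -1, hence is not injective and so not surjective on the finite
  residue field. Odd characteristic enters here.\<close>

lemma nonresidue: obtains d :: 'k where "d ^ q = d" "!!c. c ^ q = c ==> c ^ 2 ~= d"
proof -
 let ?F = "rd ` OF_ring L" and ?s = "%c::'k. c ^ 2"
 have sub: "?s ` ?F \<subseteq> ?F" by (auto simp: power2_eq_square intro: Fq.F_mult)
 have "?s ` ?F ~= ?F"
 proof
  assume "?s ` ?F = ?F"
  hence "inj_on ?s ?F" using Fq.fin by (simp add: finite_surj_inj)
  hence "(1::'k) = - 1" by (rule inj_onD) (use Fq.F_1 Fq.F_uminus[OF Fq.F_1] in simp_all)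
  thus False using two_nz by (metis add.right_inverse one_add_one)
 qed
 then obtain d where d: "d \<in> ?F" "d \<notin> ?s ` ?F" using sub by blast
 show thesis
 proof (rule that)
  show "d ^ q = d" using d Fq_iff by blast
  show "c ^ 2 ~= d" if "c ^ q = c" for c
  proof
   assume "c ^ 2 = d"
   hence "d \<in> ?s ` ?F" using that Fq_iff[of c] by (intro image_eqI[of _ _ c]) simp_all
   thus False using d by blast
  qed
 qed
qed

text \<open>A square root of the Teichmueller lift of a nonresidue: a root of unity with E = F(om)
  and conjugate -om. It makes E and its conjugation explicit.\<close>

definition om :: 'c where
 "om = (SOME w. \<exists>d. d ^ q = d & (\<forall>c. c ^ q = c --> c ^ 2 ~= d) & w ^ 2 = teich L d)"

lemma base_algebraic: "x \<in> base L ==> x \<in> algebraic_over (base L)"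
 unfolding algebraic_over_def
 by (auto intro!: exI[of _ "[:- x, 1:]"] simp: coeff_pCons base_uminus base_0 base_1 split: nat.split)

lemma om_ex: "\<exists>d. d ^ q = d & (\<forall>c. c ^ q = c --> c ^ 2 ~= d) & om ^ 2 = teich L d"
proof -
 obtain d :: 'k where d: "d ^ q = d" "!!c. c ^ q = c ==> c ^ 2 ~= d" using nonresidue by blast
 have "\<exists>x. poly [:- teich L d, 0, 1:] x = 0" using teich[OF d(1)] by (intro algebraic_root)
   (auto simp: coeff_pCons intro!: base_algebraic base_uminus base_0 base_1 split: nat.split)
 then obtain x where "x ^ 2 = teich L d" by (auto simp: power2_eq_square)
 hence "\<exists>w d. d ^ q = d & (\<forall>c. c ^ q = c --> c ^ 2 ~= d) & w ^ 2 = teich L d" using d by blast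
 thus ?thesis unfolding om_def by (rule someI_ex)
qed

lemma om_sq_base: "om * om \<in> base L" and om_sq_power: "(om * om) ^ q = om * om" and V_om: "V 0 om"
 and rd_om: "rd om ^ q ~= rd om"
proof -
 obtain d where d: "d ^ q = d" "!!c. c ^ q = c ==> c ^ 2 ~= d" "om ^ 2 = teich L d"
  using om_ex by blast
 show "om * om \<in> base L" "(om * om) ^ q = om * om" using teich[OF d(1)] d(3) by (simp_all add: power2_eq_square)
 show V: "V 0 om" using V0_of_power[of om 2] teich[OF d(1)] d(3) by simp
 show "rd om ^ q ~= rd om"
 proof
  assume "rd om ^ q = rd om"
  from d(2)[OF this] show False using rd_power[OF V, of 2] d teich[OF d(1)] by simp
 qed
qed

lemma om_q: "om ^ q = - om"
proof -
 have "om ^ q * om ^ q = om * om" using om_sq_power by (simp add: power_mult_distrib)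
 hence "(om ^ q - om) * (om ^ q + om) = 0" by (simp add: algebra_simps)
 moreover have "om ^ q ~= om" using rd_om rd_power[OF V_om] by metis
 ultimately show ?thesis by (simp add: eq_neg_iff_add_eq_0)
qed

lemma q2_eq: "x ^ q ^ 2 = (x ^ q) ^ q" for x :: "'a::monoid_mult"
 by (simp add: power_mult[symmetric] power2_eq_square)
lemma om_q2: "om ^ q ^ 2 = om" using om_q q_odd by (simp add: q2_eq)
lemma om_nz: "om ~= 0" using rd_om q3 by (intro notI) simp
lemma rd_base: "x \<in> base L ==> V 0 x ==> rd x ^ q = rd x"
 using Fq_iff OF_iff by blast

lemma rd_om_comb:
 fixes s t :: 'k assumes "s ^ q = s" "t ^ q = t" "s + t * rd om = 0" shows "s = 0 & t = 0"
proof (cases "t = 0")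
 case False
 hence "rd om = - s / t" using assms(3) by (simp add: field_simps eq_neg_iff_add_eq_0)
 hence "rd om ^ q = rd om" using assms q_odd by (simp add: power_divide)
 thus ?thesis using rd_om by simp
qed (use assms in simp)

text \<open>After division by the coordinate of smaller valuation one residue is nonzero; as the
  residue of \<open>om\<close> is not in the field with q elements, the sum is a unit. So E is
  unramified and conjugation is isometric.\<close>

lemma V_om_comb: assumes x: "x \<in> base L" and y: "y \<in> base L"
 shows "V r (x + y * om) <-> V r x & V r y"
proof
 show "V r (x + y * om)" if "V r x & V r y" using that by (intro N_add N_mult_right V_om) auto
 have *: "val L (x + y * om) = min (val L x) (val L y)"
 proof (cases "x = 0 & y = 0")
  case False
  have unit: "val L (s + t * om) = 0" if "s \<in> base L" "t \<in> base L" "V 0 s" "V 0 t" "rd s ~= 0 | rd t ~= 0" for s t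
  proof -
   have "rd (s + t * om) = rd s + rd t * rd om" using that V_om by (simp add: rd_add rd_mult N_mult_left)
   hence "rd (s + t * om) ~= 0" using rd_om_comb[of "rd s" "rd t"] rd_base that by auto
   thus ?thesis using that V_om val_unit_iff by (simp add: N_add N_mult_left)
  qed
  show ?thesis
  proof (cases "val L x <= val L y")
   case True
   have xn: "x ~= 0"
   proof
    assume "x = 0"
    hence "val L y = \<infinity>" using True by simp
    thus False using val_infty[of y] False \<open>x = 0\<close> by simp
   qed
   then obtain a where a: "val L x = ereal a" by (rule val_real)
   have "V 0 (y / x)" unfolding V_divide_iff[OF a] using True a by (simp add: V_def)
   hence "val L (1 + (y / x) * om) = 0"
    using x y by (intro unit) (auto intro: base_1 base_divide V_1 simp: rd_1)
   moreover have "x + y * om = x * (1 + (y / x) * om)" using xn by (simp add: algebra_simps)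
   ultimately show ?thesis using True by (simp add: val_mult min_def)
  next
   case F: False
   hence yn: "y ~= 0" by auto
   then obtain a where a: "val L y = ereal a" by (rule val_real)
   have "V 0 (x / y)" unfolding V_divide_iff[OF a] using F a by (simp add: V_def)
   hence "val L (x / y + 1 * om) = 0"
    using x y by (intro unit) (auto intro: base_1 base_divide V_1 simp: rd_1)
   moreover have "x + y * om = y * (x / y + 1 * om)" using yn by (simp add: algebra_simps)
   ultimately show ?thesis using F by (simp add: val_mult min_def)
  qed
 qed simp
 show "V r x & V r y" if "V r (x + y * om)" using that by (simp add: V_def *)
qed

definition K :: "'c set" where "K = {x + y * om | x y. x \<in> base L & y \<in> base L}"

lemma K_I: "x \<in> base L ==> y \<in> base L ==> x + y * om \<in> K" by (auto simp: K_def)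
lemma K_E: assumes "z \<in> K" obtains x y where "x \<in> base L" "y \<in> base L" "z = x + y * om"
 using assms by (auto simp: K_def)

lemma K_unique:
 assumes "x \<in> base L" "y \<in> base L" "x' \<in> base L" "y' \<in> base L" "x + y * om = x' + y' * om"
 shows "x = x'" "y = y'"
proof -
 have e: "(x - x') + (y - y') * om = 0" using assms(5) by (simp add: algebra_simps)
 have "V r ((x - x') + (y - y') * om)" for r by (simp add: e)
 hence "V r (x - x')" "V r (y - y')" for r
  using V_om_comb[of "x - x'" "y - y'" r] assms base_diff by blast+
 hence "x - x' = 0" "y - y' = 0" using V_all_imp_0 by blast+
 thus "x = x'" "y = y'" by simp_all
qed

definition conj :: "'c => 'c" where
 "conj z = (THE w. \<exists>x\<in>base L. \<exists>y\<in>base L. z = x + y * om & w = x - y * om)"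

lemma conj_eq: "x \<in> base L ==> y \<in> base L ==> conj (x + y * om) = x - y * om"
 unfolding conj_def by (rule the_equality) (use K_unique in blast)+

lemma K_base: "x \<in> base L ==> x \<in> K" using K_I[of x 0] base_0 by simp
lemma conj_base: "x \<in> base L ==> conj x = x" using conj_eq[of x 0] base_0 by simp
lemma K_0: "0 \<in> K" and K_1: "1 \<in> K" using K_base base_0 base_1 by auto

lemma K_add: "z \<in> K ==> w \<in> K ==> z + w \<in> K & conj (z + w) = conj z + conj w"
proof -
 assume "z \<in> K" "w \<in> K"
 then obtain x y x' y' where b: "x \<in> base L" "y \<in> base L" "x' \<in> base L" "y' \<in> base L"
  and z: "z = x + y * om" "w = x' + y' * om" by (meson K_E)
 have "z + w = (x + x') + (y + y') * om" by (simp add: z algebra_simps)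
 thus ?thesis using b z K_I[of "x + x'" "y + y'"] conj_eq[of "x + x'" "y + y'"]
  by (simp add: base_add conj_eq algebra_simps)
qed

lemma K_mult: "z \<in> K ==> w \<in> K ==> z * w \<in> K & conj (z * w) = conj z * conj w"
proof -
 assume "z \<in> K" "w \<in> K"
 then obtain x y x' y' where b: "x \<in> base L" "y \<in> base L" "x' \<in> base L" "y' \<in> base L"
  and z: "z = x + y * om" "w = x' + y' * om" by (meson K_E)
 define A where "A = x * x' + y * y' * (om * om)"
 define B where "B = x * y' + y * x'"
 have AB: "A \<in> base L" "B \<in> base L" unfolding A_def B_def
  using b om_sq_base by (auto intro!: base_add base_mult)
 have "z * w = A + B * om" by (simp add: z A_def B_def algebra_simps)
 moreover have "conj z * conj w = A - B * om" using b by (simp add: z conj_eq A_def B_def algebra_simps)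
 ultimately show ?thesis using AB by (simp add: K_I conj_eq)
qed

lemma K_uminus: "z \<in> K ==> - z \<in> K"
 using K_mult[of "- 1" z] K_base[OF base_uminus[OF base_1]] by simp
lemma K_diff: "z \<in> K ==> w \<in> K ==> z - w \<in> K" using K_add[of z "- w"] K_uminus by simp
lemma K_power: "z \<in> K ==> z ^ n \<in> K" by (induction n) (auto simp: K_1 K_mult)

lemma conj_conj: "z \<in> K ==> conj z \<in> K & conj (conj z) = z"
proof -
 assume "z \<in> K"
 then obtain x y where b: "x \<in> base L" "y \<in> base L" "z = x + y * om" by (rule K_E)
 hence "conj z = x + (- y) * om" by (simp add: conj_eq)
 thus ?thesis using b K_I[of x "- y"] conj_eq[of x "- y"] by (simp add: base_uminus)
qed

lemma V_conj: "z \<in> K ==> V r (conj z) <-> V r z"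
proof -
 assume "z \<in> K"
 then obtain x y where b: "x \<in> base L" "y \<in> base L" "z = x + y * om" by (rule K_E)
 thus ?thesis using V_om_comb[of x "- y" r] V_om_comb[of x y r] N_uminus[of r y] N_uminus[of r "- y"]
  by (auto simp: conj_eq base_uminus)
qed

lemma K_norm: "z \<in> K ==> z * conj z \<in> base L"
proof -
 assume "z \<in> K"
 then obtain x y where b: "x \<in> base L" "y \<in> base L" "z = x + y * om" by (rule K_E)
 hence "z * conj z = x * x - y * y * (om * om)" by (simp add: conj_eq algebra_simps)
 thus ?thesis using b om_sq_base by (auto intro!: base_diff base_mult)
qed

lemma K_inverse: "z \<in> K ==> inverse z \<in> K"
proof (cases "z = 0")
 case False
 assume z: "z \<in> K"
 have "conj z ~= 0" using conj_conj[OF z] conj_base[OF base_0] False by auto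
 hence "inverse z = conj z * inverse (z * conj z)" by simp
 moreover have "conj z * inverse (z * conj z) \<in> K"
  using K_mult conj_conj[OF z] K_base[OF base_inverse[OF K_norm[OF z]]] by blast
 ultimately show ?thesis by (simp only:)
qed (simp add: K_0)

lemma K_divide: "z \<in> K ==> w \<in> K ==> z / w \<in> K" by (simp add: divide_inverse K_mult K_inverse)
lemma K_unif: "\<pi>' \<in> K" using unif_base K_base by blast
lemma K_V_1: "z \<in> K ==> V r z ==> 0 < r ==> V 1 z"
 by (metis K_E V_om_comb base_V_1)
lemma K_rd_0: "z \<in> K ==> V 0 z ==> rd z = 0 ==> V 1 z"
 using rd_0_iff mC_iff K_V_1 by blast

lemma dist_K: assumes "x \<in> base L" "y \<in> base L" "x' \<in> base L" "y' \<in> base L"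
 shows "dist x x' <= dist (x + y * om) (x' + y' * om) & dist y y' <= dist (x + y * om) (x' + y' * om)"
proof (cases "x + y * om = x' + y' * om")
 case True
 thus ?thesis using K_unique[OF assms] by simp
next
 case False
 have e: "(x + y * om) - (x' + y' * om) = (x - x') + (y - y') * om" by (simp add: algebra_simps)
 obtain s where s: "val L ((x + y * om) - (x' + y' * om)) = ereal s" by (rule val_real) (use False in auto)
 have "V s (x - x')" "V s (y - y')"
  using V_om_comb[of "x - x'" "y - y'" s] s assms base_diff by (auto simp: V_def e)
 thus ?thesis using False s by (simp add: V_dist dist_val)
qed

text \<open>By \<open>dist_K\<close> the two coordinates of a Cauchy sequence in E are Cauchy in F,
  and they converge to points of the complete set F.\<close>

lemma K_closed: assumes s: "!!n. s n \<in> K" and l: "s \<longlonglongrightarrow> l" shows "l \<in> K"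
proof -
 have "\<forall>n. \<exists>x y. x \<in> base L & y \<in> base L & s n = x + y * om" using s K_E by metis
 then obtain x y where b: "!!n. x n \<in> base L" "!!n. y n \<in> base L" and e: "!!n. s n = x n + y n * om"
  by metis
 have C: "Cauchy s" using l LIMSEQ_imp_Cauchy by blast
 have dx: "dist (x m) (x n) <= dist (s m) (s n)" and dy: "dist (y m) (y n) <= dist (s m) (s n)" for m n
  using dist_K[OF b(1)[of m] b(2)[of m] b(1)[of n] b(2)[of n]] by (simp_all add: e)
 have "Cauchy x" "Cauchy y"
  unfolding Cauchy_def using C[unfolded Cauchy_def] dx dy by (meson order_le_less_trans)+
 then obtain x' y' where lim: "x \<longlonglongrightarrow> x'" "y \<longlonglongrightarrow> y'" by (meson Cauchy_convergent convergent_def)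
 have "s \<longlonglongrightarrow> x' + y' * om" unfolding tendsto_V
 proof
  fix r
  have "\<forall>\<^sub>F n in sequentially. V r (x n - x')" "\<forall>\<^sub>F n in sequentially. V r (y n - y')"
   using lim tendsto_V by blast+
  thus "\<forall>\<^sub>F n in sequentially. V r (s n - (x' + y' * om))"
  proof eventually_elim
   case (elim n)
   hence "V r ((x n - x') + (y n - y') * om)" by (intro N_add N_mult_right V_om)
   thus ?case by (simp add: e algebra_simps)
  qed
 qed
 hence "l = x' + y' * om" using l LIMSEQ_unique by blast
 thus ?thesis using K_I lim b base_closed by metis
qed

lemma base_frob: "x \<in> base L ==> V 0 x ==> V 1 (x ^ q - x)"
proof -
 assume x: "x \<in> base L" "V 0 x"
 hence d: "x ^ q - x \<in> K" "V 0 (x ^ q - x)" by (auto intro: K_base base_diff base_power N_diff N_power0)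
 have "rd (x ^ q - x) = 0" using x rd_base by (simp add: rd_diff rd_power N_power0)
 thus ?thesis using K_rd_0 d by blast
qed

text \<open>Modulo pi the q-th power is additive and fixes the coordinates in F, and it sends
  \<open>om\<close> to -om: exactly the conjugation.\<close>

lemma K_frob: assumes z: "z \<in> K" "V 0 z" shows "V 1 (z ^ q - conj z)"
proof -
 obtain x y where b: "x \<in> base L" "y \<in> base L" and e: "z = x + y * om" using z(1) by (rule K_E)
 have V: "V 0 x" "V 0 y" using z V_om_comb b e by blast+
 have "V 1 ((x + y * om) ^ q - (x ^ q + (y * om) ^ q))"
  using V V_om by (intro N_frob_add N_mult_left)
 moreover have "V 1 ((x ^ q - x) - (y ^ q - y) * om)"
  using V b V_om by (intro N_diff N_mult_right base_frob)
 ultimately have "V 1 (((x + y * om) ^ q - (x ^ q + (y * om) ^ q)) + ((x ^ q - x) - (y ^ q - y) * om))"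
  by (rule N_add)
 moreover have "((x + y * om) ^ q - (x ^ q + (y * om) ^ q)) + ((x ^ q - x) - (y ^ q - y) * om)
   = z ^ q - conj z" using b by (simp add: e conj_eq power_mult_distrib om_q algebra_simps)
 ultimately show ?thesis by (simp only:)
qed

lemma K_frob2: assumes z: "z \<in> K" "V 0 z" shows "V 1 (z ^ q ^ 2 - z)"
proof -
 have c: "V 0 (conj z)" using V_conj z by blast
 have "V 1 ((z ^ q) ^ q - conj z ^ q)" using z c by (intro N_power_diff N_power0 K_frob)
 moreover have "V 1 (conj z ^ q - z)" using K_frob[of "conj z"] conj_conj z c by simp
 ultimately show ?thesis using N_trans[of 1 "(z ^ q) ^ q" "conj z ^ q" z] by (simp add: q2_eq)
qed

lemma rd_conj: "z \<in> K ==> V 0 z ==> rd (conj z) = rd z ^ q"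
 using rd_eqI[of 1 "z ^ q" "conj z"] K_frob V_conj[of z 0] rd_power by simp
lemma frobr_K: "frobr V q (%z. z \<in> K) (%z. z) 2"
 by unfold_locales (auto simp: K_0 K_1 K_add K_uminus K_mult K_frob2)
lemma frobr_conj: "frobr V q (%z. z \<in> K) conj 1"
 by unfold_locales (auto simp: K_0 K_1 K_add K_uminus K_mult conj_conj K_frob conj_base base_1)
lemma frobr_base: "frobr V q (%z. z \<in> base L) (%z. z) 1"
 by unfold_locales (auto simp: base_0 base_1 base_add base_uminus base_mult base_frob)

text \<open>The residues of E are spanned by 1 and the residue of \<open>om\<close>, so there are
  q^2 of them; a finite subring with q^2 elements is the fixed set of the q^2-th power.\<close>

lemma K_residue: assumes "c ^ q ^ 2 = c" obtains z where "z \<in> K" "V 0 z" "rd z = c"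
proof -
 let ?F = "rd ` OF_ring L"
 define G where "G = (%(a, b). a + b * rd om) ` (?F \<times> ?F)"
 have fix1: "a ^ q = a" if "a \<in> ?F" for a using that Fq_iff by blast
 have inj: "inj_on (%(a, b). a + b * rd om) (?F \<times> ?F)"
 proof (rule inj_onI)
  fix u v assume "u \<in> ?F \<times> ?F" "v \<in> ?F \<times> ?F"
   "(case u of (a, b) => a + b * rd om) = (case v of (a, b) => a + b * rd om)"
  then obtain a b a' b' where uv: "u = (a, b)" "v = (a', b')"
   and *: "a \<in> ?F" "b \<in> ?F" "a' \<in> ?F" "b' \<in> ?F" "a + b * rd om = a' + b' * rd om"
   by (auto simp del: image_iff)
  hence "(a - a') + (b - b') * rd om = 0" by (simp add: algebra_simps)
  moreover have "(a - a') ^ q = a - a'" "(b - b') ^ q = b - b'" using * fix1 Fq.F_diff by blast+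
  ultimately show "u = v" using rd_om_comb[of "a - a'" "b - b'"] by (simp add: uv)
 qed
 have card: "card G = q ^ 2" unfolding G_def
  using card_image[OF inj] by (simp add: card_cartesian_product card_Fq power2_eq_square)
 have G: "g \<in> G <-> (\<exists>z\<in>K. V 0 z & rd z = g)" for g
 proof
  assume "g \<in> G"
  then obtain x y where b: "x \<in> base L" "V 0 x" "y \<in> base L" "V 0 y" "g = rd x + rd y * rd om"
   by (auto simp: G_def OF_iff)
  thus "\<exists>z\<in>K. V 0 z & rd z = g"
   using V_om by (intro bexI[of _ "x + y * om"]) (auto simp: rd_add rd_mult N_mult_left N_add K_I)
 next
  assume "\<exists>z\<in>K. V 0 z & rd z = g"
  then obtain x y where b: "x \<in> base L" "y \<in> base L" "V 0 (x + y * om)" "rd (x + y * om) = g"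
   by (metis K_E)
  hence "V 0 x" "V 0 y" using V_om_comb by blast+
  hence "g = rd x + rd y * rd om" "rd x \<in> ?F" "rd y \<in> ?F"
   using b V_om OF_iff by (auto simp: rd_add rd_mult N_mult_left)
  thus "g \<in> G" by (auto simp: G_def simp del: image_iff)
 qed
 interpret G: finite_subring G
 proof
  show "finite G" unfolding G_def using Fq.fin by simp
  show "1 \<in> G" using G K_1 V_1 rd_1 by blast
  show "x - y \<in> G" if "x \<in> G" "y \<in> G" for x y
   using that unfolding G by (metis K_diff N_diff rd_diff)
  show "x * y \<in> G" if "x \<in> G" "y \<in> G" for x y
   using that unfolding G by (metis K_mult N_mult_left rd_mult)
 qed
 have "c \<in> G" using G.fixed_iff[of c] card assms by simp
 thus thesis using G that by blast
qed

lemma K_teichmuller: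
 assumes z: "z \<in> K" "V 0 z" obtains t where "t \<in> K" "t ^ q ^ 2 = t" "V 1 (z - t)" "V 0 t" "rd t = rd z"
proof -
 define T where "T n = ((%x. x ^ q ^ 2) ^^ n) z" for n
 have T: "T 0 = z" "T (Suc n) = 1 * T n ^ q ^ 2" for n by (simp_all add: T_def)
 obtain t where t: "T \<longlonglongrightarrow> t" "t ^ q ^ 2 = 1 * t" "V 1 (t - T 0)"
  by (rule frob_solution[of 1 1 T 1 2]) (use K_frob2[OF z] z T in "simp_all add: V_1")
 have TK: "T n \<in> K" for n by (induction n) (auto simp: T z K_power)
 have "rd t = rd z" using rd_eqI[of 1 t z] t z by (simp add: T)
 moreover have "V 0 t" using V0_trans[of 1 t z] t z by (simp add: T)
 ultimately show thesis using that t K_closed[OF TK t(1)] N_diff_commute[of 1 t z] by (simp add: T)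
qed

lemma K_of_frob2_fixed: assumes "x ^ q ^ 2 = x" shows "x \<in> K"
proof -
 have V: "V 0 x" using frob_fixed_V0 assms by simp
 hence "rd x ^ q ^ 2 = rd x" using assms rd_power by metis
 then obtain z where "z \<in> K" "V 0 z" "rd z = rd x" by (rule K_residue)
 then obtain t where t: "t \<in> K" "t ^ q ^ 2 = t" "rd t = rd x" using K_teichmuller by metis
 hence "t = x" using frob_fixed_eq[of t 2 x] assms by simp
 thus ?thesis using t by simp
qed

lemma root_of_unity_iff: "x ^ (q\<^sup>2 - 1) = 1 <-> x ~= 0 & x ^ q ^ 2 = x" for x :: "'a::field"
proof -
 have "q ^ 2 = Suc (q\<^sup>2 - 1)" using q3 by simp
 hence *: "x ^ q ^ 2 = x * x ^ (q\<^sup>2 - 1)" by (metis power_Suc)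
 have "1 < q ^ 2" using q2 by (intro one_less_power) auto
 hence "x ~= 0" if "x ^ (q\<^sup>2 - 1) = 1" using that by (intro notI) (simp add: zero_power)
 thus ?thesis unfolding * by auto
qed

lemma E_eq_K: "E_field L = K"
proof
 have "subfield_set K" unfolding subfield_set_def using K_1 K_diff K_mult K_inverse by auto
 moreover have "base L \<subseteq> K" using K_base by blast
 moreover have "{x. x ^ (q\<^sup>2 - 1) = 1} \<subseteq> K" using root_of_unity_iff K_of_frob2_fixed by auto
 ultimately show "E_field L \<subseteq> K" unfolding E_field_def by blast
 show "K \<subseteq> E_field L"
 proof
  fix z assume "z \<in> K"
  then obtain x y where b: "x \<in> base L" "y \<in> base L" "z = x + y * om" by (rule K_E)
  show "z \<in> E_field L" unfolding E_field_def
  proof clarify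
   fix S assume S: "subfield_set S" "base L \<subseteq> S" "{x. x ^ (q\<^sup>2 - 1) = 1} \<subseteq> S"
   have "om \<in> S" using S(3) root_of_unity_iff om_nz om_q2 by auto
   moreover have "x \<in> S" "y \<in> S" "0 \<in> S" using b S(2) base_0 by auto
   ultimately have "x - (0 - y * om) \<in> S" using S(1) unfolding subfield_set_def by blast
   thus "z \<in> S" by (simp add: b)
  qed
 qed
qed

lemma OE_iff: "z \<in> OE_ring L <-> z \<in> K & V 0 z" by (simp add: OE_ring_def E_eq_K OC_iff)
lemma muE_iff: "a \<in> muE L <-> a ~= 0 & a ^ q ^ 2 = a"
 unfolding muE_def OE_iff using root_of_unity_iff K_of_frob2_fixed frob_fixed_V0[of a 2] by auto

end

section \<open>The logarithms of the formal modules\<close>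

text \<open>For this discrete filtration a congruence of level 1 is an equality. Thus the results on
  \<open>filtq\<close> yield exact additivity of the q-th power when the binomials vanish.\<close>

lemma filtq_discrete:
 assumes "3 <= q" "odd q" "!!i. 0 < i ==> i < q ==> of_nat (q choose i) = (0::'a::comm_ring_1)"
 shows "filtq (%r x::'a. r <= 0 | x = 0) q" by unfold_locales (use assms in auto)

lemma frob_add_char: fixes A B :: "'a::comm_ring_1"
 assumes "3 <= q" "odd q" "!!i. 0 < i ==> i < q ==> of_nat (q choose i) = (0::'a)"
 shows "(A + B) ^ q ^ k = A ^ q ^ k + B ^ q ^ k"
proof -
 interpret filtq "%r x::'a. r <= 0 | x = 0" q by (rule filtq_discrete[OF assms])
 show ?thesis using N_frob_add_iter[of A B k] by simp
qed

lemma elog_compose_add_char: fixes A B :: "'a::comm_ring_1 fps"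
 assumes q: "3 <= q" "odd q" "!!i. 0 < i ==> i < q ==> of_nat (q choose i) = (0::'a)"
  and A: "A $ 0 = 0" "B $ 0 = 0"
 shows "elog q v oo (A + B) = (elog q v oo A) + (elog q v oo B)"
proof -
 have z: "of_nat (q choose i) = (0::'a fps)" if "0 < i" "i < q" for i
  using q(3)[OF that] by (simp add: fps_of_nat[symmetric])
 have p: "(A + B) ^ q ^ k = A ^ q ^ k + B ^ q ^ k" for k by (rule frob_add_char[OF q(1,2) z])
 have "2 <= q" using q by simp
 thus ?thesis by (intro fps_ext) (simp add: elog_compose_nth A p distrib_left sum.distrib)
qed

lemma elog_eqI: "(!!k. v k = v' k) ==> elog q v = elog q v'"
 by (simp add: elog_def)

lemma elog_compose_monom: fixes a :: "'a::comm_ring_1" assumes q: "2 <= q"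
 shows "elog q v oo (fps_const a * fps_X ^ q ^ i) = elog q (%k. if i <= k then v (k - i) * a ^ q ^ (k - i) else 0)"
proof (rule fps_ext)
 fix n
 have z: "(fps_const a * fps_X ^ q ^ i) $ 0 = (0::'a)" using q by simp
 have pw: "((fps_const a * fps_X ^ q ^ i) ^ q ^ k) $ n = (if q ^ (i + k) = n then a ^ q ^ k else 0)" for k
  by (simp add: power_mult_distrib power_mult[symmetric] power_add[symmetric])
 have "elog q (%k. if i <= k then v (k - i) * a ^ q ^ (k - i) else 0) $ n
   = (\<Sum>k\<le>i + n. if q ^ k = n then (if i <= k then v (k - i) * a ^ q ^ (k - i) else 0) else 0)"
  unfolding elog_nth[OF q]
 proof (rule sum.mono_neutral_left)
  have "q ^ k ~= n" if "n < k" for k using less_power_self[OF q, of k] that by auto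
  thus "\<forall>k\<in>{..i + n} - {..n}. (if q ^ k = n then (if i <= k then v (k - i) * a ^ q ^ (k - i) else 0) else 0) = 0"
   by auto
 qed auto
 also have "... = (\<Sum>k\<in>{i..i + n}. if q ^ k = n then v (k - i) * a ^ q ^ (k - i) else 0)"
  by (rule sum.mono_neutral_cong_right) auto
 also have "... = (\<Sum>k\<le>n. if q ^ (i + k) = n then v k * a ^ q ^ k else 0)"
  by (rule sum.reindex_bij_witness[where i = "%k. i + k" and j = "%k. k - i"]) auto
 finally show "(elog q v oo (fps_const a * fps_X ^ q ^ i)) $ n
   = elog q (%k. if i <= k then v (k - i) * a ^ q ^ (k - i) else 0) $ n"
  unfolding elog_compose_nth[OF q z] pw by (auto intro!: sum.cong)
qed

section \<open>Logarithm coefficients in both characteristics\<close>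

context lt
begin

text \<open>In equal characteristic f([pi](X)) = pi f(X) gives, in degree q^k, the factor pi -
  pi^(q^k) in front of the k-th coefficient of f. With \<open>vp\<close> as denominator the
  recursion of \<open>lc\<close> covers both cases.\<close>

definition vp :: "nat => 'c" where
 "vp k = (if CHAR('c) = 0 then \<pi>' else \<pi>' - \<pi>' ^ q ^ k)"

lemma val_unif_power: "val L (\<pi>' ^ n) = ereal (real n)" using val_power[of \<pi>' 1 n] val_unif by simp

lemma val_vp: assumes "0 < k" shows "val L (vp k) = 1"
proof -
 have "1 < q ^ k" by (rule one_less_power) (use q2 assms in auto)
 hence "(1::real) < real (q ^ k)" by (metis of_nat_1 of_nat_less_iff)
 hence "val L \<pi>' < val L (- (\<pi>' ^ q ^ k))"
  unfolding val_uminus val_unif_power val_unif one_ereal_def by (simp only: less_ereal.simps(1))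
 from val_add_eq[OF this] show ?thesis by (simp add: vp_def val_unif)
qed

lemma vp_nz: "0 < k ==> vp k ~= 0" using val_vp[of k] by (metis val_0 PInfty_neq_ereal(2) one_ereal_def)
lemma vp_base: "vp k \<in> base L" by (simp add: vp_def unif_base base_diff base_power)
lemma V_vp_div: "0 < k ==> V r (y / vp k) <-> V (r + 1) y"
 using V_divide_iff[of "vp k" 1] val_vp by simp
lemma V_unif_vp: "V (real (q ^ k)) (\<pi>' - vp k)" by (simp add: vp_def V_def val_unif_power)

fun lc :: "'c => nat => 'c" where "lc u 0 = 1" | "lc u (Suc 0) = u / vp 1"
| "lc u (Suc (Suc k)) = (lc u (Suc k) * u ^ q ^ Suc k + lc u k) / vp (Suc (Suc k))"

lemma vp_lc: "vp (Suc (Suc k)) * lc u (Suc (Suc k)) = lc u (Suc k) * u ^ q ^ Suc k + lc u k"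
 using vp_nz[of "Suc (Suc k)"] by simp
lemma vp_lc_1: "vp (Suc 0) * lc u (Suc 0) = u" using vp_nz[of "Suc 0"] by simp

declare lc.simps(2,3) [simp del]

definition ll :: "'c => 'c fps" where "ll u = elog q (lc u)"

lemma flog_eq: assumes "CHAR('c) = 0" shows "flog L u = ll u"
proof -
 have "bcoef L u k = lc u k" for k by (induction k rule: induct_nat_012) (simp_all add: lc.simps vp_def assms)
 thus ?thesis by (simp add: flog_def ll_def elog_def)
qed

text \<open>Two steps of the recursion cost one division by an element of valuation 1, that is 1/2
  each; in the mixed term the power of u, of valuation at least 3/4, covers the missing
  half.\<close>

lemma V_lc: assumes u: "V (3/4) u" shows "V (- real k / 2) (lc u k)"
proof (induction k rule: less_induct)
 case (less k)
 consider "k = 0" | "k = 1" | j where "k = Suc (Suc j)" by (metis One_nat_def not0_implies_Suc)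
 thus ?case
 proof cases
  case 1
  thus ?thesis by (simp add: V_1)
 next
  case 2
  thus ?thesis using u N_mono[of "3/4" u "1/2"] by (simp add: lc.simps V_vp_div)
 next
  case (3 j)
  have "1 <= q ^ Suc j" using q2 by simp
  hence "1 <= real (q ^ Suc j)" by (metis of_nat_1 of_nat_le_iff)
  hence e: "3/4 <= real (q ^ Suc j) * (3/4)" by linarith
  have "V (- real (Suc j) / 2 + 3/4) (lc u (Suc j) * u ^ q ^ Suc j)"
   by (rule N_mult[OF less.IH N_power_le[OF u e]]) (simp add: 3)
  hence "V (- real j / 2) (lc u (Suc j) * u ^ q ^ Suc j)" by (rule N_mono) (simp add: field_simps)
  moreover have "V (- real j / 2) (lc u j)" using less.IH[of j] 3 by simp
  ultimately have "V (- real j / 2) (lc u (Suc j) * u ^ q ^ Suc j + lc u j)" by (rule N_add)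
  thus ?thesis unfolding 3 lc.simps V_vp_div[OF zero_less_Suc] by (simp add: field_simps)
 qed
qed

lemma lc_base: "u \<in> base L ==> lc u k \<in> base L" by (induction u k rule: lc.induct)
  (auto simp: lc.simps intro!: base_1 base_divide base_add base_mult base_power vp_base)
lemma lc_0_SS: "lc 0 (Suc (Suc k)) = lc 0 k / vp (Suc (Suc k))" using q3 by (simp add: lc.simps)

lemma sum_1_q_q2: assumes "!!n. n < q ^ 2 ==> n ~= 1 ==> n ~= q ==> f n = 0"
 shows "sum f {0..q ^ 2} = f 1 + (f q + f (q ^ 2))" and "sum f {0..q} = f 1 + f q"
proof -
 have q: "1 < q" "q < q ^ 2" using q3 power_strict_increasing[of 1 2 q] by simp_all
 have "sum f {0..q ^ 2} = sum f {1, q, q ^ 2}" by (rule sum.mono_neutral_right) (use q assms in "auto simp: le_less")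
 thus "sum f {0..q ^ 2} = f 1 + (f q + f (q ^ 2))" using q by simp
 have "sum f {0..q} = sum f {1, q}" by (rule sum.mono_neutral_right) (use q assms in auto)
 thus "sum f {0..q} = f 1 + f q" using q by simp
qed

lemma lc_0_odd: "odd k ==> lc 0 k = 0"
 by (induction k rule: induct_nat_012) (auto simp: lc_0_SS lc.simps(2))

text \<open>For u = 0 only even coefficients survive, so roots of unity of order dividing q^2 - 1
  pass through the logarithm. This is the O_E-structure of the module at u = 0.\<close>

lemma lc_0_fixed: fixes t :: 'c assumes "t ^ q ^ 2 = t" "lc 0 k ~= 0" shows "t ^ q ^ k = t"
proof -
 obtain j where j: "k = 2 * j" using assms(2) lc_0_odd by (blast elim: evenE)
 have "t ^ (q ^ 2) ^ j = t" by (induction j) (simp_all add: power_mult assms(1))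
 thus ?thesis by (simp only: j power_mult)
qed

lemma lc_0_nz: "even k ==> lc 0 k ~= 0"
 by (induction k rule: induct_nat_012) (auto simp: lc_0_SS vp_nz)
lemma ll_nth_0 [simp]: "ll u $ 0 = 0" by (simp add: ll_def q2)
lemma ll_nth_1 [simp]: "ll u $ Suc 0 = 1" by (simp add: ll_def q2 elog_nth_1)

definition linv :: "'c => 'c fps" where "linv u = fps_inv (ll u)"

lemma linv_nth_0 [simp]: "linv u $ 0 = 0" by (simp add: linv_def fps_inv_def)
lemma linv_ll: "linv u oo ll u = fps_X" unfolding linv_def by (rule fps_inv) auto
lemma ll_linv: "ll u oo linv u = fps_X" unfolding linv_def by (rule fps_inv_right) auto

lemma ll_linv_compose: "G $ 0 = 0 ==> ll u oo (linv u oo G) = G"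
 using fps_compose_assoc[of G "linv u" "ll u"] by (simp add: ll_linv)
lemma linv_ll_compose: "G $ 0 = 0 ==> linv u oo (ll u oo G) = G"
 using fps_compose_assoc[of G "ll u" "linv u"] by (simp add: linv_ll)
lemma ll_inj: "s $ 0 = 0 ==> t $ 0 = 0 ==> ll u oo s = ll u oo t ==> s = t"
 using linv_ll_compose by metis

subsection \<open>Limits of sums and products\<close>

lemma tendsto_V_const: "(%n. c) \<longlonglongrightarrow> (c::'c)" by simp

text \<open>The type class of \<open>'c\<close> does not link the metric with the field operations;
  their continuity is derived from the valuation.\<close>

lemma tendsto_V_add: fixes s t :: "nat => 'c" assumes "s \<longlonglongrightarrow> l" "t \<longlonglongrightarrow> m" shows "(%n. s n + t n) \<longlonglongrightarrow> l + m"
 unfolding tendsto_V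
proof
 fix r
 have "\<forall>\<^sub>F n in sequentially. V r (s n - l)" "\<forall>\<^sub>F n in sequentially. V r (t n - m)"
  using assms unfolding tendsto_V by blast+
 thus "\<forall>\<^sub>F n in sequentially. V r (s n + t n - (l + m))"
 proof eventually_elim
  case (elim n)
  from N_add[OF this] show ?case by (simp add: algebra_simps)
 qed
qed

lemma V_bound: obtains B where "B <= 0" "V B x"
proof (cases "x = 0")
 case True
 thus thesis using that[of 0] by simp
next
 case False
 then obtain r where r: "val L x = ereal r" by (rule val_real)
 show thesis by (rule that[of "min r 0"]) (auto simp: V_def r)
qed

lemma tendsto_V_mult: fixes s t :: "nat => 'c" assumes "s \<longlonglongrightarrow> l" "t \<longlonglongrightarrow> m" shows "(%n. s n * t n) \<longlonglongrightarrow> l * m"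
 unfolding tendsto_V
proof
 fix r
 obtain B where B: "B <= 0" "V B l" by (rule V_bound)
 obtain C where C: "C <= 0" "V C m" by (rule V_bound)
 have "\<forall>\<^sub>F n in sequentially. V (r - C) (s n - l)" "\<forall>\<^sub>F n in sequentially. V (r - B) (t n - m)"
  "\<forall>\<^sub>F n in sequentially. V C (t n - m)" using assms unfolding tendsto_V by blast+
 thus "\<forall>\<^sub>F n in sequentially. V r (s n * t n - l * m)"
 proof eventually_elim
  case (elim n)
  have "V C (t n)" using N_add[OF elim(3) C(2)] by simp
  from N_mult[OF elim(1) this] N_mult[OF B(2) elim(2)]
  have "V r ((s n - l) * t n + l * (t n - m))" by (intro N_add) simp_all
  thus ?case by (simp add: algebra_simps)
 qed
qed

lemma tendsto_V_power: fixes s :: "nat => 'c" shows "s \<longlonglongrightarrow> l ==> (%n. s n ^ k) \<longlonglongrightarrow> l ^ k"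
 by (induction k) (auto intro: tendsto_V_mult)
lemma tendsto_V_sum: fixes s :: "'i => nat => 'c" shows "(!!i. i \<in> A ==> (%n. s i n) \<longlonglongrightarrow> l i) ==> (%n. \<Sum>i\<in>A. s i n) \<longlonglongrightarrow> (\<Sum>i\<in>A. l i)"
 by (induction A rule: infinite_finite_induct) (auto intro: tendsto_V_add)

subsection \<open>Digit expansions in equal characteristic\<close>

lemma char_p_binom: assumes "CHAR('c) ~= 0" "0 < i" "i < q" shows "of_nat (q choose i) = (0::'c)"
proof -
 have "prime CHAR('c)" using assms prime_CHAR_semidom by simp
 have "rd (of_nat CHAR('c)) = 0" by simp
 hence "CHAR('k) dvd CHAR('c)" by (simp only: rd_of_nat of_nat_eq_0_iff_char_dvd)
 hence "CHAR('k) = CHAR('c)" using primes_dvd_imp_eq[OF Fq.prime_CHAR \<open>prime CHAR('c)\<close>] by simp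
 thus ?thesis using Fq.CHAR_dvd_binomial[of i] assms card_Fq by (simp add: of_nat_eq_0_iff_char_dvd)
qed

text \<open>Subtract the Teichmueller representative, divide by pi, repeat. For elements of F the
  representative is taken in F, so that the digits are fixed by the q-th power and the quotients
  stay in F.\<close>

lemma K_digits: assumes z: "z \<in> K" "V 0 z"
 obtains c where "!!k. c k ^ q ^ 2 = c k" "!!n. V (real n) (z - (\<Sum>k<n. c k * \<pi>' ^ k))"
  "!!k. z \<in> base L ==> c k ^ q = c k"
proof -
 have ex: "\<exists>t. t ^ q ^ 2 = t & t \<in> K & V 1 (z - t) & (z \<in> base L --> t ^ q = t & t \<in> base L)"
  if z: "z \<in> K" "V 0 z" for z
 proof (cases "z \<in> base L")
  case True
  define t where "t = teich L (rd z)"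
  have r: "rd z ^ q = rd z" using True z rd_base by blast
  note t = teich[OF r, folded t_def]
  have "V 1 (z - t)" using True z t by (intro K_rd_0 K_base base_diff N_diff) (simp_all add: rd_diff)
  thus ?thesis using t K_base by (intro exI[of _ t]) (simp add: q2_eq)
 next
  case False
  thus ?thesis using K_teichmuller[OF z] by metis
 qed
 define c0 where "c0 z = (SOME t. t ^ q ^ 2 = t & t \<in> K & V 1 (z - t) & (z \<in> base L --> t ^ q = t & t \<in> base L))" for z
 have c0: "c0 z ^ q ^ 2 = c0 z" "c0 z \<in> K" "V 1 (z - c0 z)" "z \<in> base L ==> c0 z ^ q = c0 z & c0 z \<in> base L"
  if "z \<in> K" "V 0 z" for z using someI_ex[OF ex[OF that]] unfolding c0_def by blast+
 define Z where "Z n = ((%x. (x - c0 x) / \<pi>') ^^ n) z" for n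
 have Z: "Z n \<in> K & V 0 (Z n) & (z \<in> base L --> Z n \<in> base L)" for n
 proof (induction n)
  case (Suc n)
  hence "V 1 (Z n - c0 (Z n))" using c0 by blast
  thus ?case using Suc c0[of "Z n"]
   by (auto simp: Z_def V_unif_div intro!: K_divide K_diff K_unif base_divide base_diff unif_base)
 qed (simp add: Z_def z)
 have S: "z - (\<Sum>k<n. c0 (Z k) * \<pi>' ^ k) = \<pi>' ^ n * Z n" for n
 proof (induction n)
  case (Suc n)
  have "\<pi>' * Z (Suc n) = Z n - c0 (Z n)" by (simp add: Z_def)
  hence "\<pi>' ^ n * (\<pi>' * Z (Suc n)) = \<pi>' ^ n * (Z n - c0 (Z n))" by (rule arg_cong)
  hence "\<pi>' ^ Suc n * Z (Suc n) = \<pi>' ^ n * Z n - c0 (Z n) * \<pi>' ^ n" by (simp add: algebra_simps)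
  thus ?case using Suc by simp
 qed (simp add: Z_def)
 show thesis
 proof (rule that[of "%k. c0 (Z k)"])
  show "V (real n) (z - (\<Sum>k<n. c0 (Z k) * \<pi>' ^ k))" for n
   unfolding S using Z[of n] by (intro N_mult_right) (auto simp: V_def val_unif_power)
 qed (use c0 Z in blast)+
qed

lemma tendsto_VI: assumes "!!n. V (real n) (a - S n)" shows "S \<longlonglongrightarrow> a" unfolding tendsto_V
proof
 fix r obtain N where N: "r <= real N" using real_arch_simple by blast
 have "V r (S n - a)" if "n \<ge> N" for n
  by (rule N_mono[OF N_diff_commute[OF assms[of n]]]) (use N that in simp)
 thus "\<forall>\<^sub>F n in sequentially. V r (S n - a)" by (rule eventually_sequentiallyI)
qed

text \<open>Two expansions that agree below k have partial sums differing by (d k - c k) * pi^k up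
  to level k + 1, and fixed points of the q^2-th power that are congruent modulo pi are
  equal.\<close>

lemma digits_eq:
 assumes c: "!!k. c k ^ q ^ 2 = c k" and S: "!!n. V (real n) (z - (\<Sum>k<n. c k * \<pi>' ^ k))"
 shows "digits L z = c"
proof -
 have lim: "(%n. \<Sum>k<n. c k * \<pi>' ^ k) \<longlonglongrightarrow> z" by (rule tendsto_VI[OF S])
 show ?thesis unfolding digits_def
 proof (rule the_equality)
  show "(\<forall>k. c k ^ q\<^sup>2 = c k) & (%k. c k * \<pi>' ^ k) sums z" using c lim by (simp add: sums_def)
 next
  fix d assume d: "(\<forall>k. d k ^ q\<^sup>2 = d k) & (%k. d k * \<pi>' ^ k) sums z"
  hence dl: "(%n. \<Sum>k<n. d k * \<pi>' ^ k) \<longlonglongrightarrow> z" by (simp add: sums_def)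
  have "d k = c k" for k
  proof (induction k rule: less_induct)
   case (less k)
   have V0: "V 0 (c i)" "V 0 (d i)" for i using frob_fixed_V0[of "c i" 2] frob_fixed_V0[of "d i" 2] c d by simp_all
   have "\<forall>\<^sub>F n in sequentially. V (real k + 1) ((\<Sum>k<n. d k * \<pi>' ^ k) - z)"
    "\<forall>\<^sub>F n in sequentially. V (real k + 1) ((\<Sum>k<n. c k * \<pi>' ^ k) - z)"
    using lim dl unfolding tendsto_V by blast+
   hence "\<forall>\<^sub>F n in sequentially. V (real k + 1) ((\<Sum>i<n. d i * \<pi>' ^ i) - z)
    & V (real k + 1) ((\<Sum>i<n. c i * \<pi>' ^ i) - z) & k < n"
    using eventually_gt_at_top[of k] by eventually_elim blast
   from eventually_happens'[OF sequentially_bot this]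
   obtain n where n: "V (real k + 1) ((\<Sum>i<n. d i * \<pi>' ^ i) - z)"
    "V (real k + 1) ((\<Sum>i<n. c i * \<pi>' ^ i) - z)" "k < n" by blast
   have e: "(\<Sum>i<n. d i * \<pi>' ^ i) - (\<Sum>i<n. c i * \<pi>' ^ i) = (\<Sum>i<n. (d i - c i) * \<pi>' ^ i)"
    by (simp add: sum_subtractf left_diff_distrib)
   have "V (real k + 1) (\<Sum>i<n. (d i - c i) * \<pi>' ^ i)" using N_diff[OF n(1,2)] by (simp add: e)
   also have "(\<Sum>i<n. (d i - c i) * \<pi>' ^ i) = (\<Sum>i\<in>insert k {k<..<n}. (d i - c i) * \<pi>' ^ i)"
   proof (rule sum.mono_neutral_right)
    have "i < k" if "i \<in> {..<n} - insert k {k<..<n}" for i using that by auto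
    hence "d i - c i = 0" if "i \<in> {..<n} - insert k {k<..<n}" for i using that less.IH by auto
    thus "\<forall>i\<in>{..<n} - insert k {k<..<n}. (d i - c i) * \<pi>' ^ i = 0" by (intro ballI) simp
   qed (use n in auto)
   also have "... = (d k - c k) * \<pi>' ^ k + (\<Sum>i\<in>{k<..<n}. (d i - c i) * \<pi>' ^ i)" by simp
   finally have l1: "V (real k + 1) ((d k - c k) * \<pi>' ^ k + (\<Sum>i\<in>{k<..<n}. (d i - c i) * \<pi>' ^ i))" .
   have l2: "V (real k + 1) (\<Sum>i\<in>{k<..<n}. (d i - c i) * \<pi>' ^ i)"
    by (intro N_sum N_mult_left N_diff V0) (auto simp: V_def val_unif_power)
   have "V (real k + 1) ((d k - c k) * \<pi>' ^ k)" using N_diff[OF l1 l2] by simp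
   hence "V 1 (d k - c k)"
    using V_mult_iff[OF val_unif_power[of k], of "real k + 1" "d k - c k"] by (simp add: mult.commute)
   hence "rd (d k) = rd (c k)" using rd_eqI[of 1 "d k" "c k"] V0 by simp
   thus ?case using frob_fixed_eq[of "d k" 2 "c k"] c d by simp
  qed
  thus "d = c" by blast
 qed
qed

lemma elog_compose_cmult:
 assumes "!!k. v k ~= 0 ==> d ^ q ^ k = d" "P $ 0 = (0::'c)"
 shows "elog q v oo (fps_const d * P) = fps_const d * (elog q v oo P)"
proof (rule fps_ext)
 fix n
 have *: "v k * ((fps_const d * P) ^ q ^ k) $ n = d * (v k * (P ^ q ^ k) $ n)" for k
  using assms(1)[of k] by (cases "v k = 0") (simp_all add: power_mult_distrib fps_const_power)
 thus "(elog q v oo (fps_const d * P)) $ n = (fps_const d * (elog q v oo P)) $ n"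
  using assms(2) by (simp only: elog_compose_nth[OF q2] fps_mult_left_const_nth sum_distrib_left mult_zero_right)
qed

text \<open>Additivity of the logarithm splits [pi]_u into its three monomials; comparing
  coefficients in degree q^k gives back the recursion of \<open>lc\<close>.\<close>

lemma ll_pi_series: assumes "CHAR('c) ~= 0" shows "ll u oo pi_series L u = fps_const \<pi>' * ll u"
proof -
 note b = q3 q_odd char_p_binom[OF assms]
 have q0: "0 < q" using q3 by simp
 have "pi_series L u = fps_const \<pi>' * fps_X ^ q ^ 0 + fps_const u * fps_X ^ q ^ 1 + fps_const 1 * fps_X ^ q ^ 2"
  by (simp add: pi_series_def)
 hence "ll u oo pi_series L u = (ll u oo (fps_const \<pi>' * fps_X ^ q ^ 0))
   + (ll u oo (fps_const u * fps_X ^ q ^ 1)) + (ll u oo (fps_const 1 * fps_X ^ q ^ 2))"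
  using q0 by (simp only: ll_def) (subst elog_compose_add_char[OF b], (simp add: fps_X_power_nth)+)+
 also have "... = elog q (%k. \<pi>' * lc u k)"
  unfolding ll_def elog_compose_monom[OF q2] elog_add[symmetric]
 proof (rule elog_eqI)
  fix k :: nat
  consider "k = 0" | "k = 1" | j where "k = Suc (Suc j)" by (metis One_nat_def not0_implies_Suc)
  thus "(if 0 <= k then lc u (k - 0) * \<pi>' ^ q ^ (k - 0) else 0) +
    (if 1 <= k then lc u (k - 1) * u ^ q ^ (k - 1) else 0) +
    (if 2 <= k then lc u (k - 2) * 1 ^ q ^ (k - 2) else 0) = \<pi>' * lc u k"
  proof cases
   case 2
   thus ?thesis using vp_lc_1[of u] assms by (simp add: vp_def algebra_simps)
  next
   case (3 j)
   thus ?thesis using vp_lc[of j u] assms by (simp add: vp_def algebra_simps)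
  qed simp
 qed
 also have "... = fps_const \<pi>' * ll u" by (simp add: elog_cmult ll_def)
 finally show ?thesis .
qed

definition scal :: "'c => 'c => bool" where
 "scal u a <-> V 0 a & (a \<in> base L | u = 0 & a \<in> K)"

definition pcomp :: "'c => nat => 'c fps" where
 "pcomp u k = ((%s. pi_series L u oo s) ^^ k) fps_X"

text \<open>As the logarithm is additive, the partial sums of compositional powers are exactly [A]_u
  for the partial sums A of the digit expansion; each coefficient of [A]_u is a polynomial in A,
  hence continuous.\<close>

lemma fmult_sums: assumes a: "scal u a" and False: "CHAR('c) ~= 0"
 shows "(%k. digits L a k * pcomp u k $ n) sums ((linv u oo (fps_const a * ll u)) $ n)"
  and "digits L a k ^ q ^ 2 = digits L a k"
proof -
 have aK: "a \<in> K" "V 0 a" using a K_base by (auto simp: scal_def)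
 obtain c where c: "!!k. c k ^ q ^ 2 = c k" "!!n. V (real n) (a - (\<Sum>k<n. c k * \<pi>' ^ k))"
  "!!k. a \<in> base L ==> c k ^ q = c k" by (rule K_digits[OF aK]) blast
 have dig: "digits L a = c" by (rule digits_eq[OF c(1,2)])
 define P where "P = pcomp u"
 have pz: "pi_series L u $ 0 = 0" using q3 by (simp add: pi_series_def)
 have P: "P k $ 0 = 0 & ll u oo P k = fps_const (\<pi>' ^ k) * ll u" for k
 proof (induction k)
  case (Suc k)
  have "ll u oo P (Suc k) = ll u oo pi_series L u oo P k"
   unfolding P_def pcomp_def using fps_compose_assoc[of "P k" "pi_series L u" "ll u"] Suc pz
   by (simp add: P_def pcomp_def)
  also have "... = fps_const \<pi>' * (ll u oo P k)"
   using Suc by (simp add: ll_pi_series[OF False] fps_compose_mult_distrib)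
  finally show ?case using Suc pz by (simp add: P_def pcomp_def)
 qed (simp add: P_def pcomp_def)
 \<comment> \<open>The digits must commute with the logarithm: for a in F by c^q = c, for u = 0
   because only even indices k occur.\<close>
 have cz: "c i ^ q ^ k = c i" if "lc u k ~= 0" for i k
 proof (cases "a \<in> base L")
  case True
  thus ?thesis using c(3)[of i] by (induction k) (auto simp: power_mult mult.commute[of q])
 next
  case False
  hence "u = 0" using a by (simp add: scal_def)
  thus ?thesis using lc_0_fixed[OF c(1)] that by simp
 qed
 have part: "(\<Sum>k<n. fps_const (c k) * P k) = linv u oo (fps_const (\<Sum>k<n. c k * \<pi>' ^ k) * ll u)" for n
 proof -
  have z: "(\<Sum>k<n. fps_const (c k) * P k) $ 0 = 0" for n by (simp add: fps_sum_nth P)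
  have "ll u oo (\<Sum>k<n. fps_const (c k) * P k) = fps_const (\<Sum>k<n. c k * \<pi>' ^ k) * ll u"
  proof (induction n)
   case (Suc n)
   have "ll u oo (\<Sum>k<Suc n. fps_const (c k) * P k)
     = (ll u oo (\<Sum>k<n. fps_const (c k) * P k)) + (ll u oo (fps_const (c n) * P n))"
    unfolding ll_def sum.lessThan_Suc
    by (rule elog_compose_add_char[OF q3 q_odd char_p_binom[OF False]]) (simp_all add: z P)
   also have "ll u oo (fps_const (c n) * P n) = fps_const (c n) * (ll u oo P n)"
    unfolding ll_def by (rule elog_compose_cmult) (use cz P in auto)
   finally show ?case using Suc P
    by (simp add: mult.assoc[symmetric] fps_const_add[symmetric] distrib_right del: fps_const_add)
  qed simp
  thus ?thesis using linv_ll_compose[OF z] by metis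
 qed
 have "(%k. c k * P k $ n) sums ((linv u oo (fps_const a * ll u)) $ n)" for n
 proof -
  define A where "A n = (\<Sum>k<n. c k * \<pi>' ^ k)" for n
  have "A \<longlonglongrightarrow> a" by (rule tendsto_VI) (simp only: A_def c)
  hence "(%m. \<Sum>i=0..n. linv u $ i * (A m ^ i * (ll u ^ i) $ n))
    \<longlonglongrightarrow> (\<Sum>i=0..n. linv u $ i * (a ^ i * (ll u ^ i) $ n))"
   by (intro tendsto_V_sum tendsto_V_mult tendsto_V_const tendsto_V_power)
  moreover have "(linv u oo (fps_const x * ll u)) $ n
   = (\<Sum>i=0..n. linv u $ i * (x ^ i * (ll u ^ i) $ n))" for x
   by (simp add: fps_compose_nth power_mult_distrib)
  moreover have "(\<Sum>k<m. c k * P k $ n) = (linv u oo (fps_const (A m) * ll u)) $ n" for m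
   unfolding A_def part[symmetric] by (simp add: fps_sum_nth)
  ultimately show ?thesis by (simp add: sums_def)
 qed
 thus "(%k. digits L a k * pcomp u k $ n) sums ((linv u oo (fps_const a * ll u)) $ n)"
  by (simp add: dig P_def)
 show "digits L a k ^ q ^ 2 = digits L a k" by (simp only: dig c)
qed

lemma fmult_eq: assumes a: "scal u a" shows "fmult L u a = linv u oo (fps_const a * ll u)"
proof (cases "CHAR('c) = 0")
 case True
 thus ?thesis by (simp add: fmult_def flog_eq linv_def)
next
 case False
 thus ?thesis
  by (intro fps_ext) (simp add: fmult_def sums_unique[OF fmult_sums(1)[OF a False], symmetric] pcomp_def[symmetric])
qed

lemma fps_compose_integral: "fN V 0 s ==> fN V 0 t ==> fN V 0 (s oo t)"
proof -
 interpret F: filt "fN V" by (rule filt_fN) unfold_locales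
 assume st: "fN V 0 s" "fN V 0 t"
 thus ?thesis unfolding fN_def fps_compose_nth
  using F.N_power0[OF st(2)] by (auto simp: fN_def intro!: N_sum N_mult_left)
qed

lemma fmult_integral_char_p: assumes a: "scal u a" and p: "CHAR('c) ~= 0" and u: "V 0 u"
 shows "fN V 0 (fmult L u a)" unfolding fN_def
proof
 fix n
 interpret F: filt "fN V" by (rule filt_fN) unfold_locales
 have cst: "fN V 0 (fps_const a)" if "V 0 a" for a using that by (simp add: fN_def)
 have X: "fN V 0 fps_X" by (simp add: fN_def V_1)
 have "V 0 \<pi>'" by (simp add: V_def val_unif)
 hence pi: "fN V 0 (pi_series L u)"
  unfolding pi_series_def using u by (intro F.N_add F.N_mult_left F.N_power0 cst X)
 have "fN V 0 (pcomp u k)" for k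
  by (induction k) (auto simp: pcomp_def fps_compose_integral[OF pi], simp add: fN_def fps_X_def V_1)
 hence "V 0 (\<Sum>k<m. digits L a k * pcomp u k $ n)" for m
  using fmult_sums(2)[OF a p] frob_fixed_V0[of _ 2] by (intro N_sum N_mult_left) (auto simp: fN_def)
 thus "V 0 (fmult L u a $ n)" using fmult_sums(1)[OF a p, of n] unfolding sums_def fmult_eq[OF a]
  by (rule_tac V_limit) (auto intro: always_eventually)
qed

lemma fmult_nth_0: "scal u a ==> fmult L u a $ 0 = 0" by (simp add: fmult_eq)
lemma ll_fmult: "scal u a ==> ll u oo fmult L u a = fps_const a * ll u"
 by (simp add: fmult_eq ll_linv_compose)
lemma fadd_nth_0: "(fadd L u $ 0) $ 0 = 0" by (simp add: fadd_def subst1_nth fps_inv_def in_X_def)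

lemma ll_fadd: "subst1 (ll u) (fadd L u) = in_X (ll u) + in_Y (ll u)"
proof (cases "CHAR('c) = 0")
 case True
 have z: "((in_X (ll u) + in_Y (ll u)) $ 0) $ 0 = 0" by (simp add: in_X_def)
 have "fadd L u = subst1 (linv u) (in_X (ll u) + in_Y (ll u))"
  using True by (simp add: fadd_def flog_eq linv_def)
 thus ?thesis using subst1_subst1[OF linv_nth_0 z] subst1_X[OF z] by (simp add: ll_linv)
next
 case False
 have b: "of_nat (q choose i) = (0::'c fps)" if "0 < i" "i < q" for i
  using char_p_binom[OF False that] by (simp add: fps_of_nat[symmetric])
 have "diagT (subst1 (ll u) (fadd L u)) = in_Y (ll u) oo (diagT (in_X fps_X) + diagT (in_Y fps_X))"
  using False by (simp add: fadd_def diagT_subst1 diagT_add)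
 also have "... = (in_Y (ll u) oo diagT (in_X fps_X)) + (in_Y (ll u) oo diagT (in_Y fps_X))"
  unfolding ll_def in_Y_elog
  by (rule elog_compose_add_char[OF q3 q_odd b]) (simp_all add: diagT_nth_0 in_X_def)
 also have "... = diagT (in_X (ll u) + in_Y (ll u))"
  by (simp add: diagT_subst1[symmetric] diagT_add subst1_in_X subst1_in_Y)
 finally show ?thesis by (simp add: diagT_inj)
qed

end

section \<open>Quasi-logarithms and the Gross--Hopkins coordinates\<close>

lemma elog_compose_power: assumes q: "2 <= q" and Z: "Z $ 0 = (0::'a::idom)"
 shows "elog q v oo Z ^ q = elog q (%k. if 1 <= k then v (k - 1) else 0) oo Z"
proof (rule fps_ext)
 fix n
 have Zq: "(Z ^ q) $ 0 = 0" using q Z by simp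
 have van: "(Z ^ q ^ Suc n) $ n = 0"
  using startsby_zero_power_prefix[OF Z, of "q ^ Suc n"] less_power_self[OF q, of "Suc n"] by simp
 have "(\<Sum>k\<le>n. v k * ((Z ^ q) ^ q ^ k) $ n) = (\<Sum>k\<le>n. v k * (Z ^ q ^ Suc k) $ n)"
  by (simp add: power_mult[symmetric])
 also have "... = (\<Sum>k\<le>Suc n. (if 1 <= k then v (k - 1) else 0) * (Z ^ q ^ k) $ n)"
  by (simp only: sum.atMost_Suc_shift) simp
 also have "... = (\<Sum>k\<le>n. (if 1 <= k then v (k - 1) else 0) * (Z ^ q ^ k) $ n)"
  using van by simp
 finally show "(elog q v oo Z ^ q) $ n = (elog q (%k. if 1 <= k then v (k - 1) else 0) oo Z) $ n"
  unfolding elog_compose_nth[OF q Zq] elog_compose_nth[OF q Z] .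
qed

context lt
begin

abbreviation th :: real where "th \<equiv> 3 / 4"

lemma q_power_ge: "1 + 2 * real m <= real (q ^ m)"
proof (induction m)
 case (Suc m)
 have "3 * real (q ^ m) <= real q * real (q ^ m)" using q3 by (intro mult_right_mono) auto
 thus ?case using Suc by simp
qed simp

lemma V_power_disc: "V th u ==> r <= th * real (q ^ m) ==> V r (u ^ q ^ m)"
 by (rule N_power_le[of th]) (simp_all add: mult.commute)

text \<open>Dividing the coefficients of f_u, even and odd, by the even ones of f_0 normalises their
  growth. The quotients \<open>P0\<close> and \<open>P1\<close> converge, and their limits
  \<open>Phi0\<close>, \<open>Phi1\<close> are the homogeneous Gross--Hopkins coordinates.\<close>

definition lam :: "nat => 'c" where "lam k = lc 0 (2 * k)"
definition P0 :: "'c => nat => 'c" where "P0 u k = lc u (2 * k) / lam k"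
definition P1 :: "'c => nat => 'c" where "P1 u k = lc u (Suc (2 * k)) / lam k"

lemma lam_nz: "lam k ~= 0" by (simp add: lam_def lc_0_nz)
lemma lam_Suc: "lam (Suc k) = lam k / vp (Suc (Suc (2 * k)))" by (simp add: lam_def lc_0_SS)

lemma val_lam: "val L (lam k) = ereal (- real k)"
proof (induction k)
 case (Suc k)
 have "val L (vp (Suc (Suc (2 * k)))) = ereal 1" using val_vp by simp
 from val_inverse[OF this] Suc show ?case by (simp add: lam_Suc divide_inverse val_mult)
qed (simp add: lam_def)

lemma P0_0: "P0 u 0 = 1" by (simp add: P0_def lam_def)
lemma P1_0: "P1 u 0 = u / vp 1" by (simp add: P1_def lam_def lc.simps)

lemma P0_Suc: "P0 u (Suc k) = P0 u k + P1 u k * u ^ q ^ Suc (2 * k)"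
proof -
 have n: "vp (Suc (Suc (2 * k))) ~= 0" by (simp add: vp_nz)
 hence "P0 u (Suc k) = (lc u (Suc (2 * k)) * u ^ q ^ Suc (2 * k) + lc u (2 * k)) / lam k"
  by (simp add: P0_def lam_Suc lc.simps(3))
 thus ?thesis by (simp add: P0_def P1_def add_divide_distrib)
qed

lemma P1_Suc: "P1 u (Suc k) = P1 u k * (vp (Suc (Suc (2 * k))) / vp (Suc (Suc (Suc (2 * k)))))
  + P0 u (Suc k) * u ^ q ^ Suc (Suc (2 * k)) / vp (Suc (Suc (Suc (2 * k))))"
proof -
 have "P1 u (Suc k) = (lc u (Suc (Suc (2 * k))) * u ^ q ^ Suc (Suc (2 * k)) + lc u (Suc (2 * k)))
   / vp (Suc (Suc (Suc (2 * k)))) / lam (Suc k)" by (simp add: P1_def lc.simps(3))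
 thus ?thesis using lam_nz[of k] vp_nz[of "Suc (Suc (Suc (2 * k)))"] by (simp add: P0_def P1_def lam_Suc field_simps)
qed

lemma V_vp_quot: "V (real (q ^ Suc m) - 1) (vp (Suc m) / vp (Suc (Suc m)) - 1)"
proof -
 have "real (q ^ Suc m) <= real (q ^ Suc (Suc m))"
  unfolding of_nat_le_iff using q2 by (intro power_increasing) auto
 hence "V (real (q ^ Suc m)) ((\<pi>' - vp (Suc (Suc m))) - (\<pi>' - vp (Suc m)))"
  by (intro N_diff N_mono[OF V_unif_vp[of "Suc (Suc m)"]] V_unif_vp)
 hence "V (real (q ^ Suc m) - 1) ((vp (Suc m) - vp (Suc (Suc m))) / vp (Suc (Suc m)))"
  by (simp add: V_vp_div)
 thus ?thesis using vp_nz[of "Suc (Suc m)"] by (simp add: diff_divide_distrib)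
qed

text \<open>The increments carry a high power of u or a quotient of denominators close to 1; at k =
  0 the bound for \<open>P0\<close> is 3 * 3/4 - 1/4 = 2.\<close>

lemma P_step: assumes u: "V th u" and P: "V 0 (P0 u k)" "V (- 1/4) (P1 u k)"
 shows "V (2 + real k) (P0 u (Suc k) - P0 u k)" "V (2 + real k) (P1 u (Suc k) - P1 u k)"
proof -
 have g1: "3 + 4 * real k <= real (q ^ Suc (2 * k))" using q_power_ge[of "Suc (2 * k)"] by simp
 have g2: "5 + 4 * real k <= real (q ^ Suc (Suc (2 * k)))" using q_power_ge[of "Suc (Suc (2 * k))"] by simp
 have "V (2 + real k) (P1 u k * u ^ q ^ Suc (2 * k))"
  by (rule N_mult_le[OF P(2) V_power_disc[OF u, of "th * real (q ^ Suc (2 * k))"]]) (use g1 in auto)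
 thus 0: "V (2 + real k) (P0 u (Suc k) - P0 u k)" by (simp add: P0_Suc)
 have P0: "V 0 (P0 u (Suc k))" using V0_trans[OF 0 _ P(1)] by simp
 have "V (3 + real k) (P0 u (Suc k) * u ^ q ^ Suc (Suc (2 * k)))"
  by (rule N_mult_le[OF P0 V_power_disc[OF u, of "th * real (q ^ Suc (Suc (2 * k)))"]]) (use g2 in auto)
 hence a: "V (2 + real k) (P0 u (Suc k) * u ^ q ^ Suc (Suc (2 * k)) / vp (Suc (Suc (Suc (2 * k)))))"
  by (simp only: V_vp_div[OF zero_less_Suc]) (simp add: add.commute)
 have b: "V (2 + real k) (P1 u k * (vp (Suc (Suc (2 * k))) / vp (Suc (Suc (Suc (2 * k)))) - 1))"
  by (rule N_mult_le[OF P(2) V_vp_quot]) (use g2 in auto)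
 have "P1 u (Suc k) - P1 u k = P1 u k * (vp (Suc (Suc (2 * k))) / vp (Suc (Suc (Suc (2 * k)))) - 1)
   + P0 u (Suc k) * u ^ q ^ Suc (Suc (2 * k)) / vp (Suc (Suc (Suc (2 * k))))"
  by (simp add: P1_Suc algebra_simps)
 thus "V (2 + real k) (P1 u (Suc k) - P1 u k)" using N_add[OF b a] by simp
qed

lemma V_P: assumes u: "V th u" shows "V 0 (P0 u k) & V (- 1/4) (P1 u k)"
proof (induction k)
 case 0
 have "V (- 1/4) (u / vp 1)" using u by (simp add: V_vp_div)
 thus ?case by (simp add: P0_0 P1_0 V_1)
next
 case (Suc k)
 have "V 0 (P0 u (Suc k) - P0 u k)" "V (- 1/4) (P1 u (Suc k) - P1 u k)"
  using P_step[OF u] Suc N_mono[of "2 + real k"] by auto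
 thus ?case using N_add[of 0 "P0 u (Suc k) - P0 u k" "P0 u k"]
   N_add[of "- 1/4" "P1 u (Suc k) - P1 u k" "P1 u k"] Suc by simp
qed

definition Phi0 :: "'c => 'c" where "Phi0 u = lim (P0 u)"
definition Phi1 :: "'c => 'c" where "Phi1 u = lim (P1 u)"

lemma Phi_limits: assumes u: "V th u"
 shows "P0 u \<longlonglongrightarrow> Phi0 u" "V (2 + real k) (P0 u k - Phi0 u)"
  "P1 u \<longlonglongrightarrow> Phi1 u" "V (2 + real k) (P1 u k - Phi1 u)"
proof -
 have s: "V (2 + 1 * real k) (P0 u (Suc k) - P0 u k)" "V (2 + 1 * real k) (P1 u (Suc k) - P1 u k)" for k
  using P_step[OF u] V_P[OF u, of k] by simp_all
 obtain l where l: "P0 u \<longlonglongrightarrow> l" "!!k. V (2 + 1 * real k) (P0 u k - l)"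
  by (rule V_Cauchy_limit[OF s(1)]) auto
 obtain m where m: "P1 u \<longlonglongrightarrow> m" "!!k. V (2 + 1 * real k) (P1 u k - m)"
  by (rule V_Cauchy_limit[OF s(2)]) auto
 have "Phi0 u = l" "Phi1 u = m" unfolding Phi0_def Phi1_def using l(1) m(1) by (auto intro: limI)
 thus "P0 u \<longlonglongrightarrow> Phi0 u" "V (2 + real k) (P0 u k - Phi0 u)"
  "P1 u \<longlonglongrightarrow> Phi1 u" "V (2 + real k) (P1 u k - Phi1 u)" using l m by simp_all
qed

lemma V_Phi: assumes u: "V th u"
 shows "V 2 (Phi0 u - 1)" "V 2 (Phi1 u - u / vp 1)" "V 0 (Phi0 u)" "V (- 1/4) (Phi1 u)" "val L (Phi0 u) = 0"
proof -
 show a: "V 2 (Phi0 u - 1)" "V 2 (Phi1 u - u / vp 1)"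
  using Phi_limits(2,4)[OF u, of 0] N_diff_commute by (simp_all add: P0_0 P1_0)
 show b: "V 0 (Phi0 u)" using V0_trans[OF a(1)] V_1 by simp
 have "V (- 1/4) (u / vp 1)" using u by (simp add: V_vp_div)
 thus "V (- 1/4) (Phi1 u)"
  using N_add[of "- 1/4" "Phi1 u - u / vp 1" "u / vp 1"] N_mono[OF a(2), of "- 1/4"] by simp
 have "rd (Phi0 u) = rd 1" using rd_eqI[OF a(1)] V_1 by simp
 thus "val L (Phi0 u) = 0" using b val_unit_iff rd_1 by simp
qed

lemma V_power_diff_disc: assumes u: "V th u" "V th v" and s: "V s (u - v)" and n: "0 < n"
 shows "V (s + th * real (n - 1)) (u ^ n - v ^ n)" using n
proof (induction n)
 case (Suc n)
 show ?case
 proof (cases "n = 0")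
  case False
  hence IH: "V (s + th * real (n - 1)) (u ^ n - v ^ n)" using Suc by simp
  have "V (s + th * real n) (u * (u ^ n - v ^ n))"
   by (rule N_mult_le[OF u(1) IH]) (use False in "cases n, simp_all add: field_simps")
  moreover have "V (s + th * real n) ((u - v) * v ^ n)"
   by (rule N_mult_le[OF s N_power[OF u(2)]]) (simp add: algebra_simps)
  ultimately have "V (s + th * real n) (u * (u ^ n - v ^ n) + (u - v) * v ^ n)" by (rule N_add)
  thus ?thesis by (simp add: algebra_simps)
 qed (use s in simp)
qed simp

text \<open>The linear term u / vp 1 of \<open>P1\<close> loses 1 and is therefore removed. What
  remains gains 1, because a difference of high powers of u gains from the other factors u.\<close>

lemma P_lipschitz: assumes u: "V th u" and v: "V th v" and s: "V s (u - v)"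
 shows "V (s + 1) (P0 u k - P0 v k) & V (s + 1) ((P1 u k - u / vp 1) - (P1 v k - v / vp 1))"
proof (induction k)
 case (Suc k)
 define x where "x = u ^ q ^ Suc (2 * k)"
 define x' where "x' = v ^ q ^ Suc (2 * k)"
 define y where "y = u ^ q ^ Suc (Suc (2 * k))"
 define y' where "y' = v ^ q ^ Suc (Suc (2 * k))"
 have g1: "3 <= real (q ^ Suc (2 * k))" using q_power_ge[of "Suc (2 * k)"] by simp
 have g2: "9 <= real (q ^ Suc (Suc (2 * k)))"
 proof -
  have "3 * 3 <= real q * real (q ^ Suc (2 * k))" using q3 g1 by (intro mult_mono) auto
  thus ?thesis by simp
 qed
 have pos: "0 < q ^ m" for m using q3 by simp
 have r1: "real (q ^ m - 1) = real (q ^ m) - 1" for m using pos[of m] by (simp add: Suc_leI)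
 have x: "V (9/4) x'" unfolding x'_def by (rule V_power_disc[OF v]) (use g1 in linarith)
 have xx: "V (s + 3/2) (x - x')" unfolding x_def x'_def
  by (rule N_mono[OF V_power_diff_disc[OF u v s pos]]) (use g1 r1[of "Suc (2 * k)"] in linarith)
 have y: "V (27/4) y'" unfolding y'_def by (rule V_power_disc[OF v]) (use g2 in linarith)
 have yy: "V (s + 6) (y - y')" unfolding y_def y'_def
  by (rule N_mono[OF V_power_diff_disc[OF u v s pos]]) (use g2 r1[of "Suc (Suc (2 * k))"] in linarith)
 have sv: "V (s - 1) (u / vp 1 - v / vp 1)" using s by (simp add: diff_divide_distrib[symmetric] V_vp_div)
 have d1: "V (s - 1) (P1 u k - P1 v k)"
  using N_add[OF N_mono[of "s + 1" "(P1 u k - u / vp 1) - (P1 v k - v / vp 1)" "s - 1"] sv] Suc by simp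
 have c1: "V (s + 1) (P1 u k * (x - x') + (P1 u k - P1 v k) * x')" using V_P[OF u, of k] d1 x xx
  by (intro N_add N_mult_le[of "- 1/4" _ "s + 3/2"] N_mult_le[of "s - 1" _ "9/4"]) auto
 have "V (s + 1) ((P0 u k - P0 v k) + (P1 u k * (x - x') + (P1 u k - P1 v k) * x'))"
  by (rule N_add[OF conjunct1[OF Suc.IH] c1])
 hence 0: "V (s + 1) (P0 u (Suc k) - P0 v (Suc k))"
  unfolding P0_Suc x_def[symmetric] x'_def[symmetric] by (simp add: algebra_simps)
 define t where "t = vp (Suc (Suc (2 * k))) / vp (Suc (Suc (Suc (2 * k))))"
 have t: "V 2 (t - 1)" unfolding t_def by (rule N_mono[OF V_vp_quot]) (use g2 in auto)
 have a: "V (s + 1) ((P1 u k - P1 v k) * (t - 1))" by (rule N_mult_le[OF d1 t]) simp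
 have "V (s + 2) (P0 u (Suc k) * (y - y') + (P0 u (Suc k) - P0 v (Suc k)) * y')"
  using V_P[OF u, of "Suc k"] 0 y yy
  by (intro N_add N_mult_le[of 0 _ "s + 6"] N_mult_le[of "s + 1" _ "27/4"]) auto
 hence b: "V (s + 1) ((P0 u (Suc k) * (y - y') + (P0 u (Suc k) - P0 v (Suc k)) * y') / vp (Suc (Suc (Suc (2 * k)))))"
  by (simp only: V_vp_div[OF zero_less_Suc]) (simp add: add.commute)
 have e: "(P1 u (Suc k) - u / vp 1) - (P1 v (Suc k) - v / vp 1)
  = ((P1 u k - u / vp 1) - (P1 v k - v / vp 1)) + ((P1 u k - P1 v k) * (t - 1)
   + (P0 u (Suc k) * (y - y') + (P0 u (Suc k) - P0 v (Suc k)) * y') / vp (Suc (Suc (Suc (2 * k)))))"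
  unfolding P1_Suc t_def[symmetric] y_def[symmetric] y'_def[symmetric]
  by (simp add: diff_divide_distrib algebra_simps)
 show ?case unfolding e by (rule conjI[OF 0 N_add[OF conjunct2[OF Suc.IH] N_add[OF a b]]])
qed (simp add: P0_0 P1_0)

lemma Phi_lipschitz: assumes u: "V th u" and v: "V th v" and s: "V s (u - v)"
 shows "V (s + 1) (Phi0 u - Phi0 v)" "V (s + 1) ((Phi1 u - u / vp 1) - (Phi1 v - v / vp 1))"
proof -
 obtain k :: nat where k: "s + 1 <= real k" using real_arch_simple by blast
 have "V (s + 1) (P0 u k - Phi0 u)" "V (s + 1) (P0 v k - Phi0 v)"
  "V (s + 1) (P1 u k - Phi1 u)" "V (s + 1) (P1 v k - Phi1 v)"
  using Phi_limits(2,4)[OF u, of k] Phi_limits(2,4)[OF v, of k] k N_mono[of "2 + real k" _ "s + 1"] by auto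
 note w = this
 note P = P_lipschitz[OF assms, of k]
 have e0: "Phi0 u - Phi0 v = (P0 u k - P0 v k) - (P0 u k - Phi0 u) + (P0 v k - Phi0 v)" by simp
 show "V (s + 1) (Phi0 u - Phi0 v)" unfolding e0 using P w by (intro N_add N_diff[of _ "P0 u k - P0 v k"]) auto
 have e1: "(Phi1 u - u / vp 1) - (Phi1 v - v / vp 1) = ((P1 u k - u / vp 1) - (P1 v k - v / vp 1))
   - (P1 u k - Phi1 u) + (P1 v k - Phi1 v)" by simp
 show "V (s + 1) ((Phi1 u - u / vp 1) - (Phi1 v - v / vp 1))"
  unfolding e1 using P w by (intro N_add N_diff[of _ "(P1 u k - u / vp 1) - (P1 v k - v / vp 1)"]) auto
qed

text \<open>The equation Phi1 u = T * Phi0 u, solved for the linear term of Phi1. By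
  \<open>Phi_lipschitz\<close> the remaining terms make this a contraction.\<close>

definition Tmap :: "'c => 'c => 'c" where
 "Tmap T u = vp 1 * (T * Phi0 u - (Phi1 u - u / vp 1))"

lemma Tmap_fixed: "Tmap T u = u <-> Phi1 u = T * Phi0 u"
 using vp_nz[of 1] by (auto simp: Tmap_def field_simps)
lemma V_vp_mult: "0 < k ==> V r (vp k * y) <-> V (r - 1) y"
 using V_mult_iff[of "vp k" 1] val_vp by simp

lemma Tmap_disc: assumes T: "V (- 1/4) T" and u: "V th u" shows "V th (Tmap T u)"
proof -
 have "V (- 1/4) (T * Phi0 u)" using T V_Phi(3)[OF u] by (rule N_mult_right)
 moreover have "V (- 1/4) (Phi1 u - u / vp 1)" by (rule N_mono[OF V_Phi(2)[OF u]]) simp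
 ultimately have "V (- 1/4) (T * Phi0 u - (Phi1 u - u / vp 1))" by (rule N_diff)
 thus ?thesis unfolding Tmap_def by (simp add: V_vp_mult)
qed

lemma Tmap_contract:
 assumes T: "V (- 1/4) T" and u: "V th u" and v: "V th v" and s: "V s (u - v)"
 shows "V (s + 1) (Tmap T u - Tmap T v)"
proof -
 note P = Phi_lipschitz[OF u v s]
 have "V s (T * (Phi0 u - Phi0 v))" by (rule N_mult_le[OF T P(1)]) simp
 moreover have "V s ((Phi1 u - u / vp 1) - (Phi1 v - v / vp 1))" by (rule N_mono[OF P(2)]) simp
 ultimately have "V s (T * (Phi0 u - Phi0 v) - ((Phi1 u - u / vp 1) - (Phi1 v - v / vp 1)))" by (rule N_diff)
 hence "V (s + 1) (vp 1 * (T * (Phi0 u - Phi0 v) - ((Phi1 u - u / vp 1) - (Phi1 v - v / vp 1))))"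
  by (simp add: V_vp_mult)
 thus ?thesis by (simp add: Tmap_def algebra_simps)
qed

lemma Phi_quotient_inj:
 assumes u: "V th u" and v: "V th v" and e: "Phi1 u * Phi0 v = Phi1 v * Phi0 u" shows "u = v"
proof -
 define T where "T = Phi1 u / Phi0 u"
 have nz: "Phi0 u ~= 0" "Phi0 v ~= 0" using V_Phi(5)[OF u] V_Phi(5)[OF v] by auto
 have T: "V (- 1/4) T" unfolding T_def
  using V_divide_iff[of "Phi0 u" 0 "- 1/4" "Phi1 u"] V_Phi[OF u] by simp
 have f: "Tmap T u = u" "Tmap T v = v"
  unfolding Tmap_fixed using nz e by (simp_all add: T_def)
 have "V (th + 1 * real n) (u - v)" for n
 proof (induction n)
  case 0
  thus ?case using u v by (simp add: N_diff)
 next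
  case (Suc n)
  from Tmap_contract[OF T u v this] show ?case by (simp add: f)
 qed
 hence "u - v = 0" by (rule V_seq_imp_0) simp
 thus ?thesis by simp
qed

text \<open>The iteration from 0 is kept explicit because \<open>usol\<close> must later be a
  uniform limit of polynomial functions on the affinoid.\<close>

definition uit :: "'c => nat => 'c" where "uit T n = (Tmap T ^^ n) 0"
definition usol :: "'c => 'c" where "usol T = lim (uit T)"

lemma usol: assumes T: "V (- 1/4) T"
 shows "V th (uit T n)" "V (th + real n) (uit T n - usol T)" "V th (usol T)"
  "Phi1 (usol T) = T * Phi0 (usol T)"
proof -
 have uS: "uit T (Suc n) = Tmap T (uit T n)" for n by (simp add: uit_def)
 show disc: "V th (uit T n)" for n
 proof (induction n)
  case (Suc n)
  thus ?case unfolding uS by (rule Tmap_disc[OF T])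
 qed (simp add: uit_def)
 have step: "V (th + 1 * real n) (uit T (Suc n) - uit T n)" for n
 proof (induction n)
  case 0
  have "uit T 0 = 0" by (simp add: uit_def)
  thus ?case using disc[of "Suc 0"] by simp
 next
  case (Suc n)
  from Tmap_contract[OF T disc disc Suc.IH] show ?case by (simp add: uS)
 qed
 obtain l where l: "uit T \<longlonglongrightarrow> l" "!!n. V (th + 1 * real n) (uit T n - l)"
  by (rule V_Cauchy_limit[OF step]) auto
 have lu: "usol T = l" unfolding usol_def using l(1) by (rule limI)
 thus conv: "V (th + real n) (uit T n - usol T)" for n using l by simp
 show u: "V th (usol T)" using conv[of 0] N_uminus[of th "uit T 0 - usol T"] by (simp add: uit_def)
 have "V (th + 1 * real n) (Tmap T (usol T) - usol T)" for n
 proof -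
  have "V (th + real n + 1) (Tmap T (usol T) - Tmap T (uit T n))"
   by (rule Tmap_contract[OF T u disc N_diff_commute[OF conv]])
  hence a: "V (th + real n) (Tmap T (usol T) - uit T (Suc n))"
   unfolding uS by (rule N_mono) simp
  have b: "V (th + real n) (uit T (Suc n) - usol T)" by (rule N_mono[OF conv]) simp
  show ?thesis using N_trans[OF a b] by simp
 qed
 hence "Tmap T (usol T) - usol T = 0" by (rule V_seq_imp_0) simp
 thus "Phi1 (usol T) = T * Phi0 (usol T)" using Tmap_fixed by simp
qed

text \<open>The quotients approach their limits to level 2 + j, and multiplication by
  \<open>lam j\<close> loses only j.\<close>

lemma V_lc_defect: assumes u: "V th u"
 shows "V th (lc u k - (Phi0 u * lc 0 k + Phi1 u * (if 1 <= k then lc 0 (k - 1) else 0)))"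
proof (cases "even k")
 case True
 then obtain j where j: "k = 2 * j" by (rule evenE)
 have "(if 1 <= k then lc 0 (k - 1) else 0) = 0" using True by (auto simp: lc_0_odd)
 hence "lc u k - (Phi0 u * lc 0 k + Phi1 u * (if 1 <= k then lc 0 (k - 1) else 0)) = lam j * (P0 u j - Phi0 u)"
  using lam_nz[of j] by (simp add: j P0_def lam_def field_simps)
 moreover have "V th (lam j * (P0 u j - Phi0 u))"
  unfolding V_mult_iff[OF val_lam] by (rule N_mono[OF Phi_limits(2)[OF u]]) simp
 ultimately show ?thesis by simp
next
 case False
 then obtain j where j: "k = Suc (2 * j)" by (metis oddE Suc_eq_plus1)
 have "lc u k - (Phi0 u * lc 0 k + Phi1 u * (if 1 <= k then lc 0 (k - 1) else 0)) = lam j * (P1 u j - Phi1 u)"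
  using lam_nz[of j] by (simp add: j P1_def lam_def lc_0_odd field_simps)
 moreover have "V th (lam j * (P1 u j - Phi1 u))"
  unfolding V_mult_iff[OF val_lam] by (rule N_mono[OF Phi_limits(4)[OF u]]) simp
 ultimately show ?thesis by simp
qed

text \<open>Stated for an algebra \<open>e\<close> over \<open>\<^bold>C\<close>, since it is needed for series in one and in two variables.\<close>

lemma ll_approx: fixes N :: "real => 'a::idom => bool" and e :: "'c => 'a"
 assumes N: "filtq N q" and e: "!!x y. e (x + y) = e x + e y" "!!x y. e (x * y) = e x * e y"
  and eV: "!!r x. V r x ==> N r (e x)" and u: "V th u" and Z: "fN N 0 Z" "Z $ 0 = 0"
 shows "fN N th ((elog q (%k. e (lc u k)) oo Z) - (fps_const (e (Phi0 u)) * (elog q (%k. e (lc 0 k)) oo Z)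
   + fps_const (e (Phi1 u)) * (elog q (%k. e (lc 0 k)) oo Z ^ q)))"
proof -
 interpret N: filtq N q by fact
 have e0: "e 0 = 0" using e(1)[of 0 0] by (metis add.right_neutral add_left_imp_eq)
 define dt where "dt k = lc u k - (Phi0 u * lc 0 k + Phi1 u * (if 1 <= k then lc 0 (k - 1) else 0))" for k
 have "elog q (%k. e (lc u k)) = fps_const (e (Phi0 u)) * elog q (%k. e (lc 0 k))
   + fps_const (e (Phi1 u)) * elog q (%k. if 1 <= k then e (lc 0 (k - 1)) else 0) + elog q (%k. e (dt k))"
  unfolding elog_cmult[symmetric] elog_add[symmetric]
 proof (rule elog_eqI)
  fix k
  have "lc u k = (Phi0 u * lc 0 k + Phi1 u * (if 1 <= k then lc 0 (k - 1) else 0)) + dt k" by (simp add: dt_def)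
  hence "e (lc u k) = e ((Phi0 u * lc 0 k + Phi1 u * (if 1 <= k then lc 0 (k - 1) else 0)) + dt k)" by simp
  thus "e (lc u k) = e (Phi0 u) * e (lc 0 k)
    + e (Phi1 u) * (if 1 <= k then e (lc 0 (k - 1)) else 0) + e (dt k)"
   by (simp only: e) (simp add: e e0)
 qed
 hence "(elog q (%k. e (lc u k)) oo Z) - (fps_const (e (Phi0 u)) * (elog q (%k. e (lc 0 k)) oo Z)
   + fps_const (e (Phi1 u)) * (elog q (%k. e (lc 0 k)) oo Z ^ q)) = elog q (%k. e (dt k)) oo Z"
  by (simp add: fps_compose_add_distrib fps_compose_mult_distrib[OF Z(2)] elog_compose_power[OF q2 Z(2)])
 moreover have "fN N th (elog q (%k. e (dt k)) oo Z)"
 proof (rule N.elog_small[OF _ Z])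
  show "N th (e (dt k))" for k unfolding dt_def by (rule eV[OF V_lc_defect[OF u]])
 qed
 ultimately show ?thesis by simp
qed

end

section \<open>Integrality of the formal modules and lifting of isogenies\<close>

lemma fps_compose_X_powers: fixes s :: "'a::idom fps" assumes "0 < m" "0 < n"
 shows "(s oo fps_X ^ m) oo fps_X ^ n = s oo (fps_X ^ m) ^ n"
proof -
 have z: "(fps_X ^ n :: 'a fps) $ 0 = 0" "(fps_X ^ m :: 'a fps) $ 0 = 0"
  using assms by simp_all
 have "(fps_X ^ m :: 'a fps) oo fps_X ^ n = (fps_X ^ m) ^ n"
  using fps_compose_power[OF z(1), of fps_X m] fps_X_fps_compose_startby0[OF z(1)]
  by (simp add: power_mult[symmetric] mult.commute)
 thus ?thesis using fps_compose_assoc[OF z, of s] by simp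
qed

lemma elog_fN: assumes "filt N" "2 <= q" "!!k. N r (ga k)" shows "fN N r (elog q ga)"
proof -
 interpret filt N by fact
 show ?thesis unfolding fN_def elog_nth[OF assms(2)] by (auto intro!: N_sum simp: assms(3) N_0)
qed

lemma elog_diff: "elog q (%k. v k - v' k) = elog q v - elog q v'"
 by (simp add: elog_def fps_eq_iff sum_subtractf)

context lt
begin

sublocale F1: filtq "fN V" q by (rule filtq_fN) unfold_locales
sublocale F2: filtq "fN (fN V)" q by (rule filtq_fN) (rule F1.filtq_axioms)

lemma fN_const: "V r a ==> fN V r (fps_const a)" by (simp add: fN_def)
lemma fN_X: "fN V 0 fps_X" by (simp add: fN_def V_1)
lemma fN_const_mult: "V r a ==> fN V s G ==> t <= r + s ==> fN V t (fps_const a * G)"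
 by (rule F1.N_mult_le[OF fN_const])

lemma Xq_0: "(fps_X ^ q) $ 0 = 0" using q3 by simp
lemma base_sum: "(!!i. i \<in> A ==> f i \<in> base L) ==> sum f A \<in> base L"
 by (induction A rule: infinite_finite_induct) (auto intro: base_0 base_add)
lemma ll_nth_base: "ll 0 $ n \<in> base L"
 unfolding ll_def elog_nth[OF q2] by (intro base_sum) (auto intro: lc_base base_0)
lemma ll_Xq_nth: "(ll 0 oo fps_X ^ q) $ n = (if q dvd n then ll 0 $ (n div q) else 0)"
 using q3 by (intro fps_compose_X_power_nth) auto

definition lcomb :: "'c => 'c => 'c fps" where
 "lcomb w v = fps_const w * ll 0 + fps_const v * (ll 0 oo fps_X ^ q)"

text \<open>The logarithm of \<open>sab w v\<close> is \<open>w f\<^sub>0(X) + v f\<^sub>0(X\<^sup>q)\<close>; its reduction is the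
 endomorphism \<open>w + v\<phi>\<close> of \<open>\<Sigma>\<close>.\<close>

definition sab :: "'c => 'c => 'c fps" where "sab w v = linv 0 oo lcomb w v"

lemma lcomb_0 [simp]: "lcomb w v $ 0 = 0" by (simp add: lcomb_def)
lemma sab_nth_0 [simp]: "sab w v $ 0 = 0" by (simp add: sab_def)
lemma ll_sab: "ll 0 oo sab w v = lcomb w v" by (simp add: sab_def ll_linv_compose)

lemma sab_fmult: "scal 0 a ==> fmult L 0 a = sab a 0" by (simp add: fmult_eq sab_def lcomb_def)
lemma sab_1_0: "sab 1 0 = fps_X" by (simp add: sab_def lcomb_def linv_ll)

lemma lcomb_K: assumes "w \<in> K" "v \<in> K" shows "fR (%z. z \<in> K) (lcomb w v)"
 unfolding fR_def lcomb_def
proof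
 fix n
 have "(ll 0 oo fps_X ^ q) $ n \<in> K"
  unfolding ll_Xq_nth using ll_nth_base K_base K_0 by simp
 thus "(fps_const w * ll 0 + fps_const v * (ll 0 oo fps_X ^ q)) $ n \<in> K"
  using assms ll_nth_base K_base by (simp add: K_add K_mult)
qed

lemma sab_K: assumes "w \<in> K" "v \<in> K" shows "fR (%z. z \<in> K) (sab w v)"
proof (rule frobr.fR_elog_inv[OF frobr_K])
 show "fR (%z. z \<in> K) (elog q (lc 0) oo sab w v)"
  using lcomb_K[OF assms] by (simp add: ll_sab[unfolded ll_def])
qed (auto intro: K_base lc_base base_0)

lemma lubin_tate_K:
 assumes "CHAR('c) = 0" shows "lubin_tate V q (%z. z \<in> K) (%z. z) (inverse \<pi>') (lc 0)"
proof -
 interpret frobr V q "%z. z \<in> K" "%z. z" 2 by (rule frobr_K)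
 show ?thesis
 proof
  show "V (r - 1) (inverse \<pi>' * x)" if "V r x" for r x
   using that V_unif_div[of "r - 1" x] by (simp add: divide_inverse mult.commute)
  show "lc 0 (Suc (Suc k)) = inverse \<pi>' * lc 0 k" for k
   using assms by (simp add: lc_0_SS vp_def divide_inverse)
 qed (auto simp: K_inverse K_unif lc_0_odd)
qed

text \<open>In characteristic 0 the functional equation applies: \<open>lcomb w v\<close> minus 1/pi
  times its twist is w X + v X^q. In equal characteristic the series is [w](X) + [v](X^q), since
  addition is the usual one.\<close>

lemma sab_integral: assumes a: "w \<in> K" "V 0 w" and b: "v \<in> K" "V 0 v"
 shows "fN V 0 (sab w v)"
proof (cases "CHAR('c) = 0")
 case True
 interpret lubin_tate V q "%z. z \<in> K" "%z. z" "inverse \<pi>'" "lc 0" by (rule lubin_tate_K[OF True])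
 have QX: "(fps_X ^ q ^ 2) $ 0 = (0::'c)" using q3 by simp
 have Qp: "0 < q ^ 2" "0 < q" using q3 by simp_all
 have id: "fmap (%z. z) s = s" for s :: "'c fps" by (rule fps_ext) simp
 have f1: "ll 0 = fps_X + fps_const (inverse \<pi>') * (ll 0 oo fps_X ^ q ^ 2)"
  using elog_functional[of fps_X] by (simp add: ll_def)
 have f2: "ll 0 oo fps_X ^ q = fps_X ^ q + fps_const (inverse \<pi>') * ((ll 0 oo fps_X ^ q) oo fps_X ^ q ^ 2)"
  using elog_functional[OF Xq_0] fps_compose_X_powers[of q "q ^ 2" "ll 0"] Qp by (simp add: ll_def)
 have "sigf (lcomb w v) = fps_const w * (ll 0 oo fps_X ^ q ^ 2) + fps_const v * ((ll 0 oo fps_X ^ q) oo fps_X ^ q ^ 2)"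
  unfolding sigf_def id lcomb_def by (simp add: fps_compose_add_distrib fps_compose_mult_distrib[OF QX])
 moreover have "lcomb w v = (fps_const w * fps_X + fps_const v * fps_X ^ q)
   + fps_const (inverse \<pi>') * (fps_const w * (ll 0 oo fps_X ^ q ^ 2) + fps_const v * ((ll 0 oo fps_X ^ q) oo fps_X ^ q ^ 2))"
  unfolding lcomb_def by (subst f1, subst f2) (simp only: distrib_left mult.left_commute add_ac)
 ultimately have eq: "(elog q (lc 0) oo sab w v) - fps_const (inverse \<pi>') * sigf (elog q (lc 0) oo sab w v)
   = fps_const w * fps_X + fps_const v * fps_X ^ q"
  unfolding ll_sab[unfolded ll_def] by (metis add_diff_cancel_right')
 show ?thesis
 proof (rule integral_of_functional_equation)
  show "fN V 0 ((elog q (lc 0) oo sab w v) - fps_const (inverse \<pi>') * sigf (elog q (lc 0) oo sab w v))"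
   unfolding eq using a b by (intro F1.N_add F1.N_mult_left F1.N_power0 fN_const fN_X)
 qed (use sab_K a b in auto)
next
 case False
 have sc: "scal 0 w" "scal 0 v" using a b by (auto simp: scal_def)
 have z: "fmult L 0 w $ 0 = 0" "(fmult L 0 v oo fps_X ^ q) $ 0 = 0"
  using sc by (simp_all add: fmult_nth_0)
 have "ll 0 oo (fmult L 0 w + (fmult L 0 v oo fps_X ^ q)) = (ll 0 oo fmult L 0 w) + (ll 0 oo (fmult L 0 v oo fps_X ^ q))"
  unfolding ll_def by (rule elog_compose_add_char[OF q3 q_odd char_p_binom[OF False] z])
 also have "ll 0 oo (fmult L 0 v oo fps_X ^ q) = (ll 0 oo fmult L 0 v) oo fps_X ^ q"
  by (rule fps_compose_assoc[OF Xq_0]) (simp add: fmult_nth_0 sc)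
 also have "(ll 0 oo fmult L 0 w) + ((ll 0 oo fmult L 0 v) oo fps_X ^ q) = ll 0 oo sab w v"
  by (simp add: ll_fmult sc ll_sab lcomb_def fps_compose_mult_distrib[OF Xq_0])
 finally have "sab w v = fmult L 0 w + (fmult L 0 v oo fps_X ^ q)"
  using ll_inj[of "sab w v" "fmult L 0 w + (fmult L 0 v oo fps_X ^ q)" 0] z by simp
 moreover have "fN V 0 (fmult L 0 w)" "fN V 0 (fmult L 0 v)"
  using sc False by (auto intro!: fmult_integral_char_p)
 ultimately show ?thesis by (auto intro!: F1.N_add fps_compose_integral F1.N_power0 fN_X)
qed

text \<open>The logarithm has coefficients in F, so the Frobenius lift of E acts on the series by
  conjugating w and v.\<close>

lemma sab_frob: assumes a: "w \<in> K" "V 0 w" and b: "v \<in> K" "V 0 v"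
 shows "fN V 1 (sab w v ^ q - (sab (conj w) (conj v) oo fps_X ^ q))"
proof -
 interpret C: frobr V q "%z. z \<in> K" conj 1 by (rule frobr_conj)
 have lk: "lc 0 k \<in> K" "conj (lc 0 k) = lc 0 k" for k by (intro K_base conj_base lc_base base_0)+
 have "fmap conj (lcomb w v) $ n = lcomb (conj w) (conj v) $ n" for n
 proof -
  have "(ll 0 oo fps_X ^ q) $ n \<in> base L"
   unfolding ll_Xq_nth using ll_nth_base base_0 by simp
  thus ?thesis using a b ll_nth_base[of n] by (simp add: lcomb_def K_add K_mult K_base conj_base)
 qed
 hence m: "fmap conj (lcomb w v) = lcomb (conj w) (conj v)" by (rule fps_ext)
 have "ll 0 oo C.sigf (sab w v) = C.sigf (ll 0 oo sab w v)"
  unfolding ll_def using sab_K a b lk by (intro C.sigf_elog[symmetric]) auto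
 also have "... = lcomb (conj w) (conj v) oo fps_X ^ q" unfolding ll_sab C.sigf_def m by simp
 also have "... = ll 0 oo (sab (conj w) (conj v) oo fps_X ^ q)"
  unfolding ll_sab[symmetric] by (rule fps_compose_assoc[symmetric, OF Xq_0]) simp
 finally have "ll 0 oo C.sigf (sab w v) = ll 0 oo (sab (conj w) (conj v) oo fps_X ^ q)" .
 from ll_inj[OF C.sigf_nth_0[OF sab_nth_0] _ this]
 have "C.sigf (sab w v) = sab (conj w) (conj v) oo fps_X ^ q" by simp
 thus ?thesis using C.frob_fps[OF sab_K[OF a(1) b(1)] sab_integral[OF assms]] by simp
qed

lemma ll_X_q2: "ll u oo fps_X ^ q ^ 2 = elog q (%k. if 2 <= k then lc u (k - 2) else 0)"
 using elog_compose_monom[OF q2, of "lc u" 1 2] by (simp add: ll_def cong: if_cong)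

text \<open>The recursion of \<open>lc\<close> up to small terms: multiplication by pi shifts the
  index by 2. On series this says that [pi]_u is close to X^(q^2).\<close>

lemma unif_lc_congruence: assumes u: "V th u" "V r u" "r <= 1"
 shows "V r (\<pi>' * lc u k - (if 2 <= k then lc u (k - 2) else 0))"
proof -
 have ur: "V (r - 1) (u / vp 1)" using u by (simp add: V_vp_div)
 consider "k = 0" | "k = 1" | j where "k = Suc (Suc j)" by (metis One_nat_def not0_implies_Suc)
 thus ?thesis
 proof cases
  case 1
  have "V (r - 1) 1" by (rule N_mono[OF V_1]) (use u in simp)
  hence "V r (\<pi>' * 1)" by (simp only: V_unif_mult)
  thus ?thesis using 1 by simp
 next
  case 2
  have "V r (\<pi>' * (u / vp 1))" using ur by (simp only: V_unif_mult)
  thus ?thesis using 2 by (simp add: lc.simps(2))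
 next
  case (3 j)
  have e: "\<pi>' * lc u k - (if 2 <= k then lc u (k - 2) else 0)
    = (\<pi>' - vp k) * lc u k + lc u (Suc j) * u ^ q ^ Suc j"
   using vp_lc[of j u] by (simp add: 3 algebra_simps)
  show ?thesis unfolding e
  proof (rule N_add)
   show "V r ((\<pi>' - vp k) * lc u k)"
    by (rule N_mult_le[OF V_unif_vp V_lc[OF u(1)]]) (use q_power_ge[of k] u in simp)
   have aux: "r <= - x / 2 + th * y" if "1 + 2 * x <= y" "1 <= x" for x y :: real
    using that u(3) by argo
   have "r <= - real (Suc j) / 2 + th * real (q ^ Suc j)" by (rule aux[OF q_power_ge]) simp
   thus "V r (lc u (Suc j) * u ^ q ^ Suc j)"
    by (rule N_mult_le[OF V_lc[OF u(1)] V_power_disc[OF u(1) order.refl]])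
  qed
 qed
qed

text \<open>The relation phi^2 = pi on the level of quasi-logarithms.\<close>

lemma ll_Xq_Xq: "fN V 1 (((ll 0 oo fps_X ^ q) oo fps_X ^ q) - fps_const \<pi>' * ll 0)"
proof -
 have "(ll 0 oo fps_X ^ q) oo fps_X ^ q = ll 0 oo fps_X ^ q ^ 2"
  using q3 by (subst fps_compose_X_powers) (simp_all add: power_mult[symmetric] power2_eq_square)
 hence "((ll 0 oo fps_X ^ q) oo fps_X ^ q) - fps_const \<pi>' * ll 0
   = elog q (%k. (if 2 <= k then lc 0 (k - 2) else 0) - \<pi>' * lc 0 k)"
  unfolding elog_diff elog_cmult ll_X_q2 by (simp add: ll_def)
 moreover have "V 1 ((if 2 <= k then lc 0 (k - 2) else 0) - \<pi>' * lc 0 k)" for k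
  by (rule N_diff_commute[OF unif_lc_congruence]) simp_all
 ultimately show ?thesis using elog_fN[OF filt_axioms q2, of 1] by simp
qed

lemma V_lc1: "V th u ==> V (- real k) (lc u k)" by (rule N_mono[OF V_lc]) auto

lemma ll_perturb: assumes u: "V th u" and Z: "fN V 0 Z" "Z $ 0 = 0" "Z' $ 0 = 0"
  and E: "fN V th ((ll u oo Z') - (ll u oo Z))" shows "fN V th (Z' - Z)"
proof (rule elog_perturb)
 show "V (- real k / 2) (lc u k)" for k by (rule V_lc[OF u])
 show "fN V th ((elog q (lc u) oo Z') - (elog q (lc u) oo Z))" using E by (simp only: ll_def)
qed (use Z in simp_all)

lemma ll_congruence:
 assumes u: "V th u" and rh: "1 / 2 <= rh" and Z: "fN V 0 Z" "Z $ 0 = 0" "Z' $ 0 = 0"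
  and E: "fN V rh (Z' - Z)" shows "fN V rh ((ll u oo Z') - (ll u oo Z))" unfolding ll_def
proof (rule elog_congruence)
 show "V (- real k) (lc u k)" for k by (rule V_lc1[OF u])
qed (use assms in simp_all)

text \<open>Insert s = \<open>sab w v\<close> into Phi0 f_0(s) + Phi1 f_0(s^q): Frobenius conjugates
  w and v in the second term, and phi^2 = pi folds it back. The outcome is a 2 x 2 matrix in w, v
  and their conjugates acting on the row (Phi0, Phi1).\<close>

lemma ll_sab_approx:
 assumes a: "w \<in> K" "V 0 w" and b: "v \<in> K" "V 0 v" and u: "V th u"
 shows "fN V th ((ll u oo sab w v)
  - lcomb (Phi0 u * w + \<pi>' * Phi1 u * conj v) (Phi0 u * v + Phi1 u * conj w))"
proof -
 define s where "s = sab w v"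
 have s: "fN V 0 s" "s $ 0 = 0" using sab_integral[OF a b] by (simp_all add: s_def)
 have sq0: "(s ^ q) $ 0 = 0" using s q3 by simp
 have c: "conj w \<in> K" "V 0 (conj w)" "conj v \<in> K" "V 0 (conj v)"
  using a b conj_conj V_conj by auto
 have A: "fN V th ((ll u oo s) - (fps_const (Phi0 u) * (ll 0 oo s) + fps_const (Phi1 u) * (ll 0 oo s ^ q)))"
  using ll_approx[OF filtq_axioms, of "%x. x" u s] u s by (simp add: ll_def)
 define t where "t = sab (conj w) (conj v) oo fps_X ^ q"
 have t: "fN V 0 t" "t $ 0 = 0"
  unfolding t_def by (auto intro!: fps_compose_integral sab_integral c F1.N_power0 fN_X)
 have "fN V 1 ((ll 0 oo s ^ q) - (ll 0 oo t))"
  using sab_frob[OF a b] t sq0 by (intro ll_congruence) (simp_all add: s_def t_def)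
 moreover have "ll 0 oo t = fps_const (conj w) * (ll 0 oo fps_X ^ q) + fps_const (conj v) * ((ll 0 oo fps_X ^ q) oo fps_X ^ q)"
  unfolding t_def using fps_compose_assoc[OF Xq_0 sab_nth_0, of "ll 0"]
  by (simp add: ll_sab lcomb_def fps_compose_add_distrib fps_compose_mult_distrib[OF Xq_0])
 ultimately have B: "fN V 1 ((ll 0 oo s ^ q) - (fps_const (conj w) * (ll 0 oo fps_X ^ q) + fps_const (conj v) * ((ll 0 oo fps_X ^ q) oo fps_X ^ q)))"
  by simp
 have C: "fN V 1 (fps_const (conj v) * (((ll 0 oo fps_X ^ q) oo fps_X ^ q) - fps_const \<pi>' * ll 0))"
  by (rule fN_const_mult[OF c(4) ll_Xq_Xq]) simp
 have D: "fN V 1 ((ll 0 oo s ^ q) - (fps_const (conj w) * (ll 0 oo fps_X ^ q) + fps_const (\<pi>' * conj v) * ll 0))"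
  using F1.N_add[OF B C] by (simp add: algebra_simps fps_const_mult[symmetric] del: fps_const_mult)
 \<comment> \<open>Multiplication by Phi1 costs 1/4, so level 1 drops to th.\<close>
 have E: "fN V th (fps_const (Phi1 u) * ((ll 0 oo s ^ q) - (fps_const (conj w) * (ll 0 oo fps_X ^ q) + fps_const (\<pi>' * conj v) * ll 0)))"
  by (rule fN_const_mult[OF V_Phi(4)[OF u] D]) simp
 have eq: "(ll u oo s) - lcomb (Phi0 u * w + \<pi>' * Phi1 u * conj v) (Phi0 u * v + Phi1 u * conj w)
  = ((ll u oo s) - (fps_const (Phi0 u) * (ll 0 oo s) + fps_const (Phi1 u) * (ll 0 oo s ^ q)))
  + fps_const (Phi1 u) * ((ll 0 oo s ^ q) - (fps_const (conj w) * (ll 0 oo fps_X ^ q) + fps_const (\<pi>' * conj v) * ll 0))"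
  by (simp add: s_def ll_sab lcomb_def algebra_simps fps_const_mult[symmetric] fps_const_add[symmetric]
    del: fps_const_mult fps_const_add)
 show ?thesis unfolding s_def[symmetric] eq by (rule F1.N_add[OF A E])
qed

lemma ll_lcomb: assumes u: "V th u" shows "fN V th (ll u - lcomb (Phi0 u) (Phi1 u))"
 using ll_sab_approx[OF K_1 V_1 K_0 V_0 u] conj_base[OF base_0] conj_base[OF base_1] by (simp add: sab_1_0)
lemma lcomb_cmult: "fps_const c * lcomb w v = lcomb (c * w) (c * v)"
 by (simp add: lcomb_def algebra_simps fps_const_mult[symmetric] del: fps_const_mult)

lemma fmult_integral: assumes u: "V th u" and a: "a \<in> base L" "V 0 a"
 shows "fN V th (fmult L u a - sab a 0)" "fN V 0 (fmult L u a)"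
proof -
 have sc: "scal u a" using a by (simp add: scal_def)
 have A: "fN V th ((ll u oo sab a 0) - lcomb (a * Phi0 u) (a * Phi1 u))"
  using ll_sab_approx[OF K_base[OF a(1)] a(2) K_0 V_0 u] conj_base[OF base_0] conj_base[OF a(1)]
  by (simp add: mult.commute[of a])
 have B: "fN V th (fps_const a * (ll u - lcomb (Phi0 u) (Phi1 u)))"
  by (rule fN_const_mult[OF a(2) ll_lcomb[OF u]]) simp
 have eq: "(ll u oo fmult L u a) - (ll u oo sab a 0)
   = fps_const a * (ll u - lcomb (Phi0 u) (Phi1 u)) - ((ll u oo sab a 0) - lcomb (a * Phi0 u) (a * Phi1 u))"
  by (simp add: ll_fmult[OF sc] lcomb_cmult right_diff_distrib)
 have i: "fN V 0 (sab a 0)" by (rule sab_integral[OF K_base[OF a(1)] a(2) K_0 V_0])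
 have "fN V th ((ll u oo fmult L u a) - (ll u oo sab a 0))" unfolding eq by (rule F1.N_diff[OF B A])
 thus 1: "fN V th (fmult L u a - sab a 0)" by (rule ll_perturb[OF u i sab_nth_0 fmult_nth_0[OF sc]])
 have "fN V 0 (fmult L u a - sab a 0)" by (rule F1.N_mono[OF 1]) simp
 from F1.N_add[OF this i] show "fN V 0 (fmult L u a)" by simp
qed

lemma scal_unif: "scal u \<pi>'" by (simp add: scal_def unif_base V_def val_unif)

lemma fmult_unif: assumes u: "V th u" shows "fN V th (fmult L u \<pi>' - fps_X ^ q ^ 2)"
proof (rule ll_perturb[OF u])
 show "(fps_X ^ q ^ 2) $ 0 = (0::'c)" using q3 by simp
 have "(ll u oo fmult L u \<pi>') - (ll u oo fps_X ^ q ^ 2)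
   = elog q (%k. \<pi>' * lc u k - (if 2 <= k then lc u (k - 2) else 0))"
  unfolding elog_diff elog_cmult ll_X_q2 ll_fmult[OF scal_unif] by (simp add: ll_def)
 moreover have "V th (\<pi>' * lc u k - (if 2 <= k then lc u (k - 2) else 0))" for k
  by (rule unif_lc_congruence) (use u in simp_all)
 ultimately show "fN V th ((ll u oo fmult L u \<pi>') - (ll u oo fps_X ^ q ^ 2))"
  using elog_fN[OF filt_axioms q2, of th] by simp
qed (auto simp: fmult_nth_0[OF scal_unif] intro: F1.N_power0 fN_X)

subsection \<open>Integrality of the formal group law\<close>

definition gX :: "'c fps fps" where "gX = diagT (in_X fps_X)"
definition gY :: "'c fps fps" where "gY = diagT (in_Y fps_X)"

lemma gXY_0: "gX $ 0 = 0" "gY $ 0 = 0" by (simp_all add: gX_def gY_def diagT_nth_0 in_X_def)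
lemma gXY_integral: "fN (fN V) 0 gX" "fN (fN V) 0 gY" by (auto simp: gX_def gY_def fN_diagT[OF filt_axioms])
  (auto simp: fN_def in_X_def fps_X_def V_1)
lemma gXY_R: "R 0 ==> R 1 ==> fR (fR R) gX & fR (fR R) gY"
 by (auto simp: gX_def gY_def fR_def diagT_nth in_X_def)

abbreviation El :: "'c => 'c fps fps" where "El u \<equiv> elog q (%k. fps_const (lc u k))"

lemma El_eq: "El u = in_Y (ll u)" by (simp add: ll_def in_Y_elog)

lemma El_fadd: "El u oo diagT (fadd L u) = (El u oo gX) + (El u oo gY)"
proof -
 have "El u oo diagT (fadd L u) = diagT (subst1 (ll u) (fadd L u))" by (simp add: El_eq diagT_subst1)
 also have "... = diagT (subst1 (ll u) (in_X fps_X)) + diagT (subst1 (ll u) (in_Y fps_X))"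
  by (simp add: ll_fadd diagT_add subst1_in_X subst1_in_Y)
 finally show ?thesis by (simp add: diagT_subst1 El_eq gX_def gY_def)
qed

lemma diagT_fadd_0: "diagT (fadd L u) $ 0 = 0" by (rule diagT_nth_0[OF fadd_nth_0])

text \<open>R is a parameter since two cases occur: E with m = 2 for integrality, F with m = 1 for
  the Frobenius congruence.\<close>

lemma fadd_0_R:
 assumes "frobr V q R (%z. z) m" "!!k. R (lc 0 k)" shows "fR (fR R) (diagT (fadd L 0))"
proof -
 interpret A: frobr V q R "%z. z" m by fact
 interpret B: frobr "fN V" q "fR R" A.sigf m by (rule A.frobr_fps)
 have c: "fR R (fps_const (lc 0 k))" for k using assms(2) by (simp add: fR_def A.R_0)
 have g: "fR (fR R) gX" "fR (fR R) gY" using gXY_R[of R] A.R_0 A.R_1 by blast+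
 have add: "fR (fR R) (x + y)" if "fR (fR R) x" "fR (fR R) y" for x y using that by (simp add: fR_def A.R_add)
 have "fR (fR R) (El 0 oo diagT (fadd L 0))" unfolding El_fadd by (intro add B.fR_elog c g gXY_0)
 thus ?thesis
  by (rule B.fR_elog_inv[where v = "%k. fps_const (lc 0 k)", rotated 3]) (simp_all add: c diagT_fadd_0)
qed

text \<open>The functional equation is additive and holds for X and Y, hence for the logarithm of
  the group law; its converse over the ring of series gives integrality. In equal characteristic the
  law is X + Y.\<close>

lemma fadd_0_integral: "fN (fN V) 0 (diagT (fadd L 0))"
proof (cases "CHAR('c) = 0")
 case True
 interpret A: lubin_tate V q "%z. z \<in> K" "%z. z" "inverse \<pi>'" "lc 0" by (rule lubin_tate_K[OF True])
 interpret B: frobr "fN V" q "fR (%z. z \<in> K)" A.sigf 2 by (rule A.frobr_fps)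
 have sc: "A.sigf (fps_const a) = fps_const a" for a by (rule fps_ext) (auto simp: A.sigf_nth dvd_div_eq_0_iff)
 interpret lubin_tate "fN V" q "fR (%z. z \<in> K)" A.sigf "fps_const (inverse \<pi>')" "%k. fps_const (lc 0 k)"
 proof
  show "fN V (r - 1) (fps_const (inverse \<pi>') * x)" if "fN V r x" for r x
   using that A.N_io by (simp add: fN_def)
 qed (auto simp: fR_def A.R_0 A.R_io A.v_1 A.v_SS sc)
 have lcK: "lc 0 k \<in> K" for k by (intro K_base lc_base base_0)
 have c: "fR (%z. z \<in> K) (fps_const (lc 0 k))" for k using lcK by (simp add: fR_def K_0)
 have g: "fR (fR (%z. z \<in> K)) gX" "fR (fR (%z. z \<in> K)) gY" using gXY_R[of "%z. z \<in> K"] K_0 K_1 by blast+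
 have Eg: "fR (fR (%z. z \<in> K)) (El 0 oo gX)" "fR (fR (%z. z \<in> K)) (El 0 oo gY)"
  by (intro B.fR_elog c g gXY_0)+
 show ?thesis
 proof (rule integral_of_functional_equation)
  show "fR (fR (%z. z \<in> K)) (diagT (fadd L 0))" by (rule fadd_0_R[OF frobr_K lcK])
  show "diagT (fadd L 0) $ 0 = 0" by (rule diagT_fadd_0)
  have "B.sigf ((El 0 oo gX) + (El 0 oo gY)) = B.sigf (El 0 oo gX) + B.sigf (El 0 oo gY)"
   by (rule B.sigf_add[OF Eg])
  hence "(El 0 oo diagT (fadd L 0)) - fps_const (fps_const (inverse \<pi>')) * B.sigf (El 0 oo diagT (fadd L 0))
   = ((El 0 oo gX) - fps_const (fps_const (inverse \<pi>')) * B.sigf (El 0 oo gX))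
    + ((El 0 oo gY) - fps_const (fps_const (inverse \<pi>')) * B.sigf (El 0 oo gY))"
   unfolding El_fadd by (simp add: algebra_simps)
  thus "fN (fN V) 0 ((El 0 oo diagT (fadd L 0)) - fps_const (fps_const (inverse \<pi>')) * B.sigf (El 0 oo diagT (fadd L 0)))"
   using functional_equation_integral[OF g(1) gXY_integral(1) gXY_0(1)]
    functional_equation_integral[OF g(2) gXY_integral(2) gXY_0(2)] F2.N_add by simp
 qed
next
 case False
 hence "diagT (fadd L 0) = gX + gY" by (simp add: fadd_def gX_def gY_def diagT_add)
 thus ?thesis using F2.N_add[OF gXY_integral] by simp
qed

lemma El_frob: fixes R :: "'c => bool"
 assumes A: "frobr V q R (%z. z) 1" and R: "!!k. R (lc 0 k)"
  and g: "fR (fR R) g" "fN (fN V) 0 g" "g $ 0 = 0"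
 shows "fN (fN V) 1 ((El 0 oo g ^ q) - frobr.sigf q (frobr.sigf q (%z. z) 1) 1 (El 0 oo g))"
proof -
 interpret A: frobr V q R "%z. z" 1 by fact
 interpret B: frobr "fN V" q "fR R" A.sigf 1 by (rule A.frobr_fps)
 have c: "fR R (fps_const (lc 0 k))" for k using R by (simp add: fR_def A.R_0)
 have sc: "A.sigf (fps_const a) = fps_const a" for a
  by (rule fps_ext) (unfold A.sigf_nth, use q3 in \<open>auto simp: dvd_div_eq_0_iff\<close>)
 have "B.sigf (El 0 oo g) = El 0 oo B.sigf g" by (rule B.sigf_elog) (use c sc g in auto)
 moreover have "fN (fN V) 1 ((El 0 oo g ^ q) - (El 0 oo B.sigf g))"
 proof (rule F1.elog_congruence)
  show "fN V (- real k) (fps_const (lc 0 k))" for k by (intro fN_const V_lc1) simp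
  show d: "fN (fN V) 1 (g ^ q - B.sigf g)" using B.frob_fps[OF g(1,2)] by simp
  have "fN (fN V) 0 (g ^ q - B.sigf g)" by (rule F2.N_mono[OF d]) simp
  from F2.N_diff[OF F2.N_power0[OF g(2), of q] this] show "fN (fN V) 0 (B.sigf g)" by simp
  show "(B.sigf g) $ 0 = 0" by (rule B.sigf_nth_0) fact
  show "(g ^ q) $ 0 = 0" using g q3 by simp
 qed simp
 ultimately show ?thesis by simp
qed

text \<open>f_0(X^q) is additive modulo pi: over F the q-th power is congruent to a Frobenius twist,
  and the twist respects sums of logarithms.\<close>

lemma El_fadd_q: "fN (fN V) 1 ((El 0 oo diagT (fadd L 0) ^ q) - ((El 0 oo gX ^ q) + (El 0 oo gY ^ q)))"
proof -
 define Z where "Z = diagT (fadd L 0)"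
 interpret A: frobr V q "%z. z \<in> base L" "%z. z" 1 by (rule frobr_base)
 interpret B: frobr "fN V" q "fR (%z. z \<in> base L)" A.sigf 1 by (rule A.frobr_fps)
 have lcb: "lc 0 k \<in> base L" for k by (intro lc_base base_0)
 have c: "fR (%z. z \<in> base L) (fps_const (lc 0 k))" for k using lcb by (simp add: fR_def base_0)
 have ZR: "fR (fR (%z. z \<in> base L)) Z" unfolding Z_def by (rule fadd_0_R[OF frobr_base lcb])
 have g: "fR (fR (%z. z \<in> base L)) gX" "fR (fR (%z. z \<in> base L)) gY"
  using gXY_R[of "%z. z \<in> base L"] base_0 base_1 by blast+
 have Eg: "fR (fR (%z. z \<in> base L)) (El 0 oo gX)" "fR (fR (%z. z \<in> base L)) (El 0 oo gY)"
  by (intro B.fR_elog c g gXY_0)+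
 have EZ: "El 0 oo Z = (El 0 oo gX) + (El 0 oo gY)" unfolding Z_def by (rule El_fadd)
 note fr = El_frob[OF frobr_base lcb]
 have Z: "fN (fN V) 0 Z" "Z $ 0 = 0" using fadd_0_integral diagT_fadd_0 by (auto simp: Z_def)
 have "fN (fN V) 1 (((El 0 oo gX ^ q) - B.sigf (El 0 oo gX)) + ((El 0 oo gY ^ q) - B.sigf (El 0 oo gY)))"
  by (intro F2.N_add fr g gXY_integral gXY_0)
 from F2.N_diff[OF fr[OF ZR Z] this]
 show ?thesis unfolding EZ B.sigf_add[OF Eg] Z_def[symmetric] by (simp add: algebra_simps)
qed

text \<open>On the law at u = 0 the series f_0(X) is additive, f_0(X^q) is so modulo pi, and the
  factor Phi1 costs 1/4. Hence the law at u differs from the law at 0 only at level th.\<close>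

lemma fadd_integral: assumes u: "V th u" shows "fN (fN V) 0 (fadd L u)"
proof -
 define Z where "Z = diagT (fadd L 0)"
 have Z: "fN (fN V) 0 Z" "Z $ 0 = 0" using fadd_0_integral diagT_fadd_0 by (auto simp: Z_def)
 have EZ: "El 0 oo Z = (El 0 oo gX) + (El 0 oo gY)" unfolding Z_def by (rule El_fadd)
 note q1 = El_fadd_q[folded Z_def]
 have ap: "fN (fN V) th ((El u oo W) - (fps_const (fps_const (Phi0 u)) * (El 0 oo W)
   + fps_const (fps_const (Phi1 u)) * (El 0 oo W ^ q)))" if "fN (fN V) 0 W" "W $ 0 = 0" for W
  by (rule ll_approx[OF F1.filtq_axioms _ _ _ u that]) (auto intro: fN_const)
 have P: "fN V (- 1/4) (fps_const (Phi1 u))" by (rule fN_const[OF V_Phi(4)[OF u]])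
 have P2: "fN (fN V) (- 1/4) (fps_const (fps_const (Phi1 u)))" using P by (simp add: fN_def)
 have q2: "fN (fN V) th (fps_const (fps_const (Phi1 u)) * ((El 0 oo Z ^ q) - ((El 0 oo gX ^ q) + (El 0 oo gY ^ q))))"
  by (rule F2.N_mult_le[OF P2 q1]) simp
 have alg: "((eX - (a * x + b * xq)) + (eY - (a * y + b * yq))) - (eZ - (a * (x + y) + b * zq)) - b * (zq - (xq + yq))
   = (eX + eY) - eZ" for eX eY eZ a b x y xq yq zq :: "'c fps fps" by (simp add: algebra_simps)
 note F = F2.N_diff[OF F2.N_diff[OF F2.N_add[OF ap[OF gXY_integral(1) gXY_0(1)] ap[OF gXY_integral(2) gXY_0(2)]] ap[OF Z]] q2]
 have E: "fN (fN V) th ((El u oo diagT (fadd L u)) - (El u oo Z))" using F unfolding El_fadd EZ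
   alg[where eX = "El u oo gX" and eY = "El u oo gY" and eZ = "El u oo Z" and x = "El 0 oo gX"
    and y = "El 0 oo gY" and xq = "El 0 oo gX ^ q" and yq = "El 0 oo gY ^ q" and zq = "El 0 oo Z ^ q"
    and a = "fps_const (fps_const (Phi0 u))" and b = "fps_const (fps_const (Phi1 u))"] .
 have d: "fN (fN V) th (diagT (fadd L u) - Z)"
 proof (rule F1.elog_perturb[OF _ _ _ _ _ _ E])
  show "fN V (- real k / 2) (fps_const (lc u k))" for k by (rule fN_const[OF V_lc[OF u]])
 qed (simp_all add: Z diagT_fadd_0)
 have "fN (fN V) 0 (diagT (fadd L u) - Z)" by (rule F2.N_mono[OF d]) simp
 from F2.N_add[OF this Z(1)] show ?thesis by (simp add: fN_diagT[OF filt_axioms])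
qed

end

context lt
begin

subsection \<open>Homomorphisms\<close>

lemma subst1_ll_inj: assumes z: "(A $ 0) $ 0 = 0" "(B $ 0) $ 0 = 0" and e: "subst1 (ll u) A = subst1 (ll u) B"
 shows "A = B"
proof -
 have "subst1 (linv u) (subst1 (ll u) A) = subst1 (linv u) (subst1 (ll u) B)" using e by simp
 thus ?thesis using subst1_subst1[OF ll_nth_0 z(1)] subst1_subst1[OF ll_nth_0 z(2)]
  by (simp add: linv_ll subst1_X z)
qed

lemma hom_of_log: assumes h: "h $ 0 = 0" and e: "ll u' oo h = fps_const c * ll u"
 shows "formal_hom (OF_ring L) (fadd L u) (fmult L u) (fadd L u') (fmult L u') h" unfolding formal_hom_def
proof (intro conjI ballI)
 show "h $ 0 = 0" by fact
 show "subst1 h (fadd L u) = subst2 (fadd L u') h h"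
 proof (rule subst1_ll_inj[of _ _ u'])
  have "subst1 (ll u') (subst1 h (fadd L u)) = subst1 (fps_const c * ll u) (fadd L u)"
   by (simp add: subst1_subst1 h fadd_nth_0 e)
  also have "... = fps_const (fps_const c) * subst1 (ll u) (fadd L u)"
   by (intro fps_ext) (simp add: subst1_nth sum_distrib_left mult.assoc)
  also have "... = in_X (fps_const c * ll u) + in_Y (fps_const c * ll u)"
   by (intro fps_ext) (simp add: ll_fadd in_X_def distrib_left)
  also have "... = subst2 (in_X (ll u') + in_Y (ll u')) h h"
   by (simp add: subst2_add subst2_in_X subst2_in_Y e)
  also have "... = subst1 (ll u') (subst2 (fadd L u') h h)"
   by (simp add: subst1_subst2 h fadd_nth_0 ll_fadd)
  finally show "subst1 (ll u') (subst1 h (fadd L u)) = subst1 (ll u') (subst2 (fadd L u') h h)" .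
 qed (simp_all add: subst1_nth_0 subst2_nth_0 h fadd_nth_0)
 fix a assume "a \<in> OF_ring L"
 hence sc: "scal v a" for v by (simp add: scal_def OF_iff)
 have z: "fmult L v a $ 0 = 0" for v by (rule fmult_nth_0[OF sc])
 show "h oo fmult L u a = fmult L u' a oo h"
 proof (rule ll_inj[of _ _ u'])
  have "ll u' oo (h oo fmult L u a) = (ll u' oo h) oo fmult L u a" by (rule fps_compose_assoc[OF z h])
  also have "... = fps_const c * (fps_const a * ll u)"
   by (simp add: e fps_compose_mult_distrib[OF z] ll_fmult[OF sc])
  also have "... = (ll u' oo fmult L u' a) oo h"
   by (simp add: ll_fmult[OF sc] fps_compose_mult_distrib[OF h] e)
  also have "... = ll u' oo (fmult L u' a oo h)" by (rule fps_compose_assoc[OF h z, symmetric])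
  finally show "ll u' oo (h oo fmult L u a) = ll u' oo (fmult L u' a oo h)" .
 qed (simp_all add: h z)
qed

text \<open>The defect D satisfies D o [pi] = pi D and has no terms of degree 0 and 1; a first
  nonzero coefficient in degree n would give pi^n = pi.\<close>

lemma log_of_hom: assumes h0: "h $ 0 = 0" and comm: "h oo fmult L u \<pi>' = fmult L u' \<pi>' oo h"
 shows "ll u' oo h = fps_const (h $ 1) * ll u"
proof -
 define P where "P = fmult L u \<pi>'"
 have P0: "P $ 0 = 0" using fmult_nth_0[OF scal_unif] by (simp add: P_def)
 have LP: "ll u oo P = fps_const \<pi>' * ll u" unfolding P_def by (rule ll_fmult[OF scal_unif])
 have "(ll u oo P) $ 1 = P $ 1"
  using P0 elog_compose_nth'[OF q2 P0, of "lc u" 1] fps_power_nth_cong[of 1 P 0 q] q3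
  by (simp add: ll_def zero_power)
 hence P1: "P $ 1 = \<pi>'" using LP by simp
 define D where "D = (ll u' oo h) - fps_const (h $ 1) * ll u"
 have "(ll u' oo h) oo P = ll u' oo (h oo P)" by (rule fps_compose_assoc[OF P0 h0, symmetric])
 also have "... = (ll u' oo fmult L u' \<pi>') oo h"
  using comm by (simp add: P_def fps_compose_assoc[OF h0 fmult_nth_0[OF scal_unif]])
 also have "... = fps_const \<pi>' * (ll u' oo h)"
  by (simp add: ll_fmult[OF scal_unif] fps_compose_mult_distrib[OF h0])
 finally have DP: "D oo P = fps_const \<pi>' * D"
  by (simp add: D_def fps_compose_sub_distrib fps_compose_mult_distrib[OF P0] LP right_diff_distrib)
 have "(ll u' oo h) $ 1 = h $ 1"
  using elog_compose_nth'[OF q2 h0, of "lc u'" 1] fps_power_nth_cong[of 1 h 0 q] h0 q3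
  by (simp add: ll_def zero_power)
 hence D01: "D $ 0 = 0" "D $ 1 = 0" by (simp_all add: D_def)
 have "D $ n = 0" for n
 proof (induction n rule: less_induct)
  case (less n)
  show ?case
  proof (cases "n <= 1")
   case True
   hence "n = 0 | n = 1" by auto
   thus ?thesis using D01 by auto
  next
   case False
   have "(D oo P) $ n = (\<Sum>i\<in>{n}. D $ i * (P ^ i) $ n)"
    unfolding fps_compose_nth using less by (intro sum.mono_neutral_right) auto
   hence "D $ n * \<pi>' ^ n = \<pi>' * D $ n"
    using DP P1 startsby_zero_power_nth_same[OF P0, of n] by auto
   moreover have "\<pi>' ^ n ~= \<pi>'"
   proof
    assume "\<pi>' ^ n = \<pi>'"
    hence "ereal (real n) = 1" using val_unif_power[of n] val_unif by simp
    hence "real n = 1" by (metis ereal.inject one_ereal_def)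
    thus False using False by simp
   qed
   ultimately show ?thesis by (metis mult.commute mult_left_cancel)
  qed
 qed
 hence "D = 0" by (intro fps_ext) simp
 thus ?thesis by (simp add: D_def)
qed

lemma compose_congruence: assumes s: "fN V 0 s" and A: "fN V 0 A" and B: "fN V 0 B" and AB: "fN V r (A - B)"
 shows "fN V r ((s oo A) - (s oo B))"
proof -
 have "fN V r (A ^ i - B ^ i)" for i by (rule F1.N_power_diff[OF A B AB])
 hence "V r (\<Sum>i=0..n. s $ i * (A ^ i - B ^ i) $ n)" for n
  using s unfolding fN_def by (intro N_sum N_mult_left) blast+
 thus ?thesis by (simp add: fN_def fps_compose_nth right_diff_distrib sum_subtractf)
qed

lemma compose_congruence_left: assumes s: "fN V r (s - t)" and A: "fN V 0 A"
 shows "fN V r ((s oo A) - (t oo A))"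
proof -
 have "V r (\<Sum>i=0..n. (s - t) $ i * (A ^ i) $ n)" for n
  using s F1.N_power0[OF A] unfolding fN_def by (intro N_sum N_mult_right) blast+
 thus ?thesis by (simp add: fN_def fps_compose_nth left_diff_distrib sum_subtractf)
qed

lemma inverse_integral: assumes h: "fN V 0 h" "h $ 0 = 0" "val L (h $ 1) = 0"
  and g: "g $ 0 = 0" "h oo g = fps_X" shows "fN V 0 g"
proof -
 have "V 0 (g $ n)" for n
 proof (induction n rule: less_induct)
  case (less n)
  show ?case
  proof (cases "n = 0")
   case False
   have c: "fN V 0 (fps_cutoff n g)" using less by (simp add: fN_def)
   have e: "(g ^ k) $ n = (fps_cutoff n g ^ k) $ n" if "2 <= k" for k
    by (rule fps_power_nth_cong) (use that g in auto)
   have "(h oo g) $ n = (\<Sum>i\<in>{1..n}. h $ i * (g ^ i) $ n)"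
    unfolding fps_compose_nth using h(2) by (intro sum.mono_neutral_right) (auto simp: not_le)
   also have "... = h $ 1 * g $ n + (\<Sum>i\<in>{2..n}. h $ i * (g ^ i) $ n)"
   proof -
    have "{1..n} = insert 1 {2..n}" using False by auto
    thus ?thesis by simp
   qed
   also have "(\<Sum>i\<in>{2..n}. h $ i * (g ^ i) $ n) = (\<Sum>i\<in>{2..n}. h $ i * (fps_cutoff n g ^ i) $ n)"
    by (intro sum.cong) (auto simp: e)
   finally have "h $ 1 * g $ n
     = fps_X $ n - (\<Sum>i\<in>{2..n}. h $ i * (fps_cutoff n g ^ i) $ n)" using g(2) by simp
   moreover have "V 0 ..."
    using h(1) F1.N_power0[OF c] fN_X unfolding fN_def by (intro N_diff N_sum N_mult_left) blast+
   ultimately show ?thesis using V_mult_unit[OF h(3)] by metis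
  qed (simp add: g)
 qed
 thus ?thesis by (simp add: fN_def)
qed

lemma iso_of_log:
 assumes h: "fN V 0 h" "h $ 0 = 0" and e: "ll u' oo h = fps_const c * ll u" and c: "val L c = 0"
 shows "OC_iso L u u' h"
  and "\<exists>g. fN V 0 g & g $ 0 = 0 & ll u oo g = fps_const (inverse c) * ll u' & h oo g = fps_X & g oo h = fps_X"
proof -
 have cn: "c ~= 0" using c by auto
 define g where "g = linv u oo (fps_const (inverse c) * ll u')"
 have g0: "g $ 0 = 0" by (simp add: g_def)
 have lg: "ll u oo g = fps_const (inverse c) * ll u'" by (simp add: g_def ll_linv_compose)
 have "ll u' oo (h oo g) = (ll u' oo h) oo g" by (rule fps_compose_assoc[OF g0 h(2)])
 also have "... = ll u' oo fps_X" using cn by (simp add: e fps_compose_mult_distrib[OF g0] lg)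
 finally have e1: "ll u' oo (h oo g) = ll u' oo fps_X" .
 have hg: "h oo g = fps_X" by (rule ll_inj[OF _ _ e1]) (simp_all add: h g0)
 have "ll u oo (g oo h) = (ll u oo g) oo h" by (rule fps_compose_assoc[OF h(2) g0])
 also have "... = ll u oo fps_X" using cn by (simp add: lg fps_compose_mult_distrib[OF h(2)] e)
 finally have e2: "ll u oo (g oo h) = ll u oo fps_X" .
 have gh: "g oo h = fps_X" by (rule ll_inj[OF _ _ e2]) (simp_all add: h g0)
 have "(ll u' oo h) $ 1 = h $ 1"
  using elog_compose_nth'[OF q2 h(2), of "lc u'" 1] fps_power_nth_cong[of 1 h 0 q] h q3
  by (simp add: ll_def zero_power)
 hence h1: "h $ 1 = c" using e by simp
 have gi: "fN V 0 g" by (rule inverse_integral[OF h _ g0 hg]) (simp only: h1 c)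
 have "OC_hom L u u' h" unfolding OC_hom_def OC_iff using h(1)[unfolded fN_def] hom_of_log[OF h(2) e] by (rule conjI)
 moreover have "OC_hom L u' u g" unfolding OC_hom_def OC_iff using gi[unfolded fN_def] hom_of_log[OF g0 lg] by (rule conjI)
 ultimately show "OC_iso L u u' h" unfolding OC_iso_def using hg gh by blast
 show "\<exists>g. fN V 0 g & g $ 0 = 0 & ll u oo g = fps_const (inverse c) * ll u' & h oo g = fps_X & g oo h = fps_X"
  using gi g0 lg hg gh by blast
qed

subsection \<open>Lifting an automorphism of the reduction\<close>

text \<open>By \<open>ll_sab_approx\<close> the logarithm of \<open>sab w v\<close> at u' has
  coordinates (Phi0' w + pi Phi1' conj v, Phi0' v + Phi1' conj w). \<open>Th\<close> is the value of
  Phi1'/Phi0' that makes them proportional to (Phi0 u, Phi1 u), and \<open>cnew\<close> is the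
  factor.\<close>

definition Th :: "'c => 'c => 'c => 'c" where
 "Th w v u = (w * Phi1 u - v * Phi0 u) / (conj w * Phi0 u - \<pi>' * conj v * Phi1 u)"

definition unew :: "'c => 'c => 'c => 'c" where "unew w v u = usol (Th w v u)"

definition cnew :: "'c => 'c => 'c => 'c" where
 "cnew w v u = (Phi0 (unew w v u) * w + \<pi>' * Phi1 (unew w v u) * conj v) / Phi0 u"

definition hnew :: "'c => 'c => 'c => 'c fps" where
 "hnew w v u = linv (unew w v u) oo (fps_const (cnew w v u) * ll u)"

context
 fixes w v u :: 'c
 assumes a: "w \<in> K" "V 0 w" "rd w ~= 0" and b: "v \<in> K" "V 0 v" and u: "V th u"
begin

lemma V_pi_Phi1: assumes "V th z" "V 0 x" shows "V th (\<pi>' * x * Phi1 z)"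
proof -
 have "V (- 1/4) (x * Phi1 z)" using assms V_Phi(4) by (intro N_mult_left) auto
 hence "V th (\<pi>' * (x * Phi1 z))" unfolding V_unif_mult by simp
 thus ?thesis by (simp only: mult.assoc)
qed

lemma unit_plus_small: assumes "val L x = 0" "V th y" shows "val L (x + y) = 0"
proof -
 have "V 0 y" by (rule N_mono[OF assms(2)]) simp
 moreover have "rd y = 0" using rd_0I[OF assms(2)] by simp
 ultimately show ?thesis using assms(1) val_unit_iff by (simp add: rd_add N_add)
qed

lemma conj_unit: "V 0 (conj w)" "V 0 (conj v)" "val L (conj w) = 0" "val L w = 0"
proof -
 show c: "V 0 (conj w)" "V 0 (conj v)" using a b V_conj by blast+
 have "rd (conj w) ~= 0" using rd_conj[OF a(1,2)] a(3) by simp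
 thus "val L (conj w) = 0" "val L w = 0" using a c val_unit_iff by auto
qed

lemma Th_den_unit: "val L (conj w * Phi0 u - \<pi>' * conj v * Phi1 u) = 0"
 using unit_plus_small[OF val_mult_unit[OF conj_unit(3) V_Phi(5)[OF u]] N_uminus[OF V_pi_Phi1[OF u conj_unit(2)]]]
 by simp

lemma V_Th: "V (- 1/4) (Th w v u)"
proof -
 have "V (- 1/4) (w * Phi1 u)" using a V_Phi(4)[OF u] by (intro N_mult_left)
 moreover have "V (- 1/4) (v * Phi0 u)" using N_mult_left[OF b(2) V_Phi(3)[OF u]] by (rule N_mono) simp
 ultimately have "V (- 1/4) (w * Phi1 u - v * Phi0 u)" by (rule N_diff)
 moreover have "val L (conj w * Phi0 u - \<pi>' * conj v * Phi1 u) = ereal 0" using Th_den_unit by simp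
 ultimately show ?thesis unfolding Th_def using V_divide_iff by (metis add.right_neutral)
qed

lemma V_unew: "V th (unew w v u)" unfolding unew_def by (rule usol(3)[OF V_Th])

lemma cnew_unit: "val L (cnew w v u) = 0"
proof -
 have "val L (Phi0 (unew w v u) * w + \<pi>' * conj v * Phi1 (unew w v u)) = 0"
  by (intro unit_plus_small val_mult_unit V_Phi(5) V_unew conj_unit V_pi_Phi1)
 hence "val L ((Phi0 (unew w v u) * w + \<pi>' * conj v * Phi1 (unew w v u)) * inverse (Phi0 u)) = 0"
  using val_inverse_unit[OF V_Phi(5)[OF u]] by (rule val_mult_unit)
 thus ?thesis by (simp add: cnew_def divide_inverse mult.assoc mult.commute[of "conj v"])
qed

lemma hnew_0: "hnew w v u $ 0 = 0" by (simp add: hnew_def)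
lemma ll_hnew: "ll (unew w v u) oo hnew w v u = fps_const (cnew w v u) * ll u"
 by (simp add: hnew_def ll_linv_compose)

lemma hnew_approx: "fN V th (hnew w v u - sab w v)"
proof -
 define u' where "u' = unew w v u"
 define T where "T = Th w v u"
 define c where "c = cnew w v u"
 define D where "D = conj w * Phi0 u - \<pi>' * conj v * Phi1 u"
 have Dn: "D ~= 0" using Th_den_unit unfolding D_def by auto
 have Pn: "Phi0 u ~= 0" using V_Phi(5)[OF u] by auto
 have T: "Phi1 u' = T * Phi0 u'" unfolding u'_def unew_def T_def by (rule usol(4)[OF V_Th])
 have TD: "T * D = w * Phi1 u - v * Phi0 u" using Dn by (simp add: T_def Th_def D_def)
 have c0: "c * Phi0 u = Phi0 u' * w + \<pi>' * Phi1 u' * conj v"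
  using Pn by (simp add: c_def cnew_def u'_def)
 \<comment> \<open>The first coordinates match by the choice of \<open>cnew\<close>; the Moebius
   equation for T yields the second.\<close>
 have "Phi0 u * (c * Phi1 u) = Phi1 u * (Phi0 u' * w + \<pi>' * Phi1 u' * conj v)"
  unfolding c0[symmetric] by simp
 also have "... = Phi0 u' * (w * Phi1 u + T * (\<pi>' * conj v * Phi1 u))" by (simp add: T algebra_simps)
 also have "w * Phi1 u + T * (\<pi>' * conj v * Phi1 u) = v * Phi0 u + T * (conj w * Phi0 u)"
  using TD by (simp add: D_def algebra_simps)
 also have "Phi0 u' * ... = Phi0 u * (Phi0 u' * v + Phi1 u' * conj w)" by (simp add: T algebra_simps)
 finally have c1: "c * Phi1 u = Phi0 u' * v + Phi1 u' * conj w" using Pn by simp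
 have cV: "V 0 c" using cnew_unit val_unit_iff unfolding c_def by blast
 have A: "fN V th (fps_const c * (ll u - lcomb (Phi0 u) (Phi1 u)))"
  by (rule fN_const_mult[OF cV ll_lcomb[OF u]]) simp
 have B: "fN V th ((ll u' oo sab w v) - lcomb (c * Phi0 u) (c * Phi1 u))"
  unfolding c0 c1 using V_unew unfolding u'_def by (intro ll_sab_approx a b)
 have eq: "(ll u' oo hnew w v u) - (ll u' oo sab w v)
  = fps_const c * (ll u - lcomb (Phi0 u) (Phi1 u)) - ((ll u' oo sab w v) - lcomb (c * Phi0 u) (c * Phi1 u))"
  unfolding u'_def c_def ll_hnew by (simp add: lcomb_cmult right_diff_distrib)
 show ?thesis
 proof (rule ll_perturb)
  show "V th u'" unfolding u'_def by (rule V_unew)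
  show "fN V th ((ll u' oo hnew w v u) - (ll u' oo sab w v))" unfolding eq by (rule F1.N_diff[OF A B])
 qed (use a b in "auto simp: hnew_0 intro: sab_integral")
qed

lemma hnew_integral: "fN V 0 (hnew w v u)"
proof -
 have "fN V 0 (hnew w v u - sab w v)" by (rule F1.N_mono[OF hnew_approx]) simp
 from F1.N_add[OF this sab_integral[OF a(1,2) b]] show ?thesis by simp
qed

lemma hnew_iso: "OC_iso L u (unew w v u) (hnew w v u)"
 by (rule iso_of_log(1)[OF hnew_integral hnew_0 ll_hnew cnew_unit])

end

lemma fps_redn_nth [simp]: "fps_redn L s $ n = rd (s $ n)" by (simp add: fps_redn_def)
lemma fps_redn_eqI: "fN V r (s - t) ==> 0 < r ==> fN V 0 t ==> fps_redn L s = fps_redn L t"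
 by (rule fps_ext) (auto simp: fN_def intro: rd_eqI)
lemma fps_redn_mult: "fN V 0 s ==> fN V 0 t ==> fps_redn L (s * t) = fps_redn L s * fps_redn L t"
 by (rule fps_ext) (auto simp: fps_mult_nth fN_def rd_sum rd_mult N_mult_left intro!: sum.cong)
lemma fps_redn_1: "fps_redn L 1 = 1" by (rule fps_ext) (simp add: rd_1)
lemma fps_redn_power: "fN V 0 s ==> fps_redn L (s ^ n) = fps_redn L s ^ n"
 by (induction n) (auto simp: fps_redn_1 fps_redn_mult F1.N_power0)

lemma fps_redn_compose:
 assumes s: "fN V 0 s" and t: "fN V 0 t" shows "fps_redn L (s oo t) = fps_redn L s oo fps_redn L t"
proof (rule fps_ext)
 fix n
 have t': "V 0 ((t ^ i) $ n)" "V 0 (s $ i)" for i using F1.N_power0[OF t] s by (auto simp: fN_def)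
 have "rd (\<Sum>i=0..n. s $ i * (t ^ i) $ n) = (\<Sum>i=0..n. rd (s $ i) * rd ((t ^ i) $ n))"
  using t' by (simp add: rd_sum rd_mult N_mult_left)
 thus "fps_redn L (s oo t) $ n = (fps_redn L s oo fps_redn L t) $ n"
  by (simp add: fps_compose_nth fps_redn_power[OF t, symmetric])
qed

lemma fps_redn_X: "fps_redn L fps_X = fps_X" by (rule fps_ext) (simp add: fps_X_def rd_1)

text \<open>The q^2-th power of x is closer to y than x is, while x lies within r of that power; so
  the distance improves until r is reached.\<close>

lemma frob_close: assumes y: "V 0 y" "y ^ q ^ 2 = y" and e: "V e (x - y)" "0 < e" and r: "V r (x - x ^ q ^ 2)"
 shows "V r (x - y)"
proof -
 define d where "d = min e 1"
 have d: "0 < d" "d <= 1" using e by (auto simp: d_def)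
 have *: "V (min r (d + d * real n)) (x - y)" for n
 proof (induction n)
  case 0
  have "V d (x - y)" by (rule N_mono[OF e(1)]) (simp add: d_def)
  thus ?case by (rule N_mono) simp
 next
  case (Suc n)
  show ?case
  proof (cases "r <= d + d * real n")
   case True
   thus ?thesis using Suc by (auto elim!: N_mono)
  next
   case False
   hence "V (d + d * real n + d) (x ^ q ^ 2 - y ^ q ^ 2)" using Suc d by (intro pow_contract y) auto
   hence "V (min r (d + d * real n + d)) (x ^ q ^ 2 - y ^ q ^ 2)" by (rule N_mono) simp
   moreover have "V (min r (d + d * real n + d)) (x - x ^ q ^ 2)" by (rule N_mono[OF r]) simp
   ultimately have "V (min r (d + d * real n + d)) ((x - x ^ q ^ 2) + (x ^ q ^ 2 - y ^ q ^ 2))"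
    by (intro N_add)
   thus ?thesis by (simp add: y algebra_simps)
  qed
 qed
 obtain n :: nat where "r / d < real n" using reals_Archimedean2 by blast
 hence "r <= d + d * real n" using d by (simp add: field_simps)
 thus ?thesis using *[of n] by simp
qed

lemma ll_compose_q: assumes "h $ 0 = 0" shows "(ll u oo h) $ q = h $ q + u / vp 1 * (h $ 1) ^ q"
proof -
 have "(\<Sum>k=1..q. lc u k * (h ^ q ^ k) $ q) = (\<Sum>k\<in>{1}. lc u k * (h ^ q ^ k) $ q)"
 proof (rule sum.mono_neutral_right)
  show "\<forall>k\<in>{1..q} - {1}. lc u k * (h ^ q ^ k) $ q = 0"
  proof
   fix k assume "k \<in> {1..q} - {1}"
   hence "q ^ 1 < q ^ k" using q2 by (intro power_strict_increasing) auto
   thus "lc u k * (h ^ q ^ k) $ q = 0" using startsby_zero_power_prefix[OF assms, of "q ^ k"] by simp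
  qed
 qed (use q3 in auto)
 moreover have "(h ^ q) $ q = (h $ 1) ^ q" using startsby_zero_power_nth_same[OF assms, of q] by simp
 ultimately show ?thesis unfolding ll_def elog_compose_nth'[OF q2 assms] by (simp add: lc.simps(2))
qed

text \<open>The coefficient of X^q in the equation of logarithms expresses c^q u' through c u and
  \<open>vp 1\<close> times an integral element, so u' inherits bounds up to 1.\<close>

lemma hom_disc: assumes h: "fN V 0 h" "h $ 0 = 0" "val L (h $ 1) = 0"
  and e: "ll u' oo h = fps_const (h $ 1) * ll u" and u: "V r u" "r <= 1" shows "V r u'"
proof -
 define c where "c = h $ 1"
 have c: "V 0 c" "val L c = 0" using h val_unit_iff by (auto simp: c_def)
 have lq: "ll u $ q = u / vp 1" using elog_nth_power[OF q2, of "lc u" 1] by (simp add: ll_def lc.simps(2))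
 have "h $ q + u' / vp 1 * c ^ q = c * (u / vp 1)" using ll_compose_q[OF h(2), of u'] e lq by (simp add: c_def)
 hence "(c ^ q * u') / vp 1 = (c * u - vp 1 * h $ q) / vp 1"
  by (simp add: diff_divide_distrib mult.commute add.commute eq_diff_eq)
 hence "c ^ q * u' = c * u - vp 1 * h $ q" using vp_nz[of 1] by simp
 moreover have "V r (c * u - vp 1 * h $ q)"
 proof (rule N_diff[OF N_mult_left[OF c(1) u(1)]])
  have "V 1 (vp 1 * h $ q)" unfolding V_vp_mult[OF zero_less_one] using h(1) by (simp add: fN_def)
  thus "V r (vp 1 * h $ q)" using u(2) by (rule N_mono)
 qed
 ultimately have "V r (c ^ q * u')" by simp
 thus ?thesis using V_mult_unit[OF val_power_unit[OF c(2)]] by blast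
qed

text \<open>t intertwines the series [pi] at u1 and u2, both X^(q^2) up to level th. So its
  coefficients are nearly fixed by the q^2-th power and, having the reduction of X, t is X up to th.
  Then c f_u1 - f_u2 is bounded, and division by \<open>lam k\<close> shows that c carries (Phi0,
  Phi1) at u1 to its value at u2.\<close>

lemma iso_unique_1:
 assumes u1: "V th u1" and u2: "V th u2" and t: "fN V 0 t" "t $ 0 = 0" "fps_redn L t = fps_X"
  and e: "ll u2 oo t = fps_const c * ll u1" and cV: "V 0 c" shows "u1 = u2 & t = fps_X"
proof -
 have Qp: "0 < q ^ 2" using q3 by simp
 have sc: "scal v \<pi>'" for v by (rule scal_unif)
 have P0: "fmult L v \<pi>' $ 0 = 0" for v by (rule fmult_nth_0[OF sc])
 have pi: "\<pi>' \<in> OF_ring L" using unif_base by (simp add: OF_iff V_def val_unif)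
 have XQ: "fN V 0 (fps_X ^ q ^ 2)" by (intro F1.N_power0 fN_X)
 have comm: "t oo fmult L u1 \<pi>' = fmult L u2 \<pi>' oo t"
  using hom_of_log[OF t(2) e] pi unfolding formal_hom_def by blast
 have mi: "fN V 0 (fmult L u1 \<pi>')" by (rule fmult_integral(2)[OF u1]) (use pi OF_iff in auto)
 have c1: "fN V th ((t oo fmult L u1 \<pi>') - (t oo fps_X ^ q ^ 2))"
  by (rule compose_congruence[OF t(1) mi XQ fmult_unif[OF u1]])
 have c2: "fN V th ((fmult L u2 \<pi>' oo t) - (fps_X ^ q ^ 2 oo t))"
  by (rule compose_congruence_left[OF fmult_unif[OF u2] t(1)])
 have tq: "fps_X ^ q ^ 2 oo t = t ^ q ^ 2"
  using fps_compose_power[OF t(2), of fps_X "q ^ 2"] fps_X_fps_compose_startby0[OF t(2)] by simp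
 have d1: "fN V th ((t oo fps_X ^ q ^ 2) - t ^ q ^ 2)" using F1.N_diff[OF c2 c1] by (simp add: comm tq)
 have "fN V 1 (t ^ q ^ 2 - (fmap (%x. x ^ q ^ 2) t oo fps_X ^ q ^ 2))"
  by (rule frob_fps_general) (use q3 t in "auto simp: zero_power")
 hence d2: "fN V th (t ^ q ^ 2 - (fmap (%x. x ^ q ^ 2) t oo fps_X ^ q ^ 2))" by (rule F1.N_mono) simp
 have d3: "fN V th ((t oo fps_X ^ q ^ 2) - (fmap (%x. x ^ q ^ 2) t oo fps_X ^ q ^ 2))"
  using F1.N_add[OF d1 d2] by simp
 have fr: "V th (t $ n - (t $ n) ^ q ^ 2)" for n
 proof -
  have "V th (((t oo fps_X ^ q ^ 2) - (fmap (%x. x ^ q ^ 2) t oo fps_X ^ q ^ 2)) $ (n * q ^ 2))"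
   using d3 unfolding fN_def by blast
  thus ?thesis using Qp by (simp add: fps_compose_X_power_nth[OF Qp])
 qed
 have tX: "fN V th (t - fps_X)" unfolding fN_def
 proof
  fix n
  have X01: "V 0 (fps_X $ n)" "(fps_X $ n) ^ q ^ 2 = (fps_X $ n :: 'c)"
   using q3 by (auto simp: V_1)
  have "rd (t $ n) = rd (fps_X $ n)" using t(3) by (metis fps_redn_X fps_redn_nth)
  then obtain e where "0 < e" "V e (t $ n - fps_X $ n)"
   using rd_eq_iff[of "t $ n" "fps_X $ n"] X01 t(1) mC_iff unfolding fN_def by blast
  thus "V th ((t - fps_X) $ n)" using frob_close[OF X01 _ _ fr] by simp
 qed
 have "fN V th ((ll u2 oo t) - (ll u2 oo fps_X))"
  by (rule ll_congruence[OF u2]) (use tX t fN_X in simp_all)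
 hence bd: "fN V th (fps_const c * ll u1 - ll u2)" by (simp add: e)
 have lck: "V th (c * lc u1 k - lc u2 k)" for k
 proof -
  have "V th ((fps_const c * ll u1 - ll u2) $ (q ^ k))" using bd unfolding fN_def by blast
  thus ?thesis by (simp add: ll_def elog_nth_power[OF q2])
 qed
 have P: "V (real k) (c * P0 u1 k - P0 u2 k)" "V (real k) (c * P1 u1 k - P1 u2 k)" for k
 proof -
  have l: "V (real k) (x / lam k)" if "V th x" for x
   unfolding V_divide_iff[OF val_lam] by (rule N_mono[OF that]) simp
  show "V (real k) (c * P0 u1 k - P0 u2 k)" "V (real k) (c * P1 u1 k - P1 u2 k)"
   using l[OF lck[of "2 * k"]] l[OF lck[of "Suc (2 * k)"]] by (simp_all add: P0_def P1_def diff_divide_distrib)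
 qed
 have gen: "c * x - y = 0" if "!!k. V (real k) (c * f k - g k)" "!!k. V (2 + real k) (f k - x)" "!!k. V (2 + real k) (g k - y)"
  for f g x y
 proof (rule V_seq_imp_0[of 0 1])
  fix n
  have a: "V (real n) (c * (f n - x))" by (intro N_mult_left cV N_mono[OF that(2)[of n]]) simp
  have b: "V (real n) (g n - y)" by (intro N_mono[OF that(3)[of n]]) simp
  have "V (real n) ((c * f n - g n) - c * (f n - x) + (g n - y))" by (rule N_add[OF N_diff[OF that(1) a] b])
  thus "V (0 + 1 * real n) (c * x - y)" by (simp add: algebra_simps)
 qed simp
 have e0: "c * Phi0 u1 - Phi0 u2 = 0" by (rule gen[OF P(1) Phi_limits(2)[OF u1] Phi_limits(2)[OF u2]])
 have e1: "c * Phi1 u1 - Phi1 u2 = 0" by (rule gen[OF P(2) Phi_limits(4)[OF u1] Phi_limits(4)[OF u2]])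
 have uu: "u1 = u2"
 proof (rule Phi_quotient_inj[OF u1 u2])
  have "Phi0 u2 = c * Phi0 u1" "Phi1 u2 = c * Phi1 u1" using e0 e1 by simp_all
  thus "Phi1 u1 * Phi0 u2 = Phi1 u2 * Phi0 u1" by simp
 qed
 hence "(c - 1) * Phi0 u1 = 0" using e0 by (simp add: algebra_simps)
 moreover have "Phi0 u1 ~= 0" using V_Phi(5)[OF u1] by auto
 ultimately have "c = 1" by simp
 hence "ll u2 oo t = ll u2 oo fps_X" using e uu by simp
 hence "t = fps_X" by (rule ll_inj[rotated 2]) (use t in simp_all)
 thus ?thesis using uu by blast
qed

text \<open>\<open>iso_unique_1\<close> for h2 composed with the inverse of h1, whose reduction is
  X.\<close>

lemma iso_unique:
 assumes u: "V th u" and u1: "V th u1" and h1: "fN V 0 h1" "h1 $ 0 = 0" "ll u1 oo h1 = fps_const c1 * ll u" "val L c1 = 0"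
  and iso: "OC_iso L u u2 h2" and r: "fps_redn L h2 = fps_redn L h1" and c: "fps_redn L h1 $ 1 ~= 0"
 shows "u2 = u1 & h2 = h1"
proof -
 have hom: "OC_hom L u u2 h2" using iso by (simp add: OC_iso_def)
 hence h2: "fN V 0 h2" "h2 $ 0 = 0" by (auto simp: OC_hom_def formal_hom_def OC_iff fN_def)
 have pi: "\<pi>' \<in> OF_ring L" using unif_base by (simp add: OF_iff V_def val_unif)
 define c2 where "c2 = h2 $ 1"
 have e2: "ll u2 oo h2 = fps_const c2 * ll u"
  unfolding c2_def using log_of_hom[OF h2(2)] hom pi by (auto simp: OC_hom_def formal_hom_def)
 have "rd c2 ~= 0" using c r unfolding c2_def by (metis fps_redn_nth)
 hence c2: "val L c2 = 0" using h2(1) val_unit_iff by (auto simp: c2_def fN_def)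
 have u2: "V th u2" using hom_disc[OF h2 _ _ u] c2 e2 by (simp add: c2_def)
 obtain g where g: "fN V 0 g" "g $ 0 = 0" "ll u oo g = fps_const (inverse c1) * ll u1"
  "h1 oo g = fps_X" "g oo h1 = fps_X" using iso_of_log(2)[OF h1] by blast
 have "ll u2 oo (h2 oo g) = (ll u2 oo h2) oo g" by (rule fps_compose_assoc[OF g(2) h2(2)])
 also have "... = fps_const (c2 * inverse c1) * ll u1"
  by (simp add: e2 fps_compose_mult_distrib[OF g(2)] g(3))
 finally have e: "ll u2 oo (h2 oo g) = fps_const (c2 * inverse c1) * ll u1" .
 have cV: "V 0 (c2 * inverse c1)" using val_mult_unit[OF c2 val_inverse_unit[OF h1(4)]] val_unit_iff by blast
 have "fps_redn L (h2 oo g) = fps_redn L (h1 oo g)"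
  by (simp only: fps_redn_compose[OF h2(1) g(1)] fps_redn_compose[OF h1(1) g(1)] r)
 hence rX: "fps_redn L (h2 oo g) = fps_X" by (simp only: g(4) fps_redn_X)
 have "u1 = u2 & h2 oo g = fps_X"
  by (rule iso_unique_1[OF u1 u2 fps_compose_integral[OF h2(1) g(1)] _ rX e cV]) (simp add: h2)
 moreover have "h2 = (h2 oo g) oo h1" using fps_compose_assoc[OF h1(2) g(2), of h2] g(5) by simp
 ultimately show ?thesis using fps_X_fps_compose_startby0[OF h1(2)] by simp
qed

end

section \<open>The endomorphism ring of the reduction\<close>

lemma one_plus_X_power_nth: "((1 + fps_X) ^ n) $ i = (of_nat (n choose i) :: 'a::comm_ring_1)"
proof -
 have "(1 + fps_X :: 'a fps) ^ n = (fps_X + 1) ^ n" by simp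
 also have "... = (\<Sum>k\<le>n. of_nat (n choose k) * fps_X ^ k * 1 ^ (n - k))" by (rule binomial_ring)
 finally have b: "(1 + fps_X :: 'a fps) ^ n = (\<Sum>k\<le>n. of_nat (n choose k) * fps_X ^ k * 1 ^ (n - k))" .
 have "((1 + fps_X :: 'a fps) ^ n) $ i = (\<Sum>k\<le>n. if k = i then of_nat (n choose k) else 0)"
  unfolding b fps_sum_nth by (intro sum.cong) (auto simp: fps_of_nat[symmetric] fps_X_power_nth)
 also have "... = of_nat (n choose i)" by (subst sum.delta) (auto simp: not_le binomial_eq_0)
 finally show ?thesis .
qed

text \<open>Compare coefficients of X^i Y^(n-i). In b(G) only the n-th power of G sees the
  difference, and it begins with (X + Y)^n; in G(b,b) only coefficients of degree at most i or n - i
  enter, and these lie below n.\<close>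

lemma first_difference_additive: fixes b s :: "'a::idom fps" and G :: "'a fps fps"
 assumes b: "subst1 b G = subst2 G b b" and s: "subst1 s G = subst2 G s s"
  and G: "(G $ 0) $ 0 = 0" "(G $ 0) $ 1 = 1" "(G $ 1) $ 0 = 1"
  and eq: "!!j. j < n ==> b $ j = s $ j" and i: "0 < i" "i < n"
 shows "(b $ n - s $ n) * of_nat (n choose i) = 0"
proof -
 define j where "j = n - i"
 have j: "j < n" "i + j = n" using i by (auto simp: j_def)
 have 1: "diagT G $ 1 = 1 + fps_X"
 proof (rule fps_ext)
  fix l :: nat
  consider "l = 0" | "l = 1" | "1 < l" by linarith
  thus "(diagT G $ 1) $ l = (1 + fps_X) $ l" by cases (auto simp: diagT_nth G[simplified] fps_X_def)
 qed
 have "diagT (G ^ n) $ n = (1 + fps_X) ^ n"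
  unfolding diagT_power startsby_zero_power_nth_same[OF diagT_nth_0[OF G(1)]] 1 ..
 hence Gn: "((G ^ n) $ j) $ i = of_nat (n choose i)"
  using diagT_nth'[of "G ^ n" i j] by (simp add: j one_plus_X_power_nth)
 have "(subst1 b G $ j) $ i - (subst1 s G $ j) $ i = (\<Sum>m\<in>{n}. (b $ m - s $ m) * ((G ^ m) $ j) $ i)"
  unfolding subst1_nth sum_subtractf[symmetric] left_diff_distrib[symmetric] j
  by (rule sum.mono_neutral_right) (auto simp: eq)
 also have "... = (b $ n - s $ n) * of_nat (n choose i)" by (simp add: Gn)
 finally have *: "(subst1 b G $ j) $ i - (subst1 s G $ j) $ i = (b $ n - s $ n) * of_nat (n choose i)" .
 have "(b ^ m) $ l = (s ^ m) $ l" if "l < n" for m l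
  using fps_power_nth_cong_below[of n b s l m] eq that by blast
 hence "(subst2 G b b $ j) $ i = (subst2 G s s $ j) $ i" using i j by (simp add: subst2_nth)
 thus ?thesis using * b s by simp
qed

context lt
begin

subsection \<open>Reduction of power series\<close>

definition red2 :: "'c fps fps => 'k fps fps" where "red2 G = fmap (fps_redn L) G"

lemma red2_nth: "(red2 G $ j) $ i = rd ((G $ j) $ i)" by (simp add: red2_def)
lemma Sigma_add_eq: "Sigma_add L = red2 (fadd L 0)" by (simp add: Sigma_add_def red2_def fmap_def)
lemma fN2D: "fN (fN V) 0 G ==> V 0 ((G $ j) $ i)" by (simp add: fN_def)

lemma red2_mult: assumes "fN (fN V) 0 G" "fN (fN V) 0 H" shows "red2 (G * H) = red2 G * red2 H"
 using fN2D[OF assms(1)] fN2D[OF assms(2)]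
 by (intro fps_ext) (simp add: red2_nth nth_nth_mult rd_sum rd_mult N_sum N_mult_left)

lemma red2_power: assumes "fN (fN V) 0 G" shows "red2 (G ^ n) = red2 G ^ n"
proof (induction n)
 case 0
 have "red2 1 = 1" by (intro fps_ext) (simp add: red2_nth fps_one_nth rd_1)
 thus ?case by simp
qed (simp add: red2_mult assms F2.N_power0)

lemma red2_subst1:
 assumes s: "fN V 0 s" and G: "fN (fN V) 0 G" shows "red2 (subst1 s G) = subst1 (fps_redn L s) (red2 G)"
proof (intro fps_ext)
 fix j i
 have "V 0 (s $ n)" "V 0 (((G ^ n) $ j) $ i)" for n using s fN2D[OF F2.N_power0[OF G]] by (auto simp: fN_def)
 thus "(red2 (subst1 s G) $ j) $ i = (subst1 (fps_redn L s) (red2 G) $ j) $ i"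
  by (simp add: red2_nth subst1_nth rd_sum rd_mult N_mult_left red2_power[OF G, symmetric])
qed

lemma red2_subst2: assumes s: "fN V 0 s" and t: "fN V 0 t" and G: "fN (fN V) 0 G"
 shows "red2 (subst2 G s t) = subst2 (red2 G) (fps_redn L s) (fps_redn L t)"
proof (intro fps_ext)
 fix j i
 have "V 0 ((G $ n) $ m)" "V 0 ((s ^ m) $ i)" "V 0 ((t ^ m) $ j)" for n m
  using F1.N_power0[OF s] F1.N_power0[OF t] fN2D[OF G] by (auto simp: fN_def)
 thus "(red2 (subst2 G s t) $ j) $ i = (subst2 (red2 G) (fps_redn L s) (fps_redn L t) $ j) $ i"
  by (simp add: red2_nth subst2_nth rd_sum rd_mult N_mult_left N_sum
    fps_redn_power[OF s, symmetric] fps_redn_power[OF t, symmetric])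
qed

lemma fps_redn_subst_diag: assumes s: "fN V 0 s" and t: "fN V 0 t" and G: "fN (fN V) 0 G"
 shows "fps_redn L (subst_diag G s t) = subst_diag (red2 G) (fps_redn L s) (fps_redn L t)"
proof (rule fps_ext)
 fix d
 have "V 0 ((G $ n) $ m)" "V 0 ((s ^ m * t ^ n) $ d)" for n m
  using F1.N_mult_left[OF F1.N_power0[OF s] F1.N_power0[OF t]] fN2D[OF G] by (auto simp: fN_def)
 moreover have "rd ((s ^ m * t ^ n) $ d) = (fps_redn L s ^ m * fps_redn L t ^ n) $ d" for m n
  using fps_redn_mult[OF F1.N_power0[OF s] F1.N_power0[OF t], of m n]
  by (metis fps_redn_nth fps_redn_power[OF s] fps_redn_power[OF t])
 ultimately show "fps_redn L (subst_diag G s t) $ d = subst_diag (red2 G) (fps_redn L s) (fps_redn L t) $ d"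
  by (simp add: subst_diag_def rd_sum rd_mult N_mult_left N_sum red2_nth)
qed

lemma fadd0_integral: "fN (fN V) 0 (fadd L 0)" by (rule fadd_integral) simp

lemma ll_subst_diag: assumes "s $ 0 = 0" "t $ 0 = 0"
 shows "ll u oo subst_diag (fadd L u) s t = (ll u oo s) + (ll u oo t)"
 by (simp add: subst_diag_eq[OF assms] diagS_subst1[symmetric] subst1_subst2[OF assms fadd_nth_0] ll_fadd
   subst2_add subst2_in_X subst2_in_Y diagS_add diagS_in_X diagS_in_Y)

lemma subst_diag_nth_0: "s $ 0 = 0 ==> t $ 0 = 0 ==> subst_diag (fadd L u) s t $ 0 = 0"
 by (simp add: subst_diag_def fadd_nth_0)

definition sbar :: "'c => 'c => 'k fps" where "sbar w v = fps_redn L (sab w v)"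

definition KO :: "'c => bool" where "KO z <-> z \<in> K & V 0 z"

lemma KO_add: "KO x ==> KO y ==> KO (x + y)" by (simp add: KO_def K_add N_add)
lemma KO_mult: "KO x ==> KO y ==> KO (x * y)" by (simp add: KO_def K_mult N_mult_left)
lemma KO_diff: "KO x ==> KO y ==> KO (x - y)" by (simp add: KO_def K_diff N_diff)
lemma KO_0: "KO 0" by (simp add: KO_def K_0)
lemma KO_1: "KO 1" by (simp add: KO_def K_1 V_1)
lemma KO_unif: "KO \<pi>'" by (simp add: KO_def K_unif V_def val_unif)
lemma KO_conj: "KO z ==> KO (conj z)" by (simp add: KO_def conj_conj V_conj)
lemma KO_power: "KO z ==> KO (z ^ n)" by (simp add: KO_def K_power N_power0)
lemma KO_fixed: "z ^ q ^ 2 = z ==> KO z" unfolding KO_def using K_of_frob2_fixed frob_fixed_V0[of z 2] by simp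

lemma sabO: "KO w ==> KO v ==> fN V 0 (sab w v)" unfolding KO_def by (intro sab_integral) auto
lemma lcomb_add: "lcomb (w + w') (v + v') = lcomb w v + lcomb w' v'"
 by (simp add: lcomb_def algebra_simps fps_const_add[symmetric] del: fps_const_add)

lemma sab_add: "sab (w + w') (v + v') = subst_diag (fadd L 0) (sab w v) (sab w' v')"
proof (rule ll_inj[of _ _ 0])
 show "ll 0 oo sab (w + w') (v + v') = ll 0 oo subst_diag (fadd L 0) (sab w v) (sab w' v')"
  by (simp add: ll_sab lcomb_add ll_subst_diag)
qed (simp_all add: subst_diag_nth_0)

lemma sbar_add: "KO w ==> KO v ==> KO w' ==> KO v' ==>
  OD_add L (sbar w v) (sbar w' v') = sbar (w + w') (v + v')"
 by (simp add: OD_add_def sbar_def sab_add Sigma_add_eq fps_redn_subst_diag sabO fadd0_integral)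

lemma Sigma_mult_sbar: "KO w ==> Sigma_mult L w = sbar w 0"
 by (simp add: Sigma_mult_def sbar_def sab_fmult scal_def KO_def)
lemma KO_frobs: "KO w ==> KO v ==> fN V 1 (sab w v ^ q - (sab (conj w) (conj v) oo fps_X ^ q))"
 unfolding KO_def by (intro sab_frob) auto

lemma sab_0_Xq: "sab ga 0 oo fps_X ^ q = sab 0 ga"
proof (rule ll_inj[of _ _ 0])
 show "ll 0 oo (sab ga 0 oo fps_X ^ q) = ll 0 oo sab 0 ga"
  unfolding fps_compose_assoc[OF Xq_0 sab_nth_0] ll_sab
  by (simp add: lcomb_def fps_compose_mult_distrib[OF Xq_0])
qed simp_all

lemma phiD_compose: "g $ 0 = 0 ==> phiD L oo g = g ^ q"
 using fps_compose_power[of g fps_X q] by (simp add: phiD_def)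
lemma sbar_nth_0 [simp]: "sbar w v $ 0 = 0" by (simp add: sbar_def)

text \<open>phi is semilinear for the conjugation, so the decomposition O_E + phi O_E and the normal
  form w + v phi differ by \<open>conj\<close> in the second entry.\<close>

lemma phi_sbar: assumes "KO v" shows "phiD L oo sbar v 0 = sbar 0 (conj v)"
proof -
 have i: "fN V 0 (sab v 0)" by (rule sabO[OF assms KO_0])
 have "phiD L oo sbar v 0 = fps_redn L (sab v 0 ^ q)"
  by (simp add: phiD_compose) (simp add: sbar_def fps_redn_power[OF i])
 also have "... = fps_redn L (sab (conj v) (conj 0) oo fps_X ^ q)"
  by (rule fps_redn_eqI[OF KO_frobs[OF assms KO_0]])
   (auto intro!: fps_compose_integral sabO KO_conj assms KO_0 F1.N_power0 fN_X)
 finally show ?thesis by (simp add: conj_base[OF base_0] sab_0_Xq sbar_def)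
qed

lemma OD_decomp: "KO w ==> KO v ==>
  OD_add L (Sigma_mult L w) (phiD L oo Sigma_mult L v) = sbar w (conj v)"
 by (simp add: Sigma_mult_sbar phi_sbar sbar_add KO_0 KO_conj)

lemma sbar_phi: assumes "KO w" "KO ga" shows "sbar w ga oo phiD L = sbar (\<pi>' * ga) w"
proof -
 have Xi: "fN V 0 (fps_X ^ q)" by (intro F1.N_power0 fN_X)
 have "fps_redn L (fps_X ^ q) = phiD L" unfolding phiD_def fps_redn_power[OF fN_X] fps_redn_X ..
 hence 1: "sbar w ga oo phiD L = fps_redn L (sab w ga oo fps_X ^ q)"
  using fps_redn_compose[OF sabO[OF assms] Xi] by (simp add: sbar_def)
 have c: "V 0 ga" using assms by (simp add: KO_def)
 have "fN V 1 (fps_const ga * (((ll 0 oo fps_X ^ q) oo fps_X ^ q) - fps_const \<pi>' * ll 0))"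
  by (rule fN_const_mult[OF c ll_Xq_Xq]) simp
 moreover have "(ll 0 oo (sab w ga oo fps_X ^ q)) - (ll 0 oo sab (\<pi>' * ga) w)
   = fps_const ga * (((ll 0 oo fps_X ^ q) oo fps_X ^ q) - fps_const \<pi>' * ll 0)"
  unfolding fps_compose_assoc[OF Xq_0 sab_nth_0] ll_sab
  by (simp add: lcomb_def fps_compose_mult_distrib[OF Xq_0] fps_compose_add_distrib algebra_simps
    fps_const_mult[symmetric] del: fps_const_mult)
 ultimately have "fN V 1 ((ll 0 oo (sab w ga oo fps_X ^ q)) - (ll 0 oo sab (\<pi>' * ga) w))" by simp
 hence d: "fN V th ((ll 0 oo (sab w ga oo fps_X ^ q)) - (ll 0 oo sab (\<pi>' * ga) w))"
  by (rule F1.N_mono) simp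
 have i: "fN V 0 (sab (\<pi>' * ga) w)" by (intro sabO KO_mult KO_unif assms)
 have "fN V th ((sab w ga oo fps_X ^ q) - sab (\<pi>' * ga) w)"
  by (rule ll_perturb[OF V_0 i _ _ d]) simp_all
 from fps_redn_eqI[OF this _ i] show ?thesis unfolding 1[symmetric] unfolding sbar_def[symmetric] by simp
qed

subsection \<open>The elements \<open>w + v\<phi>\<close> exhaust the endomorphisms\<close>

lemma Sigma_low: "(Sigma_add L $ 0) $ 0 = 0" "(Sigma_add L $ 0) $ 1 = 1" "(Sigma_add L $ 1) $ 0 = 1"
proof -
 have z: "(fadd L 0 $ 0) $ 0 = 0" by (rule fadd_nth_0)
 have "(subst1 (ll 0) (fadd L 0) $ 0) $ 1 = (fadd L 0 $ 0) $ 1"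
  "(subst1 (ll 0) (fadd L 0) $ 1) $ 0 = (fadd L 0 $ 1) $ 0" by (simp_all add: subst1_nth)
 thus "(Sigma_add L $ 0) $ 1 = 1" "(Sigma_add L $ 1) $ 0 = 1"
  by (simp_all add: Sigma_add_eq red2_nth ll_fadd in_X_def rd_1)
 show "(Sigma_add L $ 0) $ 0 = 0" using z by (simp add: Sigma_add_eq red2_nth)
qed

lemma compose2_integral: assumes "fN (fN V) 0 A" "fN (fN V) 0 B" shows "fN (fN V) 0 (A oo B)"
 unfolding fN_def[of "fN V"] fps_compose_nth
proof
 fix n
 have "fN V 0 (A $ i)" "fN V 0 ((B ^ i) $ n)" for i
  using assms(1) F2.N_power0[OF assms(2)] unfolding fN_def[of "fN V"] by blast+
 thus "fN V 0 (\<Sum>i=0..n. A $ i * (B ^ i) $ n)" by (intro F1.N_sum F1.N_mult_left)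
qed

lemma in_Y_lcomb_compose: assumes "Z $ 0 = 0"
 shows "in_Y (lcomb w v) oo Z = fps_const (fps_const w) * (El 0 oo Z) + fps_const (fps_const v) * (El 0 oo Z ^ q)"
proof -
 have c: "in_Y (fps_const a) = fps_const (fps_const a)" for a :: 'c by (rule fps_ext) auto
 have X: "in_Y fps_X = (fps_X :: 'c fps fps)" by (rule fps_ext) (auto simp: fps_X_def)
 have Xq0: "(fps_X ^ q) $ 0 = (0::'c fps)" using q3 by simp
 have "in_Y (lcomb w v) = fps_const (fps_const w) * El 0 + fps_const (fps_const v) * (El 0 oo fps_X ^ q)"
  unfolding lcomb_def in_Y_add in_Y_mult in_Y_compose in_Y_power c X El_eq ..
 moreover have "(El 0 oo fps_X ^ q) oo Z = El 0 oo Z ^ q"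
  using fps_compose_assoc[OF assms Xq0, of "El 0"] fps_compose_power[OF assms, of fps_X q]
   fps_X_fps_compose_startby0[OF assms] by simp
 ultimately show ?thesis by (simp add: fps_compose_add_distrib fps_compose_mult_distrib[OF assms])
qed

text \<open>The logarithms of the two sides differ by v times the additivity defect of f_0(X^q),
  which vanishes modulo pi; hence the two sides have the same reduction.\<close>

lemma sbar_additive: assumes a: "KO w" and b: "KO v"
 shows "subst1 (sbar w v) (Sigma_add L) = subst2 (Sigma_add L) (sbar w v) (sbar w v)"
proof -
 define s where "s = sab w v"
 define F where "F = fadd L 0"
 define Z where "Z = diagT F"
 have s: "fN V 0 s" "s $ 0 = 0" using sabO[OF a b] by (simp_all add: s_def)
 have F: "fN (fN V) 0 F" "(F $ 0) $ 0 = 0" using fadd0_integral fadd_nth_0 by (simp_all add: F_def)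
 have Z: "fN (fN V) 0 Z" "Z $ 0 = 0" using F by (simp_all add: Z_def fN_diagT[OF filt_axioms] diagT_nth_0)
 have sY: "fN (fN V) 0 (in_Y s)" using s by (auto simp: fN_def)
 define A where "A = diagT (subst1 s F)"
 define B where "B = diagT (subst2 F s s)"
 have A: "A = in_Y s oo Z" by (simp add: A_def Z_def diagT_subst1)
 have Ai: "fN (fN V) 0 A" unfolding A by (rule compose2_integral[OF sY Z(1)])
 have A0: "A $ 0 = 0" "B $ 0 = 0"
  unfolding A_def B_def using s F by (intro diagT_nth_0; simp add: subst1_nth_0 subst2_nth_0)+
 have EA: "El 0 oo A = fps_const (fps_const w) * ((El 0 oo gX) + (El 0 oo gY)) + fps_const (fps_const v) * (El 0 oo Z ^ q)"
 proof -
  have "El 0 oo A = diagT (subst1 (ll 0) (subst1 s F))" by (simp add: El_eq diagT_subst1 A_def)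
  also have "... = in_Y (lcomb w v) oo Z"
   using subst1_subst1[OF s(2) F(2), of "ll 0"] by (simp add: s_def ll_sab diagT_subst1 Z_def)
  finally show ?thesis unfolding in_Y_lcomb_compose[OF Z(2)] by (simp add: Z_def F_def El_fadd)
 qed
 have EB: "El 0 oo B = fps_const (fps_const w) * ((El 0 oo gX) + (El 0 oo gY)) + fps_const (fps_const v) * ((El 0 oo gX ^ q) + (El 0 oo gY ^ q))"
 proof -
  have "El 0 oo B = diagT (subst1 (ll 0) (subst2 F s s))" by (simp add: El_eq diagT_subst1 B_def)
  also have "... = diagT (in_X (lcomb w v)) + diagT (in_Y (lcomb w v))"
   unfolding subst1_subst2[OF s(2) s(2) F(2)] unfolding F_def ll_fadd
   by (simp add: subst2_add subst2_in_X subst2_in_Y s_def ll_sab diagT_add)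
  also have "... = (in_Y (lcomb w v) oo gX) + (in_Y (lcomb w v) oo gY)"
   by (simp add: gX_def gY_def diagT_subst1[symmetric] subst1_in_X subst1_in_Y)
  finally show ?thesis unfolding in_Y_lcomb_compose[OF gXY_0(1)] in_Y_lcomb_compose[OF gXY_0(2)]
   by (simp add: distrib_left)
 qed
 have bV: "fN (fN V) 0 (fps_const (fps_const v))" using b by (simp add: KO_def fN_def)
 have "fN (fN V) 1 (fps_const (fps_const v) * ((El 0 oo Z ^ q) - ((El 0 oo gX ^ q) + (El 0 oo gY ^ q))))"
  unfolding Z_def F_def by (rule F2.N_mult_left[OF bV El_fadd_q])
 from F2.N_uminus[OF this] have E: "fN (fN V) 1 ((El 0 oo B) - (El 0 oo A))"
  unfolding EA EB by (simp add: right_diff_distrib)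
 have "fN (fN V) 1 (B - A)"
 proof (rule F1.elog_perturb[OF _ _ _ _ _ _ E])
  show "fN V (- real k / 2) (fps_const (lc 0 k))" for k by (rule fN_const[OF V_lc]) simp
 qed (simp_all add: Ai A0)
 hence "fN (fN V) 1 (diagT (subst2 F s s - subst1 s F))" by (simp add: A_def B_def diagT_diff)
 hence d: "fN (fN V) 1 (subst2 F s s - subst1 s F)" unfolding fN_diagT[OF filt_axioms] .
 have i1: "fN (fN V) 0 (subst1 s F)" using Ai unfolding A_def fN_diagT[OF filt_axioms] .
 have "red2 (subst2 F s s) = red2 (subst1 s F)"
 proof (intro fps_ext)
  fix j i
  have "V 1 ((subst2 F s s $ j) $ i - (subst1 s F $ j) $ i)" using d by (simp add: fN_def)
  thus "(red2 (subst2 F s s) $ j) $ i = (red2 (subst1 s F) $ j) $ i"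
   unfolding red2_nth by (rule rd_eqI) (use fN2D[OF i1] in auto)
 qed
 thus ?thesis by (simp add: red2_subst1[OF s(1) F(1)] red2_subst2[OF s(1) s(1) F(1)])
   (simp add: s_def F_def sbar_def Sigma_add_eq)
qed

lemma sbar_residue_fixed: assumes "KO w" "KO v" shows "(sbar w v $ n) ^ q ^ 2 = sbar w v $ n"
proof -
 define x where "x = sab w v $ n"
 have x: "x \<in> K" "V 0 x" using sab_K[of w v] sabO[OF assms] assms by (auto simp: x_def KO_def fR_def fN_def)
 have "rd (x ^ q ^ 2) = rd x" by (rule rd_eqI[OF K_frob2[OF x]]) (use x in auto)
 thus ?thesis using x by (simp add: sbar_def x_def[symmetric] rd_power)
qed

lemma sab_teich: assumes "t ^ q ^ 2 = t" shows "sab t 0 = fps_const t * fps_X"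
proof (rule ll_inj[of _ _ 0])
 have "ll 0 oo (fps_const t * fps_X) = fps_const t * (ll 0 oo fps_X)"
  unfolding ll_def by (rule elog_compose_cmult) (use lc_0_fixed[OF assms] in auto)
 thus "ll 0 oo sab t 0 = ll 0 oo (fps_const t * fps_X)" by (simp add: ll_sab lcomb_def)
qed simp_all

lemma fps_compose_cX_nth: fixes c :: "'a::comm_ring_1" shows "(s oo (fps_const c * fps_X)) $ n = c ^ n * s $ n"
proof -
 have "(s oo (fps_const c * fps_X)) $ n = (\<Sum>i=0..n. if i = n then c ^ n * s $ n else 0)"
  unfolding fps_compose_nth by (intro sum.cong) (auto simp: power_mult_distrib fps_const_power fps_X_power_nth)
 thus ?thesis by simp
qed

text \<open>Elements with t^q = t pass through X^(q^k) unchanged, hence commute with the logarithm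
  and with its Frobenius twist.\<close>

lemma sab_homogeneous: assumes "t ^ q = t" shows "t ^ n * sab w v $ n = t * sab w v $ n"
proof -
 have tk: "t ^ q ^ k = t" for k by (induction k) (simp_all add: power_mult assms)
 have tz: "(fps_const t * fps_X) $ 0 = 0" by simp
 have l: "ll 0 oo (fps_const t * P) = fps_const t * (ll 0 oo P)" if "P $ 0 = 0" for P
  unfolding ll_def by (rule elog_compose_cmult) (use tk that in auto)
 have "(ll 0 oo fps_X ^ q) oo (fps_const t * fps_X) = ll 0 oo (fps_X ^ q oo (fps_const t * fps_X))"
  by (rule fps_compose_assoc[OF tz Xq_0, symmetric])
 also have "fps_X ^ q oo (fps_const t * fps_X) = (fps_const t * fps_X) ^ q"
  using fps_compose_power[OF tz, of fps_X q] by simp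
 also have "... = fps_const t * fps_X ^ q" by (simp add: power_mult_distrib assms)
 also have "ll 0 oo (fps_const t * fps_X ^ q) = fps_const t * (ll 0 oo fps_X ^ q)" by (rule l[OF Xq_0])
 finally have q: "(ll 0 oo fps_X ^ q) oo (fps_const t * fps_X) = fps_const t * (ll 0 oo fps_X ^ q)" .
 have "ll 0 oo (sab w v oo (fps_const t * fps_X)) = lcomb w v oo (fps_const t * fps_X)"
  unfolding fps_compose_assoc[OF tz sab_nth_0] ll_sab ..
 also have "... = fps_const t * lcomb w v"
  using l[of fps_X] by (simp add: lcomb_def fps_compose_add_distrib fps_compose_mult_distrib[OF tz] q distrib_left)
 also have "... = ll 0 oo (fps_const t * sab w v)" by (simp add: l ll_sab)
 finally have e: "ll 0 oo (sab w v oo (fps_const t * fps_X)) = ll 0 oo (fps_const t * sab w v)" .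
 have "sab w v oo (fps_const t * fps_X) = fps_const t * sab w v" by (rule ll_inj[OF _ _ e]) simp_all
 hence "(sab w v oo (fps_const t * fps_X)) $ n = (fps_const t * sab w v) $ n" by simp
 thus ?thesis by simp
qed

lemma sbar_homogeneous:
 assumes "c ^ q = c" "KO w" "KO v" shows "c ^ n * sbar w v $ n = c * sbar w v $ n"
proof -
 note t = teich[OF assms(1)]
 have "V 0 (sab w v $ n)" using sabO[OF assms(2,3)] by (simp add: fN_def)
 thus ?thesis using arg_cong[OF sab_homogeneous[OF t(2), of n w v], of rd] t
  by (simp add: sbar_def rd_mult rd_power N_power0)
qed

lemma fps_frob: "(s :: 'k fps) ^ q ^ m = fmap (%x. x ^ q ^ m) s oo fps_X ^ q ^ m" if "0 < m"
proof -
 have bin: "of_nat (q choose i) = (0::'k)" if "0 < i" "i < q" for i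
  using Fq.CHAR_dvd_binomial[of i] that card_Fq by (simp add: of_nat_eq_0_iff_char_dvd)
 interpret D: filtq "%r x::'k. r <= 0 | x = 0" q by (rule filtq_discrete[OF q3 q_odd bin])
 have "fN (%r x::'k. r <= 0 | x = 0) 1 (s ^ q ^ m - (fmap (%x. x ^ q ^ m) s oo fps_X ^ q ^ m))"
  by (rule D.frob_fps_general) (use q3 that in "auto simp: fN_def zero_power")
 thus ?thesis by (intro fps_ext) (simp add: fN_def)
qed

text \<open>Commuting with [pi], which reduces to X^(q^2), puts the coefficients into the field with
  q^2 elements; commuting with the Teichmueller scalars of O_F gives homogeneity.\<close>

lemma OD_facts: assumes b: "b \<in> OD L" shows "b $ 0 = 0" "subst1 b (Sigma_add L) = subst2 (Sigma_add L) b b"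
  "(b $ n) ^ q ^ 2 = b $ n" "c ^ q = c ==> c ^ n * b $ n = c * b $ n"
proof -
 show z: "b $ 0 = 0" and "subst1 b (Sigma_add L) = subst2 (Sigma_add L) b b"
  using b by (auto simp: OD_def formal_hom_def)
 have comm: "b oo Sigma_mult L a = Sigma_mult L a oo b" if "a \<in> OF_ring L" for a
  using b that by (auto simp: OD_def formal_hom_def)
 show "c ^ n * b $ n = c * b $ n" if c: "c ^ q = c"
 proof -
  note t = teich[OF c]
  have "teich L c ^ q ^ 2 = teich L c" using t by (simp add: q2_eq)
  hence "Sigma_mult L (teich L c) = fps_const c * fps_X"
   using Sigma_mult_sbar[OF KO_fixed, of "teich L c"] sab_teich[of "teich L c"] t by (auto intro!: fps_ext simp: sbar_def)
  moreover have "(fps_const c * fps_X) oo b = fps_const c * b"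
   using fps_X_fps_compose_startby0[OF z] by (simp add: fps_compose_mult_distrib[OF z])
  ultimately have "b oo (fps_const c * fps_X) = fps_const c * b" using comm[of "teich L c"] t OF_iff by simp
  hence "(b oo (fps_const c * fps_X)) $ n = (fps_const c * b) $ n" by simp
  thus ?thesis by simp
 qed
 have pi: "\<pi>' \<in> OF_ring L" using unif_base by (simp add: OF_iff V_def val_unif)
 have XQ: "fN V 0 (fps_X ^ q ^ 2)" by (intro F1.N_power0 fN_X)
 have "Sigma_mult L \<pi>' = fps_redn L (fps_X ^ q ^ 2)"
  unfolding Sigma_mult_def by (rule fps_redn_eqI[OF fmult_unif[OF V_0] _ XQ]) simp
 hence sp: "Sigma_mult L \<pi>' = fps_X ^ q ^ 2" unfolding fps_redn_power[OF fN_X] fps_redn_X .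
 have "fps_X ^ q ^ 2 oo b = b ^ q ^ 2"
  using fps_compose_power[OF z, of fps_X "q ^ 2"] fps_X_fps_compose_startby0[OF z] by simp
 hence e: "b oo fps_X ^ q ^ 2 = b ^ q ^ 2" using comm[OF pi] by (simp add: sp)
 have e2: "b ^ q ^ 2 = fmap (%x. x ^ q ^ 2) b oo fps_X ^ q ^ 2" by (rule fps_frob) simp
 have Q: "0 < q ^ 2" using q3 by simp
 have "(b oo fps_X ^ q ^ 2) $ (n * q ^ 2) = (fmap (%x. x ^ q ^ 2) b oo fps_X ^ q ^ 2) $ (n * q ^ 2)"
  using e e2 by simp
 thus "(b $ n) ^ q ^ 2 = b $ n" using Q by (simp add: fps_compose_X_power_nth[OF Q])
qed

text \<open>With m the remainder of n - 1 modulo q - 1, all q - 1 nonzero residues would be roots of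
  X^m - 1 with 0 < m < q - 1.\<close>

lemma residue_power_cong_1:
 assumes "!!c::'k. c ^ q = c ==> c ^ n = c" and n: "0 < n" shows "(q - 1) dvd (n - 1)"
proof (rule ccontr)
 assume ndvd: "~ (q - 1) dvd (n - 1)"
 define m where "m = (n - 1) mod (q - 1)"
 have m: "0 < m" "m < q - 1" using ndvd q3 by (auto simp: m_def intro!: gr0I)
 have pw: "c ^ m = 1" if c: "c ^ q = c" "c ~= 0" for c :: 'k
 proof -
  have "c * c ^ (q - 1) = c * 1" using c q3 by (metis Suc_diff_1 less_le_trans mult_1_right power_Suc zero_less_numeral)
  hence 1: "c ^ (q - 1) = 1" using c by simp
  have "c * c ^ (n - 1) = c * 1" using assms(1)[OF c(1)] n by (metis Suc_diff_1 mult_1_right power_Suc)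
  hence 2: "c ^ (n - 1) = 1" using c by simp
  have "c ^ (n - 1) = c ^ ((n - 1) div (q - 1) * (q - 1) + m)" unfolding m_def by (simp only: div_mult_mod_eq)
  also have "... = (c ^ (q - 1)) ^ ((n - 1) div (q - 1)) * c ^ m"
   by (simp only: power_add power_mult[symmetric] mult.commute)
  finally show ?thesis using 1 2 by simp
 qed
 define P :: "'k poly" where "P = monom 1 m - 1"
 have P: "P ~= 0"
 proof
  assume "P = 0"
  hence "coeff P m = 0" by simp
  thus False using m by (simp add: P_def)
 qed
 have "degree P <= m" unfolding P_def by (intro degree_diff_le) (auto simp: degree_monom_le)
 moreover have "card {x. poly P x = 0} <= degree P" by (rule card_poly_roots_bound[OF P])
 moreover have "rd ` OF_ring L - {0} \<subseteq> {x. poly P x = 0}"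
  using pw Fq_iff by (auto simp: P_def poly_monom)
 moreover have "card (rd ` OF_ring L - {0}) = q - 1" using Fq.F_0 card_Fq by simp
 ultimately have "q - 1 <= m" using card_mono[OF poly_roots_finite[OF P]] by (metis order_trans)
 thus False using m by simp
qed

text \<open>Additivity makes n a power of the residue characteristic, and homogeneity makes it 1
  modulo q - 1; together n is a power of q.\<close>

lemma first_difference_q_power: assumes b: "b \<in> OD L" and a: "KO w" "KO v"
  and eq: "!!j. j < n ==> b $ j = sbar w v $ j" and ne: "b $ n ~= sbar w v $ n"
 shows "\<exists>k. n = q ^ k"
proof -
 have n: "0 < n" using ne OD_facts(1)[OF b] by (intro gr0I) simp
 have "CHAR('k) dvd (n choose i)" if i: "0 < i" "i < n" for i
 proof -
  have "(b $ n - sbar w v $ n) * of_nat (n choose i) = 0"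
   by (rule first_difference_additive[OF OD_facts(2)[OF b] sbar_additive[OF a] Sigma_low eq i])
  hence "of_nat (n choose i) = (0::'k)" using ne by simp
  thus ?thesis by (simp add: of_nat_eq_0_iff_char_dvd)
 qed
 then obtain r where r: "n = CHAR('k) ^ r" using additive_exponent_prime_power[OF Fq.prime_CHAR n] by blast
 obtain f where f: "0 < f" "q = CHAR('k) ^ f" by (rule q_prime_power)
 have "c ^ n = c" if "c ^ q = c" for c :: 'k
 proof -
  have "c ^ n * (b $ n - sbar w v $ n) = c * (b $ n - sbar w v $ n)"
   unfolding right_diff_distrib OD_facts(4)[OF b that] sbar_homogeneous[OF that a] ..
  thus ?thesis using ne by simp
 qed
 hence "(q - 1) dvd (n - 1)" using n by (rule residue_power_cong_1)
 hence d: "CHAR('k) ^ f - 1 dvd CHAR('k) ^ r - 1" by (simp only: r f(2))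
 have "f dvd r" by (rule prime_power_cong_1[OF prime_ge_2_nat[OF Fq.prime_CHAR] f(1) d])
 then obtain k where k: "r = f * k" by (rule dvdE)
 have "n = q ^ k" unfolding r k power_mult f(2)[symmetric] ..
 thus ?thesis by (rule exI)
qed

end

section \<open>Successive approximation of endomorphisms by w + v phi\<close>

context lt
begin

lemma V_lam_mult: "V r (x * lam k) <-> V (r + real k) x"
 using V_mult_iff[OF val_lam, of r k x] by (simp add: mult.commute)

lemma V_unif_lam: "V 1 (\<pi>' ^ k * lam k - 1)"
proof (induction k)
 case (Suc k)
 define v where "v = vp (Suc (Suc (2 * k)))"
 have ls: "lam (Suc k) = lam k / v" by (simp add: lam_Suc v_def)
 have v: "val L v = ereal 1" unfolding v_def using val_vp[of "Suc (Suc (2 * k))"] by simp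
 hence v0: "v ~= 0" by auto
 have "q ^ 1 <= q ^ Suc (Suc (2 * k))" using q3 by (intro power_increasing) auto
 hence "2 <= q ^ Suc (Suc (2 * k))" using q2 unfolding power_one_right by (rule order_trans[rotated])
 hence "real 2 <= real (q ^ Suc (Suc (2 * k)))" by (rule of_nat_mono)
 hence "V 2 (\<pi>' - v)" unfolding v_def by (intro N_mono[OF V_unif_vp]) simp
 hence "V 1 ((\<pi>' - v) / v)" unfolding V_divide_iff[OF v] by simp
 moreover have "(\<pi>' - v) / v = \<pi>' / v - 1" using v0 by (simp add: diff_divide_distrib)
 ultimately have 1: "V 1 (\<pi>' / v - 1)" by simp
 hence 2: "V 0 (\<pi>' / v)" by (rule V0_trans) (simp_all add: V_1)
 have "V 1 (\<pi>' / v * (\<pi>' ^ k * lam k - 1) + (\<pi>' / v - 1))" by (rule N_add[OF N_mult_left[OF 2 Suc.IH] 1])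
 moreover have "\<pi>' / v * (\<pi>' ^ k * lam k - 1) + (\<pi>' / v - 1) = \<pi>' ^ Suc k * lam (Suc k) - 1"
  using v0 unfolding ls by (simp add: field_simps)
 ultimately show ?case by (simp only:)
qed (simp add: lam_def)

lemma ll_nth_power: "ll u $ (q ^ k) = lc u k" unfolding ll_def by (rule elog_nth_power[OF q2])
lemma ll_nth_other: "(!!k. n ~= q ^ k) ==> ll u $ n = 0"
 unfolding ll_def elog_nth[OF q2] by (intro sum.neutral ballI if_not_P) metis

lemma lcomb_nth: shows "lcomb w v $ (q ^ (2 * m)) = w * lam m"
  and "lcomb w v $ (q ^ Suc (2 * m)) = v * lam m"
  and "(!!k. n ~= q ^ k) ==> lcomb w v $ n = 0"
proof -
 have q0: "0 < q" using q3 by simp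
 have "(ll 0 oo fps_X ^ q) $ (q ^ (2 * m)) = 0"
 proof (cases m)
  case 0
  thus ?thesis using q3 by (simp add: ll_Xq_nth)
 next
  case (Suc m')
  have "q ^ (2 * m) = q * q ^ Suc (2 * m')" by (simp add: Suc)
  thus ?thesis using q0 ll_nth_power[of 0 "Suc (2 * m')"] lc_0_odd[of "Suc (2 * m')"]
   by (simp only: ll_Xq_nth) simp
 qed
 thus "lcomb w v $ (q ^ (2 * m)) = w * lam m"
  using ll_nth_power[of 0 "2 * m"] by (simp add: lcomb_def lam_def)
 have "(ll 0 oo fps_X ^ q) $ (q * q ^ (2 * m)) = lam m"
  using q0 ll_nth_power[of 0 "2 * m"] by (simp only: ll_Xq_nth) (simp add: lam_def)
 thus "lcomb w v $ (q ^ Suc (2 * m)) = v * lam m"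
  using ll_nth_power[of 0 "Suc (2 * m)"] lc_0_odd[of "Suc (2 * m)"] by (simp add: lcomb_def)
 assume n: "!!k. n ~= q ^ k"
 have "(ll 0 oo fps_X ^ q) $ n = 0"
 proof (cases "q dvd n")
  case True
  then obtain l where l: "n = q * l" by (rule dvdE)
  have "l ~= q ^ k" for k using n[of "Suc k"] l by auto
  thus ?thesis using l by (simp add: ll_Xq_nth ll_nth_other)
 qed (simp add: ll_Xq_nth)
 thus "lcomb w v $ n = 0" using ll_nth_other[OF n] by (simp add: lcomb_def)
qed

lemma lcomb_diff: "lcomb w' v' - lcomb w v = lcomb (w' - w) (v' - v)"
 using lcomb_add[of "w' - w" w "v' - v" v] by simp

text \<open>\<open>elog_perturb_step\<close> at u = 0: while the logarithms agree modulo pi so do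
  the series, and the next difference of the series is that of the logarithms.\<close>

lemma sab_difference:
 assumes a: "KO w" "KO v" and D: "!!j. j < n ==> V 1 (lcomb (w' - w) (v' - v) $ j)"
 shows "j < n ==> V 1 (sab w' v' $ j - sab w v $ j)"
  and "V 1 (sab w' v' $ n - sab w v $ n - lcomb (w' - w) (v' - v) $ n)"
proof -
 have step: "V 1 (sab w' v' $ m - sab w v $ m - lcomb (w' - w) (v' - v) $ m)"
  if "!!j. j < m ==> V 1 (sab w' v' $ j - sab w v $ j)" for m
 proof -
  have "V 1 ((sab w' v' - sab w v) $ m
    - ((elog q (lc 0) oo sab w' v') - (elog q (lc 0) oo sab w v)) $ m)"
   by (rule elog_perturb_step[OF _ V_lc]) (use that sabO[OF a] in "simp_all add: lc.simps")
  moreover have "(elog q (lc 0) oo sab w' v') - (elog q (lc 0) oo sab w v) = lcomb (w' - w) (v' - v)"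
   by (simp add: ll_def[symmetric] ll_sab lcomb_diff)
  ultimately show ?thesis by simp
 qed
 have all: "V 1 (sab w' v' $ j - sab w v $ j)" if "j < n" for j using that
 proof (induction j rule: less_induct)
  case (less j)
  have "V 1 (sab w' v' $ j - sab w v $ j - lcomb (w' - w) (v' - v) $ j)"
   by (rule step) (use less in auto)
  from N_add[OF this D[OF less.prems]] show ?case by simp
 qed
 show "j < n ==> V 1 (sab w' v' $ j - sab w v $ j)" by (rule all)
 show "V 1 (sab w' v' $ n - sab w v $ n - lcomb (w' - w) (v' - v) $ n)"
  by (rule step[OF all])
qed

lemma lcomb_nth_small: fixes r s :: real
 assumes "V r dt" "V r ep" and n: "n < q ^ k" and k: "2 * r + 1 \<ge> k + 2 * s"
 shows "V s (lcomb dt ep $ n)"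
proof (cases "\<exists>l. n = q ^ l")
 case True
 then obtain l where l: "n = q ^ l" by blast
 have "l < k" using n q3 by (simp add: l)
 show ?thesis
 proof (cases "even l")
  case True
  then obtain m where m: "l = 2 * m" by (rule evenE)
  have "real m <= r - s" using k \<open>l < k\<close> unfolding m by linarith
  thus ?thesis unfolding l m lcomb_nth V_lam_mult by (intro N_mono[OF assms(1)]) simp
 next
  case False
  then obtain m where m: "l = Suc (2 * m)" by (auto elim: oddE)
  have "real m <= r - s" using k \<open>l < k\<close> unfolding m by linarith
  thus ?thesis unfolding l m lcomb_nth V_lam_mult by (intro N_mono[OF assms(2)]) simp
 qed
qed (simp add: lcomb_nth)

lemma sab_close:
 assumes a: "KO w" "KO v" and d: "V (1 + real k) (w' - w)" "V (1 + real k) (v' - v)" and n: "n < q ^ k"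
 shows "V 1 (sab w' v' $ n - sab w v $ n)"
proof (rule sab_difference(1)[OF a _ n])
 fix j assume j: "j < q ^ k"
 show "V 1 (lcomb (w' - w) (v' - v) $ j)" by (rule lcomb_nth_small[OF d j]) simp
qed

text \<open>Equal reductions mean congruence modulo pi, as the coefficients lie in E, where pi is a
  uniformizer. Then the logarithms agree modulo pi, and their coefficients (w' - w) * lam m and (v'
  - v) * lam m force divisibility by all powers of pi.\<close>

lemma sbar_inj:
 assumes a: "KO w" "KO v" "KO w'" "KO v'" and e: "sbar w' v' = sbar w v"
 shows "w' = w & v' = v"
proof -
 have sK: "sab w v $ n \<in> K & V 0 (sab w v $ n)" if "KO w" "KO v" for w v n
  using sab_K[of w v] sabO[OF that] that by (auto simp: KO_def fR_def fN_def)
 have "fN V 1 (sab w' v' - sab w v)" unfolding fN_def fps_sub_nth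
 proof
  fix n
  have "rd (sab w' v' $ n) = rd (sab w v $ n)"
   using arg_cong[OF e, of "%s. s $ n"] by (simp add: sbar_def)
  thus "V 1 (sab w' v' $ n - sab w v $ n)"
   using sK[OF a(1,2), of n] sK[OF a(3,4), of n] by (intro K_rd_0) (auto simp: K_diff N_diff rd_diff)
 qed
 hence D: "fN V 1 (lcomb (w' - w) (v' - v))"
  using ll_congruence[of 0 1 "sab w v" "sab w' v'"] sabO[OF a(1,2)] by (simp add: ll_sab lcomb_diff)
 have "V (1 + 1 * real m) (w' - w)" "V (1 + 1 * real m) (v' - v)" for m
  using D lcomb_nth(1,2)[of "w' - w" "v' - v" m] unfolding fN_def mult_1 V_lam_mult[symmetric] by metis+
 from V_seq_imp_0[OF this(1)] V_seq_imp_0[OF this(2)] have "w' - w = 0" "v' - v = 0" by simp_all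
 thus ?thesis by simp
qed

definition agree :: "'k fps => nat => 'c \<times> 'c => bool" where
 "agree b k p <-> KO (fst p) & KO (snd p) & (\<forall>j<q ^ k. b $ j = sbar (fst p) (snd p) $ j)"

text \<open>A correction by pi^(k div 2) z, to w for even k and to v for odd k, first acts in degree
  q^k. Once that degree is right, the next difference lies in degree q^(k+1) or later, because first
  differences occur in q-power degrees only.\<close>

lemma agree_step: assumes b: "b \<in> OD L" and p: "agree b k p"
 shows "\<exists>p'. agree b (Suc k) p' & (V (real k / 2 - 1) (fst p' - fst p) & V (real k / 2 - 1) (snd p' - snd p))"
proof -
 define n w v m where "n = q ^ k" "w = fst p" "v = snd p" "m = k div 2"
 note defs = n_w_v_m_def
 have KO: "KO w" "KO v" and eq: "!!j. j < n ==> b $ j = sbar w v $ j"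
  using p by (auto simp: agree_def defs)
 define d where "d = b $ n - sbar w v $ n"
 have "d ^ q ^ 2 = d"
 proof -
  have "(x - y) ^ q ^ 2 = x ^ q ^ 2 - y ^ q ^ 2" for x y :: 'k using rd_frob_add[of "x - y" y 2] by simp
  thus ?thesis unfolding d_def using OD_facts(3)[OF b] sbar_residue_fixed[OF KO] by simp
 qed
 then obtain z where z: "z \<in> K" "V 0 z" "rd z = d" by (rule K_residue)
 define e where "e = \<pi>' ^ m * z"
 have e: "KO e" unfolding e_def using z by (intro KO_mult KO_power KO_unif) (simp add: KO_def)
 have Vm: "V (real m) e" unfolding e_def using z by (intro N_mult_right) (simp_all add: V_def val_unif_power)
 define dt ep where "dt = (if even k then e else 0)" "ep = (if even k then 0 else e)"
 note de = dt_ep_def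
 have KOde: "KO (w + dt)" "KO (v + ep)" using KO e by (auto simp: de intro!: KO_add)
 have low: "V 1 (lcomb (w + dt - w) (v + ep - v) $ j)" if "j < n" for j
 proof (cases "\<exists>l. j = q ^ l")
  case True
  then obtain l where l: "j = q ^ l" by blast
  have lk: "l < k" using that q3 by (simp add: l defs)
  show ?thesis
  proof (cases "even l")
   case True
   then obtain i where i: "l = 2 * i" by (rule evenE)
   have "V (1 + real i) dt" using lk N_mono[OF Vm, of "1 + real i"] by (auto simp: de i defs)
   thus ?thesis unfolding l i lcomb_nth V_lam_mult by simp
  next
   case False
   then obtain i where i: "l = Suc (2 * i)" by (auto elim: oddE)
   have "V (1 + real i) ep" using lk N_mono[OF Vm, of "1 + real i"] by (auto simp: de i defs elim!: oddE)
   thus ?thesis unfolding l i lcomb_nth V_lam_mult by simp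
  qed
 qed (simp add: lcomb_nth)
 note sd = sab_difference[OF KO low]
 have top: "lcomb (w + dt - w) (v + ep - v) $ n = e * lam m"
 proof (cases "even k")
  case True
  hence "n = q ^ (2 * m)" by (simp add: defs)
  thus ?thesis using True lcomb_nth(1)[of dt ep m] by (simp add: de)
 next
  case False
  hence "n = q ^ Suc (2 * m)" by (simp add: defs)
  thus ?thesis using False lcomb_nth(2)[of dt ep m] by (simp add: de)
 qed
 have "V 1 (z * (\<pi>' ^ m * lam m - 1))" by (rule N_mult_left[OF z(2) V_unif_lam])
 hence zz: "V 1 (e * lam m - z)" by (simp add: e_def algebra_simps)
 define s' where "s' = sab (w + dt) (v + ep)"
 have s0: "V 0 (sab w v $ j)" for j using sabO[OF KO] by (simp add: fN_def)
 have "b $ j = sbar (w + dt) (v + ep) $ j" if j: "j < q ^ Suc k" for j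
 proof (rule ccontr)
  assume "b $ j ~= sbar (w + dt) (v + ep) $ j"
  then obtain l where l: "l <= j" "b $ l ~= sbar (w + dt) (v + ep) $ l"
   "!!i. i < l ==> b $ i = sbar (w + dt) (v + ep) $ i"
   using exists_least_iff[of "%l. b $ l ~= sbar (w + dt) (v + ep) $ l"]
   by (metis linorder_not_le)
  from first_difference_q_power[OF b KOde l(3) l(2)] obtain i where i: "l = q ^ i" by blast
  have "q ^ i < q ^ Suc k" using l(1) j i by simp
  hence "i < Suc k" by (rule power_less_imp_less_exp[rotated]) (use q3 in simp)
  hence "i <= k" by simp
  then consider "l < n" | "l = n" using q3 by (cases "i = k") (auto simp: i defs)
  thus False
  proof cases
   case 1
   have "sbar (w + dt) (v + ep) $ l = sbar w v $ l"
    using rd_eqI[OF sd(1)[OF _ 1] _ s0] by (simp add: sbar_def)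
   thus False using l(2) eq[OF 1] by simp
  next
   case 2
   have "V 1 (s' $ n - sab w v $ n - e * lam m)" using sd(2)[of n] by (simp only: top s'_def)
   from N_add[OF this zz] have "V 1 (s' $ n - (sab w v $ n + z))" by (simp add: algebra_simps)
   hence "rd (s' $ n) = rd (sab w v $ n + z)" by (rule rd_eqI) (auto intro: N_add s0 z)
   thus False using l(2) s0 z by (simp add: 2 s'_def sbar_def rd_add d_def)
  qed
 qed
 hence "agree b (Suc k) (w + dt, v + ep)" using KOde by (simp add: agree_def)
 moreover have "V (real k / 2 - 1) e"
 proof (rule N_mono[OF Vm])
  have "k <= 2 * m + 1" by (simp add: defs)
  thus "real k / 2 - 1 <= real m" by linarith
 qed
 hence "V (real k / 2 - 1) dt" "V (real k / 2 - 1) ep" by (simp_all add: de)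
 ultimately show ?thesis by (intro exI[of _ "(w + dt, v + ep)"]) (simp add: defs)
qed

lemma OD_sbar:
 assumes b: "b \<in> OD L" obtains w v where "KO w" "KO v" "b = sbar w v"
proof -
 have "\<exists>f. \<forall>n. agree b n (f n) &
   (V (real n / 2 - 1) (fst (f (Suc n)) - fst (f n)) & V (real n / 2 - 1) (snd (f (Suc n)) - snd (f n)))"
 proof (rule dependent_nat_choice)
  show "\<exists>p. agree b 0 p" using OD_facts(1)[OF b] KO_0 by (intro exI[of _ "(0, 0)"]) (simp add: agree_def)
 qed (rule agree_step[OF b])
 then obtain f where f: "!!n. agree b n (f n)"
  "!!n. V (-1 + 1 / 2 * real n) (fst (f (Suc n)) - fst (f n))"
  "!!n. V (-1 + 1 / 2 * real n) (snd (f (Suc n)) - snd (f n))" by auto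
 obtain w where a: "(%n. fst (f n)) \<longlonglongrightarrow> w" "!!n. V (-1 + 1 / 2 * real n) (fst (f n) - w)"
  by (rule V_Cauchy_limit[OF f(2)]) auto
 obtain v where b': "(%n. snd (f n)) \<longlonglongrightarrow> v" "!!n. V (-1 + 1 / 2 * real n) (snd (f n) - v)"
  by (rule V_Cauchy_limit[OF f(3)]) auto
 have KOf: "KO (fst (f n))" "KO (snd (f n))" for n using f(1)[of n] by (auto simp: agree_def)
 have KOl: "KO l" if "!!n. KO (s n)" "s \<longlonglongrightarrow> l" for s :: "nat => 'c" and l
  using K_closed[OF _ that(2)] V_limit[OF that(2), of 0] that(1) by (simp add: KO_def)
 have K: "KO w" "KO v" using KOl[OF _ a(1)] KOl[OF _ b'(1)] KOf by auto
 have "b $ n = sbar w v $ n" for n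
 proof -
  \<comment> \<open>N / 2 - 1 = n + 1 is the precision that \<open>sab_close\<close> asks for in
    degrees below q^n.\<close>
  define N where "N = 2 * n + 4"
  have nq: "n < q ^ n" by (rule less_power_self[OF q2])
  also have "q ^ n <= q ^ N" using q3 by (intro power_increasing) (auto simp: N_def)
  finally have nN: "n < q ^ N" .
  have "V 1 (sab (fst (f N)) (snd (f N)) $ n - sab w v $ n)"
   by (rule sab_close[OF K _ _ nq]) (rule N_mono[OF a(2)] N_mono[OF b'(2)], simp add: N_def)+
  hence "rd (sab (fst (f N)) (snd (f N)) $ n) = rd (sab w v $ n)"
   by (rule rd_eqI) (use sabO[OF K] in "auto simp: fN_def")
  thus ?thesis using f(1)[of N] nN by (simp add: agree_def sbar_def)
 qed
 thus ?thesis using that[OF K] by (simp add: fps_eq_iff)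
qed

text \<open>By \<open>sbar_inj\<close> the coordinates in \<open>Nrd\<close> are determined; the
  columns of the matrix are (w, v) and (pi conj v, conj w).\<close>

lemma Nrd_eq: assumes a: "KO w" "KO v" shows "Nrd L (sbar w (conj v)) = w * conj w - \<pi>' * conj v * v"
 unfolding Nrd_def
proof (rule the_equality, goal_cases)
 note i = a KO_conj[OF a(1)] KO_conj[OF a(2)] KO_mult[OF KO_unif KO_conj[OF a(2)]]
 have c: "conj (conj z) = z" if "KO z" for z using that conj_conj by (simp add: KO_def)
 have OE: "z \<in> OE_ring L <-> KO z" for z by (simp add: OE_iff KO_def)
 have OE': "OE_ring L = Collect KO" using OE by blast
 case 1 show ?case using i c[OF a(1)] OE
  by (intro bexI[of _ w] bexI[of _ v] bexI[of _ "\<pi>' * conj v"] bexI[of _ "conj w"])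
   (simp_all add: OD_decomp sbar_phi)
 case (2 n)
 then obtain x y x' y' where k: "KO x" "KO y" "KO x'" "KO y'"
  and e: "sbar w (conj v) = OD_add L (Sigma_mult L x) (phiD L oo Sigma_mult L y)"
   "sbar w (conj v) oo phiD L = OD_add L (Sigma_mult L x') (phiD L oo Sigma_mult L y')" "n = x * y' - x' * y"
  unfolding OE' by auto
 have "w = x & conj v = conj y"
  using e(1) by (intro sbar_inj) (simp_all add: k i OD_decomp KO_conj)
 moreover have "\<pi>' * conj v = x' & w = conj y'"
  using e(2) by (intro sbar_inj) (simp_all add: k i OD_decomp KO_conj sbar_phi)
 ultimately show "n = w * conj w - \<pi>' * conj v * v"
  using e(3) c[OF k(2)] c[OF k(4)] c[OF a(2)] by metis
qed

subsection \<open>Coefficients up to degree \<open>q\<^sup>2\<close>\<close>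

lemma sab_low: shows "sab w v $ 1 = w" and "sab w v $ q = v"
  and "n < q ^ 2 ==> n ~= 1 ==> n ~= q ==> sab w v $ n = 0"
  and "sab w v $ (q ^ 2) = lam 1 * (w - w ^ q ^ 2)"
proof -
 define s where "s = sab w v"
 have s0: "s $ 0 = 0" by (simp add: s_def)
 have e: "lcomb w v $ n = s $ n + (\<Sum>k=1..n. lc 0 k * (s ^ q ^ k) $ n)" for n
  using elog_compose_nth'[OF q2 s0, of "lc 0" n] ll_sab[of w v] by (simp add: s_def ll_def)
 have l1: "lc 0 1 = 0" using lc_0_odd[of 1] by simp
 have small: "(s ^ q ^ k) $ n = 0" if "n < q ^ k" for k n
  using startsby_zero_power_prefix[OF s0, of "q ^ k"] that by blast
 have z: "lc 0 k * (s ^ q ^ k) $ n = 0" if "1 <= k" "n <= q ^ 2" "n < q ^ 2 | k ~= 2" for k n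
 proof (cases "k = 1")
  case False
  hence "k = 2 | 2 < k" using that by linarith
  moreover have "2 < k ==> q ^ 2 < q ^ k" using q3 by simp
  ultimately have "n < q ^ k" using that by auto
  thus ?thesis using small by simp
 qed (use l1 in simp)
 have L: "s $ n = lcomb w v $ n" if n: "n < q ^ 2" for n using e[of n] n by (simp add: z)
 have q1: "1 < q ^ 2" "q < q ^ 2"
  using q3 power_strict_increasing[of 1 2 q] by simp_all
 show "sab w v $ 1 = w" using L[OF q1(1)] lcomb_nth(1)[of w v 0] by (simp add: s_def lam_def)
 show "sab w v $ q = v" using L[OF q1(2)] lcomb_nth(2)[of w v 0] by (simp add: s_def lam_def)
 show "sab w v $ n = 0" if n: "n < q ^ 2" "n ~= 1" "n ~= q"
 proof -
  have "n ~= q ^ k" for k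
  proof
   assume k: "n = q ^ k"
   hence "q ^ k < q ^ 2" using n(1) by simp
   hence "k < 2" by (rule power_less_imp_less_exp[rotated]) (use q3 in simp)
   hence "k = 0 | k = 1" by auto
   thus False using n k by auto
  qed
  from lcomb_nth(3)[OF this] show ?thesis using L[OF n(1)] by (simp add: s_def)
 qed
 have "(\<Sum>k=1..q ^ 2. lc 0 k * (s ^ q ^ k) $ (q ^ 2)) = (\<Sum>k\<in>{2}. lc 0 k * (s ^ q ^ k) $ (q ^ 2))" by (rule sum.mono_neutral_right) (use q1 z in auto)
 also have "... = lam 1 * (s $ 1) ^ q ^ 2"
  using startsby_zero_power_nth_same[OF s0, of "q ^ 2"] by (simp add: lam_def)
 finally show "sab w v $ (q ^ 2) = lam 1 * (w - w ^ q ^ 2)"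
  using e[of "q ^ 2"] lcomb_nth(1)[of w v 1] L[OF q1(1)] lcomb_nth(1)[of w v 0]
  by (simp add: s_def lam_def algebra_simps power2_eq_square)
qed

text \<open>The coefficient of X^(q^2) shows the pi-digit of w: it comes from lam 1 * (w - w^(q^2)),
  where lam 1 is close to 1/pi and w^(q^2) agrees with t modulo pi^2.\<close>

lemma sbar_low: assumes "KO w" "KO v"
 shows "sbar w v $ 1 = rd w" and "sbar w v $ q = rd v"
  and "n < q ^ 2 ==> n ~= 1 ==> n ~= q ==> sbar w v $ n = 0"
  and "t ^ q ^ 2 = t ==> V 0 s ==> w = t + \<pi>' * s ==> sbar w v $ (q ^ 2) = rd s"
proof -
 show "sbar w v $ 1 = rd w" "sbar w v $ q = rd v" unfolding sbar_def fps_redn_nth sab_low by auto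
 show "n < q ^ 2 ==> n ~= 1 ==> n ~= q ==> sbar w v $ n = 0" using sab_low(3) by (simp add: sbar_def)
 assume t: "t ^ q ^ 2 = t" and s: "V 0 s" and a: "w = t + \<pi>' * s"
 have t0: "V 0 t" using frob_fixed_V0[OF t] by simp
 have "V 1 (w - t)" using s by (simp add: a V_unif_mult)
 from N_power_q_iter[OF t0 this, of 2] have "V 2 (w ^ q ^ 2 - t)" unfolding t by (rule N_mono) auto
 hence 1: "V 1 ((w ^ q ^ 2 - t) * lam 1)" by (simp add: V_lam_mult)
 have 2: "V 1 (s * (\<pi>' ^ 1 * lam 1 - 1))" by (rule N_mult_left[OF s V_unif_lam])
 have "V 1 (sab w v $ (q ^ 2) - s)"
  using N_diff[OF 2 1] unfolding sab_low by (simp add: a algebra_simps)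
 thus "sbar w v $ (q ^ 2) = rd s" unfolding sbar_def fps_redn_nth by (rule rd_eqI) (use s in auto)
qed

lemma fps_frob_nth: fixes s :: "'k fps" assumes "0 < m" shows "(s ^ q ^ m) $ (n * q ^ m) = (s $ n) ^ q ^ m"
proof -
 have Q: "0 < q ^ m" using q3 by simp
 show ?thesis using Q fps_compose_X_power_nth[OF Q, of "fmap (%x. x ^ q ^ m) s" "n * q ^ m"]
  by (subst fps_frob[OF assms]) simp
qed

lemma X_power_compose: "(d :: 'a::idom fps) $ 0 = 0 ==> fps_X ^ n oo d = d ^ n"
 using fps_compose_power[of d fps_X n] by simp

lemma Sigma_add_right_0: "Sigma_add L $ 0 = fps_X"
proof -
 have G: "(fadd L 0 $ 0) $ 0 = 0" by (rule fadd_nth_0)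
 have "subst1 (ll 0) (fadd L 0) $ 0 = ll 0 oo fadd L 0 $ 0"
  by (rule fps_ext) (simp add: subst1_nth fps_compose_nth fps_power_zeroth atMost_atLeast0)
 hence "ll 0 oo fadd L 0 $ 0 = ll 0 oo fps_X" by (simp add: ll_fadd in_X_def)
 from ll_inj[OF G _ this] show ?thesis by (intro fps_ext) (simp add: Sigma_add_eq red2_nth fps_X_def rd_1)
qed

lemma OD_add_X_high: assumes e: "!!j. j <= n ==> e $ j = 0" and i: "i <= n"
 shows "OD_add L fps_X e $ i = fps_X $ i"
proof -
 have z: "(fps_X ^ m * e ^ k) $ i = 0" if "0 < k" for k m
 proof -
  have "(e ^ k) $ j = 0" if "j <= n" for j
   using fps_power_nth_cong_below[of "Suc n" e 0 j k] e that \<open>0 < k\<close> by (simp add: zero_power)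
  thus ?thesis using i by (auto simp: fps_X_power_mult_nth)
 qed
 have "OD_add L fps_X e $ i
   = (\<Sum>m\<le>i. \<Sum>k\<in>{0}. (Sigma_add L $ k) $ m * (fps_X ^ m * e ^ k) $ i)"
  unfolding OD_add_def subst_diag_def fps_nth_Abs_fps
  by (intro sum.cong[OF refl] sum.mono_neutral_right) (use z in auto)
 also have "... = (\<Sum>m\<le>i. if m = i then fps_X $ m else 0)"
  by (intro sum.cong[OF refl]) (auto simp: Sigma_add_right_0 fps_X_power_nth)
 finally show ?thesis by simp
qed

lemma phi3_nth: assumes "d $ 0 = 0" "j < q ^ 3" shows "(phiD L oo (phiD L oo (phiD L oo d))) $ j = 0"
proof -
 have z: "(d ^ q) $ 0 = 0" "((d ^ q) ^ q) $ 0 = 0" using assms q3 by simp_all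
 have "phiD L oo (phiD L oo (phiD L oo d)) = d ^ (q * q * q)"
  unfolding phiD_compose[OF assms(1)] phiD_compose[OF z(1)] phiD_compose[OF z(2)] by (simp add: power_mult)
 thus ?thesis using startsby_zero_power_prefix[OF assms(1), of "q * q * q"] assms(2)
  by (simp add: power3_eq_cube)
qed

text \<open>The element 1 + phi^3 d is X plus terms of degree at least q^3, so the coefficients up
  to q^2 are invariants of the class.\<close>

lemma eq_mod_phi3_nth: assumes e: "eq_mod_phi3 L b c" and n: "n <= q ^ 2" shows "b $ n = c $ n"
proof -
 obtain d where d: "d \<in> OD L" and b: "b = c oo OD_add L fps_X (phiD L oo (phiD L oo (phiD L oo d)))"
  using e by (auto simp: eq_mod_phi3_def)
 have q23: "q ^ 2 < q ^ 3" using q3 by (intro power_strict_increasing) auto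
 have X: "OD_add L fps_X (phiD L oo (phiD L oo (phiD L oo d))) $ j = fps_X $ j" if "j < Suc n" for j
  by (rule OD_add_X_high[of "q ^ 2"]) (use that n q23 OD_facts(1)[OF d] phi3_nth in auto)
 have "(OD_add L fps_X (phiD L oo (phiD L oo (phiD L oo d))) ^ i) $ n = (fps_X ^ i) $ n" for i
  by (rule fps_power_nth_cong_below[OF X]) auto
 hence "b $ n = (c oo fps_X) $ n" unfolding b fps_compose_nth by simp
 thus ?thesis by simp
qed

lemma sbar_mu: "t ^ q ^ 2 = t ==> sbar t 0 = fps_const (rd t) * fps_X"
 by (auto intro!: fps_ext simp: sbar_def sab_teich)

lemma OD_elem_sbar: assumes "a0 ^ q ^ 2 = a0" "b0 ^ q ^ 2 = b0" "a1 ^ q ^ 2 = a1"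
 shows "OD_elem L a0 b0 a1 = sbar (a0 + \<pi>' * a1) (conj b0)"
proof -
 note k = KO_fixed[OF assms(1)] KO_fixed[OF assms(2)] KO_fixed[OF assms(3)]
 have pp: "(phiD L :: 'k fps) ^ q = fps_X ^ q ^ 2" by (simp add: phiD_def power_mult[symmetric] power2_eq_square)
 have z: "(phiD L :: 'k fps) $ 0 = 0" using q3 by (simp add: phiD_def)
 have "Sigma_mult L \<pi>' = sbar \<pi>' 0" by (rule Sigma_mult_sbar[OF KO_unif])
 also have "... = (sbar 1 0 oo phiD L) oo phiD L" by (simp add: sbar_phi KO_0 KO_1)
 also have "... = fps_X ^ q ^ 2" using z pp by (simp add: sbar_mu rd_1 phiD_compose)
 finally have 1: "Sigma_mult L \<pi>' oo (fps_const (rd a1) * fps_X) = (fps_const (rd a1) * fps_X) ^ q ^ 2"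
  by (simp add: X_power_compose)
 have "sbar (\<pi>' * a1) 0 = (sbar a1 0 oo phiD L) oo phiD L" by (simp add: sbar_phi k KO_0)
 also have "... = fps_const (rd a1) * fps_X ^ q ^ 2"
  using z pp by (simp add: sbar_mu assms fps_compose_mult_distrib[OF z] phiD_compose)
 also have "... = (fps_const (rd a1) * fps_X) ^ q ^ 2"
  using arg_cong[OF assms(3), of rd] k(3) by (simp add: power_mult_distrib KO_def rd_power)
 finally have 2: "Sigma_mult L \<pi>' oo (fps_const (rd a1) * fps_X) = sbar (\<pi>' * a1) 0" using 1 by simp
 have "OD_add L (fps_const (rd a0) * fps_X) (phiD L oo (fps_const (rd b0) * fps_X)) = sbar a0 (conj b0)"
  using OD_decomp[OF k(1,2)] by (simp add: Sigma_mult_sbar k sbar_mu assms)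
 thus ?thesis unfolding OD_elem_def 2 by (simp add: sbar_add k KO_conj KO_mult KO_unif KO_0)
qed

text \<open>The precision is what the class modulo phi^3 determines: w modulo pi^2 and v modulo
  pi.\<close>

definition unit_data :: "'k fps => 'c => 'c => 'c => 'c => 'c => bool" where
 "unit_data b a0 b0 a1 w v <-> KO w & KO v & b = sbar w (conj v) & V 2 (w - (a0 + \<pi>' * a1)) & V 1 (v - b0)"

lemma unit_form: assumes b: "b \<in> OD L" and e: "eq_mod_phi3 L b (OD_elem L a0 b0 a1)"
  and mu: "a0 ^ q ^ 2 = a0" "b0 ^ q ^ 2 = b0" "a1 ^ q ^ 2 = a1"
 obtains w v where "unit_data b a0 b0 a1 w v"
proof -
 obtain w ga where K: "KO w" "KO ga" and bs: "b = sbar w ga" by (rule OD_sbar[OF b])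
 define v where "v = conj ga"
 have b': "KO v" "conj v = ga" using K(2) KO_conj conj_conj by (auto simp: v_def KO_def)
 note k = KO_fixed[OF mu(1)] KO_fixed[OF mu(2)] KO_fixed[OF mu(3)]
 have k': "KO (a0 + \<pi>' * a1)" "KO (conj b0)" by (intro KO_add KO_mult KO_unif KO_conj k)+
 have eq: "n <= q ^ 2 ==> sbar w ga $ n = sbar (a0 + \<pi>' * a1) (conj b0) $ n" for n
  using eq_mod_phi3_nth[OF e, of n] by (simp add: bs OD_elem_sbar mu)
 have q1: "1 <= q ^ 2" "q <= q ^ 2" using q3 by (simp_all add: power2_eq_square)
 have V0: "V 0 a0" "V 0 a1" "V 0 b0" using k by (auto simp: KO_def)
 have "rd w = rd (a0 + \<pi>' * a1)" using eq[OF q1(1)] by (simp only: sbar_low K k')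
 also have "... = rd a0" by (rule rd_eqI[of 1]) (use V0 in "auto simp: V_unif_mult")
 finally have ra: "rd w = rd a0" .
 have "rd ga = rd (conj b0)" using eq[OF q1(2)] by (simp only: sbar_low K k')
 hence "V 1 (ga - conj b0)" using K(2) k'(2)
  by (intro K_rd_0) (auto simp: KO_def K_diff N_diff rd_diff)
 hence "V 1 (conj (ga - conj b0))" using K(2) k'(2) by (simp add: V_conj KO_def K_diff)
 moreover have "conj (ga - conj b0) = v - b0"
  using K_add[of "ga - conj b0" "conj b0"] K(2) k(2) conj_conj[of b0] by (auto simp: KO_def K_diff v_def)
 ultimately have bb: "V 1 (v - b0)" by simp
 obtain t where t: "t \<in> K" "t ^ q ^ 2 = t" "V 1 (w - t)" "V 0 t" "rd t = rd w"
  using K_teichmuller[of w] K(1) by (auto simp: KO_def)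
 have ta: "t = a0" by (rule frob_fixed_eq[OF t(2) mu(1)]) (use t(5) ra in auto)
 define s where "s = (w - a0) / \<pi>'"
 have s: "w = a0 + \<pi>' * s" by (simp add: s_def)
 have Vs: "V 0 s" using t(3) unfolding s_def V_unif_div ta by simp
 have sK: "s \<in> K" unfolding s_def using K(1) k(1) by (intro K_divide K_diff K_unif) (auto simp: KO_def)
 have "rd s = rd a1" using eq[of "q ^ 2"] sbar_low(4)[OF K mu(1) Vs s] sbar_low(4)[OF k' mu(1) V0(2)] by simp
 hence "V 1 (s - a1)" using Vs sK k(3) by (intro K_rd_0) (auto simp: KO_def K_diff N_diff rd_diff)
 hence "V 2 (\<pi>' * (s - a1))" by (simp add: V_unif_mult)
 hence "V 2 (w - (a0 + \<pi>' * a1))" by (simp add: s algebra_simps)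
 thus ?thesis using that[of w v] K b' bb bs by (simp add: unit_data_def)
qed

text \<open>Let c be the inverse and compare the coefficients of X, X^q and X^(q^2) in c o b = X. Up
  to degree q^2 only these three coefficients of c occur, and Frobenius evaluates the powers of
  b.\<close>

lemma inverse_form: assumes b: "b \<in> OD_units L" and e: "eq_mod_phi3 L b (OD_elem L a0 b0 a1)"
  and mu: "a0 ^ q ^ 2 = a0" "b0 ^ q ^ 2 = b0" "a1 ^ q ^ 2 = a1" and a0: "a0 ~= 0"
 obtains w v where "KO w" "KO v" "fps_inv b = sbar w v"
  "rd w = inverse (rd a0)" "rd v = - (rd b0 ^ q / rd a0 ^ (q + 1))"
  "sbar w v $ (q ^ 2) = rd b0 ^ (q + 1) / rd a0 ^ (q + 2) - rd a1 / rd a0 ^ 2"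
proof -
 obtain c where c: "c \<in> OD L" "b oo c = fps_X" "c oo b = fps_X" and bD: "b \<in> OD L"
  using b by (auto simp: OD_units_def)
 have z: "b $ 0 = 0" "c $ 0 = 0" using OD_facts(1) bD c(1) by auto
 note k = KO_fixed[OF mu(1)] KO_fixed[OF mu(2)] KO_fixed[OF mu(3)]
 have k': "KO (a0 + \<pi>' * a1)" "KO (conj b0)" by (intro KO_add KO_mult KO_unif KO_conj k)+
 have V0: "V 0 a0" "V 0 a1" "V 0 b0" using k by (auto simp: KO_def)
 have bn: "n <= q ^ 2 ==> b $ n = sbar (a0 + \<pi>' * a1) (conj b0) $ n" for n
  using eq_mod_phi3_nth[OF e, of n] by (simp add: OD_elem_sbar mu)
 have q1: "1 <= q ^ 2" "q <= q ^ 2" "1 < q" using q3 by (simp_all add: power2_eq_square)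
 define A0 B0 A1 where "A0 = rd a0" "B0 = rd b0" "A1 = rd a1"
 note AB = A0_B0_A1_def
 have "rd (a0 + \<pi>' * a1) = A0" unfolding AB by (rule rd_eqI[of 1]) (use V0 in "auto simp: V_unif_mult")
 hence b1: "b $ 1 = A0" using bn[OF q1(1)] sbar_low(1)[OF k'] by simp
 have bq: "b $ q = B0 ^ q" using bn[OF q1(2)] sbar_low(2)[OF k'] k(2) by (simp add: AB rd_conj KO_def)
 have bq2: "b $ (q ^ 2) = A1" using bn[of "q ^ 2"] sbar_low(4)[OF k' mu(1) V0(2)] by (simp add: AB)
 have Afix: "A0 ^ q ^ 2 = A0" "B0 ^ q ^ 2 = B0" unfolding AB rd_power[OF V0(1), symmetric] rd_power[OF V0(3), symmetric] mu by auto
 have "c oo b = fps_X" by (rule c)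
 hence "(c oo b) $ 1 = 1" by simp
 hence c1: "c $ 1 * A0 = 1" using b1 by (simp add: fps_compose_nth)
 hence A0: "A0 ~= 0" by auto
 have "fps_inv b oo b = fps_X" by (rule fps_inv) (use z b1 A0 in auto)
 hence "fps_inv b oo (b oo c) = fps_X oo c" using fps_compose_assoc[OF z(2) z(1), of "fps_inv b"] by simp
 hence ic: "fps_inv b = c" using c(2) fps_X_fps_compose_startby0[OF z(2)] by simp
 obtain w v where K: "KO w" "KO v" and cs: "c = sbar w v" by (rule OD_sbar[OF c(1)])
 have co: "n < q ^ 2 ==> n ~= 1 ==> n ~= q ==> c $ n * z = 0" for n z using sbar_low(3)[OF K] by (simp add: cs)
 have "(c oo b) $ q = c $ 1 * b $ q + c $ q * (b ^ q) $ q" unfolding fps_compose_nth by (subst sum_1_q_q2(2)[OF co]) simp_all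
 moreover have "(b ^ q) $ q = A0 ^ q" using startsby_zero_power_nth_same[OF z(1), of q] b1 by simp
 moreover have "(c oo b) $ q = 0" using c(3) q1 by simp
 ultimately have cq: "c $ 1 * B0 ^ q + c $ q * A0 ^ q = 0" using bq by simp
 have "(c oo b) $ (q ^ 2)
   = c $ 1 * b $ (q ^ 2) + (c $ q * (b ^ q) $ (q ^ 2) + c $ (q ^ 2) * (b ^ q ^ 2) $ (q ^ 2))"
  unfolding fps_compose_nth by (subst sum_1_q_q2(1)[OF co]) simp_all
 moreover have "(b ^ q ^ 1) $ (q * q ^ 1) = (b $ q) ^ q ^ 1" by (rule fps_frob_nth) simp
 hence "(b ^ q) $ (q ^ 2) = B0 ^ q ^ 2" using bq by (simp add: power2_eq_square power_mult)
 moreover have "(b ^ q ^ 2) $ (1 * q ^ 2) = (b $ 1) ^ q ^ 2" by (rule fps_frob_nth) simp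
 moreover have "(c oo b) $ (q ^ 2) = 0" using c(3) q1 by simp
 ultimately have cq2: "c $ 1 * A1 + (c $ q * B0 + c $ (q ^ 2) * A0) = 0" using bq2 b1 Afix by simp
 have C1: "c $ 1 = inverse A0" using c1 A0 by (simp add: field_simps)
 have "c $ q * A0 ^ q = - (inverse A0 * B0 ^ q)" using cq C1 by (simp add: eq_neg_iff_add_eq_0 add.commute)
 hence Cq: "c $ q = - (B0 ^ q / A0 ^ (q + 1))" using A0 by (simp add: field_simps)
 have "c $ (q ^ 2) * A0 = - (inverse A0 * A1) - c $ q * B0" using cq2 C1 by (simp add: algebra_simps eq_neg_iff_add_eq_0)
 hence Cq2: "c $ (q ^ 2) = B0 ^ (q + 1) / A0 ^ (q + 2) - A1 / A0 ^ 2" unfolding Cq using A0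
  by (simp add: field_simps power2_eq_square)
 show ?thesis by (rule that[OF K]) (use ic cs C1 Cq Cq2 sbar_low(1,2)[OF K] in "simp_all add: AB")
qed

lemma Nrd_unit:
 assumes "unit_data b a0 b0 a1 w v" and mu: "a0 ^ q ^ 2 = a0" "b0 ^ q ^ 2 = b0" "a1 ^ q ^ 2 = a1"
 shows "Nrd L b = w * conj w - \<pi>' * conj v * v" and "Nrd L b \<in> base L" and "V 0 (Nrd L b)"
  and "V 2 (Nrd L b - (a0 * conj a0 + \<pi>' * (a0 * conj a1 + a1 * conj a0 - b0 * conj b0)))"
proof -
 have K: "KO w" "KO v" and b: "b = sbar w (conj v)" and cl: "V 2 (w - (a0 + \<pi>' * a1))" "V 1 (v - b0)"
  using assms(1) by (auto simp: unit_data_def)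
 note k = KO_fixed[OF mu(1)] KO_fixed[OF mu(2)] KO_fixed[OF mu(3)]
 show N: "Nrd L b = w * conj w - \<pi>' * conj v * v" unfolding b by (rule Nrd_eq[OF K])
 show "Nrd L b \<in> base L" unfolding N using K_norm[of w] K_norm[of v] K unif_base
  by (simp add: KO_def base_diff base_mult mult.assoc mult.commute[of "conj v"])
 have KO2: "KO (w * conj w - \<pi>' * conj v * v)" by (intro KO_diff KO_mult KO_unif KO_conj K)
 thus "V 0 (Nrd L b)" unfolding N by (simp add: KO_def)
 define t where "t = a0 + \<pi>' * a1"
 have kt: "KO t" unfolding t_def by (intro KO_add KO_mult KO_unif k)
 have cd: "conj (x - y) = conj x - conj y" if "KO x" "KO y" for x y
  using K_add[of "x - y" y] that by (simp add: KO_def K_diff)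
 have ct: "conj t = conj a0 + \<pi>' * conj a1" unfolding t_def using k KO_unif conj_base[OF unif_base]
  by (simp add: K_add K_mult KO_def)
 have c1: "V 2 (conj w - conj t)" using cl(1) K kt V_conj[of "w - t" 2] by (simp add: cd[symmetric] t_def[symmetric] KO_def K_diff)
 have c2: "V 1 (conj v - conj b0)" using cl(2) K k V_conj[of "v - b0" 1] by (simp add: cd[symmetric] KO_def K_diff)
 have v: "V 0 w" "V 0 (conj t)" "V 0 (conj v)" "V 0 b0" "V 0 a1" "V 0 (conj a1)" using K kt k KO_conj by (auto simp: KO_def)
 have 1: "V 2 (w * (conj w - conj t) + (w - t) * conj t)"
  by (rule N_add[OF N_mult_left[OF v(1) c1] N_mult_right[OF _ v(2)]]) (use cl(1) t_def in simp)
 have 2: "V 1 (conj v * (v - b0) + (conj v - conj b0) * b0)"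
  by (rule N_add[OF N_mult_left[OF v(3) cl(2)] N_mult_right[OF c2 v(4)]])
 have 3: "V 2 (\<pi>' * (\<pi>' * (a1 * conj a1)))" unfolding V_unif_mult using N_mult_left[OF v(5) v(6)] by simp
 have "V 2 (\<pi>' * (conj v * (v - b0) + (conj v - conj b0) * b0))" unfolding V_unif_mult using 2 by simp
 from N_add[OF N_diff[OF 1 this] 3]
 have "V 2 (w * (conj w - conj t) + (w - t) * conj t - \<pi>' * (conj v * (v - b0) + (conj v - conj b0) * b0)
   + \<pi>' * (\<pi>' * (a1 * conj a1)))" .
 moreover have "w * (ca - ct) + (w - t) * ct - \<pi>' * (cb * (v - b0) + (cb - cb0) * b0) + \<pi>' * (\<pi>' * (a1 * ca1))
   = w * ca - \<pi>' * cb * v - (a0 * ca0 + \<pi>' * (a0 * ca1 + a1 * ca0 - b0 * cb0))"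
  if "ct = ca0 + \<pi>' * ca1" for ca ct cb cb0 ca1 ca0 unfolding that t_def by (simp add: algebra_simps)
 ultimately show "V 2 (Nrd L b - (a0 * conj a0 + \<pi>' * (a0 * conj a1 + a1 * conj a0 - b0 * conj b0)))"
  unfolding N using ct by (metis (no_types))
qed

end

section \<open>Evaluation of power series\<close>

context lt
begin

text \<open>Identities between values of series are checked on finite sums with this error;
  \<open>peval_eqI\<close> then lets N grow.\<close>

lemma peval_approx: assumes s: "fN V r s" and x: "V ee x" "0 < ee"
 shows "V (r + ee * real N) (peval s x - (\<Sum>n<N. s $ n * x ^ n))"
proof -
 define S where "S N = (\<Sum>n<N. s $ n * x ^ n)" for N
 have "V (r + ee * real n) (S (Suc n) - S n)" for n
  unfolding S_def using s by (auto simp: fN_def intro!: N_mult[OF _ N_power_le[OF x(1)]])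
 then obtain l where l: "S \<longlonglongrightarrow> l" "!!n. V (r + ee * real n) (S n - l)" using V_Cauchy_limit[OF _ x(2)] by blast
 have "(%n. s $ n * x ^ n) sums l" using l(1) unfolding sums_def S_def .
 hence "peval s x = l" unfolding peval_def by (rule sums_unique[symmetric])
 thus ?thesis using N_diff_commute[OF l(2)[of N]] by (simp add: S_def)
qed

lemma V_peval: "fN V r s ==> V ee x ==> 0 < ee ==> V r (peval s x)"
 using peval_approx[of r s ee x 0] by simp
lemma V_peval_0: assumes "fN V 0 s" "s $ 0 = 0" "V ee x" "0 < ee" shows "V ee (peval s x)"
 using peval_approx[OF assms(1,3,4), of 1] assms(2) by simp
lemma peval_eqI: assumes "!!N. V (ee * real N) (a - b)" "0 < ee" shows "a = b"
 using V_seq_imp_0[of 0 ee "a - b"] assms by simp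

definition ev :: "'c => 'c fps fps => 'c fps" where "ev x G = fmap (%g. peval g x) G"

context
 fixes x :: 'c and ee :: real assumes x: "V ee x" and ee: "0 < ee"
begin

lemma x0: "V 0 x" using x ee by (intro N_mono[OF x]) simp

lemma peval_at_0: "peval s 0 = s $ (0::nat)" for s :: "'c fps"
proof -
 have "(%n. s $ n * 0 ^ n) sums (\<Sum>n\<in>{0}. s $ n * 0 ^ n)" by (rule sums_finite) (auto simp: zero_power)
 thus ?thesis unfolding peval_def by (simp add: sums_iff)
qed

lemma peval_const: "peval (fps_const c) x = c"
proof -
 have "(%n. fps_const c $ n * x ^ n) sums (\<Sum>n\<in>{0}. fps_const c $ n * x ^ n)"
  by (rule sums_finite) (auto simp: gr0_conv_Suc)
 thus ?thesis unfolding peval_def by (simp add: sums_iff)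
qed

lemma peval_X: "peval fps_X x = x"
proof -
 have "(%n. fps_X $ n * x ^ n) sums (\<Sum>n\<in>{1}. fps_X $ n * x ^ n)"
  by (rule sums_finite) (auto simp: fps_X_def)
 thus ?thesis unfolding peval_def by (simp add: sums_iff)
qed

lemma peval_add: assumes s: "fN V 0 s" and t: "fN V 0 t" shows "peval (s + t) x = peval s x + peval t x"
proof (rule peval_eqI[OF _ ee])
 fix N
 have "V (0 + ee * real N) (peval (s + t) x - (\<Sum>n<N. (s + t) $ n * x ^ n)
   - ((peval s x - (\<Sum>n<N. s $ n * x ^ n)) + (peval t x - (\<Sum>n<N. t $ n * x ^ n))))"
  by (intro N_diff N_add peval_approx F1.N_add s t x ee)
 thus "V (ee * real N) (peval (s + t) x - (peval s x + peval t x))"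
  by (simp add: sum.distrib algebra_simps)
qed

lemma peval_sum: "(!!i. i \<in> A ==> fN V 0 (s i)) ==> peval (sum s A) x = (\<Sum>i\<in>A. peval (s i) x)"
proof (induction A rule: infinite_finite_induct)
 case (insert i A)
 have "peval (s i + sum s A) x = peval (s i) x + peval (sum s A) x"
  by (rule peval_add) (use insert.prems in "auto intro: F1.N_sum")
 thus ?case using insert by simp
qed (use peval_const[of 0] in simp_all)

lemma peval_mult: assumes s: "fN V 0 s" and t: "fN V 0 t" shows "peval (s * t) x = peval s x * peval t x"
proof (rule peval_eqI[OF _ ee])
 fix N
 define S T where "S = (\<Sum>n<N. s $ n * x ^ n)" "T = (\<Sum>n<N. t $ n * x ^ n)"
 have sn: "V 0 (s $ n)" "V 0 (t $ n)" for n using s t by (auto simp: fN_def)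
 have S: "V 0 S" unfolding S_T_def by (intro N_sum N_mult_left sn N_power0 x0)
 have pt: "V 0 (peval t x)" by (rule V_peval[OF t x ee])
 have "(\<Sum>n<N. (s * t) $ n * x ^ n) = (\<Sum>(i, j)\<in>{(i, j). i + j < N}. s $ i * t $ j * x ^ (i + j))"
  unfolding fps_mult_nth sum_distrib_right atLeast0AtMost sum.triangle_reindex[of "%i j. s $ i * t $ j * x ^ (i + j)" N] by simp
 moreover have "S * T = (\<Sum>(i, j)\<in>{..<N} \<times> {..<N}. s $ i * t $ j * x ^ (i + j))"
  unfolding S_T_def sum_product sum.cartesian_product by (simp add: power_add mult_ac)
 moreover have "(\<Sum>(i, j)\<in>{..<N} \<times> {..<N}. s $ i * t $ j * x ^ (i + j))
   = (\<Sum>(i, j)\<in>{(i, j). i + j < N}. s $ i * t $ j * x ^ (i + j))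
    + (\<Sum>(i, j)\<in>{..<N} \<times> {..<N} - {(i, j). i + j < N}. s $ i * t $ j * x ^ (i + j))"
  by (subst sum.subset_diff[of "{(i, j). i + j < N}"]) (auto simp: add.commute)
 \<comment> \<open>The product of the partial sums exceeds the partial sum of the product by terms
   with i + j >= N only.\<close>
 ultimately have e: "S * T - (\<Sum>n<N. (s * t) $ n * x ^ n)
   = (\<Sum>(i, j)\<in>{..<N} \<times> {..<N} - {(i, j). i + j < N}. s $ i * t $ j * x ^ (i + j))" by simp
 have 1: "V (ee * real N) (S * T - (\<Sum>n<N. (s * t) $ n * x ^ n))" unfolding e
 proof (rule N_sum)
  fix p assume "p \<in> {..<N} \<times> {..<N} - {(i, j). i + j < N}"
  then obtain i j where p: "p = (i, j)" and "~ i + j < N" by (cases p) auto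
  hence "ee * real N <= real (i + j) * ee" using ee by simp
  hence "V (ee * real N) (x ^ (i + j))" by (rule N_power_le[OF x])
  thus "V (ee * real N) (case p of (i, j) => s $ i * t $ j * x ^ (i + j))"
   unfolding p prod.case by (intro N_mult_left sn)
 qed
 have "V (ee * real N) (peval s x - S)" "V (ee * real N) (peval t x - T)"
  using peval_approx[OF s x ee, of N] peval_approx[OF t x ee, of N] by (simp_all add: S_T_def)
 hence 2: "V (ee * real N) ((peval s x - S) * peval t x + S * (peval t x - T))"
  by (rule N_add[OF N_mult_right[OF _ pt] N_mult_left[OF S]])
 have 3: "V (ee * real N) (peval (s * t) x - (\<Sum>n<N. (s * t) $ n * x ^ n))"
  using peval_approx[OF F1.N_mult_left[OF s t] x ee, of N] by simp
 from N_diff[OF N_diff[OF 3 2] 1] show "V (ee * real N) (peval (s * t) x - peval s x * peval t x)" by (simp add: algebra_simps)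
qed

lemma peval_power: assumes s: "fN V 0 s" shows "peval (s ^ n) x = peval s x ^ n"
proof (induction n)
 case 0
 show ?case using peval_const[of 1] by simp
next
 case (Suc n)
 show ?case using peval_mult[OF s F1.N_power0[OF s, of n]] Suc by simp
qed

lemma peval_compose: assumes s: "fN V 0 s" and t: "fN V 0 t" "t $ 0 = 0"
 shows "peval (s oo t) x = peval s (peval t x)"
proof (rule peval_eqI[OF _ ee])
 fix N
 define y where "y = peval t x"
 have y: "V ee y" unfolding y_def by (rule V_peval_0[OF t x ee])
 have "(\<Sum>n<N. (s oo t) $ n * x ^ n) = (\<Sum>n<N. \<Sum>i<N. s $ i * (t ^ i) $ n * x ^ n)"
 proof (rule sum.cong[OF refl])
  fix n assume n: "n \<in> {..<N}"
  have "(s oo t) $ n = (\<Sum>i<N. s $ i * (t ^ i) $ n)" unfolding fps_compose_nth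
   by (rule sum.mono_neutral_left) (use n startsby_zero_power_prefix[OF t(2)] in auto)
  thus "(s oo t) $ n * x ^ n = (\<Sum>i<N. s $ i * (t ^ i) $ n * x ^ n)" by (simp add: sum_distrib_right)
 qed
 also have "... = (\<Sum>i<N. s $ i * (\<Sum>n<N. (t ^ i) $ n * x ^ n))"
  by (subst sum.swap) (simp add: sum_distrib_left mult.assoc)
 finally have e: "(\<Sum>n<N. (s oo t) $ n * x ^ n) = (\<Sum>i<N. s $ i * (\<Sum>n<N. (t ^ i) $ n * x ^ n))" .
 have "V (ee * real N) (\<Sum>i<N. s $ i * (y ^ i - (\<Sum>n<N. (t ^ i) $ n * x ^ n)))"
 proof (rule N_sum)
  fix i
  have "V 0 (s $ i)" using s by (simp add: fN_def)
  moreover have "V (ee * real N) (y ^ i - (\<Sum>n<N. (t ^ i) $ n * x ^ n))"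
   using peval_approx[OF F1.N_power0[OF t(1)] x ee, where N = N] by (simp add: peval_power[OF t(1)] y_def)
  ultimately show "V (ee * real N) (s $ i * (y ^ i - (\<Sum>n<N. (t ^ i) $ n * x ^ n)))" by (rule N_mult_left)
 qed
 hence 1: "V (ee * real N) ((\<Sum>i<N. s $ i * y ^ i) - (\<Sum>n<N. (s oo t) $ n * x ^ n))"
  unfolding e by (simp add: sum_subtractf right_diff_distrib)
 have 2: "V (ee * real N) (peval s y - (\<Sum>i<N. s $ i * y ^ i))" using peval_approx[OF s y ee, of N] by simp
 have 3: "V (ee * real N) (peval (s oo t) x - (\<Sum>n<N. (s oo t) $ n * x ^ n))"
  using peval_approx[OF fps_compose_integral[OF s t(1)] x ee, of N] by simp
 from N_diff[OF 3 N_add[OF 1 2]] show "V (ee * real N) (peval (s oo t) x - peval s (peval t x))" by (simp add: y_def)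
qed

lemma ev_integral: "fN (fN V) 0 G ==> fN V 0 (ev x G)"
 by (auto simp: ev_def fN_def[of V] fN_def[of "fN V"] intro!: V_peval[OF _ x ee, unfolded fN_def])

lemma ev_mult: assumes "fN (fN V) 0 G" "fN (fN V) 0 H" shows "ev x (G * H) = ev x G * ev x H"
proof (rule fps_ext)
 fix n
 have i: "fN V 0 (G $ n)" "fN V 0 (H $ n)" for n using assms unfolding fN_def[of "fN V"] by auto
 show "ev x (G * H) $ n = (ev x G * ev x H) $ n"
  by (simp add: ev_def fps_mult_nth peval_sum peval_mult F1.N_mult_left i)
qed

lemma ev_power: assumes "fN (fN V) 0 G" shows "ev x (G ^ n) = ev x G ^ n"
proof (induction n)
 case 0
 show ?case using peval_const[of 0] peval_const[of 1] by (intro fps_ext) (simp add: ev_def fps_one_nth)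
qed (simp add: ev_mult assms F2.N_power0)

end

lemma peval2_ev: "peval2 G x y = peval (ev x G) y" by (simp add: peval2_def peval_def ev_def)

context
 fixes x y :: 'c and ee :: real assumes x: "V ee x" and y: "V ee y" and ee: "0 < ee"
begin

lemma V_peval2: assumes "fN (fN V) 0 G" "(G $ 0) $ 0 = 0" shows "V ee (peval2 G x y)"
proof -
 have G: "fN V 0 (G $ 0)" using assms(1) unfolding fN_def[of "fN V"] by blast
 have "V ee (ev x G $ 0)" using V_peval_0[OF G assms(2) x ee] by (simp add: ev_def)
 moreover have "V ee (peval (ev x G) y - ev x G $ 0)"
  using peval_approx[OF ev_integral[OF x ee assms(1)] y ee, of 1] by simp
 ultimately have "V ee (peval (ev x G) y - ev x G $ 0 + ev x G $ 0)" by (intro N_add)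
 thus ?thesis by (simp add: peval2_ev)
qed

lemma peval2_approx: assumes G: "fN (fN V) 0 G"
 shows "V (ee * real N) (peval2 G x y - (\<Sum>j<N. \<Sum>i<N. (G $ j) $ i * x ^ i * y ^ j))"
proof -
 have y0: "V 0 y" by (rule x0[OF y ee])
 have "V (ee * real N) (\<Sum>j<N. (peval (G $ j) x - (\<Sum>i<N. (G $ j) $ i * x ^ i)) * y ^ j)"
 proof (rule N_sum)
  fix j
  have "fN V 0 (G $ j)" using G unfolding fN_def[of "fN V"] by blast
  from peval_approx[OF this x ee, of N]
  show "V (ee * real N) ((peval (G $ j) x - (\<Sum>i<N. (G $ j) $ i * x ^ i)) * y ^ j)"
   by (intro N_mult_right N_power0 y0) simp
 qed
 moreover have "V (ee * real N) (peval (ev x G) y - (\<Sum>j<N. ev x G $ j * y ^ j))"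
  using peval_approx[OF ev_integral[OF x ee G] y ee, of N] by simp
 ultimately have "V (ee * real N) (peval (ev x G) y - (\<Sum>j<N. ev x G $ j * y ^ j)
   + (\<Sum>j<N. (peval (G $ j) x - (\<Sum>i<N. (G $ j) $ i * x ^ i)) * y ^ j))" by (intro N_add)
 thus ?thesis by (simp add: peval2_ev ev_def left_diff_distrib sum_subtractf sum_distrib_right)
qed

lemma peval2_subst1: assumes h: "fN V 0 h" and F: "fN (fN V) 0 F" "(F $ 0) $ 0 = 0"
  and hF: "fN (fN V) 0 (subst1 h F)" shows "peval2 (subst1 h F) x y = peval h (peval2 F x y)"
proof (rule peval_eqI[OF _ ee])
 fix N
 define z where "z = peval2 F x y"
 have z: "V ee z" unfolding z_def by (rule V_peval2[OF F])
 have pw: "peval2 (F ^ n) x y = z ^ n" for n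
  by (simp add: peval2_ev z_def ev_power[OF x ee F(1)] peval_power[OF y ee ev_integral[OF x ee F(1)]])
 define C where "C n = (\<Sum>j<N. \<Sum>i<N. ((F ^ n) $ j) $ i * x ^ i * y ^ j)" for n
 \<comment> \<open>Fewer than 2 * N powers matter: with i, j < N the coefficient of F^n vanishes for
   n > i + j.\<close>
 have "(\<Sum>j<N. \<Sum>i<N. (subst1 h F $ j) $ i * x ^ i * y ^ j)
   = (\<Sum>j<N. \<Sum>i<N. \<Sum>n<2 * N. h $ n * (((F ^ n) $ j) $ i * x ^ i * y ^ j))"
 proof (intro sum.cong refl)
  fix j i assume ij: "j \<in> {..<N}" "i \<in> {..<N}"
  have "(subst1 h F $ j) $ i = (\<Sum>n<2 * N. h $ n * ((F ^ n) $ j) $ i)"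
   unfolding subst1_nth by (rule sum.mono_neutral_left) (use ij nth_nth_power_prefix[OF F(2)] in auto)
  thus "(subst1 h F $ j) $ i * x ^ i * y ^ j
    = (\<Sum>n<2 * N. h $ n * (((F ^ n) $ j) $ i * x ^ i * y ^ j))"
   by (simp add: sum_distrib_right mult.assoc)
 qed
 also have "... = (\<Sum>j<N. \<Sum>n<2 * N. \<Sum>i<N. h $ n * (((F ^ n) $ j) $ i * x ^ i * y ^ j))"
  by (intro sum.cong refl sum.swap)
 also have "... = (\<Sum>n<2 * N. \<Sum>j<N. \<Sum>i<N. h $ n * (((F ^ n) $ j) $ i * x ^ i * y ^ j))"
  by (rule sum.swap)
 also have "... = (\<Sum>n<2 * N. h $ n * C n)" by (simp add: C_def sum_distrib_left)
 finally have e: "(\<Sum>j<N. \<Sum>i<N. (subst1 h F $ j) $ i * x ^ i * y ^ j) = (\<Sum>n<2 * N. h $ n * C n)" .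
 have "V (ee * real N) (\<Sum>n<2 * N. h $ n * (z ^ n - C n))"
 proof (rule N_sum)
  fix n
  have "V 0 (h $ n)" using h by (simp add: fN_def)
  moreover have "V (ee * real N) (z ^ n - C n)"
   using peval2_approx[OF F2.N_power0[OF F(1)], where N = N and n1 = n] by (simp add: pw C_def)
  ultimately show "V (ee * real N) (h $ n * (z ^ n - C n))" by (rule N_mult_left)
 qed
 hence 1: "V (ee * real N) ((\<Sum>n<2 * N. h $ n * z ^ n) - (\<Sum>n<2 * N. h $ n * C n))"
  by (simp add: sum_subtractf right_diff_distrib)
 have "ee * real N <= 0 + ee * real (2 * N)" using ee by simp
 hence 2: "V (ee * real N) (peval h z - (\<Sum>n<2 * N. h $ n * z ^ n))"
  by (rule N_mono[OF peval_approx[OF h z ee]])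
 have 3: "V (ee * real N) (peval2 (subst1 h F) x y - (\<Sum>n<2 * N. h $ n * C n))"
  using peval2_approx[OF hF, of N] unfolding e .
 from N_diff[OF 3 N_add[OF 1 2]] show "V (ee * real N) (peval2 (subst1 h F) x y - peval h (peval2 F x y))"
  by (simp add: z_def)
qed

lemma peval2_subst2: assumes s: "fN V 0 s" "s $ 0 = 0" and t: "fN V 0 t" "t $ 0 = 0" and G: "fN (fN V) 0 G"
 shows "peval2 (subst2 G s t) x y = peval2 G (peval s x) (peval t y)"
proof -
 have Gn: "fN V 0 (G $ n)" for n using G unfolding fN_def[of "fN V"] by blast
 have "ev x (subst2 G s t) $ n = (ev (peval s x) G oo t) $ n" for n
 proof -
  have "ev x (subst2 G s t) $ n = peval (\<Sum>i=0..n. (G $ i oo s) * fps_const ((t ^ i) $ n)) x"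
   by (simp add: ev_def subst2_eq_compose fps_compose_nth in_Y_power[symmetric])
  also have "... = (\<Sum>i=0..n. peval ((G $ i oo s) * fps_const ((t ^ i) $ n)) x)"
  proof (rule peval_sum[OF x ee])
   fix i
   have "V 0 ((t ^ i) $ n)" using F1.N_power0[OF t(1)] by (simp add: fN_def)
   thus "fN V 0 ((G $ i oo s) * fps_const ((t ^ i) $ n))"
    by (intro F1.N_mult_left fps_compose_integral Gn s fN_const)
  qed
  also have "... = (\<Sum>i=0..n. peval (G $ i) (peval s x) * (t ^ i) $ n)"
  proof (rule sum.cong[OF refl])
   fix i
   have "V 0 ((t ^ i) $ n)" using F1.N_power0[OF t(1)] by (simp add: fN_def)
   thus "peval ((G $ i oo s) * fps_const ((t ^ i) $ n)) x = peval (G $ i) (peval s x) * (t ^ i) $ n"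
    by (simp add: peval_mult[OF x ee] fps_compose_integral Gn s fN_const peval_compose[OF x ee] peval_const[OF x ee])
  qed
  finally show ?thesis by (simp add: fps_compose_nth ev_def)
 qed
 hence "ev x (subst2 G s t) = ev (peval s x) G oo t" by (rule fps_ext)
 thus ?thesis
  by (simp add: peval2_ev peval_compose[OF y ee ev_integral[OF V_peval_0[OF s x ee] ee G] t])
qed

end

subsection \<open>Transport of bases of the torsion\<close>

lemma OF_scal: "a \<in> OF_ring L ==> scal u a" by (simp add: scal_def OF_iff)
lemma fmultO: "V th u ==> a \<in> OF_ring L ==> fN V 0 (fmult L u a) & fmult L u a $ 0 = 0"
 by (simp add: fmult_integral OF_iff fmult_nth_0 OF_scal)

lemma mC_common: assumes "x \<in> mC L" "y \<in> mC L" obtains ee where "V ee x" "V ee y" "0 < ee"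
proof -
 obtain r s where "0 < r" "V r x" "0 < s" "V s y" using assms by (auto simp: mC_iff)
 thus ?thesis using N_mono[of r x "min r s"] N_mono[of s y "min r s"] that[of "min r s"] by simp
qed

lemma subst1_integral: assumes h: "fN V 0 h" and F: "fN (fN V) 0 F" shows "fN (fN V) 0 (subst1 h F)"
proof -
 have hn: "V 0 (h $ n)" for n using h by (simp add: fN_def)
 have "V 0 (((F ^ n) $ j) $ i)" for n j i using fN2D[OF F2.N_power0[OF F]] .
 hence "V 0 ((subst1 h F $ j) $ i)" for j i unfolding subst1_nth by (intro N_sum N_mult_left hn)
 thus ?thesis by (simp add: fN_def)
qed

lemma lin_comb_transport: assumes u: "V th u" "V th u'" and h: "fN V 0 h"
  and hom: "formal_hom (OF_ring L) (fadd L u) (fmult L u) (fadd L u') (fmult L u') h"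
  and xy: "x \<in> mC L" "y \<in> mC L" and ab: "a \<in> OF_ring L" "b \<in> OF_ring L"
 shows "lin_comb L u a x b y \<in> mC L"
  and "peval h (lin_comb L u a x b y) = lin_comb L u' a (peval h x) b (peval h y)"
proof -
 obtain ee where ee: "V ee x" "V ee y" "0 < ee" by (rule mC_common[OF xy])
 have h0: "h $ 0 = 0" and hF: "subst1 h (fadd L u) = subst2 (fadd L u') h h"
  and hm: "!!a. a \<in> OF_ring L ==> h oo fmult L u a = fmult L u' a oo h" using hom by (auto simp: formal_hom_def)
 note F = fadd_integral[OF u(1)] fadd_nth_0
 have f: "fN V 0 (fmult L u a)" "fmult L u a $ 0 = 0" "fN V 0 (fmult L u b)" "fmult L u b $ 0 = 0"
  "fN V 0 (fmult L u' a)" "fN V 0 (fmult L u' b)" using fmultO u ab by blast+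
 note ax = V_peval_0[OF f(1,2) ee(1,3)] note b_y = V_peval_0[OF f(3,4) ee(2,3)]
 show "lin_comb L u a x b y \<in> mC L"
  unfolding lin_comb_def mC_iff using V_peval2[OF ax b_y ee(3) F] ee(3) by blast
 have "peval h (lin_comb L u a x b y) = peval2 (subst1 h (fadd L u)) (peval (fmult L u a) x) (peval (fmult L u b) y)"
  unfolding lin_comb_def by (rule peval2_subst1[OF ax b_y ee(3) h F subst1_integral[OF h F(1)], symmetric])
 also have "... = peval2 (fadd L u') (peval h (peval (fmult L u a) x)) (peval h (peval (fmult L u b) y))"
  unfolding hF by (rule peval2_subst2[OF ax b_y ee(3) h h0 h h0 fadd_integral[OF u(2)]])
 finally show "peval h (lin_comb L u a x b y) = lin_comb L u' a (peval h x) b (peval h y)"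
  unfolding lin_comb_def peval_compose[OF ee(1,3) h f(1,2), symmetric] peval_compose[OF ee(2,3) h f(3,4), symmetric]
   hm[OF ab(1)] hm[OF ab(2)] peval_compose[OF ee(1,3) f(5) h h0] peval_compose[OF ee(2,3) f(6) h h0] .
qed

lemma peval_mC: "fN V 0 h ==> h $ 0 = 0 ==> x \<in> mC L ==> peval h x \<in> mC L"
 using V_peval_0 by (auto simp: mC_iff)

lemma tors2_transport: assumes u: "V th u" "V th u'" and h: "fN V 0 h"
  and hom: "formal_hom (OF_ring L) (fadd L u) (fmult L u) (fadd L u') (fmult L u') h" and x: "x \<in> tors2 L u"
 shows "peval h x \<in> tors2 L u'"
proof -
 have xm: "x \<in> mC L" and t: "peval (fmult L u (\<pi>'\<^sup>2)) x = 0" using x by (auto simp: tors2_def)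
 obtain ee where ee: "V ee x" "0 < ee" using xm by (auto simp: mC_iff)
 have p: "\<pi>'\<^sup>2 \<in> OF_ring L" using unif_base by (simp add: OF_iff base_power V_def val_unif_power)
 have h0: "h $ 0 = 0" and hm: "h oo fmult L u (\<pi>'\<^sup>2) = fmult L u' (\<pi>'\<^sup>2) oo h"
  using hom p by (auto simp: formal_hom_def)
 have f: "fN V 0 (fmult L u (\<pi>'\<^sup>2))" "fmult L u (\<pi>'\<^sup>2) $ 0 = 0" "fN V 0 (fmult L u' (\<pi>'\<^sup>2))"
  using fmultO[OF u(1) p] fmultO[OF u(2) p] by auto
 have "peval (fmult L u' (\<pi>'\<^sup>2)) (peval h x) = peval h (peval (fmult L u (\<pi>'\<^sup>2)) x)"
  unfolding peval_compose[OF ee f(3) h h0, symmetric] hm[symmetric] by (rule peval_compose[OF ee h f(1,2)])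
 thus ?thesis unfolding t peval_at_0[OF ee] h0 by (simp add: tors2_def peval_mC[OF h h0 xm])
qed

text \<open>Both properties of a basis over u' are obtained by going back along the inverse g:
  generation for the point g(z), independence for a vanishing combination.\<close>

lemma LT_curve_transport:
 assumes u: "V th u" "V th u'" and h: "fN V 0 h" "h $ 0 = 0" and e: "ll u' oo h = fps_const c * ll u"
  and c: "val L c = 0" and P: "(x, y, u) \<in> LT_curve L" shows "(peval h x, peval h y, u') \<in> LT_curve L"
proof -
 obtain g where g: "fN V 0 g" "g $ 0 = 0" "ll u oo g = fps_const (inverse c) * ll u'" "h oo g = fps_X" "g oo h = fps_X"
  using iso_of_log(2)[OF h e c] by blast
 note hh = hom_of_log[OF h(2) e] note gh = hom_of_log[OF g(2,3)]
 have B: "tors2_basis L u x y" using P by (auto simp: LT_curve_def)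
 hence t: "x \<in> tors2 L u" "y \<in> tors2 L u" by (auto simp: tors2_basis_def)
 have m: "z \<in> mC L" if "z \<in> tors2 L u" for u z using that by (auto simp: tors2_def)
 have hg: "peval h (peval g z) = z" "peval g (peval h z) = z" if z: "z \<in> mC L" for z
 proof -
  obtain ee where ee: "V ee z" "0 < ee" using z by (auto simp: mC_iff)
  show "peval h (peval g z) = z" using peval_compose[OF ee h(1) g(1,2)] g(4) peval_X[OF ee] by simp
  show "peval g (peval h z) = z" using peval_compose[OF ee g(1) h] g(5) peval_X[OF ee] by simp
 qed
 note lc_h = lin_comb_transport[OF u h(1) hh m[OF t(1)] m[OF t(2)]]
 have "tors2_basis L u' (peval h x) (peval h y)" unfolding tors2_basis_def
 proof (intro conjI ballI impI)
  show "peval h x \<in> tors2 L u'" "peval h y \<in> tors2 L u'" by (rule tors2_transport[OF u h(1) hh t(1)] tors2_transport[OF u h(1) hh t(2)])+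
  fix z assume z: "z \<in> tors2 L u'"
  have "peval g z \<in> tors2 L u" by (rule tors2_transport[OF u(2,1) g(1) gh z])
  then obtain a b where ab: "a \<in> OF_ring L" "b \<in> OF_ring L" "peval g z = lin_comb L u a x b y"
   using B by (auto simp: tors2_basis_def)
  hence "z = lin_comb L u' a (peval h x) b (peval h y)" using lc_h(2)[OF ab(1,2)] hg(1)[OF m[OF z]] by simp
  thus "\<exists>a\<in>OF_ring L. \<exists>b\<in>OF_ring L. z = lin_comb L u' a (peval h x) b (peval h y)" using ab by blast
 next
  fix a b assume ab: "a \<in> OF_ring L" "b \<in> OF_ring L" and z: "lin_comb L u' a (peval h x) b (peval h y) = 0"
  have "0 \<in> mC L" by (simp add: mC_def)
  then obtain ee where ee: "V ee (0::'c)" "0 < ee" by (auto simp: mC_iff)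
  have "lin_comb L u a x b y = peval g (peval h (lin_comb L u a x b y))" using hg(2)[OF lc_h(1)[OF ab]] by simp
  also have "... = 0" unfolding lc_h(2)[OF ab] z peval_at_0[OF ee] by (rule g(2))
  finally have "lin_comb L u a x b y = 0" .
  thus "a / \<pi>'\<^sup>2 \<in> OF_ring L" "b / \<pi>'\<^sup>2 \<in> OF_ring L" using B ab by (auto simp: tors2_basis_def)
 qed
 moreover have "u' \<in> mC L" unfolding mC_iff using u(2) by (intro exI[of _ th]) simp
 ultimately show ?thesis by (simp add: LT_curve_def)
qed

lemma actD_eq:
 assumes b: "fps_inv b = sbar w v" and K: "KO w" "KO v" "rd w ~= 0" and u: "V th u"
 shows "actD L b (x, y, u) = (peval (hnew w v u) x, peval (hnew w v u) y, unew w v u)"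
proof -
 have a: "w \<in> K" "V 0 w" "v \<in> K" "V 0 v" using K by (auto simp: KO_def)
 note c = a(1,2) K(3) a(3,4) u
 have r: "fps_redn L (hnew w v u) = fps_inv b"
  unfolding b sbar_def by (rule fps_redn_eqI[OF hnew_approx[OF c]]) (use sabO[OF K(1,2)] in auto)
 have "(THE (h, u'). u' \<in> mC L & OC_iso L u u' h & fps_redn L h = fps_inv b) = (hnew w v u, unew w v u)"
 proof (rule the_equality)
  have "unew w v u \<in> mC L" unfolding mC_iff using V_unew[OF c] by (intro exI[of _ th]) simp
  thus "case (hnew w v u, unew w v u) of (h, u') => u' \<in> mC L & OC_iso L u u' h & fps_redn L h = fps_inv b"
   using hnew_iso[OF c] r by simp
  fix p assume "case p of (h, u') => u' \<in> mC L & OC_iso L u u' h & fps_redn L h = fps_inv b"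
  then obtain h u' where p: "p = (h, u')" "OC_iso L u u' h" "fps_redn L h = fps_inv b" by (cases p) auto
  have "fps_redn L (hnew w v u) $ 1 ~= 0" unfolding r b using sbar_low(1)[OF K(1,2)] K(3) by simp
  from iso_unique[OF u V_unew[OF c] hnew_integral[OF c] hnew_0 ll_hnew[OF c] cnew_unit[OF c] p(2) _ this]
  show "p = (hnew w v u, unew w v u)" using p r c by simp
 qed
 thus ?thesis by (simp add: actD_def)
qed

end

section \<open>Congruences on the affinoid\<close>

locale lt_choice = lt L for L :: "('c::{field, complete_space}, 'k::field) lt_data" +
 assumes choices: "lt_choices L"
begin

text \<open>Exponents of kappa_1: \<open>no\<close> for pi, \<open>ng\<close> for gamma,
  \<open>nr\<close> for gamma^(1/q), \<open>nG\<close> for gamma^(q/(q-1)), \<open>nm\<close> for w,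
  \<open>ne\<close> for gamma^(1/(q^2-1)), and \<open>na\<close> for gamma^(1/q) w, the denominator
  of a. \<open>nE\<close> is the working precision for x and y.\<close>

definition nm :: nat where "nm = q ^ 2 - 1"
definition ne :: nat where "ne = q * (q - 1)"
definition nr :: nat where "nr = (q - 1) * nm"
definition nE :: nat where "nE = q ^ 3"
definition na :: nat where "na = q * nm"
definition nG :: nat where "nG = q ^ 2 * nm"
definition ng :: nat where "ng = q * nr"
definition no :: nat where "no = q ^ 3 * nm"

text \<open>\<open>nE = na + q\<close> leaves room after division by the denominator of a,
  \<open>nG < q * nE\<close> does so for Z after a q-th power, and \<open>4 * nE <= 3 * no\<close>
  makes errors of level th harmless. Putting q = d + 3 turns all claims into polynomial ones in a
  natural number d.\<close>

lemma nums: shows "q * na = nG" "q * ne + ne = na" "nr + nm = na" "nE = na + q" "Suc nm = q ^ 2"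
  and "ne < nr" "0 < ne" "ne < q * ne" "na < nE" "nE <= no" "nE <= q * na" "nE <= q * (q * ne)"
  and "nG < ng + nE" "nG < q * nE" "nG < no" "na <= ng" "ng <= no" "ne < na" "q * nE <= nE + no" "4 * nE <= 3 * no"
  and "na + ng = nG" "na <= no" "q * ne <= no" "0 < no" "q * nG = no" "q * ne <= ne + no" "q * nr <= nr + no"
  and "nr < no" "0 < nm" "q * ng <= no"
proof -
 define d where "d = q - 3"
 have q: "q = d + 3" using q3 by (simp add: d_def)
 have m: "nm = (d + 2) * (d + 4)" unfolding nm_def q by (simp add: power2_eq_square algebra_simps)
 have e: "ne = (d + 3) * (d + 2)" unfolding ne_def q by simp
 have r: "nr = (d + 2) * ((d + 2) * (d + 4))" unfolding nr_def m unfolding q by simp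
 have a: "na = (d + 3) * ((d + 2) * (d + 4))" unfolding na_def m unfolding q by simp
 have E: "nE = (d + 3) * ((d + 3) * (d + 3))" unfolding nE_def q by (simp add: power3_eq_cube)
 have G: "nG = (d + 3) * ((d + 3) * ((d + 2) * (d + 4)))" unfolding nG_def m unfolding q by (simp add: power2_eq_square)
 have g: "ng = (d + 3) * ((d + 2) * ((d + 2) * (d + 4)))" unfolding ng_def r unfolding q by simp
 have o: "no = (d + 3) * ((d + 3) * ((d + 3) * ((d + 2) * (d + 4))))" unfolding no_def m unfolding q by (simp add: power3_eq_cube)
 note all = m e r a E G g o
 show "q * na = nG" "q * ne + ne = na" "nr + nm = na" "nE = na + q" "Suc nm = q ^ 2"
  unfolding all unfolding q by (simp_all add: algebra_simps power2_eq_square)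
 show "ne < nr" "0 < ne" "ne < q * ne" "na < nE" "nE <= no" "nE <= q * na" "nE <= q * (q * ne)"
  "nG < ng + nE" "nG < q * nE" "nG < no" "na <= ng" "ng <= no" "ne < na" "q * nE <= nE + no" "4 * nE <= 3 * no"
  "na + ng = nG" "na <= no" "q * ne <= no" "0 < no" "q * nG = no" "q * ne <= ne + no" "q * nr <= nr + no"
  "nr < no" "0 < nm" "q * ng <= no" unfolding all unfolding q by (simp_all add: algebra_simps)
qed

definition tt :: real where "tt = 1 / real no"

lemma tt: "0 < tt" "real no * tt = 1" using nums(24) by (simp_all add: tt_def)

text \<open>Valuation in units of v(kappa_1), so that levels are natural numbers.\<close>

definition U :: "nat => 'c => bool" where "U n x <-> V (real n * tt) x"

lemma kap1_power: "kap1 L ^ no = \<pi>'" using choices by (simp add: lt_choices_def no_def nm_def)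

lemma val_kap1: "val L (kap1 L) = ereal tt"
proof -
 have "kap1 L ~= 0" using kap1_power unif_nz nums(24) by (metis power_0_left less_irrefl)
 then obtain s where s: "val L (kap1 L) = ereal s" by (rule val_real)
 have "ereal (real no * s) = 1" using val_power[OF s, of no] val_unif by (simp add: kap1_power)
 hence "real no * s = 1" unfolding one_ereal_def by (rule ereal.inject[THEN iffD1])
 hence "s = tt" using nums(24) by (simp add: tt_def field_simps)
 thus ?thesis using s by simp
qed

lemma val_kap1_power: "val L (kap1 L ^ n) = ereal (real n * tt)" by (rule val_power[OF val_kap1])
lemma kap1_nz: "kap1 L ^ n ~= 0" using val_kap1_power[of n] by (metis val_0 PInfty_neq_ereal(2))

lemma U_0: "U 0 x <-> V 0 x" by (simp add: U_def)
lemma U_zero [simp]: "U n 0" by (simp add: U_def)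
lemma U_no: "U no x <-> V 1 x" by (simp add: U_def tt)
lemma U_mono: "U n x ==> k <= n ==> U k x"
 unfolding U_def by (erule N_mono) (use tt(1) in simp)
lemma U_V0: "U n x ==> V 0 x" using U_mono[of n x 0] by (simp add: U_0)
lemma U_add: "U n x ==> U n y ==> U n (x + y)" unfolding U_def by (rule N_add)
lemma U_uminus: "U n x ==> U n (- x)" unfolding U_def by (rule N_uminus)
lemma U_diff: "U n x ==> U n y ==> U n (x - y)" unfolding U_def by (rule N_diff)
lemma U_mult: "U n x ==> U k y ==> U (n + k) (x * y)"
 unfolding U_def using N_mult[of "real n * tt" x "real k * tt" y] by (simp add: distrib_right)
lemma U_mult0: "V 0 x ==> U k y ==> U k (x * y)" using U_mult[of 0 x k y] by (simp add: U_0)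
lemma U_power: "U n x ==> U (k * n) (x ^ k)"
 unfolding U_def using N_power[of "real n * tt" x k] by (simp add: mult.assoc)
lemma U_kap1: "U n (kap1 L ^ n)" unfolding U_def V_def val_kap1_power by simp
lemma U_kap1_div: "U n (x / kap1 L ^ k) <-> U (n + k) x"
 unfolding U_def using V_divide_iff[OF val_kap1_power[of k], of "real n * tt" x] by (simp add: algebra_simps)
lemma U_unit: "val L x = 0 ==> U n (x * y) <-> U n y" unfolding U_def by (rule V_mult_unit)
lemma U_pos: "0 < n ==> U n x ==> rd x = 0" unfolding U_def using tt(1) by (intro rd_0I[of "real n * tt"]) auto

text \<open>\<open>cg n\<close> is congruence of integral elements modulo \<open>\<kappa>\<^sub>1\<^sup>n\<close>; level \<open>no\<close> is congruence modulo \<open>\<pi>\<close>.\<close>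

definition cg :: "nat => 'c => 'c => bool" where "cg n a b <-> V 0 a & V 0 b & U n (a - b)"

lemma cgI: "V 0 b ==> U n (a - b) ==> cg n a b"
 unfolding cg_def using N_add[OF U_V0[of n "a - b"], of b] by simp
lemma cg_refl: "V 0 a ==> cg n a a" by (simp add: cg_def)
lemma cg_V0: "cg n a b ==> V 0 a" "cg n a b ==> V 0 b" by (simp_all add: cg_def)
lemma cg_U: "cg n a b ==> U n (a - b)" by (simp add: cg_def)
lemma cg_0: "cg n a 0 <-> U n a" using U_V0 by (auto simp: cg_def)
lemma cg_sym: "cg n a b ==> cg n b a" unfolding cg_def U_def using N_diff_commute by blast
lemma cg_trans: assumes "cg n a b" "cg n b c" shows "cg n a c"
 using U_add[OF cg_U[OF assms(1)] cg_U[OF assms(2)]] assms by (simp add: cg_def)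
lemma cg_mono: "cg n a b ==> k <= n ==> cg k a b" unfolding cg_def using U_mono by blast
lemma cg_add: assumes "cg n a b" "cg n a' b'" shows "cg n (a + a') (b + b')"
proof (rule cgI)
 show "V 0 (b + b')" by (rule N_add[OF cg_V0(2)[OF assms(1)] cg_V0(2)[OF assms(2)]])
 show "U n (a + a' - (b + b'))" unfolding add_diff_add by (rule U_add[OF cg_U[OF assms(1)] cg_U[OF assms(2)]])
qed
lemma cg_uminus: assumes "cg n a b" shows "cg n (- a) (- b)"
proof (rule cgI)
 show "V 0 (- b)" by (rule N_uminus[OF cg_V0(2)[OF assms]])
 show "U n (- a - - b)" using U_uminus[OF cg_U[OF assms]] by simp
qed
lemma cg_diff: assumes "cg n a b" "cg n a' b'" shows "cg n (a - a') (b - b')"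
 using cg_add[OF assms(1) cg_uminus[OF assms(2)]] by simp
lemma cg_mult: assumes "cg n a b" "cg n a' b'" shows "cg n (a * a') (b * b')"
proof (rule cgI)
 have v: "V 0 a" "V 0 b" "V 0 a'" "V 0 b'" using assms by (auto simp: cg_def)
 show "V 0 (b * b')" by (rule N_mult_left[OF v(2,4)])
 have "U n (a * (a' - b') + b' * (a - b))" by (rule U_add[OF U_mult0[OF v(1) cg_U[OF assms(2)]] U_mult0[OF v(4) cg_U[OF assms(1)]]])
 thus "U n (a * a' - b * b')" by (simp add: algebra_simps)
qed
lemma cg_power: assumes "cg n a b" shows "cg n (a ^ k) (b ^ k)"
 by (induction k) (auto intro: cg_mult assms cg_refl V_1)
lemma cg_scale: assumes "cg n a b" "U k s" shows "cg (n + k) (s * a) (s * b)"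
proof (rule cgI)
 show "V 0 (s * b)" by (rule N_mult_left[OF U_V0[OF assms(2)] cg_V0(2)[OF assms(1)]])
 show "U (n + k) (s * a - s * b)" using U_mult[OF assms(2) cg_U[OF assms(1)]] by (simp add: algebra_simps)
qed
text \<open>A q-th power multiplies the level by q as long as the mixed binomial terms, which gain
  only \<open>no\<close>, do not interfere.\<close>

lemma cg_power_q: assumes "cg n a b" "q * n <= n + no" shows "cg (q * n) (a ^ q) (b ^ q)"
proof (rule cgI)
 show "V 0 (b ^ q)" by (rule N_power0[OF cg_V0(2)[OF assms(1)]])
 have 1: "real (q * n) * tt <= real q * (real n * tt)" by simp
 have "real (q * n) <= real (n + no)" using assms(2) by (rule of_nat_mono)
 hence "real (q * n) * tt <= real (n + no) * tt" using tt(1) by (intro mult_right_mono) auto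
 hence 2: "real (q * n) * tt <= real n * tt + 1" using tt(2) by (simp add: distrib_right)
 have "V (real (q * n) * tt) ((b + (a - b)) ^ q - b ^ q)"
  by (rule N_power_q_diff[OF cg_V0(2)[OF assms(1)] _ _ 1 2]) (use cg_U[OF assms(1)] tt(1) in "simp_all add: U_def")
 thus "U (q * n) (a ^ q - b ^ q)" by (simp add: U_def)
qed
lemma cg_frob: "V 0 a ==> V 0 b ==> cg no ((a + b) ^ q) (a ^ q + b ^ q)"
 by (rule cgI) (simp_all add: U_no N_frob_add N_add N_power0)
lemma cg_frob_diff: "V 0 a ==> V 0 b ==> cg no ((a - b) ^ q) (a ^ q - b ^ q)"
 using cg_frob[of a "- b"] q_odd N_uminus[of 0 b] by simp
lemma cg_rd: "cg n a b ==> 0 < n ==> rd a = rd b"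
 using U_pos[of n "a - b"] by (auto simp: cg_def rd_diff)

lemma V0_of_monic: assumes "x ^ q = a * x + b" "V 0 a" "V 0 b" shows "V 0 x"
proof (rule ccontr)
 assume n: "~ V 0 x"
 hence "x ~= 0" by auto
 then obtain s where s: "val L x = ereal s" by (rule val_real)
 have s0: "s < 0" using n V_val[OF s, of 0] by simp
 have "V s x" using V_val[OF s] by simp
 hence "V s (a * x + b)" using assms(2,3) s0 by (intro N_add N_mult_left N_mono[OF assms(3)]) auto
 hence "s <= real q * s" using V_val[OF val_power[OF s]] by (simp add: assms(1)[symmetric])
 moreover have "real q * s < 1 * s" using s0 q3 by (intro mult_strict_right_mono_neg) auto
 ultimately show False by simp
qed

lemma gam_eqs:
 shows "kap L = kap1 L ^ q" and "gam L = kap1 L ^ ng" and "gam_1_q L = kap1 L ^ nr" and "gam_q_q1 L = kap1 L ^ nG"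
  and "gam_1_qq1 L = kap1 L ^ nm" and "gam_1_q21 L = kap1 L ^ ne"
 by (simp_all add: kap_def gam_def gam_1_q_def gam_q_q1_def gam_1_qq1_def gam_1_q21_def ng_def nr_def nG_def ne_def nm_def
   power_mult)

text \<open>Modulo pi the q-th power is additive, so q-th roots of congruences can be taken up to
  level \<open>no\<close>.\<close>

lemma cg_root: assumes "cg (q * n) (a ^ q) (b ^ q)" "q * n <= no" "V 0 a" "V 0 b" shows "cg n a b"
proof (rule cgI[OF assms(4)])
 have "U (q * n) ((a - b) ^ q)"
  using cg_trans[OF cg_mono[OF cg_frob_diff[OF assms(3,4)] assms(2)] cg_diff[OF assms(1) cg_refl[OF cg_V0(2)[OF assms(1)]]]]
  by (simp add: cg_0)
 thus "U n (a - b)"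
 proof (cases "a - b = 0")
  case False
  then obtain s where s: "val L (a - b) = ereal s" by (rule val_real)
  assume "U (q * n) ((a - b) ^ q)"
  hence "real q * (real n * tt) <= real q * s" using V_val[OF val_power[OF s]] by (simp add: U_def)
  thus ?thesis using V_val[OF s] q3 by (simp add: U_def)
 qed simp
qed

lemma gam_choices: shows "gam0 L ^ q = kap1 L ^ (q * ng) * gam0 L + 1" and "gamt0 L ^ q = gam0 L"
  and "gamt1 L ^ q = - (kap1 L ^ nr * gamt1 L) - gamt0 L"
proof -
 have c: "gam0 L ^ q - gam L ^ q * gam0 L = 1" "gamt0 L ^ q = gam0 L" "gamt1 L ^ q + gamt0 L + gam_1_q L * gamt1 L = 0"
  using choices by (auto simp: lt_choices_def)
 have g: "gam L ^ q = kap1 L ^ (q * ng)" unfolding gam_eqs(2) power_mult[symmetric] by (simp add: mult.commute)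
 show "gam0 L ^ q = kap1 L ^ (q * ng) * gam0 L + 1" using c(1) unfolding g by (simp add: diff_eq_eq)
 show "gamt0 L ^ q = gam0 L" by (rule c(2))
 show "gamt1 L ^ q = - (kap1 L ^ nr * gamt1 L) - gamt0 L"
 proof -
  have "gamt1 L ^ q + (gamt0 L + kap1 L ^ nr * gamt1 L) = 0" using c(3) by (simp only: gam_eqs add.assoc)
  hence "gamt1 L ^ q = - (gamt0 L + kap1 L ^ nr * gamt1 L)" by (simp only: eq_neg_iff_add_eq_0)
  thus ?thesis by simp
 qed
qed

lemma gam0_facts: "V 0 (gam0 L)" "cg ng (gam0 L) 1" "V 0 (gamt0 L)" "rd (gamt0 L) = 1" "V 0 (gamt1 L)"
proof -
 have k: "V 0 (kap1 L ^ n)" for n by (rule U_V0[OF U_kap1])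
 show v: "V 0 (gam0 L)" by (rule V0_of_monic[OF gam_choices(1) k V_1])
 have "cg (q * ng) (gam0 L ^ q) (1 ^ q)" unfolding gam_choices
  by (rule cgI) (use U_mult[OF U_kap1[of "q * ng"], of 0 "gam0 L"] v in "simp_all add: V_1 U_0")
 thus c: "cg ng (gam0 L) 1" by (rule cg_root[OF _ nums(30) v V_1])
 show v0: "V 0 (gamt0 L)" by (rule V0_of_monic[of _ 0 "gam0 L"]) (simp_all add: gam_choices v)
 have "0 < ng" using nums(7,6,16,18) by linarith
 hence "rd (gam0 L) = 1" using cg_rd[OF c] by (simp add: rd_1)
 hence "rd (gamt0 L) ^ q = 1" using gam_choices(2) v0 by (metis rd_power)
 hence "(rd (gamt0 L) - 1 + 1) ^ q ^ 1 = 1" by simp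
 hence "(rd (gamt0 L) - 1) ^ q ^ 1 = 0" unfolding rd_frob_add by simp
 thus "rd (gamt0 L) = 1" by simp
 have "gamt1 L ^ q = (- (kap1 L ^ nr)) * gamt1 L + (- gamt0 L)" by (simp add: gam_choices)
 thus "V 0 (gamt1 L)" by (rule V0_of_monic) (simp_all add: k v0 N_uminus)
qed

text \<open>For nonzero t the equation reads t^(q^2) = A t with a unit A of residue -1, so the
  contraction results \<open>frob_solution\<close> and \<open>frob_unique\<close> apply.\<close>

lemma yhat_ex1: assumes y0: "y0 ~= 0" "y0 ^ nm = -1"
 shows "\<exists>!t. reduces_to L t y0 & t ^ nm = - (gamt0 L ^ (q - 1))"
proof -
 define A where "A = - (gamt0 L ^ (q - 1))"
 have u: "val L (gamt0 L) = 0" unfolding val_unit_iff using gam0_facts by simp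
 have uA: "val L A = 0" unfolding A_def val_uminus by (rule val_power_unit[OF u])
 have "V 0 A" "rd A ~= 0" using uA unfolding val_unit_iff by auto
 moreover have "V 0 (inverse A)" using val_inverse_unit[OF uA] unfolding val_unit_iff by auto
 moreover have "A ~= 0" using uA by auto
 moreover have "rd A = -1" unfolding A_def using gam0_facts(3,4) by (simp add: rd_uminus rd_power N_power0)
 ultimately have A: "V 0 A" "V 0 (inverse A)" "inverse A * A = 1" "rd A = -1" "A ~= 0" by simp_all
 have red: "reduces_to L t c <-> V 0 t & rd t = c" for t c by (simp add: reduces_to_def OC_iff)
 have pw: "t ^ q ^ 2 = t * t ^ nm" for t :: "'a::monoid_mult" unfolding nums(5)[symmetric] by simp
 obtain t0 where t0: "V 0 t0" "rd t0 = y0" by (rule rd_exists)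
 have "rd (t0 ^ q ^ 2 - A * t0) = y0 ^ q ^ 2 + y0" using t0 A by (simp add: rd_diff rd_power rd_mult N_power0 N_mult_left)
 also have "... = 0" unfolding pw y0(2) by simp
 finally obtain r where r: "0 < r" "V r (t0 ^ q ^ 2 - A * t0)"
  using rd_0_iff[of "t0 ^ q ^ 2 - A * t0"] N_diff[OF N_power0[OF t0(1)] N_mult_left[OF A(1) t0(1)], of "q ^ 2"] by (auto simp: mC_iff)
 define T where "T = rec_nat t0 (%_ t. inverse A * t ^ q ^ 2)"
 have T: "T 0 = t0" "T (Suc n) = inverse A * T n ^ q ^ 2" for n by (simp_all add: T_def)
 obtain t where t: "T \<longlonglongrightarrow> t" "t ^ q ^ 2 = A * t" "V (min r 1) (t - T 0)"
  by (rule frob_solution[OF A(1-3), of T "min r 1" 2]) (use t0 r T N_mono[OF r(2), of "min r 1"] in simp_all)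
 have tV: "V 0 t" by (rule V0_trans[OF t(3)]) (use r T t0 in simp_all)
 have tr: "rd t = y0" using rd_eqI[OF t(3)] r T t0 by simp
 hence "t ~= 0" using y0 by auto
 hence tA: "t ^ nm = A" using t(2) by (simp add: pw)
 show ?thesis unfolding A_def[symmetric] red
 proof (rule ex1I[of _ t])
  show "(V 0 t & rd t = y0) & t ^ nm = A" using tV tr tA by simp
  fix s assume s: "(V 0 s & rd s = y0) & s ^ nm = A"
  hence "s - t \<in> mC L" using rd_eq_iff[of s t] tV tr by simp
  then obtain e where e: "0 < e" "V e (s - t)" by (auto simp: mC_iff)
  show "s = t"
   by (rule frob_unique[OF A(2) _ _ A(3) tV e(2) e(1), of 2]) (use s tA in "simp_all add: pw mult.commute")
 qed
qed

lemma yhat_facts: assumes "j \<in> S00 L i"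
 shows "V 0 (yhat L j)" "rd (yhat L j) = snd j" "yhat L j ^ nm = - (gamt0 L ^ (q - 1))" "val L (yhat L j) = 0"
  and "V 0 t ==> rd t = snd j ==> t ^ nm = - (gamt0 L ^ (q - 1)) ==> t = yhat L j"
proof -
 have j: "snd j ~= 0" "snd j ^ nm = -1" using assms by (auto simp: S00_def nm_def)
 note ex = yhat_ex1[OF j]
 have y: "yhat L j = (THE t. reduces_to L t (snd j) & t ^ nm = - (gamt0 L ^ (q - 1)))" by (simp add: yhat_def nm_def)
 have *: "reduces_to L (yhat L j) (snd j) & yhat L j ^ nm = - (gamt0 L ^ (q - 1))" unfolding y by (rule theI'[OF ex])
 thus "V 0 (yhat L j)" "rd (yhat L j) = snd j" "yhat L j ^ nm = - (gamt0 L ^ (q - 1))" by (simp_all add: reduces_to_def OC_iff)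
 thus "val L (yhat L j) = 0" unfolding val_unit_iff using j by simp
 show "V 0 t ==> rd t = snd j ==> t ^ nm = - (gamt0 L ^ (q - 1)) ==> t = yhat L j"
  using ex * by (auto simp: reduces_to_def OC_iff)
qed

subsection \<open>The effect of the action on \<open>x\<^sup>qy - xy\<^sup>q\<close> and on \<open>\<Z>\<close>\<close>

text \<open>Moore determinants of (x, y) for the powers q, q^2 and q^3, up to sign.\<close>

abbreviation WW :: "'c => 'c => 'c" where "WW x y \<equiv> x ^ q * y - x * y ^ q"
abbreviation QQ :: "'c => 'c => 'c" where "QQ x y \<equiv> x ^ q ^ 2 * y - x * y ^ q ^ 2"
abbreviation VV :: "'c => 'c => 'c" where "VV x y \<equiv> x ^ q ^ 3 * y - x * y ^ q ^ 3"

lemma pow_q: "x ^ q ^ 2 = (x ^ q) ^ q" "x ^ q ^ 3 = ((x ^ q) ^ q) ^ q" for x :: "'a::monoid_mult"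
 by (simp_all add: power2_eq_square power3_eq_cube power_mult)

lemma cg_WW_power: assumes "V 0 x" "V 0 y" shows "cg no (WW x y ^ q) (x ^ q ^ 2 * y ^ q - x ^ q * y ^ q ^ 2)"
  and "cg no (QQ x y ^ q) (x ^ q ^ 3 * y ^ q - x ^ q * y ^ q ^ 3)"
  and "cg no ((WW x y ^ q) ^ q) (x ^ q ^ 3 * y ^ q ^ 2 - x ^ q ^ 2 * y ^ q ^ 3)"
proof -
 have v: "V 0 (x ^ n)" "V 0 (y ^ n)" for n using assms N_power0 by blast+
 have 1: "V 0 x'" "V 0 y'" "V 0 x" "V 0 y ==> True" if "V 0 x'" "V 0 y'" for x' y' using that assms by auto
 have g: "cg no ((a * y' - x' * b) ^ q) (a ^ q * y' ^ q - x' ^ q * b ^ q)" if "V 0 a" "V 0 b" "V 0 x'" "V 0 y'" for a b x' y'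
  using cg_frob_diff[OF N_mult_left[OF that(1,4)] N_mult_left[OF that(3,2)]] by (simp add: power_mult_distrib)
 show W: "cg no (WW x y ^ q) (x ^ q ^ 2 * y ^ q - x ^ q * y ^ q ^ 2)" unfolding pow_q by (rule g) (rule v assms)+
 show "cg no (QQ x y ^ q) (x ^ q ^ 3 * y ^ q - x ^ q * y ^ q ^ 3)" unfolding pow_q by (rule g) (rule N_power0 v assms)+
 have "cg no ((x ^ q ^ 2 * y ^ q - x ^ q * y ^ q ^ 2) ^ q) (x ^ q ^ 3 * y ^ q ^ 2 - x ^ q ^ 2 * y ^ q ^ 3)"
  unfolding pow_q by (rule g) (rule N_power0 v assms)+
 with cg_power[OF W, of q] show "cg no ((WW x y ^ q) ^ q) (x ^ q ^ 3 * y ^ q ^ 2 - x ^ q ^ 2 * y ^ q ^ 3)" by (rule cg_trans)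
qed

text \<open>The terms of degree 1, q and q^2 of the lifted isomorphism at X = kappa x, divided by
  kappa = kappa_1^q: the exponents are q^2 - q = ne and q^3 - q = na.\<close>

definition new_coord :: "'c => 'c => 'c => 'c => 'c" where
 "new_coord c v dt x = c * x + (v * kap1 L ^ ne * x ^ q + dt * kap1 L ^ na * x ^ q ^ 2)"

context
 fixes c v dt :: 'c assumes c: "c ^ q ^ 2 = c" and b: "KO v" and d: "V 0 dt"
begin

lemma cV: "V 0 c" using frob_fixed_V0[OF c] by simp

text \<open>Frobenius multiplies the exponents of kappa_1 by q: the first power pushes the
  \<open>dt\<close> term beyond \<open>nE\<close>, the second the v term.\<close>

lemma new_coord_powers: assumes x: "V 0 x" and x': "cg nE x' (new_coord c v dt x)"
 shows "cg nE (x' ^ q) (c ^ q * x ^ q + v ^ q * kap1 L ^ (q * ne) * x ^ q ^ 2)"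
  and "cg nE (x' ^ q ^ 2) (c * x ^ q ^ 2)" and "cg nE (x' ^ q ^ 3) (c ^ q * x ^ q ^ 3)"
proof -
 have bV: "V 0 v" using b by (simp add: KO_def)
 have k: "V 0 (kap1 L ^ n)" for n by (rule U_V0[OF U_kap1])
 have v: "V 0 (x ^ n)" for n by (rule N_power0[OF x])
 define A B D where "A = c * x" "B = v * kap1 L ^ ne * x ^ q" "D = dt * kap1 L ^ na * x ^ q ^ 2"
 note ABD = A_B_D_def
 have V: "V 0 A" "V 0 B" "V 0 D" unfolding ABD by (intro N_mult_left cV bV d k v x)+
 note E = nums(10)
 have "U (na + 0) D" unfolding ABD using U_mult[OF U_mult0[OF d U_kap1], of 0 "x ^ q ^ 2" na] v by (simp add: U_0)
 hence "U (q * na) (D ^ q)" by (simp add: U_power)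
 hence D0: "cg nE (D ^ q) 0" unfolding cg_0 by (rule U_mono[OF _ nums(11)])
 have "cg nE ((A + (B + D)) ^ q) (A ^ q + (B + D) ^ q)" by (rule cg_mono[OF cg_frob[OF V(1) N_add[OF V(2,3)]] E])
 moreover have "cg nE ((B + D) ^ q) (B ^ q + D ^ q)" by (rule cg_mono[OF cg_frob[OF V(2,3)] E])
 hence "cg nE ((B + D) ^ q) (B ^ q + 0)"
  using cg_add[OF cg_refl[OF N_power0[OF V(2), of q]] D0] by (rule cg_trans)
 from cg_add[OF cg_refl[OF N_power0[OF V(1), of q]] this] have "cg nE (A ^ q + (B + D) ^ q) (A ^ q + (B ^ q + 0))" .
 ultimately have "cg nE ((A + (B + D)) ^ q) (A ^ q + (B ^ q + 0))" by (rule cg_trans)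
 with cg_power[OF x', of q] have "cg nE (x' ^ q) (A ^ q + (B ^ q + 0))"
  unfolding new_coord_def ABD[symmetric] by (rule cg_trans)
 thus 1: "cg nE (x' ^ q) (c ^ q * x ^ q + v ^ q * kap1 L ^ (q * ne) * x ^ q ^ 2)"
  by (simp add: ABD power_mult_distrib pow_q power_mult[symmetric] mult.commute[of ne])
 define B' where "B' = v ^ q * kap1 L ^ (q * ne) * x ^ q ^ 2"
 have B'U: "U (q * ne + 0) B'" unfolding B'_def
  using U_mult[OF U_mult0[OF N_power0[OF bV] U_kap1], of 0 "x ^ q ^ 2"] v by (simp add: U_0)
 hence "U (q * (q * ne)) (B' ^ q)" by (simp add: U_power)
 hence B'0: "cg nE (B' ^ q) 0" unfolding cg_0 by (rule U_mono[OF _ nums(12)])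
 have A'V: "V 0 (c ^ q * x ^ q)" by (intro N_mult_left N_power0 cV x)
 have "cg nE ((c ^ q * x ^ q + B') ^ q) ((c ^ q * x ^ q) ^ q + B' ^ q)" by (rule cg_mono[OF cg_frob[OF A'V U_V0[OF B'U]] E])
 moreover have "cg nE ((c ^ q * x ^ q) ^ q + B' ^ q) ((c ^ q * x ^ q) ^ q + 0)"
  by (rule cg_add[OF cg_refl[OF N_power0[OF A'V]] B'0])
 ultimately have "cg nE ((c ^ q * x ^ q + B') ^ q) ((c ^ q * x ^ q) ^ q + 0)" by (rule cg_trans)
 with cg_power[OF 1, of q] have "cg nE ((x' ^ q) ^ q) ((c ^ q * x ^ q) ^ q + 0)" unfolding B'_def by (rule cg_trans)
 thus 2: "cg nE (x' ^ q ^ 2) (c * x ^ q ^ 2)" using c by (simp add: power_mult_distrib pow_q)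
 from cg_power[OF 2, of q] show "cg nE (x' ^ q ^ 3) (c ^ q * x ^ q ^ 3)" by (simp add: power_mult_distrib pow_q)
qed

context
 fixes x y x' y' :: 'c assumes x: "V 0 x" and y: "V 0 y"
  and x': "cg nE x' (new_coord c v dt x)" and y': "cg nE y' (new_coord c v dt y)"
begin

lemma xy_V: "V 0 (x ^ n)" "V 0 (y ^ n)" "V 0 (kap1 L ^ n)" "V 0 (WW x y)" "V 0 (QQ x y)" "V 0 (VV x y)" "V 0 v"
 using x y b by (auto simp: KO_def intro!: N_power0 N_diff N_mult_left U_V0[OF U_kap1])

lemma new_WW: "cg nE (WW x' y') (c * c ^ q * WW x y + c * v ^ q * kap1 L ^ (q * ne) * QQ x y
   + (v * v ^ q - c ^ q * dt) * kap1 L ^ na * WW x y ^ q)"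
proof -
 define b1 d1 d2 where "b1 = v ^ q * kap1 L ^ (q * ne)" "d1 = v * kap1 L ^ ne" "d2 = dt * kap1 L ^ na"
 note bd = b1_d1_d2_def
 note px = new_coord_powers(1)[OF x x'] note py = new_coord_powers(1)[OF y y']
 have "cg nE (WW x' y') ((c ^ q * x ^ q + b1 * x ^ q ^ 2) * new_coord c v dt y - new_coord c v dt x * (c ^ q * y ^ q + b1 * y ^ q ^ 2))"
  unfolding bd by (intro cg_diff cg_mult px py x' y')
 moreover have "(c ^ q * x ^ q + b1 * x ^ q ^ 2) * new_coord c v dt y - new_coord c v dt x * (c ^ q * y ^ q + b1 * y ^ q ^ 2)
   = c * c ^ q * WW x y + c * b1 * QQ x y + (d1 * b1 - c ^ q * d2) * (x ^ q ^ 2 * y ^ q - x ^ q * y ^ q ^ 2)"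
  unfolding new_coord_def bd(2,3)[symmetric] by (simp add: algebra_simps)
 moreover have "d1 * b1 = v * v ^ q * kap1 L ^ na" unfolding bd nums(2)[symmetric] power_add by simp
 hence dd: "d1 * b1 - c ^ q * d2 = (v * v ^ q - c ^ q * dt) * kap1 L ^ na" by (simp add: bd algebra_simps)
 moreover have "V 0 ((v * v ^ q - c ^ q * dt) * kap1 L ^ na)" "V 0 (c * c ^ q * WW x y)" "V 0 (c * b1 * QQ x y)"
  unfolding bd by (intro N_mult_left N_diff N_power0 xy_V cV d)+
 hence "cg nE (c * c ^ q * WW x y + c * b1 * QQ x y + (v * v ^ q - c ^ q * dt) * kap1 L ^ na * (x ^ q ^ 2 * y ^ q - x ^ q * y ^ q ^ 2))
   (c * c ^ q * WW x y + c * b1 * QQ x y + (v * v ^ q - c ^ q * dt) * kap1 L ^ na * WW x y ^ q)"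
  by (intro cg_add cg_mult cg_refl cg_mono[OF cg_sym[OF cg_WW_power(1)[OF x y]] nums(10)])
 ultimately show ?thesis by (simp only: bd mult.assoc) (rule cg_trans)
qed

lemma new_VV:
 "cg nE (VV x' y') (c * c ^ q * VV x y + c ^ q * v * kap1 L ^ ne * QQ x y ^ q + c ^ q * dt * kap1 L ^ na * (WW x y ^ q) ^ q)"
proof -
 define d1 d2 where "d1 = v * kap1 L ^ ne" "d2 = dt * kap1 L ^ na"
 note bd = d1_d2_def
 note px = new_coord_powers(3)[OF x x'] note py = new_coord_powers(3)[OF y y']
 have "cg nE (VV x' y') ((c ^ q * x ^ q ^ 3) * new_coord c v dt y - new_coord c v dt x * (c ^ q * y ^ q ^ 3))"
  by (intro cg_diff cg_mult px py x' y')
 moreover have "(c ^ q * x ^ q ^ 3) * new_coord c v dt y - new_coord c v dt x * (c ^ q * y ^ q ^ 3)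
   = c * c ^ q * VV x y + c ^ q * d1 * (x ^ q ^ 3 * y ^ q - x ^ q * y ^ q ^ 3) + c ^ q * d2 * (x ^ q ^ 3 * y ^ q ^ 2 - x ^ q ^ 2 * y ^ q ^ 3)"
  unfolding new_coord_def bd[symmetric] by (simp add: algebra_simps)
 moreover have "V 0 (c * c ^ q * VV x y)" "V 0 (c ^ q * d1)" "V 0 (c ^ q * d2)"
  unfolding bd by (intro N_mult_left N_diff N_power0 xy_V cV d)+
 hence "cg nE (c * c ^ q * VV x y + c ^ q * d1 * (x ^ q ^ 3 * y ^ q - x ^ q * y ^ q ^ 3) + c ^ q * d2 * (x ^ q ^ 3 * y ^ q ^ 2 - x ^ q ^ 2 * y ^ q ^ 3))
   (c * c ^ q * VV x y + c ^ q * d1 * QQ x y ^ q + c ^ q * d2 * (WW x y ^ q) ^ q)"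
  by (intro cg_add cg_mult cg_refl cg_mono[OF cg_sym[OF cg_WW_power(2)[OF x y]] nums(10)]
    cg_mono[OF cg_sym[OF cg_WW_power(3)[OF x y]] nums(10)])
 ultimately show ?thesis by (simp only: bd mult.assoc) (rule cg_trans)
qed

text \<open>The terms in QQ^q cancel between WW^q and gamma VV: q * (q * ne) = ng + ne equalises the
  powers of kappa_1, and v^(q^2) is v modulo pi.\<close>

lemma new_Z: "cg (Suc nG) (WW x' y' ^ q - gam L * VV x' y') (c * c ^ q * (WW x y ^ q - gam L * VV x y)
   + kap1 L ^ nG * ((v ^ q * v ^ q ^ 2 - c * dt ^ q - c ^ q * dt) * (WW x y ^ q) ^ q))"
proof -
 define W Q Y where "W = WW x y" "Q = QQ x y" "Y = VV x y"
 note WQY = W_Q_Y_def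
 have V: "V 0 W" "V 0 Q" "V 0 Y" unfolding WQY by (rule xy_V)+
 define A B e where "A = c * c ^ q * W" "B = c * v ^ q * kap1 L ^ (q * ne) * Q" "e = (v * v ^ q - c ^ q * dt) * kap1 L ^ na"
 note ABe = A_B_e_def
 have VV: "V 0 A" "V 0 B" "V 0 e" "V 0 (e * W ^ q)"
  unfolding ABe by (intro N_mult_left N_diff N_power0 xy_V cV d V)+
 have n: "Suc nG <= no" "Suc nG <= q * nE" "Suc nG <= nE + ng" using nums(13-15) by auto
 have cq: "(c ^ q) ^ q = c" using c by (simp add: pow_q)
 have "cg (q * nE) (WW x' y' ^ q) ((A + B + e * W ^ q) ^ q)"
  using cg_power_q[OF new_WW nums(19)] unfolding WQY[symmetric] ABe[symmetric] .
 hence 1: "cg (Suc nG) (WW x' y' ^ q) ((A + B + e * W ^ q) ^ q)" by (rule cg_mono[OF _ n(2)])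
 have 2: "cg (Suc nG) ((A + B + e * W ^ q) ^ q) ((A + B) ^ q + (e * W ^ q) ^ q)"
  by (rule cg_mono[OF cg_frob[OF N_add[OF VV(1,2)] VV(4)] n(1)])
 have 3: "cg (Suc nG) ((A + B) ^ q) (A ^ q + B ^ q)" by (rule cg_mono[OF cg_frob[OF VV(1,2)] n(1)])
 have Ve: "V 0 (v * v ^ q)" "V 0 (c ^ q * dt)" by (intro N_mult_left N_power0 xy_V cV d)+
 have "cg (Suc nG) ((v * v ^ q - c ^ q * dt) ^ q) ((v * v ^ q) ^ q - (c ^ q * dt) ^ q)"
  by (rule cg_mono[OF cg_frob_diff[OF Ve] n(1)])
 moreover have "(v * v ^ q) ^ q - (c ^ q * dt) ^ q = v ^ q * v ^ q ^ 2 - c * dt ^ q"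
  by (simp add: power_mult_distrib pow_q cq)
 moreover have "(e * W ^ q) ^ q = (v * v ^ q - c ^ q * dt) ^ q * (kap1 L ^ nG * (W ^ q) ^ q)"
  by (simp add: ABe power_mult_distrib power_mult[symmetric] nums(1)[symmetric] mult_ac)
 moreover have "V 0 (kap1 L ^ nG * (W ^ q) ^ q)" by (intro N_mult_left N_power0 V xy_V)
 ultimately have 4: "cg (Suc nG) ((e * W ^ q) ^ q) ((v ^ q * v ^ q ^ 2 - c * dt ^ q) * (kap1 L ^ nG * (W ^ q) ^ q))"
  by (simp only:) (intro cg_mult cg_refl)
 have 5: "cg (Suc nG) (WW x' y' ^ q) (A ^ q + B ^ q + (v ^ q * v ^ q ^ 2 - c * dt ^ q) * (kap1 L ^ nG * (W ^ q) ^ q))"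
  by (rule cg_trans[OF 1 cg_trans[OF 2 cg_add[OF 3 4]]])
 have Aq: "A ^ q = c * c ^ q * W ^ q" by (simp add: ABe power_mult_distrib cq)
 have "q * (q * ne) = ng + ne"
 proof -
  have "q * (q * (q * (q - 1))) = q * ((q - 1) * nm) + q * (q - 1)"
  proof -
   have "(q - 1) * q ^ 2 = (q - 1) * nm + (q - 1)" unfolding nums(5)[symmetric] by simp
   from arg_cong[OF this, of "%z. q * z"] show ?thesis by (simp add: power2_eq_square algebra_simps)
  qed
  thus ?thesis by (simp add: ne_def ng_def nr_def)
 qed
 hence Bq: "B ^ q = c ^ q * v ^ q ^ 2 * (kap1 L ^ ng * kap1 L ^ ne) * Q ^ q"
  unfolding power_add[symmetric] by (simp add: ABe power_mult_distrib pow_q power_mult[symmetric] mult_ac)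
 define V2 where "V2 = c * c ^ q * Y + c ^ q * v * kap1 L ^ ne * Q ^ q + c ^ q * dt * kap1 L ^ na * (W ^ q) ^ q"
 have 6: "cg (Suc nG) (gam L * VV x' y') (kap1 L ^ ng * V2)"
  unfolding gam_eqs V2_def WQY by (rule cg_mono[OF cg_scale[OF new_VV U_kap1] n(3)])
 define R where "R = c ^ q * (kap1 L ^ ng * kap1 L ^ ne) * Q ^ q"
 have RV: "V 0 R" unfolding R_def by (intro N_mult_left N_power0 V xy_V cV)
 have "V 1 (v ^ q ^ 2 - v)" using K_frob2[of v] b by (simp add: KO_def)
 hence "cg (Suc nG) (v ^ q ^ 2) v" by (intro cg_mono[OF cgI n(1)] xy_V) (simp add: U_no)
 hence 7: "cg (Suc nG) (v ^ q ^ 2 * R) (v * R)" by (rule cg_mult[OF _ cg_refl[OF RV]])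
 have kk: "kap1 L ^ ng * kap1 L ^ na = kap1 L ^ nG" unfolding power_add[symmetric] using nums(21) by (simp add: add.commute)
 define M where "M = v ^ q * v ^ q ^ 2 - c * dt ^ q"
 define T where "T = c * c ^ q * W ^ q + M * (kap1 L ^ nG * (W ^ q) ^ q) - kap1 L ^ ng * (c * c ^ q * Y) - c ^ q * dt * (kap1 L ^ nG * (W ^ q) ^ q)"
 have MV: "V 0 M" unfolding M_def by (intro N_diff N_mult_left N_power0 xy_V cV d)
 have TV: "V 0 T" unfolding T_def by (intro N_add N_diff N_mult_left N_power0 V xy_V cV d MV)
 define E where "E = A ^ q + B ^ q + M * (kap1 L ^ nG * (W ^ q) ^ q) - kap1 L ^ ng * V2"
 have "cg (Suc nG) (WW x' y' ^ q - gam L * VV x' y') E" using cg_diff[OF 5 6] unfolding E_def M_def .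
 moreover have "E = T + v ^ q ^ 2 * R - v * R"
  unfolding E_def V2_def Aq Bq T_def R_def kk[symmetric] by (simp add: algebra_simps)
 moreover have "cg (Suc nG) (T + v ^ q ^ 2 * R - v * R) (T + v * R - v * R)"
  by (intro cg_diff cg_add 7 cg_refl TV N_mult_left RV xy_V)
 ultimately have "cg (Suc nG) (WW x' y' ^ q - gam L * VV x' y') (T + v * R - v * R)" using cg_trans by metis
 moreover have "T + v * R - v * R = c * c ^ q * (W ^ q - gam L * Y) + kap1 L ^ nG * ((M - c ^ q * dt) * (W ^ q) ^ q)"
  unfolding T_def gam_eqs by (simp add: algebra_simps)
 ultimately show ?thesis by (simp add: M_def WQY)
qed

end

end

end

section \<open>Estimates for the coordinates a and z_1\<close>

context lt_choice
begin

lemma cg_sum: "(!!i. i \<in> A ==> cg n (f i) (g i)) ==> cg n (sum f A) (sum g A)"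
 by (induction A rule: infinite_finite_induct) (auto intro: cg_add cg_refl)

text \<open>The middle binomials are divisible by pi, so f_1 is a polynomial with integral
  coefficients; in this form it visibly preserves congruences.\<close>

definition f1sum :: "'c => 'c => 'c" where
 "f1sum X Y = - (\<Sum>k\<in>{0<..<q}. (of_nat (q choose k) / \<pi>') * (X ^ k * (- Y) ^ (q - k)))"

lemma poly_f1_eq: "poly_f1 L X Y = f1sum X Y"
proof -
 have "(X + - Y) ^ q = (\<Sum>k\<le>q. of_nat (q choose k) * X ^ k * (- Y) ^ (q - k))" by (rule binomial_ring)
 also have "{..q} = insert 0 (insert q {0<..<q})" by auto
 also have "(\<Sum>k\<in>insert 0 (insert q {0<..<q}). of_nat (q choose k) * X ^ k * (- Y) ^ (q - k))
   = (- Y) ^ q + (X ^ q + (\<Sum>k\<in>{0<..<q}. of_nat (q choose k) * X ^ k * (- Y) ^ (q - k)))"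
  using q3 by (subst sum.insert, simp, simp)+ simp
 finally have "X ^ q - Y ^ q - (X - Y) ^ q = - (\<Sum>k\<in>{0<..<q}. of_nat (q choose k) * X ^ k * (- Y) ^ (q - k))"
  using q_odd by simp
 thus ?thesis unfolding poly_f1_def f1sum_def by (simp add: sum_divide_distrib mult.assoc)
qed

lemma cg_f1: assumes "cg n X X'" "cg n Y Y'" shows "cg n (poly_f1 L X Y) (poly_f1 L X' Y')"
 unfolding poly_f1_eq f1sum_def
proof (intro cg_uminus cg_sum cg_mult cg_power assms cg_refl)
 fix k assume "k \<in> {0<..<q}"
 thus "V 0 (of_nat (q choose k) / \<pi>')" using N_binom[of k] by (simp add: V_unif_div)
qed

lemma poly_f1_homogeneous: "k ^ q = k ==> poly_f1 L (k * X) (k * Y) = k * poly_f1 L X Y"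
 unfolding poly_f1_def right_diff_distrib[symmetric] power_mult_distrib
 by simp

subsection \<open>Estimates at a point of the affinoid\<close>

definition acoord :: "'c => 'c => 'c" where
 "acoord t W = (W - t * gamt0 L - kap1 L ^ nr * (t * gamt1 L)) / kap1 L ^ na"

definition zcoord :: "'c => 'c => 'c" where "zcoord yh y = (y - yh) / (yh ^ q * kap1 L ^ ne)"

context
 fixes x y t yh :: 'c assumes x: "V 0 x" and y: "V 0 y" and t: "t ^ q = t" "val L t = 0"
  and yh: "val L yh = 0" "yh ^ nm = - (gamt0 L ^ (q - 1))" and yy: "U ne (y - yh)"
  and Z: "U nG (t * gam0 L - (WW x y ^ q - gam L * VV x y))"
begin

private definition "g = y ^ (q - 1)"
text \<open>Small because WW^(q-1) and -y^(q^2-1) are both close to gamt0^(q-1); it measures the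
  distance of y from yh.\<close>

private definition "s = WW x y ^ (q - 1) + y ^ nm"

lemma unit_V0: "val L z = 0 ==> V 0 z" by (simp add: val_unit_iff)

lemma pt_V: "V 0 (x ^ n)" "V 0 (y ^ n)" "V 0 (kap1 L ^ n)" "V 0 (WW x y)" "V 0 (QQ x y)" "V 0 (VV x y)" "V 0 t" "V 0 yh"
 "V 0 (gam0 L)" "V 0 (gamt0 L)" "V 0 (gamt1 L)" "V 0 (gam L)"
 unfolding gam_eqs using x y t yh gam0_facts by (auto simp: unit_V0 intro!: N_power0 N_diff N_mult_left U_V0[OF U_kap1])

lemma t_power: "t ^ (q - 1) = 1"
proof -
 have "t * t ^ (q - 1) = t * 1" using t(1) power_eq_if[of t q] q3 by simp
 thus ?thesis using t(2) by auto
qed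

lemma y_cg: "cg ne y yh" by (rule cgI[OF pt_V(8) yy])
lemma y_unit: "val L y = 0" unfolding val_unit_iff
 using cg_rd[OF y_cg nums(7)] y yh(1) by (auto simp: val_unit_iff)

lemma W_q: "cg ng (WW x y ^ q) (t * gam0 L)"
proof (rule cgI)
 show "V 0 (t * gam0 L)" by (intro N_mult_left pt_V)
 have "U ng (gam L * VV x y)" unfolding gam_eqs using U_mult[OF U_kap1[of ng], of 0 "VV x y"] pt_V(6) by (simp add: U_0)
 moreover have "U ng (t * gam0 L - (WW x y ^ q - gam L * VV x y))" using U_mono[OF Z] nums(21) by simp
 ultimately have "U ng (gam L * VV x y - (t * gam0 L - (WW x y ^ q - gam L * VV x y)))" by (rule U_diff)
 thus "U ng (WW x y ^ q - t * gam0 L)" by simp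
qed

lemma W_cg: "cg nr (WW x y) (t * gamt0 L)"
 by (rule cg_root) (use W_q nums(30) in "simp_all add: power_mult_distrib t(1) gam_choices(2) ng_def[symmetric] pt_V N_mult_left nums(17)")
lemma W_q1: "cg nr (WW x y ^ (q - 1)) (gamt0 L ^ (q - 1))"
 using cg_power[OF W_cg, of "q - 1"] unfolding power_mult_distrib t_power by simp

lemma s_U: "U ne s"
proof -
 have "cg ne s (gamt0 L ^ (q - 1) + yh ^ nm)" unfolding s_def
  by (intro cg_add cg_mono[OF W_q1] cg_power y_cg) (use nums(6) in simp)
 thus ?thesis by (simp add: yh(2) cg_0)
qed

lemma y_powers: "y ^ q = y * g" "y ^ q ^ 2 = y * g * g ^ q" "y ^ q ^ 3 = y * g * g ^ q * (g ^ q) ^ q" "y ^ nm = g * g ^ q"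
proof -
 show 1: "y ^ q = y * g" unfolding g_def using power_eq_if[of y q] q3 by simp
 show 2: "y ^ q ^ 2 = y * g * g ^ q" unfolding pow_q 1 power_mult_distrib by simp
 show "y ^ q ^ 3 = y * g * g ^ q * (g ^ q) ^ q" unfolding pow_q 1 power_mult_distrib by simp
 have "y * y ^ nm = y * (g * g ^ q)" using 2 nums(5) by (metis power_Suc mult.assoc)
 thus "y ^ nm = g * g ^ q" using y_unit by auto
qed

lemma g_V: "V 0 g" "V 0 (g ^ q)" "V 0 s" "val L g = 0"
 unfolding g_def using pt_V U_V0[OF s_U] N_power0 val_power_unit[OF y_unit] by auto

text \<open>Multiplication by g = y^(q-1) makes the part with x y^(q^2) a multiple of WW: g QQ =
  (x^(q^2) y^q - x^q y^(q^2)) + WW y^(q^2-1), and the bracket is WW^q modulo pi.\<close>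

lemma Q_cg: "cg no (g * QQ x y) (WW x y * s)"
proof -
 have W: "WW x y * WW x y ^ (q - 1) = WW x y ^ q" using power_eq_if[of "WW x y" q] q3 by simp
 have "g * QQ x y = (x ^ q ^ 2 * y ^ q - x ^ q * y ^ q ^ 2) + WW x y * y ^ nm"
  unfolding y_powers by (simp add: algebra_simps)
 moreover have "WW x y * s = WW x y ^ q + WW x y * y ^ nm" by (simp only: s_def distrib_left W)
 moreover have "cg no (WW x y ^ q + WW x y * y ^ nm) (x ^ q ^ 2 * y ^ q - x ^ q * y ^ q ^ 2 + WW x y * y ^ nm)"
  by (intro cg_add cg_WW_power(1)[OF x y] cg_refl N_mult_left pt_V)
 ultimately show ?thesis by (simp only: cg_sym)
qed

lemma ne_no: "Suc ne <= no" using nums(8,23) by (rule Suc_leI[OF less_le_trans])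

lemma Q_U: "U ne (QQ x y)"
proof -
 have "cg ne (g * QQ x y) (WW x y * s)" by (rule cg_mono[OF Q_cg Suc_leD[OF ne_no]])
 moreover have "cg ne (WW x y * s) 0" unfolding cg_0 by (rule U_mult0[OF pt_V(4) s_U])
 ultimately have "cg ne (g * QQ x y) 0" by (rule cg_trans)
 thus ?thesis using U_unit[OF g_V(4)] by (simp add: cg_0)
qed

text \<open>The elimination of \<open>Q_cg\<close> for the power q^3. With y^(q^2-1) = s - WW^(q-1)
  everything collapses to WW s^(q+1), which has level ne + q * ne = na.\<close>

lemma VW_U: "U na (VV x y + WW x y)"
proof -
 define Y where "Y = g * g ^ q"
 define W where "W = WW x y"
 have Yy: "y ^ nm = Y" by (simp add: Y_def y_powers)
 have V: "V 0 W" "V 0 Y" "V 0 s" "V 0 g" unfolding W_def Y_def by (intro pt_V N_mult_left g_V)+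
 have c1: "g ^ q * (g * VV x y) = g ^ q * (x ^ q ^ 3 * y ^ q - x ^ q * y ^ q ^ 3) + W * Y * Y ^ q"
  unfolding y_powers W_def Y_def power_mult_distrib by (simp add: algebra_simps)
 have c2: "cg no (g ^ q * (x ^ q ^ 3 * y ^ q - x ^ q * y ^ q ^ 3) + W * Y * Y ^ q) (g ^ q * QQ x y ^ q + W * Y * Y ^ q)"
  by (intro cg_add cg_mult cg_refl cg_sym[OF cg_WW_power(2)[OF x y]] N_mult_left N_power0 V g_V)
 have "cg no ((g * QQ x y) ^ q) ((W * s) ^ q)" unfolding W_def by (rule cg_power[OF Q_cg])
 hence c3: "cg no (g ^ q * QQ x y ^ q + W * Y * Y ^ q) (W ^ q * s ^ q + W * Y * Y ^ q)"
  unfolding power_mult_distrib by (intro cg_add cg_refl N_mult_left N_power0 V)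
 have "g ^ q * (g * VV x y) = Y * VV x y" by (simp add: Y_def)
 hence YV: "cg na (Y * VV x y) (W ^ q * s ^ q + W * Y * Y ^ q)"
  using cg_mono[OF cg_trans[OF c2 c3] nums(22)] unfolding c1[symmetric] by (simp only:)
 have sY: "Y = s - W ^ (q - 1)" by (simp add: s_def Yy W_def)
 have Y1: "cg na (Y ^ q) (s ^ q - (W ^ (q - 1)) ^ q)" unfolding sY
  by (rule cg_mono[OF cg_frob_diff nums(22)]) (intro V N_power0)+
 have "cg na ((W ^ q) ^ (q - 1)) ((t * 1) ^ (q - 1))"
  by (intro cg_power cg_trans[OF cg_mono[OF W_q nums(16), folded W_def]] cg_mult cg_refl pt_V cg_mono[OF gam0_facts(2) nums(16)])
 hence "cg na ((W ^ (q - 1)) ^ q) 1"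
  unfolding mult_1_right t_power power_mult[symmetric] by (simp only: mult.commute)
 from cg_trans[OF Y1 cg_diff[OF cg_refl[OF N_power0[OF V(3)]] this]]
 have "cg na (Y ^ q + 1) (s ^ q - 1 + 1)" by (rule cg_add[OF _ cg_refl[OF V_1]])
 hence "cg na (W * Y * (Y ^ q + 1)) (W * Y * s ^ q)" by (simp only: diff_add_cancel) (intro cg_mult cg_refl N_mult_left V)
 from cg_add[OF cg_refl[OF N_mult_left[OF N_power0[OF V(1)] N_power0[OF V(3)]], of na q q] this]
 have e1: "cg na (W ^ q * s ^ q + W * Y * (Y ^ q + 1)) (W ^ q * s ^ q + W * Y * s ^ q)" .
 have Wq: "W * W ^ (q - 1) = W ^ q" using power_eq_if[of W q] q3 by simp
 have e2: "W ^ q * s ^ q + W * Y * s ^ q = W * (s * s ^ q)"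
  unfolding Wq[symmetric] by (subst sY) (simp add: algebra_simps)
 have "U (ne + q * ne) (s * s ^ q)" by (rule U_mult[OF s_U U_power[OF s_U]])
 hence "U na (W * (s * s ^ q))" using U_mult0[OF V(1)] nums(2) by (simp add: add.commute)
 hence "cg na (W * (s * s ^ q)) 0" by (simp only: cg_0)
 hence e3: "cg na (W ^ q * s ^ q + W * Y * (Y ^ q + 1)) 0" by (rule cg_trans[OF e1[unfolded e2]])
 have e4: "cg na (Y * VV x y + Y * W) (W ^ q * s ^ q + W * Y * Y ^ q + Y * W)"
  by (intro cg_add YV cg_refl N_mult_left V)
 have e5: "W ^ q * s ^ q + W * Y * Y ^ q + Y * W = W ^ q * s ^ q + W * Y * (Y ^ q + 1)" by (simp add: algebra_simps)
 have "cg na (Y * VV x y + Y * W) 0" by (rule cg_trans[OF e4[unfolded e5] e3])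
 hence "U na (Y * (VV x y + W))" by (simp add: cg_0 distrib_left)
 moreover have "val L Y = 0" unfolding Y_def by (intro val_mult_unit val_power_unit g_V)
 ultimately show ?thesis by (simp add: U_unit W_def)
qed

text \<open>The value of the coordinate a at the point, once t is the Teichmueller lift of
  zeta.\<close>

abbreviation "aa \<equiv> acoord t (WW x y)"

text \<open>For the numerator H of a the condition on Z becomes H^q + gamma H = 0 up to level nG. If
  v(H) were below level na, then H^q would have smaller valuation than gamma H and than level nG, as
  ng = (q - 1) na and nG = q na.\<close>

lemma aa_V: "V 0 aa"
proof -
 define H where "H = WW x y - t * gamt0 L - kap1 L ^ nr * (t * gamt1 L)"
 define W where "W = WW x y"
 have V: "V 0 H" "V 0 W" "V 0 (t * gamt0 L)" "V 0 (kap1 L ^ nr * (t * gamt1 L))"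
  unfolding H_def W_def by (intro N_diff N_mult_left pt_V)+
 have W: "W = t * gamt0 L + kap1 L ^ nr * (t * gamt1 L) + H" by (simp add: H_def W_def)
 have "cg no (W ^ q) ((t * gamt0 L) ^ q + (kap1 L ^ nr * (t * gamt1 L)) ^ q + H ^ q)" unfolding W
  by (rule cg_trans[OF cg_frob[OF N_add[OF V(3,4)] V(1)] cg_add[OF cg_frob[OF V(3,4)] cg_refl[OF N_power0[OF V(1)]]]])
 hence "cg nG (W ^ q) ((t * gamt0 L) ^ q + (kap1 L ^ nr * (t * gamt1 L)) ^ q + H ^ q)"
  by (rule cg_mono) (use nums(15) in simp)
 moreover have "(t * gamt0 L) ^ q + (kap1 L ^ nr * (t * gamt1 L)) ^ q + H ^ q
   = t * gam0 L - gam L * W + (H ^ q + gam L * H)"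
  unfolding W by (simp add: power_mult_distrib t gam_choices gam_eqs ng_def power_mult[symmetric] mult.commute[of nr] algebra_simps)
 ultimately have 1: "U nG (W ^ q - (t * gam0 L - gam L * W + (H ^ q + gam L * H)))" using cg_U by metis
 have "U (ng + na) (gam L * (VV x y + W))" unfolding gam_eqs W_def by (rule U_mult[OF U_kap1 VW_U])
 hence 2: "U nG (gam L * (VV x y + W))" using nums(21) by (simp add: add.commute)
 from U_diff[OF U_diff[OF 2 Z] 1] have HU: "U nG (H ^ q + gam L * H)" by (simp add: W_def algebra_simps)
 have "U na H"
 proof (cases "H = 0")
  case False
  then obtain r where r: "val L H = ereal r" by (rule val_real)
  show ?thesis
  proof (rule ccontr)
   assume "~ U na H"
   hence lt: "r < real na * tt" using V_val[OF r] by (simp add: U_def)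
   have "real ng = (real q - 1) * real na" unfolding ng_def nr_def na_def using q3 by (simp add: of_nat_diff)
   moreover have "(real q - 1) * r < (real q - 1) * (real na * tt)" using lt q3 by (intro mult_strict_left_mono) auto
   ultimately have "(real q - 1) * r < real ng * tt" by simp
   hence l1: "real q * r < real ng * tt + r" unfolding left_diff_distrib by simp
   have "real q * r < real q * (real na * tt)" using lt q3 by (intro mult_strict_left_mono) auto
   hence l2: "real q * r < real nG * tt" unfolding nums(1)[symmetric] by simp
   define m where "m = min (real ng * tt + r) (real nG * tt)"
   have "V (real ng * tt + r) (gam L * H)" unfolding gam_eqs
    by (rule N_mult) (use U_kap1[of ng] V_val[OF r] in "simp_all add: U_def")
   hence "V m (gam L * H)" by (rule N_mono) (simp add: m_def)
   moreover have "V m (H ^ q + gam L * H)" using HU unfolding U_def by (rule N_mono) (simp add: m_def)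
   ultimately have "V m (H ^ q + gam L * H - gam L * H)" by (intro N_diff)
   hence "m <= real q * r" using V_val[OF val_power[OF r]] by simp
   thus False using l1 l2 by (simp add: m_def)
  qed
 qed simp
 thus ?thesis using U_kap1_div[of 0 H na] by (simp add: acoord_def H_def U_0)
qed

abbreviation "zz \<equiv> zcoord yh y"

lemma zz_V: "V 0 zz"
proof -
 have u: "val L (inverse (yh ^ q)) = 0" by (intro val_inverse_unit val_power_unit yh)
 have "zz = inverse (yh ^ q) * ((y - yh) / kap1 L ^ ne)" by (simp add: zcoord_def divide_inverse)
 moreover have "U 0 ((y - yh) / kap1 L ^ ne)" unfolding U_kap1_div using yy by simp
 ultimately have "U 0 zz" using U_unit[OF u] by (simp only:)
 thus ?thesis by (simp only: U_0)
qed

lemma y_zz: "y = yh + yh ^ q * kap1 L ^ ne * zz"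
proof -
 have "yh ~= 0" using yh by auto
 thus ?thesis using kap1_nz[of ne] by (simp add: zcoord_def)
qed

text \<open>With y = yh (1 + e) the factor s is e gamt0^(q-1) to first order, and e is z_1 up to
  known factors. It is through QQ that z_1 enters the formula for the new a.\<close>

lemma Q_zz: "U 1 (QQ x y / kap1 L ^ ne - t * zz)"
proof -
 define e where "e = yh ^ (q - 1) * kap1 L ^ ne * zz"
 define W where "W = WW x y"
 define Y where "Y = y ^ nm"
 have yq: "yh ^ q = yh * yh ^ (q - 1)" using power_eq_if[of yh q] q3 by simp
 have ye: "y = yh * (1 + e)" by (subst y_zz) (simp add: e_def yq algebra_simps)
 have eU: "U ne e" unfolding e_def using U_mult[OF U_mult0[OF N_power0[OF pt_V(8)] U_kap1], of 0 zz] zz_V by (simp add: U_0)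
 have eV: "V 0 e" "V 0 (1 + e)" using U_V0[OF eU] by (auto intro: N_add V_1)
 have e1: "cg ne (1 + e) 1" by (rule cgI) (simp_all add: V_1 eU)
 note n = nums(6,8,26)
 have "cg (q * ne) (((1 + e) ^ q) ^ q) ((1 ^ q) ^ q)" by (rule cg_power[OF cg_power_q[OF e1 n(3)]])
 hence "cg (Suc ne) ((1 + e) ^ q ^ 2) 1" unfolding pow_q power_one by (rule cg_mono) (rule Suc_leI[OF n(2)])
 hence "cg (Suc ne) (yh ^ nm * (1 + e) ^ q ^ 2) (yh ^ nm * 1)" by (intro cg_mult cg_refl N_power0 pt_V)
 moreover have "(1 + e) * Y = yh ^ nm * (1 + e) ^ q ^ 2"
 proof -
  have p: "z ^ q ^ 2 = z * z ^ nm" for z :: 'c unfolding nums(5)[symmetric] by simp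
  have "yh * ((1 + e) * Y) = y ^ q ^ 2" unfolding p Y_def using ye by simp
  also have "... = yh * (yh ^ nm * (1 + e) ^ q ^ 2)" unfolding ye power_mult_distrib p[of yh] by simp
  finally show ?thesis using yh(1) by auto
 qed
 ultimately have Y: "cg (Suc ne) ((1 + e) * Y) (- (gamt0 L ^ (q - 1)))" by (simp add: yh)
 have "cg (Suc ne) ((1 + e) * WW x y ^ (q - 1)) ((1 + e) * gamt0 L ^ (q - 1))"
  by (intro cg_mult cg_refl eV cg_mono[OF W_q1]) (use n in simp)
 from cg_add[OF this Y] have s: "cg (Suc ne) ((1 + e) * s) (e * gamt0 L ^ (q - 1))"
  by (simp add: s_def Y_def algebra_simps)
 have "cg (Suc ne) (g * QQ x y) (W * s)" unfolding W_def by (rule cg_mono[OF Q_cg ne_no])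
 from cg_mult[OF cg_refl[OF eV(2)] this] have "cg (Suc ne) ((1 + e) * (g * QQ x y)) (W * ((1 + e) * s))"
  by (simp only: mult.left_commute)
 moreover have "cg (Suc ne) (W * ((1 + e) * s)) (t * gamt0 L * (e * gamt0 L ^ (q - 1)))"
  unfolding W_def by (intro cg_mult s cg_mono[OF W_cg]) (use n in simp)
 moreover have "gamt0 L * gamt0 L ^ (q - 1) = gam0 L" using power_eq_if[of "gamt0 L" q] q3 gam_choices(2) by simp
 hence "t * gamt0 L * (e * gamt0 L ^ (q - 1)) = t * e * gam0 L" by simp
 moreover have "cg (Suc ne) (t * e * gam0 L) (t * e * 1)"
  by (intro cg_mult cg_refl pt_V eV cg_mono[OF gam0_facts(2)]) (use nums(16,18) in linarith)
 ultimately have "cg (Suc ne) ((1 + e) * (g * QQ x y)) (t * e * 1)" using cg_trans by metis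
 hence "U (1 + ne) ((1 + e) * (g * QQ x y) - t * e)" using cg_U by fastforce
 hence "U 1 (((1 + e) * (g * QQ x y) - t * e) / kap1 L ^ ne)" unfolding U_kap1_div .
 moreover define Q' where "Q' = QQ x y / kap1 L ^ ne"
 have QV: "V 0 Q'" using U_kap1_div[of 0 "QQ x y" ne] Q_U by (simp add: Q'_def U_0)
 have "((1 + e) * (g * QQ x y) - t * e) / kap1 L ^ ne = (1 + e) * g * Q' - yh ^ (q - 1) * (t * zz)"
  using kap1_nz[of ne] by (simp add: Q'_def e_def field_simps)
 ultimately have 1: "U 1 ((1 + e) * g * Q' - yh ^ (q - 1) * (t * zz))" by simp
 have "cg 1 ((1 + e) * g * Q') (1 * yh ^ (q - 1) * Q')"
  unfolding g_def by (intro cg_mult cg_refl QV cg_power cg_mono[OF e1] cg_mono[OF y_cg]) (use nums(7) in simp_all)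
 from U_diff[OF 1 cg_U[OF this]] have "U 1 (yh ^ (q - 1) * (Q' - t * zz))" by (simp add: right_diff_distrib)
 thus ?thesis using U_unit[OF val_power_unit[OF yh(1)]] by (simp add: Q'_def)
qed

subsection \<open>The image of a point\<close>

context
 fixes c v dt x' y' :: 'c
 assumes c: "c ^ q ^ 2 = c" "c ~= 0" and b: "KO v" and d: "V 0 dt"
  and x': "cg nE x' (new_coord c v dt x)" and y': "cg nE y' (new_coord c v dt y)"
begin

lemma c_unit: "val L c = 0" "V 0 c"
proof -
 show "V 0 c" by (rule cV[OF c(1) b d])
 moreover have "rd c ~= 0"
 proof
  assume "rd c = 0"
  hence "c = 0" using frob_fixed_eq[OF c(1), of 0] q3 by simp
  thus False using c by simp
 qed
 ultimately show "val L c = 0" by (simp add: val_unit_iff)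
qed

lemma bV: "V 0 v" using b by (simp add: KO_def)

lemma new_coord_cg: assumes "V 0 z" shows "cg ne (new_coord c v dt z) (c * z)"
 and "cg (Suc ne) (new_coord c v dt z) (c * z + v * kap1 L ^ ne * z ^ q)"
proof -
 have 1: "U ne (v * kap1 L ^ ne * z ^ q)"
  using U_mult[OF U_mult0[OF bV U_kap1], of 0 "z ^ q"] N_power0[OF assms] by (simp add: U_0)
 have "U na (dt * kap1 L ^ na * z ^ q ^ 2)"
  using U_mult[OF U_mult0[OF d U_kap1], of 0 "z ^ q ^ 2"] N_power0[OF assms] by (simp add: U_0)
 hence 2: "U (Suc ne) (dt * kap1 L ^ na * z ^ q ^ 2)" by (rule U_mono) (use nums(18) in simp)
 have V: "V 0 (c * z)" by (rule N_mult_left[OF c_unit(2) assms])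
 show "cg (Suc ne) (new_coord c v dt z) (c * z + v * kap1 L ^ ne * z ^ q)"
  by (rule cgI) (use 2 U_V0[OF 1] V N_add in "simp_all add: new_coord_def")
 show "cg ne (new_coord c v dt z) (c * z)"
  by (rule cgI[OF V]) (use U_add[OF 1 U_mono[OF 2]] in "simp add: new_coord_def")
qed

lemma nE_ne: "Suc ne <= nE" using nums(9,18) by simp
lemma x'_cg: "cg 1 x' (c * x)" and y'_cg: "cg 1 y' (c * y)" using nE_ne nums(7)
 by (intro cg_trans[OF cg_mono[OF x'] cg_mono[OF new_coord_cg(1)[OF x]]] cg_trans[OF cg_mono[OF y'] cg_mono[OF new_coord_cg(1)[OF y]]]; simp)+

lemma W'_cg: "cg 1 (WW x' y') (c * c ^ q * WW x y)"
proof -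
 have "cg 1 (WW x' y') (WW (c * x) (c * y))" by (intro cg_diff cg_mult cg_power x'_cg y'_cg)
 thus ?thesis by (simp add: algebra_simps)
qed

lemma cq: "(c ^ q) ^ q = c" "(c * c ^ q) ^ q = c * c ^ q"
 using c by (simp_all add: pow_q power_mult_distrib)

text \<open>k = c^(q+1) satisfies k^q = k, so f_1 scales by k; the constant comes from the
  kappa_1^nG term of \<open>new_Z\<close>, where WW^(q^2) is congruent to t^q = t.\<close>

lemma Z'_cg: "U 1 (((c * c ^ q * t) * gam0 L - (WW x' y' ^ q - gam L * VV x' y')) / kap1 L ^ nG
  + poly_f1 L (x' ^ q ^ 2 * y' ^ q) (x' ^ q * y' ^ q ^ 2)
  - (c * c ^ q * ((t * gam0 L - (WW x y ^ q - gam L * VV x y)) / kap1 L ^ nG + poly_f1 L (x ^ q ^ 2 * y ^ q) (x ^ q * y ^ q ^ 2))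
   - (v ^ q * v ^ q ^ 2 - c * dt ^ q - c ^ q * dt) * t))"
proof -
 define k where "k = c * c ^ q"
 define M where "M = v ^ q * v ^ q ^ 2 - c * dt ^ q - c ^ q * dt"
 define Z1 Z2 where "Z1 = WW x y ^ q - gam L * VV x y" "Z2 = WW x' y' ^ q - gam L * VV x' y'"
 have MV: "V 0 M" unfolding M_def by (intro N_diff N_mult_left N_power0 bV c_unit d)
 have "cg 1 (poly_f1 L (x' ^ q ^ 2 * y' ^ q) (x' ^ q * y' ^ q ^ 2))
   (poly_f1 L ((c * x) ^ q ^ 2 * (c * y) ^ q) ((c * x) ^ q * (c * y) ^ q ^ 2))"
  by (intro cg_f1 cg_mult cg_power x'_cg y'_cg)
 moreover have "(c * x) ^ q ^ 2 * (c * y) ^ q = k * (x ^ q ^ 2 * y ^ q)" "(c * x) ^ q * (c * y) ^ q ^ 2 = k * (x ^ q * y ^ q ^ 2)"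
  by (simp_all add: power_mult_distrib c k_def)
 ultimately have f: "U 1 (poly_f1 L (x' ^ q ^ 2 * y' ^ q) (x' ^ q * y' ^ q ^ 2) - k * poly_f1 L (x ^ q ^ 2 * y ^ q) (x ^ q * y ^ q ^ 2))"
  using poly_f1_homogeneous[of k] cq(2) cg_U by (simp add: k_def)
 have "U (1 + nG) (Z2 - (k * Z1 + kap1 L ^ nG * (M * (WW x y ^ q) ^ q)))"
  using cg_U[OF new_Z[OF c(1) b d x y x' y']] by (simp add: Z1_Z2_def k_def M_def)
 hence "U 1 ((Z2 - (k * Z1 + kap1 L ^ nG * (M * (WW x y ^ q) ^ q))) / kap1 L ^ nG)" unfolding U_kap1_div .
 moreover have "(Z2 - (k * Z1 + kap1 L ^ nG * (M * (WW x y ^ q) ^ q))) / kap1 L ^ nG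
   = (Z2 - k * Z1) / kap1 L ^ nG - M * (WW x y ^ q) ^ q" using kap1_nz[of nG] by (simp add: field_simps)
 ultimately have 1: "U 1 ((Z2 - k * Z1) / kap1 L ^ nG - M * (WW x y ^ q) ^ q)" by simp
 have ng1: "1 <= ng" using nums(7,16,18) by linarith
 have "cg 1 ((WW x y ^ q) ^ q) ((t * 1) ^ q)"
  by (intro cg_power cg_trans[OF cg_mono[OF W_q ng1]] cg_mult cg_refl pt_V cg_mono[OF gam0_facts(2) ng1])
 hence "cg 1 (M * (WW x y ^ q) ^ q) (M * t)" using t by (intro cg_mult cg_refl MV) simp
 from U_diff[OF f U_add[OF 1 cg_U[OF this]]]
 have "U 1 (poly_f1 L (x' ^ q ^ 2 * y' ^ q) (x' ^ q * y' ^ q ^ 2) - k * poly_f1 L (x ^ q ^ 2 * y ^ q) (x ^ q * y ^ q ^ 2)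
   - ((Z2 - k * Z1) / kap1 L ^ nG - M * t))" by simp
 moreover have "p' - k * p - ((Z2 - k * Z1) / K - M * t) = ((k * t) * g0 - Z2) / K + p' - (k * ((t * g0 - Z1) / K + p) - M * t)"
  for p p' K g0 by (simp add: diff_divide_distrib distrib_left right_diff_distrib)
 ultimately show ?thesis unfolding k_def[symmetric] M_def[symmetric] Z1_Z2_def[symmetric] by (simp only:)
qed

lemma y'_disc: "U ne (y' - c * yh)"
proof -
 have "cg ne y' (c * yh)"
  by (rule cg_trans[OF cg_mono[OF y'] cg_trans[OF new_coord_cg(1)[OF y] cg_mult[OF cg_refl[OF c_unit(2)] y_cg]]])
   (use nE_ne in simp)
 thus ?thesis by (rule cg_U)
qed

lemma z'_cg: "U 1 (zcoord (c * yh) y' - (c * zz + v) / c ^ q)"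
proof -
 have yh0: "yh ~= 0" and k0: "kap1 L ^ ne ~= 0" using yh kap1_nz by auto
 have "cg (Suc ne) y' (c * y + v * kap1 L ^ ne * y ^ q)"
  by (rule cg_trans[OF cg_mono[OF y' nE_ne] new_coord_cg(2)[OF y]])
 hence "U (1 + ne) (y' - (c * y + v * kap1 L ^ ne * y ^ q))" using cg_U by simp
 moreover have "cg (ne + ne) (v * kap1 L ^ ne * y ^ q) (v * kap1 L ^ ne * yh ^ q)"
  by (intro cg_scale cg_power y_cg U_mult0 bV U_kap1)
 hence "U (1 + ne) (v * kap1 L ^ ne * y ^ q - v * kap1 L ^ ne * yh ^ q)"
  by (rule U_mono[OF cg_U]) (use nums(7) in linarith)
 ultimately have "U (1 + ne) (y' - (c * y + v * kap1 L ^ ne * y ^ q) + (v * kap1 L ^ ne * y ^ q - v * kap1 L ^ ne * yh ^ q))" by (rule U_add)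
 hence "U 1 ((y' - (c * y + v * kap1 L ^ ne * y ^ q) + (v * kap1 L ^ ne * y ^ q - v * kap1 L ^ ne * yh ^ q)) / kap1 L ^ ne)"
  unfolding U_kap1_div .
 hence "U 1 (inverse ((c * yh) ^ q) * ((y' - (c * y + v * kap1 L ^ ne * y ^ q) + (v * kap1 L ^ ne * y ^ q - v * kap1 L ^ ne * yh ^ q)) / kap1 L ^ ne))"
  using U_unit[OF val_inverse_unit[OF val_power_unit[OF val_mult_unit[OF c_unit(1) yh(1)]]]] by blast
 moreover have "inverse ((c * yh) ^ q) * ((y' - (c * y + v * kap1 L ^ ne * y ^ q) + (v * kap1 L ^ ne * y ^ q - v * kap1 L ^ ne * yh ^ q)) / kap1 L ^ ne)
   = zcoord (c * yh) y' - (c * zz + v) / c ^ q"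
  unfolding zcoord_def using yh0 k0 c(2) by (simp add: field_simps)
 ultimately show ?thesis by simp
qed

text \<open>\<open>new_WW\<close> divided by kappa_1^na, with QQ eliminated through
  \<open>Q_zz\<close> and WW^q replaced by t.\<close>

lemma a'_cg:
 "U 1 (acoord (c * c ^ q * t) (WW x' y') - (c * c ^ q * aa + c * v ^ q * t * zz + (v * v ^ q - c ^ q * dt) * t))"
proof -
 define k where "k = c * c ^ q"
 define M where "M = v * v ^ q - c ^ q * dt"
 define Q' where "Q' = QQ x y / kap1 L ^ ne"
 have MV: "V 0 M" unfolding M_def by (intro N_diff N_mult_left N_power0 bV c_unit d)
 have "cg nE (WW x' y') (k * WW x y + c * v ^ q * kap1 L ^ (q * ne) * QQ x y + M * kap1 L ^ na * WW x y ^ q)"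
  using new_WW[OF c(1) b d x y x' y'] by (simp add: k_def M_def)
 hence "U (q + na) (WW x' y' - (k * WW x y + c * v ^ q * kap1 L ^ (q * ne) * QQ x y + M * kap1 L ^ na * WW x y ^ q))"
  using nums(4) cg_U by (simp add: add.commute)
 hence "U (1 + na) (WW x' y' - (k * WW x y + c * v ^ q * kap1 L ^ (q * ne) * QQ x y + M * kap1 L ^ na * WW x y ^ q))"
  by (rule U_mono) (use q3 in simp)
 hence "U 1 ((WW x' y' - (k * WW x y + c * v ^ q * kap1 L ^ (q * ne) * QQ x y + M * kap1 L ^ na * WW x y ^ q)) / kap1 L ^ na)"
  unfolding U_kap1_div .
 moreover have ka: "kap1 L ^ na = kap1 L ^ (q * ne) * kap1 L ^ ne" unfolding power_add[symmetric] nums(2) ..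
 have "(w' - (k * w + c * v ^ q * kap1 L ^ (q * ne) * QQ x y + M * kap1 L ^ na * wq)) / kap1 L ^ na
   = (w' - k * w) / kap1 L ^ na - c * v ^ q * Q' - M * wq" for w w' wq
  using kap1_nz[of ne] kap1_nz[of "q * ne"] unfolding ka Q'_def by (simp add: field_simps)
 ultimately have 1: "U 1 ((WW x' y' - k * WW x y) / kap1 L ^ na - c * v ^ q * Q' - M * WW x y ^ q)" by simp
 have "V 0 (c * v ^ q)" by (intro N_mult_left N_power0 bV c_unit)
 from U_mult0[OF this Q_zz] have 2: "U 1 (c * v ^ q * (Q' - t * zz))" by (simp add: Q'_def)
 have ng1: "1 <= ng" using nums(7,16,18) by linarith
 have "cg 1 (WW x y ^ q) (t * 1)"
  by (intro cg_trans[OF cg_mono[OF W_q ng1]] cg_mult cg_refl pt_V cg_mono[OF gam0_facts(2) ng1])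
 hence "cg 1 (M * WW x y ^ q) (M * t)" by (intro cg_mult cg_refl MV) simp
 from U_add[OF U_add[OF 1 2] cg_U[OF this]]
 have "U 1 ((WW x' y' - k * WW x y) / kap1 L ^ na - c * v ^ q * Q' - M * WW x y ^ q + c * v ^ q * (Q' - t * zz)
   + (M * WW x y ^ q - M * t))" (is "U 1 ?L") .
 moreover have alg: "(w' - k * w) / K - cb * Q' - Mw + cb * (Q' - t * zz) + (Mw - M * t)
   = (w' - (k * t) * g0 - r * ((k * t) * g1)) / K - (k * ((w - t * g0 - r * (t * g1)) / K) + cb * t * zz + M * t)"
  for w w' K cb Mw g0 g1 r by (simp add: diff_divide_distrib right_diff_distrib mult_ac)
 have "?L = acoord (k * t) (WW x' y') - (k * aa + c * v ^ q * t * zz + M * t)"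
  unfolding acoord_def by (rule alg)
 ultimately show ?thesis unfolding k_def[symmetric] M_def[symmetric] by (simp only:)
qed

end

end

end

section \<open>The action on points\<close>

context lt_choice
begin

lemma nonneg_disc: "th <= real q / (real q + 1)" "real q / (real q + 1) <= 1"
 using q3 by (simp_all add: field_simps)
lemma fZ_eq: "fZ L P = WW (fx L P) (fy L P) ^ q - gam L * VV (fx L P) (fy L P)" by (simp add: fZ_def fW_def)

lemma coord_a_eq: "coord_a L i P = acoord (teich L (fst i)) (WW (fx L P) (fy L P))"
proof -
 have "kap1 L ^ na = kap1 L ^ nr * kap1 L ^ nm" unfolding power_add[symmetric] nums(3) ..
 thus ?thesis using kap1_nz[of nr] by (simp add: coord_a_def acoord_def gam_eqs fW_def field_simps)
qed

lemma coord_z1_eq: "coord_z1 L j P = zcoord (yhat L j) (fy L P)"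
 by (simp add: coord_z1_def zcoord_def w1_def gam_eqs)
lemma red_iff: "reduces_to L z r <-> V 0 z & rd z = r" by (simp add: reduces_to_def OC_iff)

context
 fixes i j :: "'k \<times> 'k" assumes i: "i \<in> comp_index L" and j: "j \<in> S00 L i"
begin

lemma t_facts: "teich L (fst i) ^ q = teich L (fst i)" "val L (teich L (fst i)) = 0" "rd (teich L (fst i)) = fst i"
 "V 0 (teich L (fst i))" "teich L (fst i) \<in> base L"
 using teich[of "fst i"] i by (auto simp: comp_index_def val_unit_iff)

lemma val_w1: "val L (w1 L j) = ereal (real ne * tt)"
 using val_power_unit[OF yhat_facts(4)[OF j]] val_kap1_power[of ne] by (simp add: w1_def gam_eqs val_mult)
lemma w1_le: "val L (w1 L j) <= val L z <-> U ne z" by (simp add: val_w1 U_def V_def)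

abbreviation "f1P P \<equiv> poly_f1 L (fx L P ^ q ^ 2 * fy L P ^ q) (fx L P ^ q * fy L P ^ q ^ 2)"

text \<open>f_1 takes integral values, so integrality of the function that labels the component is a
  bound on Z alone.\<close>

lemma cond_iff: assumes "V 0 (fx L P)" "V 0 (fy L P)"
 shows "V 0 ((teich L (fst i) * gam0 L - fZ L P) / gam_q_q1 L +
    f1P P)
  <-> U nG (teich L (fst i) * gam0 L - (WW (fx L P) (fy L P) ^ q - gam L * VV (fx L P) (fy L P)))"
proof -
 have "cg 0 (f1P P)
   (f1P P)"
  by (intro cg_f1 cg_refl N_mult_left N_power0 assms)
 hence f: "V 0 (f1P P)" by (rule cg_V0)
 have "V 0 (z + w) <-> V 0 z" if "V 0 w" for z w using N_add[OF _ that] N_diff[OF _ that, of "z + w"] by auto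
 from this[OF f] show ?thesis using U_kap1_div[of 0 _ nG] by (simp add: gam_eqs(4) U_0 fZ_eq)
qed

lemma Xaff_point: assumes P: "P \<in> Xaff L i j"
 shows "P \<in> LT_curve L" "V (real q / (real q + 1)) (snd (snd P))" "V th (snd (snd P))"
  and "V 0 (fx L P)" "V 0 (fy L P)" "rd (fx L P) = fst j" "rd (fy L P) = snd j" and "U ne (fy L P - yhat L j)"
  and "U nG (teich L (fst i) * gam0 L - (WW (fx L P) (fy L P) ^ q - gam L * VV (fx L P) (fy L P)))"
  and "rd (WW (fx L P) (fy L P)) = fst i" and "rd ((teich L (fst i) * gam0 L - fZ L P) / gam_q_q1 L +
    f1P P) = snd i * fst i"
proof -
 have Y: "P \<in> Y22_comp L i" and r: "reduces_to L (fx L P) (fst j)" "reduces_to L (fy L P) (snd j)"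
  and w: "val L (w1 L j) <= val L (fy L P - yhat L j)" using P by (auto simp: Xaff_def)
 have Y2: "P \<in> Y22 L" and rW: "reduces_to L (fW L P) (fst i)" and rZ: "reduces_to L ((teich L (fst i) * gam0 L - fZ L P) / gam_q_q1 L +
    f1P P) (snd i * fst i)"
  using Y by (auto simp: Y22_comp_def)
 show "P \<in> LT_curve L" and u: "V (real q / (real q + 1)) (snd (snd P))" using Y2 by (auto simp: Y22_def V_def)
 show "V th (snd (snd P))" by (rule N_mono[OF u nonneg_disc(1)])
 show xy: "V 0 (fx L P)" "V 0 (fy L P)" and "rd (fx L P) = fst j" "rd (fy L P) = snd j" using r by (auto simp: red_iff)
 show "U ne (fy L P - yhat L j)" using w by (simp only: w1_le)
 show "U nG (teich L (fst i) * gam0 L - (WW (fx L P) (fy L P) ^ q - gam L * VV (fx L P) (fy L P)))"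
  using rZ unfolding red_iff cond_iff[OF xy] by blast
 show "rd (WW (fx L P) (fy L P)) = fst i" using rW by (simp add: red_iff fW_def)
 show "rd ((teich L (fst i) * gam0 L - fZ L P) / gam_q_q1 L +
    f1P P) = snd i * fst i" using rZ by (simp add: red_iff)
qed

lemmas yh = yhat_facts[OF j]

lemma coords_V0: assumes P: "P \<in> Xaff L i j" shows "V 0 (coord_a L i P)" "V 0 (coord_z1 L j P)"
proof -
 note p = Xaff_point[OF P]
 show "V 0 (coord_a L i P)" unfolding coord_a_eq by (rule aa_V[OF p(4,5) t_facts(1,2) yh(4,3) p(8,9)])
 show "V 0 (coord_z1 L j P)" unfolding coord_z1_eq by (rule zz_V[OF p(4,5) t_facts(1,2) yh(4,3) p(8,9)])
qed

end

end

text \<open>Two pairs occur because the action uses the inverse of b: w, v belong to that inverse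
  and give the coordinates, wa, vb belong to b and give the reduced norm.\<close>

locale lt_act = lt_choice L for L :: "('c::{field, complete_space}, 'k::field) lt_data" +
 fixes a0 b0 a1 w v wa vb :: 'c and b :: "'k fps" and i j :: "'k \<times> 'k"
 assumes mu: "a0 ^ q ^ 2 = a0" "b0 ^ q ^ 2 = b0" "a1 ^ q ^ 2 = a1" "a0 ~= 0"
  and ud: "unit_data b a0 b0 a1 wa vb"
  and inv: "KO w" "KO v" "fps_inv b = sbar w v" "rd w = inverse (rd a0)" "rd v = - (rd b0 ^ q / rd a0 ^ (q + 1))"
   "sbar w v $ (q ^ 2) = rd b0 ^ (q + 1) / rd a0 ^ (q + 2) - rd a1 / rd a0 ^ 2"
  and i: "i \<in> comp_index L" and j: "j \<in> S00 L i"
begin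

abbreviation "A0 \<equiv> rd a0"
abbreviation "B0 \<equiv> rd b0"
abbreviation "A1 \<equiv> rd a1"
definition "c = inverse a0"
definition "dt = lam 1 * (w - w ^ q ^ 2)"
definition "t = teich L (fst i)"
definition "ib = act_index L b i"
definition "jb = (fst j * inverse A0, snd j * inverse A0)"
definition "kk = c * c ^ q"

lemma dt: "V 0 dt" "rd dt = B0 ^ (q + 1) / A0 ^ (q + 2) - A1 / A0 ^ 2"
proof -
 have e: "sab w v $ (q ^ 2) = dt" unfolding dt_def by (rule sab_low(4))
 show "V 0 dt" using sabO[OF inv(1,2)] e by (metis fN_def)
 show "rd dt = B0 ^ (q + 1) / A0 ^ (q + 2) - A1 / A0 ^ 2" using inv(6) by (simp add: sbar_def e)
qed

lemma V0s: "V 0 a0" "V 0 b0" "V 0 a1" "V 0 w" "V 0 v"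
 using KO_fixed mu inv(1,2) by (auto simp: KO_def)
lemma A_fixed: "A0 ^ q ^ 2 = A0" "B0 ^ q ^ 2 = B0" "A1 ^ q ^ 2 = A1" using mu V0s by (metis rd_power)+
lemma A_fixed': "(A0 ^ q) ^ q = A0" "(B0 ^ q) ^ q = B0" "(A1 ^ q) ^ q = A1"
 using A_fixed by (simp_all add: pow_q)
lemma c_fixed: "c ^ q ^ 2 = c" "c ~= 0" using mu by (simp_all add: c_def power_inverse)

lemma A0: "A0 ~= 0" "val L a0 = 0"
proof -
 show "A0 ~= 0"
 proof
  assume "A0 = 0"
  hence "a0 = 0" using frob_fixed_eq[OF mu(1), of 0] q3 by simp
  thus False using mu(4) by simp
 qed
 thus "val L a0 = 0" using V0s by (simp add: val_unit_iff)
qed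

lemma c_facts: "val L c = 0" "V 0 c" "rd c = inverse A0"
 unfolding c_def using val_inverse_unit[OF A0(2)] rd_inverse[OF A0(2)] by (auto simp: val_unit_iff)

lemma kk_facts: "V 0 kk" "rd kk = inverse (A0 * A0 ^ q)" "kk ^ q = kk" "val L kk = 0"
proof -
 show "V 0 kk" unfolding kk_def by (intro N_mult_left N_power0 c_facts)
 show "rd kk = inverse (A0 * A0 ^ q)" unfolding kk_def using c_facts
  by (simp add: rd_mult rd_power N_power0 power_inverse)
 show "kk ^ q = kk" unfolding kk_def using c_fixed by (simp add: power_mult_distrib pow_q)
 show "val L kk = 0" unfolding kk_def by (intro val_mult_unit val_power_unit c_facts)
qed

lemma v_powers: "rd v = - (B0 ^ q / (A0 * A0 ^ q))" "rd v ^ q = - (B0 / (A0 * A0 ^ q))"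
proof -
 show 1: "rd v = - (B0 ^ q / (A0 * A0 ^ q))" using inv(5) by simp
 show "rd v ^ q = - (B0 / (A0 * A0 ^ q))" unfolding 1
  using q_odd by (simp add: power_divide power_mult_distrib A_fixed')
qed

lemma dt_powers: "rd dt = B0 * B0 ^ q / (A0 ^ 2 * A0 ^ q) - A1 / A0 ^ 2"
 "rd dt ^ q = B0 * B0 ^ q / ((A0 ^ q) ^ 2 * A0) - A1 ^ q / (A0 ^ q) ^ 2"
proof -
 show 1: "rd dt = B0 * B0 ^ q / (A0 ^ 2 * A0 ^ q) - A1 / A0 ^ 2" unfolding dt(2) power_add power_one_right by (simp only: mult.commute)
 have "(x - y) ^ q = x ^ q - y ^ q" for x y :: 'k using rd_frob_add[of "x - y" y 1] by simp
 moreover have "(z ^ 2) ^ q = (z ^ q) ^ 2" for z :: 'k by (simp add: power_mult[symmetric] mult.commute)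
 ultimately show "rd dt ^ q = B0 * B0 ^ q / ((A0 ^ q) ^ 2 * A0) - A1 ^ q / (A0 ^ q) ^ 2" unfolding 1
  by (simp add: power_divide power_mult_distrib A_fixed')
qed

text \<open>\<open>MZ\<close> and \<open>Ma\<close> are the constants of \<open>Z'_cg\<close> and
  \<open>a'_cg\<close>; \<open>N1\<close> is the residue of the pi-coefficient of the reduced norm.
  The relation between \<open>MZ\<close> and \<open>N1\<close> is what sends the component of i to
  that of ib.\<close>

definition "MZ = v ^ q * v ^ q ^ 2 - c * dt ^ q - c ^ q * dt"
definition "Ma = v * v ^ q - c ^ q * dt"
definition "N1 = A0 * A1 ^ q + A1 * A0 ^ q - B0 * B0 ^ q"

lemma MZ: "rd MZ = N1 / (A0 * A0 ^ q) ^ 2"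
proof -
 have "rd MZ = rd v ^ q * (rd v ^ q) ^ q - rd c * rd dt ^ q - rd c ^ q * rd dt"
  unfolding MZ_def using V0s dt(1) c_facts by (simp add: rd_diff rd_mult rd_power N_power0 N_mult_left N_diff pow_q)
 also have "(rd v ^ q) ^ q = rd v" unfolding v_powers(2) using q_odd by (simp add: power_divide power_mult_distrib A_fixed' v_powers(1))
 finally have e: "rd MZ = rd v ^ q * rd v - rd c * rd dt ^ q - rd c ^ q * rd dt" .
 have alg: "- (b / (a * a')) * - (b' / (a * a')) - inverse a * (b * b' / (a' ^ 2 * a) - d' / a' ^ 2)
   - inverse a' * (b * b' / (a ^ 2 * a') - d / a ^ 2) = (a * d' + d * a' - b * b') / (a * a') ^ 2"
  if "a ~= 0" "a' ~= 0" for a a' b b' d d' :: 'k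
  using that by (simp add: field_simps power2_eq_square)
 have "A0 ^ q ~= 0" using A0 by simp
 from alg[OF A0(1) this, of B0 "B0 ^ q" "A1 ^ q" A1] show ?thesis
  unfolding e v_powers(2) dt_powers(2) unfolding v_powers(1) dt_powers(1) c_facts power_inverse N1_def .
qed

lemma Ma: "rd Ma = A1 / (A0 * A0 * A0 ^ q)"
proof -
 have "rd Ma = rd v * rd v ^ q - rd c ^ q * rd dt"
  unfolding Ma_def using V0s dt(1) c_facts by (simp add: rd_diff rd_mult rd_power N_power0 N_mult_left)
 moreover have alg: "- (b' / (a * a')) * - (b / (a * a')) - inverse a' * (b * b' / (a ^ 2 * a') - d / a ^ 2) = d / (a * a * a')"
  if "a ~= 0" "a' ~= 0" for a a' b b' d d' :: 'k
  using that by (simp add: field_simps power2_eq_square)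
 have "A0 ^ q ~= 0" using A0 by simp
 note alg[OF A0(1) this, of "B0 ^ q" B0 A1]
 ultimately show ?thesis unfolding v_powers(2) unfolding v_powers(1) dt_powers(1) c_facts power_inverse by simp
qed

lemma conj_root: assumes "z ^ q ^ 2 = z" shows "conj z = z ^ q"
proof (rule frob_fixed_eq[of _ 2])
 have z: "z \<in> K" "V 0 z" using KO_fixed[OF assms] by (auto simp: KO_def)
 have "conj (z ^ n) = conj z ^ n" for n by (induction n) (simp_all add: K_mult K_power z conj_base base_1)
 thus "conj z ^ q ^ 2 = conj z" using assms by metis
 show "(z ^ q) ^ q ^ 2 = z ^ q" using assms by (metis power_mult mult.commute)
 show "rd (conj z) = rd (z ^ q)" using z by (simp add: rd_conj rd_power)
qed simp

text \<open>The norm is a0 a0^q + pi n1 modulo pi^2. Inverting it and splitting off the Teichmueller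
  part kk t leaves the second coordinate, shifted by -MZ.\<close>

lemma ib_facts: "fst ib = inverse (A0 * A0 ^ q) * fst i" "teich L (fst ib) = kk * t" "ib \<in> comp_index L"
 "snd ib * fst ib = inverse (A0 * A0 ^ q) * (snd i * fst i) - rd MZ * fst i"
proof -
 define N where "N = Nrd L b"
 note Nf = Nrd_unit[OF ud mu(1-3), folded N_def]
 define n1 where "n1 = a0 * conj a1 + a1 * conj a0 - b0 * conj b0"
 have K: "KO a0" "KO a1" "KO b0" using KO_fixed mu by auto
 have n1V: "V 0 n1" unfolding n1_def using K KO_conj by (intro N_diff N_add N_mult_left) (auto simp: KO_def)
 have n1r: "rd n1 = N1" unfolding n1_def N1_def conj_root[OF mu(1)] conj_root[OF mu(2)] conj_root[OF mu(3)]
  using V0s by (simp add: rd_diff rd_add rd_mult rd_power N_power0 N_mult_left N_add)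
 have N2: "V 2 (N - (a0 * a0 ^ q + \<pi>' * n1))" using Nf(4) unfolding n1_def conj_root[OF mu(1)] .
 have "V 1 (N - (a0 * a0 ^ q + \<pi>' * n1) + \<pi>' * n1)"
  by (rule N_add[OF N_mono[OF N2]]) (use n1V in "simp_all add: V_unif_mult")
 hence "V 1 (N - a0 * a0 ^ q)" by simp
 hence Nr: "rd N = A0 * A0 ^ q" using rd_eqI[of 1 N "a0 * a0 ^ q"] V0s by (simp add: rd_mult rd_power N_power0 N_mult_left)
 hence Nu: "val L N = 0" using Nf(3) A0 by (simp add: val_unit_iff)
 have fi: "fst i ^ q = fst i" "fst i ~= 0" "snd i ^ q = snd i" using i by (auto simp: comp_index_def)
 have fsi: "(fst i * snd i) ^ q = fst i * snd i" by (simp add: power_mult_distrib fi)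
 note T1 = teich[OF fi(1)] note T2 = teich[OF fsi]
 define t2 where "t2 = teich L (fst i * snd i)"
 define l where "l = t + t2 * \<pi>'"
 have lift: "unit_lift L i = l" by (simp add: unit_lift_def l_def t_def t2_def)
 have tV: "V 0 t" "V 0 t2" "rd t = fst i" "rd t2 = fst i * snd i" using T1 T2 by (simp_all add: t_def t2_def)
 have lV: "V 0 l" "rd l = fst i"
 proof -
  have "V 1 (l - t)" using tV by (simp add: l_def mult.commute[of _ \<pi>'] V_unif_mult)
  thus "V 0 l" "rd l = fst i" using V0_trans[of 1 l t] rd_eqI[of 1 l t] tV by auto
 qed
 define iN where "iN = inverse N"
 have iN: "V 0 iN" "rd iN = inverse (A0 * A0 ^ q)" "iN * N = 1"
 proof -
  show "V 0 iN" unfolding iN_def using val_inverse_unit[OF Nu] by (simp only: val_unit_iff)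
  show "rd iN = inverse (A0 * A0 ^ q)" unfolding iN_def rd_inverse[OF Nu] Nr ..
  have "N ~= 0" using Nu by auto
  thus "iN * N = 1" by (simp add: iN_def)
 qed
 have ib: "ib = unit_coords L (iN * l)" by (simp add: ib_def act_index_def lift iN_def N_def)
 show f: "fst ib = inverse (A0 * A0 ^ q) * fst i" using iN lV by (simp add: ib unit_coords_def rd_mult)
 have "(kk * t) ^ q = kk * t" using kk_facts T1 by (simp add: power_mult_distrib t_def)
 moreover have "rd (kk * t) = fst ib" using kk_facts tV f by (simp add: rd_mult)
 ultimately show tib: "teich L (fst ib) = kk * t" using teich_eqI by metis
 have kn: "kk * (a0 * a0 ^ q) = 1" using mu(4) by (simp add: kk_def c_def field_simps)
 define e where "e = N - (a0 * a0 ^ q + \<pi>' * n1)"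
 have "N = a0 * a0 ^ q + \<pi>' * n1 + e" by (simp add: e_def)
 hence "kk * N = kk * (a0 * a0 ^ q) + kk * (\<pi>' * n1 + e)" by (simp add: algebra_simps)
 hence kN: "kk * N = 1 + kk * (\<pi>' * n1 + e)" by (simp only: kn)
 have "iN * l - kk * t = iN * (l - (kk * N) * t)"
 proof -
  have "iN * (kk * N * t) = kk * t * (iN * N)" by (simp only: mult_ac)
  thus ?thesis by (simp only: right_diff_distrib iN(3) mult_1_right)
 qed
 also have "l - (kk * N) * t = \<pi>' * (t2 - kk * n1 * t) - kk * e * t" unfolding kN l_def by (simp add: algebra_simps)
 finally have d: "(iN * l - kk * t) / \<pi>' = iN * (t2 - kk * n1 * t) - iN * (kk * t * (e / \<pi>'))"
  by (simp add: field_simps)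
 have e1: "V 1 (e / \<pi>')" unfolding V_unif_div e_def using N2 by simp
 have "V 1 (iN * (kk * t * (e / \<pi>')))" by (intro N_mult_left iN tV kk_facts e1)
 hence d1: "V 1 ((iN * l - kk * t) / \<pi>' - iN * (t2 - kk * n1 * t))" unfolding d using N_uminus by fastforce
 have V0: "V 0 (iN * (t2 - kk * n1 * t))" by (intro N_mult_left N_diff iN tV kk_facts n1V)
 have rr: "rd ((iN * l - kk * t) / \<pi>') = inverse (A0 * A0 ^ q) * (fst i * snd i - inverse (A0 * A0 ^ q) * N1 * fst i)"
  using rd_eqI[OF d1 _ V0] iN tV kk_facts n1V n1r by (simp add: rd_mult rd_diff N_mult_left N_diff)
 have si: "snd ib = rd ((iN * l - kk * t) / \<pi>') / fst ib"
  using tib by (simp add: ib unit_coords_def)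
 have fn: "fst ib ~= 0" using f A0 fi by simp
 show "snd ib * fst ib = inverse (A0 * A0 ^ q) * (snd i * fst i) - rd MZ * fst i"
  using fn A0 unfolding si rr MZ by (simp add: field_simps power2_eq_square)
 have bs: "(iN * l - kk * t) / \<pi>' \<in> base L"
 proof -
  have "teich L (fst ib) \<in> base L" using teich[of "fst ib"] \<open>(kk * t) ^ q = kk * t\<close> \<open>rd (kk * t) = fst ib\<close> kk_facts tV
   by (metis N_mult_left rd_power)
  hence "kk * t \<in> base L" by (simp only: tib)
  moreover have "iN \<in> base L" unfolding iN_def using base_divide[OF base_1 Nf(2)] by (simp add: divide_inverse)
  moreover have "l \<in> base L" unfolding l_def t_def t2_def by (intro base_add base_mult T1 T2 unif_base)
  ultimately show ?thesis by (intro base_divide base_diff unif_base) (rule base_mult)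
 qed
 have "V 0 ((iN * l - kk * t) / \<pi>')" by (rule V0_trans[OF d1 _ V0]) simp
 hence "rd ((iN * l - kk * t) / \<pi>') ^ q = rd ((iN * l - kk * t) / \<pi>')" by (rule rd_base[OF bs])
 moreover have "fst ib ^ q = fst ib" using \<open>(kk * t) ^ q = kk * t\<close> \<open>rd (kk * t) = fst ib\<close> kk_facts tV
  by (metis N_mult_left rd_power)
 ultimately show "ib \<in> comp_index L" using fn by (simp add: comp_index_def case_prod_beta si power_divide)
qed

lemma A0_m: "A0 ^ nm = 1"
proof -
 have "A0 * A0 ^ nm = A0 * 1" using A_fixed(1) unfolding nums(5)[symmetric] by simp
 thus ?thesis using A0 by simp
qed

lemma jb_S00: "jb \<in> S00 L ib"
proof -
 have j': "fst j ~= 0" "snd j ~= 0" "fst j ^ q * snd j - fst j * snd j ^ q = fst i" "fst j ^ nm = -1" "snd j ^ nm = -1"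
  using j by (auto simp: S00_def nm_def)
 have "(fst j * inverse A0) ^ q * (snd j * inverse A0) - fst j * inverse A0 * (snd j * inverse A0) ^ q
   = inverse (A0 * A0 ^ q) * (fst j ^ q * snd j - fst j * snd j ^ q)"
  by (simp add: power_inverse algebra_simps)
 thus ?thesis unfolding S00_def jb_def nm_def[symmetric] using j' A0 A0_m
  by (simp add: ib_facts power_mult_distrib power_inverse)
qed

lemma yhat_jb: "yhat L jb = c * yhat L j"
proof -
 note yh = yhat_facts[OF j]
 have "c * c ^ nm = c * 1" using c_fixed(1) unfolding nums(5)[symmetric] by simp
 hence cm: "c ^ nm = 1" using c_fixed(2) by simp
 have 1: "V 0 (c * yhat L j)" by (rule N_mult_left[OF c_facts(2) yh(1)])
 have 2: "rd (c * yhat L j) = snd jb" unfolding rd_mult[OF c_facts(2) yh(1)] c_facts(3) yh(2) jb_def by simp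
 have 3: "(c * yhat L j) ^ nm = - (gamt0 L ^ (q - 1))" unfolding power_mult_distrib cm yh(3) by simp
 show ?thesis by (rule yhat_facts(5)[OF jb_S00 1 2 3, symmetric])
qed

lemma ab: "w \<in> K" "V 0 w" "rd w ~= 0" "v \<in> K" "V 0 v"
 using inv(1,2,4) A0 by (simp_all add: KO_def)

lemma new_point: assumes x: "V 0 (X / kap L)" and u: "V th u"
 shows "cg nE (peval (hnew w v u) X / kap L) (new_coord c v dt (X / kap L))"
proof -
 define h where "h = hnew w v u"
 define x where "x = X / kap L"
 have k0: "kap L ~= 0" unfolding gam_eqs by (rule kap1_nz)
 have X: "X = kap1 L ^ q * x" using k0 by (simp add: x_def gam_eqs)
 have xV: "V 0 x" using x by (simp add: x_def)
 note cc = ab u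
 have hV: "fN V 0 h" "h $ 0 = 0" unfolding h_def by (rule hnew_integral[OF cc], rule hnew_0[OF cc])
 have XU: "U q X" unfolding X using U_mult[OF U_kap1[of q], of 0 x] xV by (simp add: U_0)
 have xi: "0 < real q * tt" using tt(1) q3 by simp
 \<comment> \<open>The tail beyond X^(q^2) has level q (q^2 + 1) = nE + q, hence nE after division
   by kappa.\<close>
 have "V (0 + real q * tt * real (Suc (q ^ 2))) (peval h X - (\<Sum>n<Suc (q ^ 2). h $ n * X ^ n))"
  by (rule peval_approx[OF hV(1) XU[unfolded U_def] xi])
 moreover have "0 + real q * tt * real (Suc (q ^ 2)) = real (nE + q) * tt"
  unfolding nE_def by (simp add: power2_eq_square power3_eq_cube algebra_simps)
 ultimately have 1: "U (nE + q) (peval h X - (\<Sum>n<Suc (q ^ 2). h $ n * X ^ n))" unfolding U_def by (simp only:)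
 have "V (real nE * tt) z" if "V th z" for z
 proof (rule N_mono[OF that])
  have "real (4 * nE) <= real (3 * no)" using nums(20) by (rule of_nat_mono)
  hence "real nE <= 3 / 4 * real no" by simp
  hence "real nE * tt <= 3 / 4 * real no * tt" using tt(1) by (intro mult_right_mono) auto
  thus "real nE * tt <= th" using tt(2) by simp
 qed
 hence hs: "U nE (h $ n - sab w v $ n)" for n
  using hnew_approx[OF cc] unfolding fN_def U_def h_def by simp
 have "U (nE + q) (\<Sum>n<Suc (q ^ 2). (h $ n - sab w v $ n) * X ^ n)" unfolding U_def
 proof (rule N_sum)
  fix n
  show "V (real (nE + q) * tt) ((h $ n - sab w v $ n) * X ^ n)"
  proof (cases n)
   case (Suc m)
   have "U q (X ^ m * X)" by (intro U_mult0 N_power0 U_V0[OF XU] XU)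
   thus ?thesis using U_mult[OF hs[of n]] Suc unfolding U_def[symmetric] by (simp add: mult.commute)
  qed (simp add: hV)
 qed
 moreover have "(\<Sum>n<Suc (q ^ 2). (h $ n - sab w v $ n) * X ^ n)
   = (\<Sum>n<Suc (q ^ 2). h $ n * X ^ n) - (\<Sum>n<Suc (q ^ 2). sab w v $ n * X ^ n)"
  by (simp only: left_diff_distrib sum_subtractf)
 moreover have "(\<Sum>n<Suc (q ^ 2). sab w v $ n * X ^ n) = w * X + (v * X ^ q + dt * X ^ q ^ 2)"
  unfolding lessThan_Suc_atMost atLeast0AtMost[symmetric]
  by (subst sum_1_q_q2(1)) (simp_all add: sab_low(1,2,4)[simplified] sab_low(3) dt_def)
 ultimately have 2: "U (nE + q) ((\<Sum>n<Suc (q ^ 2). h $ n * X ^ n) - (w * X + (v * X ^ q + dt * X ^ q ^ 2)))" by simp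
 \<comment> \<open>w may be replaced by c = 1/a0: both reduce to 1/A0 and lie in E, so they agree
   modulo pi.\<close>
 have "rd (w - c) = 0" using inv(4) c_facts ab by (simp add: rd_diff)
 moreover have "c \<in> K" unfolding c_def using KO_fixed[OF mu(1)] by (intro K_inverse) (simp add: KO_def)
 ultimately have "V 1 (w - c)" using ab c_facts by (intro K_rd_0 K_diff N_diff)
 hence "U nE (w - c)" unfolding U_no[symmetric] by (rule U_mono) (rule nums(10))
 from U_mult[OF this XU] have 3: "U (nE + q) ((w - c) * X)" .
 have "U (nE + q) (peval h X - (\<Sum>n<Suc (q ^ 2). h $ n * X ^ n)
   + ((\<Sum>n<Suc (q ^ 2). h $ n * X ^ n) - (w * X + (v * X ^ q + dt * X ^ q ^ 2))) + (w - c) * X)"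
  by (rule U_add[OF U_add[OF 1 2] 3])
 moreover have "s1 - s2 + (s2 - (w * X + (v * X ^ q + dt * X ^ q ^ 2))) + (w - c) * X = s1 - (c * X + (v * X ^ q + dt * X ^ q ^ 2))" for s1 s2
  by (simp add: algebra_simps)
 ultimately have "U (nE + q) (peval h X - (c * X + (v * X ^ q + dt * X ^ q ^ 2)))" by (simp only:)
 hence "U nE ((peval h X - (c * X + (v * X ^ q + dt * X ^ q ^ 2))) / kap1 L ^ q)" unfolding U_kap1_div .
 moreover have "(p - (c * X + (v * X ^ q + dt * X ^ q ^ 2))) / kap1 L ^ q = p / kap L - new_coord c v dt x" for p
 proof -
  have "q ^ 1 * q = q + ne" "q * q ^ 2 = q + na"
   unfolding ne_def na_def nums(5)[symmetric] using q3 by (simp_all add: algebra_simps)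
  hence XX: "X ^ q = kap1 L ^ q * (kap1 L ^ ne * x ^ q)" "X ^ q ^ 2 = kap1 L ^ q * (kap1 L ^ na * x ^ q ^ 2)"
   unfolding X power_mult_distrib by (simp_all add: power_mult[symmetric] power_add mult.assoc)
  hence "c * X + (v * X ^ q + dt * X ^ q ^ 2) = kap1 L ^ q * new_coord c v dt x"
   unfolding XX new_coord_def by (simp add: X algebra_simps)
  thus ?thesis using kap1_nz[of q] by (simp add: gam_eqs(1) diff_divide_distrib)
 qed
 ultimately have 4: "U nE (peval h X / kap L - new_coord c v dt x)" by simp
 have "V 0 (new_coord c v dt x)" unfolding new_coord_def
  by (intro N_add N_mult_left N_power0 xV c_facts V0s dt U_V0[OF U_kap1])
 from cgI[OF this 4] show ?thesis by (simp add: h_def x_def)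
qed

definition act :: "'c \<times> 'c \<times> 'c => 'c \<times> 'c \<times> 'c" where "act = actD L b"

lemma act_eq: assumes "V th (snd (snd P))"
 shows "act P = (peval (hnew w v (snd (snd P))) (fst P), peval (hnew w v (snd (snd P))) (fst (snd P)), unew w v (snd (snd P)))"
 using actD_eq[OF inv(3) inv(1,2) _ assms, of "fst P" "fst (snd P)"] inv(4) A0 by (simp add: act_def)

lemma act_point: assumes P: "P \<in> Xaff L i j" shows "act P \<in> Xaff L ib jb"
  and "U 1 (coord_a L ib (act P) - (kk * coord_a L i P + c * v ^ q * t * coord_z1 L j P + Ma * t))"
  and "U 1 (coord_z1 L jb (act P) - (c * coord_z1 L j P + v) / c ^ q)"
proof -
 note p = Xaff_point[OF i j P]
 note T = t_facts[OF i j, folded t_def]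
 note yh = yhat_facts[OF j]
 define x y u x' y' where "x = fx L P" "y = fy L P" "u = snd (snd P)" "x' = fx L (act P)" "y' = fy L (act P)"
 note xy = x_y_u_x'_y'_def
 define h where "h = hnew w v u"
 have P': "act P = (peval h (fst P), peval h (fst (snd P)), unew w v u)" using act_eq[OF p(3)] by (simp add: h_def xy)
 have u: "V th u" "V (real q / (real q + 1)) u" using p(2,3) by (simp_all add: xy)
 note cc = ab u(1)
 have x': "cg nE x' (new_coord c v dt x)" and y': "cg nE y' (new_coord c v dt y)"
  using new_point[OF _ u(1)] p(4,5) by (simp_all add: xy fx_def fy_def P'[unfolded h_def xy])
 note base_hyps = p(4,5)[folded xy] T(1,2) yh(4,3) p(8,9)[folded xy t_def]
 note hyps = base_hyps c_fixed inv(2) dt(1) x' y'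
 have V': "V 0 x'" "V 0 y'" using cg_V0(1) x' y' by auto
 have W'r: "rd (WW x' y') = fst ib"
 proof -
  have "V 0 (WW x y)" using p(4,5) unfolding xy by (intro N_diff N_mult_left N_power0)
  thus ?thesis using cg_rd[OF W'_cg[OF hyps]] kk_facts p(10) by (simp add: kk_def[symmetric] rd_mult ib_facts xy)
 qed
 define z' where "z' = (teich L (fst ib) * gam0 L - fZ L (act P)) / gam_q_q1 L + poly_f1 L (x' ^ q ^ 2 * y' ^ q) (x' ^ q * y' ^ q ^ 2)"
 have Z': "V 0 z' & rd z' = snd ib * fst ib"
 proof -
  define z where "z = (t * gam0 L - (WW x y ^ q - gam L * VV x y)) / kap1 L ^ nG + poly_f1 L (x ^ q ^ 2 * y ^ q) (x ^ q * y ^ q ^ 2)"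
  have z: "V 0 z" "rd z = snd i * fst i"
   using p(9,11) cond_iff[OF i j p(4,5)] by (simp_all add: z_def xy t_def gam_eqs(4) fZ_eq)
  have MV: "V 0 MZ" unfolding MZ_def by (intro N_diff N_mult_left N_power0 V0s c_facts dt)
  have "U 1 (z' - (kk * z - MZ * t))"
   using Z'_cg[OF hyps] unfolding z_def z'_def MZ_def kk_def ib_facts(2) fZ_eq gam_eqs(4) xy(4,5) .
  hence d: "V tt (z' - (kk * z - MZ * t))" by (simp add: U_def)
  have V0: "V 0 (kk * z - MZ * t)" by (intro N_diff N_mult_left kk_facts z MV T)
  have "rd (kk * z - MZ * t) = snd ib * fst ib" unfolding ib_facts(4)
   using kk_facts z MV T by (simp add: rd_diff rd_mult N_mult_left)
  thus ?thesis using V0_trans[OF d _ V0] rd_eqI[OF d tt(1) V0] tt(1) by simp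
 qed
 have LT: "act P \<in> LT_curve L" unfolding P' unfolding h_def
  by (rule LT_curve_transport[OF u(1) V_unew[OF cc] hnew_integral[OF cc] hnew_0[OF cc] ll_hnew[OF cc] cnew_unit[OF cc]])
   (use p(1) in "simp add: xy(3)")
 have h1: "h $ 1 = cnew w v u"
  using arg_cong[OF ll_hnew[OF cc], of "%s. s $ 1"] by (simp add: fps_compose_nth h_def)
 have hd: "V (real q / (real q + 1)) (unew w v u)"
  by (rule hom_disc[of h _ u]) (use h1 hnew_integral[OF cc] hnew_0[OF cc] ll_hnew[OF cc] cnew_unit[OF cc] u(2) nonneg_disc in "simp_all add: h_def")
 have x'r: "rd x' = fst jb" "rd y' = snd jb"
  using cg_rd[OF x'_cg[OF hyps]] cg_rd[OF y'_cg[OF hyps]] p(4-7) c_facts by (simp_all add: rd_mult xy jb_def)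
 show "act P \<in> Xaff L ib jb" unfolding Xaff_def mem_Collect_eq
 proof (intro conjI)
  have "act P \<in> Y22 L" using LT hd unfolding P' by (simp add: Y22_def V_def)
  thus "act P \<in> Y22_comp L ib" using W'r Z' V' unfolding Y22_comp_def mem_Collect_eq red_iff
   by (auto simp: fW_def xy z'_def[unfolded xy, symmetric] N_diff N_mult_left N_power0)
  show "reduces_to L (fx L (act P)) (fst jb)" "reduces_to L (fy L (act P)) (snd jb)"
   using V' x'r by (simp_all add: red_iff xy)
  show "val L (w1 L jb) <= val L (fy L (act P) - yhat L jb)"
   unfolding w1_le[OF ib_facts(3) jb_S00] yhat_jb using y'_disc[OF hyps] by (simp add: xy)
 qed
 show "U 1 (coord_a L ib (act P) - (kk * coord_a L i P + c * v ^ q * t * coord_z1 L j P + Ma * t))"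
  using a'_cg[OF hyps] unfolding coord_a_eq coord_z1_eq ib_facts(2) Ma_def kk_def t_def[symmetric] xy .
 show "U 1 (coord_z1 L jb (act P) - (c * coord_z1 L j P + v) / c ^ q)"
  using z'_cg[OF hyps] unfolding coord_z1_eq yhat_jb xy .
qed

lemma residues: shows "rd kk = inverse (A0 ^ (q + 1))"
  and "rd (c * v ^ q * t) = - (inverse (A0 ^ (q + 1)) * (B0 / A0 * fst i))"
  and "rd (Ma * t) = inverse (A0 ^ (q + 1)) * (A1 / A0 * fst i)"
  and "rd (c / c ^ q) = A0 ^ (q - 1)" and "rd (v / c ^ q) = - (A0 ^ (q - 1) * (B0 / A0) ^ q)"
  and "V 0 (c * v ^ q * t)" and "V 0 (Ma * t)" and "V 0 (c / c ^ q)" and "V 0 (v / c ^ q)"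
proof -
 note T = t_facts[OF i j, folded t_def]
 show "rd kk = inverse (A0 ^ (q + 1))" using kk_facts by simp
 show 1: "V 0 (c * v ^ q * t)" by (intro N_mult_left N_power0 V0s c_facts T)
 have MV: "V 0 Ma" unfolding Ma_def by (intro N_diff N_mult_left N_power0 V0s c_facts dt)
 show "V 0 (Ma * t)" by (intro N_mult_left MV T)
 have cq: "V 0 (inverse (c ^ q))" "rd (inverse (c ^ q)) = A0 ^ q"
  using val_inverse_unit[OF val_power_unit[OF c_facts(1)]] rd_inverse[OF val_power_unit[OF c_facts(1)]] c_facts
  by (auto simp: val_unit_iff rd_power power_inverse)
 show "V 0 (c / c ^ q)" "V 0 (v / c ^ q)" unfolding divide_inverse by (intro N_mult_left cq c_facts V0s)+
 have Aq: "A0 * A0 ^ (q - 1) = A0 ^ q" using power_eq_if[of A0 q] q3 by simp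
 have "rd (c * v ^ q * t) = rd c * rd v ^ q * fst i"
  using V0s c_facts T by (simp add: rd_mult rd_power N_power0 N_mult_left)
 moreover have "inverse a * - (b / (a * a')) * f = - (inverse (a' * a) * (b / a * f))" for a a' b f :: 'k
  by (simp add: divide_inverse)
 ultimately show "rd (c * v ^ q * t) = - (inverse (A0 ^ (q + 1)) * (B0 / A0 * fst i))"
  unfolding v_powers(2) c_facts power_add power_one_right by simp
 have "rd (Ma * t) = rd Ma * fst i" using MV T by (simp add: rd_mult)
 thus "rd (Ma * t) = inverse (A0 ^ (q + 1)) * (A1 / A0 * fst i)"
  unfolding Ma power_add power_one_right by (simp add: divide_inverse)
 have "rd (c / c ^ q) = inverse A0 * A0 ^ q" using c_facts cq by (simp add: divide_inverse rd_mult)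
 thus "rd (c / c ^ q) = A0 ^ (q - 1)" unfolding Aq[symmetric] using A0 by simp
 have "rd (v / c ^ q) = rd v * A0 ^ q" using V0s cq by (simp add: divide_inverse rd_mult)
 hence "rd (v / c ^ q) = - (B0 ^ q / A0)" unfolding v_powers(1) by simp
 also have "... = - (A0 ^ (q - 1) * (B0 ^ q / A0 ^ q))" unfolding Aq[symmetric] by simp
 finally show "rd (v / c ^ q) = - (A0 ^ (q - 1) * (B0 / A0) ^ q)" by (simp only: power_divide)
qed

end

section \<open>Functions on affinoids\<close>

context lt
begin

text \<open>Membership in the uniform closure of the polynomials, in terms of the valuation and
  without extensionality, so that it applies to plain function terms.\<close>

definition apx :: "'c pointset => 'c fun3 => bool" where
 "apx S f <-> (\<forall>N. \<exists>p\<in>poly_funs. \<forall>P\<in>S. V N (f P - p P))"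

text \<open>Integral coordinates bound every polynomial function, which uniform approximation of
  products requires.\<close>

definition bpts :: "'c pointset => bool" where
 "bpts S <-> (\<forall>P\<in>S. V 0 (fst P) & V 0 (fst (snd P)) & V 0 (snd (snd P)))"

lemma powr_less: assumes "0 < e" obtains r where "real q powr (- r) < e"
proof -
 have "real q powr (- (- log (real q) e + 1)) < real q powr (log (real q) e)" using q_powr by simp
 also have "... = e" using q_powr assms by simp
 finally show ?thesis by (rule that)
qed

lemma affinoid_iff: "f \<in> affinoid_funs S <-> f \<in> extensional S & apx S f"
proof
 assume f: "f \<in> affinoid_funs S"
 then obtain p where p: "!!n. p n \<in> poly_funs" "uniform_limit S p f sequentially" by (auto simp: affinoid_funs_def)
 have "\<exists>p\<in>poly_funs. \<forall>P\<in>S. V N (f P - p P)" for N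
 proof -
  have "0 < real q powr (- N)" using q_powr by simp
  from uniform_limitD[OF p(2) this] obtain n where n: "\<forall>P\<in>S. dist (p n P) (f P) < real q powr (- N)"
   by (auto simp: eventually_sequentially)
  thus ?thesis using p(1)[of n] by (intro bexI[of _ "p n"]) (auto simp: V_dist dist_commute less_imp_le)
 qed
 thus "f \<in> extensional S & apx S f" using f by (simp add: apx_def affinoid_funs_def)
next
 assume f: "f \<in> extensional S & apx S f"
 hence "\<forall>n::nat. \<exists>p. p \<in> poly_funs & (\<forall>P\<in>S. V (real n) (f P - p P))" by (auto simp: apx_def)
 then obtain p where p: "!!n::nat. p n \<in> poly_funs & (\<forall>P\<in>S. V (real n) (f P - p n P))" by metis
 have "uniform_limit S p f sequentially"
 proof (rule uniform_limitI)
  fix e :: real assume "0 < e"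
  then obtain r where r: "real q powr (- r) < e" by (rule powr_less)
  show "\<forall>\<^sub>F n in sequentially. \<forall>P\<in>S. dist (p n P) (f P) < e"
   unfolding eventually_sequentially
  proof (intro exI allI impI ballI)
   fix n P assume n: "nat \<lceil>r\<rceil> <= n" and P: "P \<in> S"
   have "r <= real n" using n by linarith
   have "V (real n) (f P - p n P)" using p[of n] P by blast
   from N_mono[OF this \<open>r <= real n\<close>] have "V r (f P - p n P)" .
   thus "dist (p n P) (f P) < e" using r by (simp add: V_dist dist_commute)
  qed
 qed
 thus "f \<in> affinoid_funs S" using f p by (auto simp: affinoid_funs_def)
qed

lemma apx_poly: "p \<in> poly_funs ==> apx S p" unfolding apx_def by (intro allI bexI[of _ p]) auto
lemma apx_const: "apx S (%_. a)" by (rule apx_poly[OF poly_funs.const])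
lemma apx_coords: "apx S (%P. fst P)" "apx S (%P. fst (snd P))" "apx S (%P. snd (snd P))"
 using apx_poly[OF poly_funs.X2] apx_poly[OF poly_funs.Y2] apx_poly[OF poly_funs.u] by (simp_all add: case_prod_unfold)

lemma apx_limit:
 assumes "!!N. \<exists>g. apx S g & (\<forall>P\<in>S. V N (f P - g P))" shows "apx S f"
 unfolding apx_def
proof
 fix N
 obtain g where g: "apx S g" "\<forall>P\<in>S. V N (f P - g P)" using assms by blast
 obtain p where p: "p \<in> poly_funs" "\<forall>P\<in>S. V N (g P - p P)" using spec[OF g(1)[unfolded apx_def], of N] by blast
 have "V N (f P - p P)" if "P \<in> S" for P using g(2) p(2) that N_trans by blast
 thus "\<exists>p\<in>poly_funs. \<forall>P\<in>S. V N (f P - p P)" using p(1) by blast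
qed

lemma apx_cong: "apx S f ==> (!!P. P \<in> S ==> f P = g P) ==> apx S g" by (simp add: apx_def)

lemma apx_add: assumes "apx S f" "apx S g" shows "apx S (%P. f P + g P)" unfolding apx_def
proof
 fix N
 obtain p r where p: "p \<in> poly_funs" "\<forall>P\<in>S. V N (f P - p P)" and r: "r \<in> poly_funs" "\<forall>P\<in>S. V N (g P - r P)"
  using assms by (metis apx_def)
 have "V N (f P + g P - (p P + r P))" if "P \<in> S" for P
  using N_add[of N "f P - p P" "g P - r P"] p r that by (simp add: add_diff_add)
 thus "\<exists>p\<in>poly_funs. \<forall>P\<in>S. V N (f P + g P - p P)" by (intro bexI[OF _ poly_funs.add[OF p(1) r(1)]]) simp
qed

lemma apx_scale: assumes "apx S f" shows "apx S (%P. a * f P)" unfolding apx_def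
proof
 fix N
 obtain B where B: "B <= 0" "V B a" by (rule V_bound)
 obtain p where p: "p \<in> poly_funs" "\<forall>P\<in>S. V (N - B) (f P - p P)" using assms by (metis apx_def)
 have "V N (a * f P - a * p P)" if "P \<in> S" for P
  using N_mult_le[OF B(2), of "N - B" "f P - p P" N] p that by (simp add: right_diff_distrib)
 thus "\<exists>p\<in>poly_funs. \<forall>P\<in>S. V N (a * f P - p P)" by (intro bexI[OF _ poly_funs.mult[OF poly_funs.const[of a] p(1)]]) simp
qed

lemma apx_uminus: "apx S f ==> apx S (%P. - f P)" using apx_scale[of S f "-1"] by simp
lemma apx_diff: "apx S f ==> apx S g ==> apx S (%P. f P - g P)" using apx_add[OF _ apx_uminus] by fastforce
lemma apx_divide: "apx S f ==> apx S (%P. f P / a)" using apx_scale[of S f "inverse a"] by (simp add: divide_inverse mult.commute)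
lemma apx_sum: "(!!i. i \<in> A ==> apx S (%P. f i P)) ==> apx S (%P. \<Sum>i\<in>A. f i P)"
 by (induction A rule: infinite_finite_induct) (auto intro: apx_const apx_add)

context
 fixes S :: "'c pointset" assumes Sb: "bpts S"
begin

lemma poly_bounded: "p \<in> poly_funs ==> \<exists>B\<le>0. \<forall>P\<in>S. V B (p P)"
proof (induction rule: poly_funs.induct)
 case (const a)
 obtain B where "B <= 0" "V B a" by (rule V_bound)
 thus ?case by blast
next
 case (add f g)
 then obtain B B' where "B <= 0" "\<forall>P\<in>S. V B (f P)" "B' <= 0" "\<forall>P\<in>S. V B' (g P)" by blast
 hence "min B B' <= 0" "\<forall>P\<in>S. V (min B B') (f P + g P)"
  using N_mono[of B _ "min B B'"] N_mono[of B' _ "min B B'"] by (auto intro!: N_add)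
 thus ?case by blast
next
 case (mult f g)
 then obtain B B' where "B <= 0" "\<forall>P\<in>S. V B (f P)" "B' <= 0" "\<forall>P\<in>S. V B' (g P)" by blast
 hence "B + B' <= 0" "\<forall>P\<in>S. V (B + B') (f P * g P)" using N_mult by auto
 thus ?case by blast
qed (use Sb in "auto simp: bpts_def intro!: exI[of _ 0]")

lemma apx_bounded: assumes "apx S f" shows "\<exists>B\<le>0. \<forall>P\<in>S. V B (f P)"
proof -
 obtain p where p: "p \<in> poly_funs" "\<forall>P\<in>S. V 0 (f P - p P)" using assms by (metis apx_def)
 obtain B where B: "B <= 0" "\<forall>P\<in>S. V B (p P)" using poly_bounded[OF p(1)] by blast
 have "V B (f P)" if "P \<in> S" for P using N_add[OF N_mono[of 0 "f P - p P" B], of "p P"] p B that by simp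
 thus ?thesis using B by blast
qed

lemma apx_mult: assumes "apx S f" "apx S g" shows "apx S (%P. f P * g P)" unfolding apx_def
proof
 fix N
 obtain B B' where B: "B <= 0" "\<forall>P\<in>S. V B (f P)" "B' <= 0" "\<forall>P\<in>S. V B' (g P)"
  using apx_bounded[OF assms(1)] apx_bounded[OF assms(2)] by blast
 define M where "M = max 0 (N - (B + B'))"
 obtain p r where p: "p \<in> poly_funs" "\<forall>P\<in>S. V M (f P - p P)" and r: "r \<in> poly_funs" "\<forall>P\<in>S. V M (g P - r P)"
  using assms by (metis apx_def)
 have "V N (f P * g P - p P * r P)" if P: "P \<in> S" for P
 proof -
  have f: "V B (f P)" and g: "V B' (g P)" and d: "V M (f P - p P)" "V M (g P - r P)" using B p r P by auto
  have "V B' (g P - r P)" by (rule N_mono[OF d(2)]) (use B in "simp add: M_def")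
  from N_diff[OF g this] have r': "V B' (r P)" by simp
  have "V N (f P * (g P - r P) + (f P - p P) * r P)"
   by (rule N_add[OF N_mult_le[OF f d(2)] N_mult_le[OF d(1) r']]) (use B in "simp_all add: M_def")
  thus ?thesis by (simp add: algebra_simps)
 qed
 thus "\<exists>p\<in>poly_funs. \<forall>P\<in>S. V N (f P * g P - p P)" by (intro bexI[OF _ poly_funs.mult[OF p(1) r(1)]]) simp
qed

lemma apx_power: "apx S f ==> apx S (%P. f P ^ n)"
 by (induction n) (auto intro: apx_const apx_mult)

text \<open>Geometric series around the constant a: the values 1 - f/a have valuation at least th
  uniformly on S.\<close>

lemma apx_inverse:
 assumes f: "apx S f" and a: "val L a = 0" and fa: "!!P. P \<in> S ==> V th (f P - a)"
 shows "apx S (%P. inverse (f P))"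
proof (rule apx_limit)
 fix N
 define n where "n = nat \<lceil>N / th\<rceil>"
 have "N / th <= real n" unfolding n_def by (rule real_nat_ceiling_ge)
 hence n: "N <= real n * th" by simp
 define y where "y P = 1 - f P / a" for P
 define g where "g P = inverse a * (\<Sum>k<n. y P ^ k)" for P
 have a0: "a ~= 0" using a by auto
 have "apx S g" unfolding g_def y_def by (intro apx_scale apx_sum apx_power apx_diff apx_const apx_divide f)
 moreover have "V N (inverse (f P) - g P)" if P: "P \<in> S" for P
 proof -
  have "V th (inverse a * (f P - a))" using V_mult_unit[OF val_inverse_unit[OF a]] fa[OF P] by blast
  hence "V th (- (inverse a * (f P - a)))" by (rule N_uminus)
  moreover have "- (inverse a * (f P - a)) = y P" using a0 by (simp add: y_def field_simps)
  ultimately have y: "V th (y P)" by simp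
  hence "rd (1 - y P) = 1" using rd_diff[OF V_1 N_mono[OF y]] rd_0I[OF y] by (simp add: rd_1)
  moreover have "V 0 (1 - y P)" by (rule N_diff[OF V_1 N_mono[OF y]]) simp
  ultimately have u: "val L (1 - y P) = 0" by (simp add: val_unit_iff)
  hence u0: "1 - y P ~= 0" by auto
  have fP: "f P = a * (1 - y P)" using a0 by (simp add: y_def)
  have "(1 - y P) * (\<Sum>k<n. y P ^ k) = 1 - y P ^ n" by (rule one_diff_power_eq[symmetric])
  hence s: "(\<Sum>k<n. y P ^ k) = (1 - y P ^ n) * inverse (1 - y P)" using u0 by (simp add: field_simps)
  have "inverse (f P) - g P = inverse a * (inverse (1 - y P) * y P ^ n)"
   unfolding g_def s fP inverse_mult_distrib by (simp add: algebra_simps)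
  moreover have "V N (inverse a * (inverse (1 - y P) * y P ^ n))"
   unfolding V_mult_unit[OF val_inverse_unit[OF a]] V_mult_unit[OF val_inverse_unit[OF u]]
   by (rule N_power_le[OF y n])
  ultimately show ?thesis by simp
 qed
 ultimately show "\<exists>g. apx S g & (\<forall>P\<in>S. V N (inverse (f P) - g P))" by blast
qed

lemma apx_lc: assumes v: "apx S v" shows "apx S (%P. lc (v P) k)"
proof -
 have "apx S (%P. lc (v P) k) & apx S (%P. lc (v P) (Suc k))"
 proof (induction k)
  case 0
  show ?case unfolding lc.simps(1,2) by (intro conjI apx_const apx_divide v)
 next
  case (Suc k)
  hence X: "apx S (%P. (lc (v P) (Suc k) * v P ^ q ^ Suc k + lc (v P) k) / vp (Suc (Suc k)))"
   by (intro apx_divide apx_add apx_mult apx_power v) auto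
  show ?case unfolding lc.simps(3) using Suc X by (intro conjI) auto
 qed
 thus ?thesis ..
qed

lemma apx_Phi: assumes v: "apx S v" and vd: "!!P. P \<in> S ==> V th (v P)"
 shows "apx S (%P. Phi0 (v P))" "apx S (%P. Phi1 (v P))"
proof -
 have "V N (Phi0 (v P) - P0 (v P) (nat \<lceil>N\<rceil>))" "V N (Phi1 (v P) - P1 (v P) (nat \<lceil>N\<rceil>))" if P: "P \<in> S" for P N
 proof -
  have le: "N <= 2 + real (nat \<lceil>N\<rceil>)" by linarith
  show "V N (Phi0 (v P) - P0 (v P) (nat \<lceil>N\<rceil>))" by (rule N_diff_commute[OF N_mono[OF Phi_limits(2)[OF vd[OF P]] le]])
  show "V N (Phi1 (v P) - P1 (v P) (nat \<lceil>N\<rceil>))" by (rule N_diff_commute[OF N_mono[OF Phi_limits(4)[OF vd[OF P]] le]])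
 qed
 moreover have "apx S (%P. P0 (v P) k)" "apx S (%P. P1 (v P) k)" for k
  unfolding P0_def P1_def by (intro apx_divide apx_lc v)+
 ultimately show "apx S (%P. Phi0 (v P))" "apx S (%P. Phi1 (v P))" by (intro apx_limit; blast)+
qed

text \<open>The iterates \<open>uit\<close> approach \<open>usol\<close> at a rate independent of T,
  and each arises from T by operations that preserve approximability.\<close>

lemma apx_usol: assumes T: "apx S T" and Td: "!!P. P \<in> S ==> V (- 1 / 4) (T P)"
 shows "apx S (%P. usol (T P))"
proof (rule apx_limit)
 fix N
 have it: "apx S (%P. uit (T P) n)" for n
 proof (induction n)
  case 0
  show ?case unfolding uit_def by (simp add: apx_const)
 next
  case (Suc n)
  have "V th (uit (T P) n)" if "P \<in> S" for P using usol(1)[of "T P" n] Td[OF that] by simp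
  note Ph = apx_Phi[OF Suc this]
  have "apx S (%P. vp 1 * (T P * Phi0 (uit (T P) n) - (Phi1 (uit (T P) n) - uit (T P) n / vp 1)))"
   by (intro apx_scale apx_diff apx_mult T Ph apx_divide Suc)
  thus ?case by (simp add: uit_def Tmap_def)
 qed
 have "V N (usol (T P) - uit (T P) (nat \<lceil>N\<rceil>))" if P: "P \<in> S" for P
 proof (rule N_diff_commute[OF N_mono[OF usol(2)]])
  show "V (- 1 / 4) (T P)" by (rule Td[OF P])
  show "N <= th + real (nat \<lceil>N\<rceil>)" by linarith
 qed
 thus "\<exists>g. apx S g & (\<forall>P\<in>S. V N (usol (T P) - g P))" using it by blast
qed

lemma apx_power_coeff: "(!!i. apx S (%P. F P $ i)) ==> apx S (%P. (F P ^ m) $ n)"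
proof (induction m arbitrary: n)
 case 0
 show ?case by (cases n) (simp_all add: apx_const)
next
 case (Suc m)
 show ?case unfolding power_Suc fps_mult_nth by (intro apx_sum apx_mult Suc)
qed

context
 fixes w v :: 'c
 assumes a: "w \<in> K" "V 0 w" "rd w ~= 0" and b: "v \<in> K" "V 0 v"
  and ud: "!!P. P \<in> S ==> V th (snd (snd P))"
begin

lemma apx_Th: "apx S (%P. Th w v (snd (snd P)))"
proof -
 note Ph = apx_Phi[OF apx_coords(3) ud]
 have "apx S (%P. inverse (conj w * Phi0 (snd (snd P)) - \<pi>' * conj v * Phi1 (snd (snd P))))"
 proof (rule apx_inverse)
  show "apx S (%P. conj w * Phi0 (snd (snd P)) - \<pi>' * conj v * Phi1 (snd (snd P)))"
   by (intro apx_diff apx_scale Ph)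
  show "val L (conj w) = 0" using V_conj[of w 0] a rd_conj[of w] by (simp add: val_unit_iff)
  fix P assume P: "P \<in> S"
  have cb: "V 0 (conj w)" "V 0 (conj v)" using a b by (simp_all add: V_conj)
  have "V 2 (conj w * (Phi0 (snd (snd P)) - 1))" by (rule N_mult_left[OF cb(1) V_Phi(1)[OF ud[OF P]]])
  hence 1: "V th (conj w * (Phi0 (snd (snd P)) - 1))" by (rule N_mono) simp
  have 2: "V th (\<pi>' * conj v * Phi1 (snd (snd P)))"
   unfolding mult.assoc V_unif_mult using N_mult_left[OF cb(2) V_Phi(4)[OF ud[OF P]]] by simp
  show "V th (conj w * Phi0 (snd (snd P)) - \<pi>' * conj v * Phi1 (snd (snd P)) - conj w)"
   using N_diff[OF 1 2] by (simp add: algebra_simps)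
 qed
 thus ?thesis unfolding Th_def divide_inverse by (intro apx_mult apx_diff apx_scale Ph)
qed

lemma apx_unew: "apx S (%P. unew w v (snd (snd P)))"
 unfolding unew_def by (rule apx_usol[OF apx_Th V_Th[OF a b ud]])

lemma apx_cnew: "apx S (%P. cnew w v (snd (snd P)))"
proof -
 have "apx S (%P. inverse (Phi0 (snd (snd P))))"
 proof (rule apx_inverse[OF apx_Phi(1)[OF apx_coords(3) ud]])
  show "val L 1 = 0" by simp
  show "V th (Phi0 (snd (snd P)) - 1)" if "P \<in> S" for P by (rule N_mono[OF V_Phi(1)[OF ud[OF that]]]) simp
 qed
 thus ?thesis unfolding cnew_def divide_inverse
  by (intro apx_mult apx_add apx_const apx_Phi[OF apx_unew V_unew[OF a b ud]])
qed

text \<open>The equation of logarithms determines the n-th coefficient from lower ones by ring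
  operations; the factor \<open>cnew\<close> and the new parameter \<open>unew\<close> are already
  approximable.\<close>

lemma apx_hnew: "apx S (%P. hnew w v (snd (snd P)) $ n)"
proof (induction n rule: less_induct)
 case (less n)
 define h where "h P = hnew w v (snd (snd P))" for P :: "'c \<times> 'c \<times> 'c"
 define u' where "u' P = unew w v (snd (snd P))" for P :: "'c \<times> 'c \<times> 'c"
 define H where "H P = fps_cutoff n (h P)" for P
 have "apx S (%P. H P $ i)" for i using less[of i] by (cases "i < n") (simp_all add: H_def h_def apx_const)
 hence Hp: "apx S (%P. (H P ^ m) $ n)" for m by (rule apx_power_coeff)
 have "apx S (%P. cnew w v (snd (snd P)) * ll (snd (snd P)) $ n
   - (\<Sum>k=1..n. lc (u' P) k * (H P ^ q ^ k) $ n))"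
 proof (intro apx_diff apx_mult apx_cnew apx_sum Hp)
  have "apx S (%P. if q ^ k = n then lc (snd (snd P)) k else 0)" for k
   by (cases "q ^ k = n") (simp_all add: apx_const apx_lc apx_coords)
  thus "apx S (%P. ll (snd (snd P)) $ n)" unfolding ll_def elog_nth[OF q2] by (rule apx_sum)
  show "apx S (%P. lc (u' P) k)" for k unfolding u'_def by (rule apx_lc[OF apx_unew])
 qed
 thus ?case
 proof (rule apx_cong)
  fix P assume P: "P \<in> S"
  note c = a b ud[OF P]
  have h0: "h P $ 0 = 0" unfolding h_def by (rule hnew_0[OF c])
  have pw: "(h P ^ q ^ k) $ n = (H P ^ q ^ k) $ n" if "1 <= k" for k
  proof (rule fps_power_nth_cong)
   show "2 <= q ^ k" using q2 that power_increasing[of 1 k q] by simp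
   show "H P $ 0 = 0" using h0 by (cases n) (simp_all add: H_def)
  qed (use h0 in "simp_all add: H_def")
  have "(ll (u' P) oo h P) $ n = h P $ n + (\<Sum>k=1..n. lc (u' P) k * (h P ^ q ^ k) $ n)"
   unfolding ll_def elog_compose_nth'[OF q2 h0] by simp
  moreover have "(\<Sum>k=1..n. lc (u' P) k * (h P ^ q ^ k) $ n) = (\<Sum>k=1..n. lc (u' P) k * (H P ^ q ^ k) $ n)"
   by (intro sum.cong refl) (simp add: pw)
  ultimately show "cnew w v (snd (snd P)) * ll (snd (snd P)) $ n - (\<Sum>k=1..n. lc (u' P) k * (H P ^ q ^ k) $ n)
    = hnew w v (snd (snd P)) $ n"
   using arg_cong[OF ll_hnew[OF c], of "%s. s $ n"] by (simp add: h_def u'_def)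
 qed
qed

lemma apx_peval_hnew:
 assumes f: "apx S f" and fd: "!!P. P \<in> S ==> V ee (f P)" and ee: "0 < ee"
 shows "apx S (%P. peval (hnew w v (snd (snd P))) (f P))"
proof (rule apx_limit)
 fix N
 define n where "n = nat \<lceil>N / ee\<rceil>"
 have "N / ee <= real n" unfolding n_def by (rule real_nat_ceiling_ge)
 hence n: "N <= 0 + ee * real n" using ee by (simp add: field_simps)
 have "apx S (%P. \<Sum>i<n. hnew w v (snd (snd P)) $ i * f P ^ i)"
  by (intro apx_sum apx_mult apx_power f apx_hnew)
 moreover have "V N (peval (hnew w v (snd (snd P))) (f P) - (\<Sum>i<n. hnew w v (snd (snd P)) $ i * f P ^ i))"
  if P: "P \<in> S" for P
  by (rule N_mono[OF peval_approx[OF hnew_integral[OF a b ud[OF P]] fd[OF P] ee] n])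
 ultimately show "\<exists>g. apx S g & (\<forall>P\<in>S. V N (peval (hnew w v (snd (snd P))) (f P) - g P))" by blast
qed

end

lemma apx_compose:
 assumes g: "apx S (%P. fst (g P))" "apx S (%P. fst (snd (g P)))" "apx S (%P. snd (snd (g P)))"
  and gT: "!!P. P \<in> S ==> g P \<in> T" and f: "apx T f"
 shows "apx S (%P. f (g P))"
proof (rule apx_limit)
 fix N
 obtain p where p: "p \<in> poly_funs" "\<forall>P\<in>T. V N (f P - p P)" using f by (metis apx_def)
 have "apx S (%P. p (g P))" using p(1)
  by (induction rule: poly_funs.induct) (auto simp: case_prod_unfold intro: apx_const g apx_add apx_mult)
 thus "\<exists>h. apx S h & (\<forall>P\<in>S. V N (f (g P) - h P))" using p gT by blast
qed

end

end

section \<open>Rings of power-bounded functions and their reductions\<close>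

context lt
begin

definition PB :: "'c pointset => 'c fun3 => bool" where "PB S f <-> apx S f & (\<forall>P\<in>S. V 0 (f P))"

text \<open>The uniform bound matters: topological nilpotence refers to the supremum norm, for which
  pointwise positive valuation would be too weak.\<close>

definition small :: "'c pointset => 'c fun3 => bool" where "small S f <-> (\<exists>e>0. \<forall>P\<in>S. V e (f P))"

lemma apx_restrict: "apx S (restrict f S) <-> apx S f" by (simp add: apx_def)
lemma PB_restrict: "PB S (restrict f S) <-> PB S f" by (simp add: PB_def apx_restrict)

lemma power_bounded_iff: "f \<in> power_bounded S <-> f \<in> extensional S & PB S f"
proof -
 have "(\<exists>B. \<forall>n. \<forall>P\<in>S. dist (f P ^ n) 0 <= B) <-> (\<forall>P\<in>S. V 0 (f P))"
 proof
  assume "\<forall>P\<in>S. V 0 (f P)"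
  hence "\<forall>n. \<forall>P\<in>S. dist (f P ^ n) 0 <= 1"
   using V_dist[of 0 _ 0] q_powr N_power0 by simp
  thus "\<exists>B. \<forall>n. \<forall>P\<in>S. dist (f P ^ n) 0 <= B" by blast
 next
  assume "\<exists>B. \<forall>n. \<forall>P\<in>S. dist (f P ^ n) 0 <= B"
  then obtain B where B: "!!n P. P \<in> S ==> dist (f P ^ n) 0 <= B" by blast
  define r where "r = - log (real q) (max B 1)"
  have "B <= real q powr (- r)" using q_powr by (simp add: r_def)
  hence Vr: "V r (f P ^ n)" if "P \<in> S" for n P using B[OF that, of n] V_dist[of r "f P ^ n" 0] by simp
  show "\<forall>P\<in>S. V 0 (f P)"
  proof (rule ballI, rule ccontr)
   fix P assume P: "P \<in> S" and n: "~ V 0 (f P)"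
   hence "f P ~= 0" by auto
   then obtain s where s: "val L (f P) = ereal s" by (rule val_real)
   have s0: "0 < - s" using n V_val[OF s, of 0] by simp
   obtain n where "- r < real n * - s" using ex_less_of_nat_mult[OF s0] by blast
   moreover have "r <= real n * s" using Vr[OF P, of n] V_val[OF val_power[OF s]] by simp
   ultimately show False by simp
  qed
 qed
 thus ?thesis by (auto simp: power_bounded_def affinoid_iff PB_def)
qed

lemma top_nilpotent_iff: "f \<in> top_nilpotent S <-> f \<in> extensional S & apx S f & small S f"
proof -
 have "uniform_limit S (%n P. f P ^ n) (%_. 0) sequentially <-> small S f"
 proof
  assume u: "uniform_limit S (%n P. f P ^ n) (%_. 0) sequentially"
  have "0 < real q powr (- 1)" using q_powr by simp
  from uniform_limitD[OF u this] obtain n0 where n0: "!!n P. n0 <= n ==> P \<in> S ==> dist (f P ^ n) 0 < real q powr (- 1)"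
   by (auto simp: eventually_sequentially)
  define n where "n = Suc n0"
  have "V (1 / real n) (f P)" if P: "P \<in> S" for P
  proof (cases "f P = 0")
   case False
   then obtain s where s: "val L (f P) = ereal s" by (rule val_real)
   have "V 1 (f P ^ n)" using n0[of n P] P V_dist[of 1 "f P ^ n" 0] by (simp add: n_def)
   hence "1 <= real n * s" using V_val[OF val_power[OF s]] by simp
   thus ?thesis using V_val[OF s] by (simp add: n_def field_simps)
  qed simp
  thus "small S f" unfolding small_def by (intro exI[of _ "1 / real n"]) (simp add: n_def)
 next
  assume "small S f"
  then obtain e where e: "0 < e" "!!P. P \<in> S ==> V e (f P)" by (auto simp: small_def)
  show "uniform_limit S (%n P. f P ^ n) (%_. 0) sequentially"
  proof (rule uniform_limitI)
   fix d :: real assume "0 < d"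
   then obtain r where r: "real q powr (- r) < d" by (rule powr_less)
   define n0 where "n0 = nat \<lceil>r / e\<rceil>"
   have "r / e <= real n0" unfolding n0_def by (rule real_nat_ceiling_ge)
   hence n0: "r <= real n0 * e" using e(1) by (simp add: field_simps)
   show "\<forall>\<^sub>F n in sequentially. \<forall>P\<in>S. dist (f P ^ n) 0 < d"
    unfolding eventually_sequentially
   proof (intro exI allI impI ballI)
    fix n P assume n: "n0 <= n" and P: "P \<in> S"
    have "real n0 * e <= real n * e" using n e(1) by simp
    hence "V r (f P ^ n)" using n0 by (intro N_power_le[OF e(2)[OF P]]) simp
    thus "dist (f P ^ n) 0 < d" using r V_dist[of r "f P ^ n" 0] by simp
   qed
  qed
 qed
 thus ?thesis by (auto simp: top_nilpotent_def affinoid_iff)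
qed

lemma small_PB: "apx S f ==> small S f ==> PB S f"
 unfolding PB_def small_def using N_mono less_imp_le by blast

lemma small_add: assumes "small S f" "small S g" shows "small S (%P. f P + g P)"
proof -
 obtain d e where d: "0 < d" "!!P. P \<in> S ==> V d (f P)" and e: "0 < e" "!!P. P \<in> S ==> V e (g P)"
  using assms by (auto simp: small_def)
 have "V (min d e) (f P + g P)" if "P \<in> S" for P
  by (rule N_add[OF N_mono[OF d(2)[OF that]] N_mono[OF e(2)[OF that]]]) auto
 thus ?thesis using d(1) e(1) unfolding small_def by (intro exI[of _ "min d e"]) simp
qed

lemma small_mult: assumes "small S f" "!!P. P \<in> S ==> V 0 (g P)" shows "small S (%P. f P * g P)"
 using assms N_mult_right unfolding small_def by blast
lemma small_const: "V 0 a ==> rd a = 0 ==> small S (%_. a)"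
 using rd_0_iff[of a] by (auto simp: small_def mC_iff)
lemma small_0: "small S (%_. 0)" by (rule small_const) simp_all

lemma PB_const: "V 0 a ==> PB S (%_. a)" by (simp add: PB_def apx_const)
lemma PB_add: "PB S f ==> PB S g ==> PB S (%P. f P + g P)" by (simp add: PB_def apx_add N_add)
lemma PB_uminus: "PB S f ==> PB S (%P. - f P)" by (simp add: PB_def apx_uminus N_uminus)
lemma PB_diff: "PB S f ==> PB S g ==> PB S (%P. f P - g P)" by (simp add: PB_def apx_diff N_diff)

context
 fixes S :: "'c pointset" assumes Sb: "bpts S"
begin

lemma PB_mult: "PB S f ==> PB S g ==> PB S (%P. f P * g P)" by (simp add: PB_def apx_mult[OF Sb] N_mult_left)

abbreviation "PR \<equiv> power_bounded_ring S"

lemma pbr_simps: "carrier (PR) = power_bounded S"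
 "mult (PR) f g = (\<lambda>P\<in>S. f P * g P)" "one (PR) = (\<lambda>P\<in>S. 1)"
 "zero (PR) = (\<lambda>P\<in>S. 0)" "add (PR) f g = (\<lambda>P\<in>S. f P + g P)"
 by (simp_all add: power_bounded_ring_def)

lemma pb_restrict: "PB S f ==> restrict f S \<in> power_bounded S" by (simp add: power_bounded_iff PB_restrict)
lemma ext_eqI: "f \<in> extensional S ==> g \<in> extensional S ==> (!!P. P \<in> S ==> f P = g P) ==> f = g"
 by (rule extensionalityI) auto

lemma pbr_cring: "cring (PR)"
proof (rule cringI)
 note i = power_bounded_iff PB_restrict
 show "abelian_group (PR)"
 proof (rule abelian_groupI; unfold pbr_simps)
  fix f assume f: "f \<in> power_bounded S"
  show "\<exists>g\<in>power_bounded S. (\<lambda>P\<in>S. g P + f P) = (\<lambda>P\<in>S. 0)"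
   by (rule bexI[of _ "\<lambda>P\<in>S. - f P"]) (use f in "auto simp: i PB_uminus")
 qed (auto simp: i PB_add PB_const add_ac intro!: ext_eqI restrict_ext)
 show "comm_monoid (PR)" by (rule comm_monoidI; unfold pbr_simps)
   (auto simp: i PB_mult PB_const V_1 mult_ac intro!: ext_eqI restrict_ext)
 fix f g h
 show "(f \<oplus>\<^bsub>PR\<^esub> g) \<otimes>\<^bsub>PR\<^esub> h
   = f \<otimes>\<^bsub>PR\<^esub> h \<oplus>\<^bsub>PR\<^esub> g \<otimes>\<^bsub>PR\<^esub> h"
  unfolding pbr_simps by (auto simp: distrib_right)
qed

lemma a_inv_eq: assumes "f \<in> power_bounded S" shows "a_inv (PR) f = (\<lambda>P\<in>S. - f P)"
proof -
 interpret cring "PR" by (rule pbr_cring)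
 have "PB S f" using assms by (simp add: power_bounded_iff)
 hence g: "(\<lambda>P\<in>S. - f P) \<in> power_bounded S" by (intro pb_restrict PB_uminus)
 have "(\<lambda>P\<in>S. - f P) \<oplus>\<^bsub>PR\<^esub> f = \<zero>\<^bsub>PR\<^esub>"
  unfolding pbr_simps by auto
 thus ?thesis using minus_equality[of "\<lambda>P\<in>S. - f P" f] g assms by (simp add: pbr_simps)
qed

lemma nil_ideal: "ideal (top_nilpotent S) (PR)"
proof (rule idealI)
 interpret cring "PR" by (rule pbr_cring)
 note i = power_bounded_iff top_nilpotent_iff
 show "ring (PR)" by (rule ring_axioms)
 show "subgroup (top_nilpotent S) (add_monoid (PR))"
 proof (rule group.subgroupI[OF a_group])
  show "top_nilpotent S \<subseteq> carrier (add_monoid (PR))" using small_PB by (auto simp: pbr_simps i)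
  have "(\<lambda>P\<in>S. 0) \<in> top_nilpotent S" unfolding i
   using small_0[of S] by (simp add: apx_restrict apx_const small_def)
  thus "top_nilpotent S ~= {}" by blast
  fix f assume f: "f \<in> top_nilpotent S"
  have fp: "f \<in> power_bounded S" using f small_PB by (auto simp: i)
  have "inv\<^bsub>add_monoid (PR)\<^esub> f = (\<lambda>P\<in>S. - f P)" using a_inv_eq[OF fp] by (simp add: a_inv_def)
  moreover have "(\<lambda>P\<in>S. - f P) \<in> top_nilpotent S"
   using f N_uminus by (auto simp: i apx_restrict apx_uminus small_def)
  ultimately show "inv\<^bsub>add_monoid (PR)\<^esub> f \<in> top_nilpotent S" by simp
  fix g assume g: "g \<in> top_nilpotent S"
  have "small S (%P. f P + g P)" "apx S (%P. f P + g P)" using f g by (auto simp: i intro: small_add apx_add)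
  thus "f \<otimes>\<^bsub>add_monoid (PR)\<^esub> g \<in> top_nilpotent S"
   by (simp add: pbr_simps i apx_restrict small_def)
 qed
 fix f g assume f: "f \<in> top_nilpotent S" and g: "g \<in> carrier (PR)"
 have "small S (%P. f P * g P)" "apx S (%P. f P * g P)"
  using f g by (auto simp: pbr_simps i PB_def intro: small_mult apx_mult[OF Sb])
 thus 1: "f \<otimes>\<^bsub>PR\<^esub> g \<in> top_nilpotent S" by (simp add: pbr_simps i apx_restrict small_def)
 have "f \<in> carrier (PR)" using f small_PB by (auto simp: pbr_simps i)
 thus "g \<otimes>\<^bsub>PR\<^esub> f \<in> top_nilpotent S" using 1 g by (simp add: m_comm)
qed

lemma reduction_cring: "cring (reduction S)"
 unfolding reduction_def by (rule ideal.quotient_is_cring[OF nil_ideal pbr_cring])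
lemma rc_hom: "(%f. top_nilpotent S +>\<^bsub>PR\<^esub> f) \<in> ring_hom (PR) (reduction S)"
 unfolding reduction_def by (rule ideal.rcos_ring_hom[OF nil_ideal])
lemma rc_carrier: "PB S f ==> red_class S f \<in> carrier (reduction S)"
 using ring_hom_memE(1)[OF rc_hom] pb_restrict by (simp add: red_class_def pbr_simps)

lemma rc_mult: assumes "PB S f" "PB S g"
 shows "red_class S f \<otimes>\<^bsub>reduction S\<^esub> red_class S g = red_class S (%P. f P * g P)"
proof -
 have "restrict (%P. f P * g P) S = restrict f S \<otimes>\<^bsub>PR\<^esub> restrict g S"
  unfolding pbr_simps by auto
 thus ?thesis using ring_hom_memE(2)[OF rc_hom] pb_restrict assms by (simp add: red_class_def pbr_simps(1))
qed

lemma rc_add: assumes "PB S f" "PB S g"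
 shows "red_class S f \<oplus>\<^bsub>reduction S\<^esub> red_class S g = red_class S (%P. f P + g P)"
proof -
 have "restrict (%P. f P + g P) S = restrict f S \<oplus>\<^bsub>PR\<^esub> restrict g S"
  unfolding pbr_simps by auto
 thus ?thesis using ring_hom_memE(3)[OF rc_hom] pb_restrict assms by (simp add: red_class_def pbr_simps(1))
qed

lemma rc_one: "red_class S (%_. 1) = \<one>\<^bsub>reduction S\<^esub>"
 using ring_hom_memE(4)[OF rc_hom] by (simp add: red_class_def pbr_simps)

lemma rc_diff: assumes "PB S f" "PB S g"
 shows "red_class S f \<ominus>\<^bsub>reduction S\<^esub> red_class S g = red_class S (%P. f P - g P)"
proof -
 interpret R: cring "reduction S" by (rule reduction_cring)
 note c = rc_carrier[OF assms(1)] rc_carrier[OF assms(2)] rc_carrier[OF PB_diff[OF assms]]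
 have "red_class S (%P. f P - g P) \<oplus>\<^bsub>reduction S\<^esub> red_class S g = red_class S f"
  using rc_add[OF PB_diff[OF assms] assms(2)] by simp
 hence "red_class S f \<ominus>\<^bsub>reduction S\<^esub> red_class S g
   = red_class S (%P. f P - g P) \<oplus>\<^bsub>reduction S\<^esub> red_class S g \<ominus>\<^bsub>reduction S\<^esub> red_class S g" by simp
 also have "... = red_class S (%P. f P - g P)" using c by (simp add: R.minus_eq R.a_assoc R.r_neg)
 finally show ?thesis .
qed

lemma rc_eqI: assumes "PB S f" "PB S g" "small S (%P. f P - g P)" shows "red_class S f = red_class S g"
proof -
 interpret R: cring "PR" by (rule pbr_cring)
 have c: "restrict f S \<in> carrier (PR)" "restrict g S \<in> carrier (PR)"
  using assms pb_restrict by (simp_all add: pbr_simps)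
 have "restrict f S \<ominus>\<^bsub>PR\<^esub> restrict g S = (\<lambda>P\<in>S. f P - g P)"
  using a_inv_eq c by (auto simp: pbr_simps a_minus_def)
 moreover have "(\<lambda>P\<in>S. f P - g P) \<in> top_nilpotent S"
  using assms by (simp add: top_nilpotent_iff apx_restrict PB_def apx_diff small_def)
 ultimately show ?thesis using R.quotient_eq_iff_same_a_r_cos[OF nil_ideal c] by (simp add: red_class_def)
qed

lemma rc_surj: assumes "X \<in> carrier (reduction S)" obtains f where "f \<in> power_bounded S" "PB S f" "X = red_class S f"
proof -
 obtain f where f: "f \<in> carrier (PR)" "X = top_nilpotent S +>\<^bsub>PR\<^esub> f"
  using assms by (auto simp: reduction_def FactRing_def A_RCOSETS_def')
 hence "f \<in> power_bounded S" by (simp add: pbr_simps)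
 thus ?thesis using that[of f] f(2) by (simp add: power_bounded_iff red_class_def extensional_restrict)
qed

lemma rc_mem: assumes f: "PB S f" and g: "g \<in> red_class S f"
 shows "PB S g" "small S (%P. g P - f P)"
proof -
 obtain h where h: "h \<in> top_nilpotent S" "g = h \<oplus>\<^bsub>PR\<^esub> restrict f S"
  using g by (auto simp: red_class_def a_r_coset_def')
 have e: "g P = h P + f P" if "P \<in> S" for P using that by (simp add: h(2) pbr_simps)
 have "PB S h" "small S h" using h(1) small_PB by (auto simp: top_nilpotent_iff)
 hence "PB S (%P. h P + f P)" by (intro PB_add f)
 thus "PB S g" using apx_cong[of S "%P. h P + f P" g] e by (simp add: PB_def)
 show "small S (%P. g P - f P)" using \<open>small S h\<close> by (simp add: small_def e)
qed

lemma rc_nonempty: assumes f: "PB S f" shows "restrict f S \<in> red_class S f"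
proof -
 have "(\<lambda>P\<in>S. 0) \<in> top_nilpotent S"
  using small_0[of S] by (simp add: top_nilpotent_iff apx_restrict apx_const small_def)
 moreover have "restrict f S = (\<lambda>P\<in>S. 0) \<oplus>\<^bsub>PR\<^esub> restrict f S"
  unfolding pbr_simps by auto
 ultimately show ?thesis unfolding red_class_def a_r_coset_def' by blast
qed

end

lemma induces_exists:
 assumes S: "bpts S" and T: "bpts T" and gT: "!!P. P \<in> S ==> g P \<in> T"
  and g: "apx S (%P. fst (g P))" "apx S (%P. fst (snd (g P)))" "apx S (%P. snd (snd (g P)))"
 obtains PP where "induces_on_reduction g S T PP" "!!f. PB T f ==> PP (red_class T f) = red_class S (%P. f (g P))"
  "!!f. PB T f ==> PB S (%P. f (g P))"
proof -
 have ac: "apx S (%P. f (g P))" if "apx T f" for f by (rule apx_compose[OF S g gT that])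
 have pc: "PB S (%P. f (g P))" if "PB T f" for f using ac that gT by (simp add: PB_def)
 have sc: "small S (%P. f (g P))" if "small T f" for f using that gT by (auto simp: small_def)
 \<comment> \<open>Any representative may be chosen: two of them differ by a uniformly small
   function, which remains so after composition with g.\<close>
 define PP where "PP X = red_class S ((SOME f. f \<in> X) \<circ> g)" for X
 have P: "PP (red_class T f) = red_class S (%P. f (g P))" if f: "PB T f" for f
 proof -
  define f' where "f' = (SOME f'. f' \<in> red_class T f)"
  have "f' \<in> red_class T f" unfolding f'_def by (rule someI[of "%f'. f' \<in> red_class T f", OF rc_nonempty[OF T f]])
  note f' = rc_mem[OF T f this]
  have "red_class S (%P. f' (g P)) = red_class S (%P. f (g P))"
   by (rule rc_eqI[OF S pc[OF f'(1)] pc[OF f] sc[OF f'(2)]])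
  thus ?thesis by (simp add: PP_def f'_def comp_def)
 qed
 have hom: "PP \<in> ring_hom (reduction T) (reduction S)"
 proof (rule ring_hom_memI)
  fix X assume "X \<in> carrier (reduction T)"
  then obtain f where f: "PB T f" "X = red_class T f" by (rule rc_surj[OF T])
  show "PP X \<in> carrier (reduction S)" unfolding f(2) P[OF f(1)] by (rule rc_carrier[OF S pc[OF f(1)]])
  fix Y assume "Y \<in> carrier (reduction T)"
  then obtain h where h: "PB T h" "Y = red_class T h" by (rule rc_surj[OF T])
  show "PP (X \<otimes>\<^bsub>reduction T\<^esub> Y) = PP X \<otimes>\<^bsub>reduction S\<^esub> PP Y"
   unfolding f(2) h(2) rc_mult[OF T f(1) h(1)] P[OF f(1)] P[OF h(1)] P[OF PB_mult[OF T f(1) h(1)]]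
    rc_mult[OF S pc[OF f(1)] pc[OF h(1)]] ..
  show "PP (X \<oplus>\<^bsub>reduction T\<^esub> Y) = PP X \<oplus>\<^bsub>reduction S\<^esub> PP Y"
   unfolding f(2) h(2) rc_add[OF T f(1) h(1)] P[OF f(1)] P[OF h(1)] P[OF PB_add[OF f(1) h(1)]]
    rc_add[OF S pc[OF f(1)] pc[OF h(1)]] ..
 next
  show "PP \<one>\<^bsub>reduction T\<^esub> = \<one>\<^bsub>reduction S\<^esub>"
   unfolding rc_one[OF T, symmetric] P[OF PB_const[OF V_1]] by (rule rc_one[OF S])
 qed
 have "induces_on_reduction g S T PP" unfolding induces_on_reduction_def
 proof (intro conjI ballI hom)
  show "g ` S \<subseteq> T" using gT by blast
  show "restrict (f \<circ> g) S \<in> affinoid_funs S" if "f \<in> affinoid_funs T" for f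
   using that ac[of f] by (simp add: affinoid_iff apx_restrict comp_def)
  show "PP (red_class T f) = red_class S (f \<circ> g)" if "f \<in> power_bounded T" for f
   using P[of f] that by (simp add: power_bounded_iff comp_def)
 qed
 from that[OF this P pc] show ?thesis by blast
qed

definition lft :: "'k => 'c" where "lft r = (SOME z. reduces_to L z r)"

lemma lft: "V 0 (lft r)" "rd (lft r) = r"
proof -
 obtain z where "V 0 z" "rd z = r" by (rule rd_exists)
 hence "reduces_to L z r" by (simp add: reduces_to_def OC_iff)
 hence "reduces_to L (lft r) r" unfolding lft_def by (rule someI)
 thus "V 0 (lft r)" "rd (lft r) = r" by (simp_all add: reduces_to_def OC_iff)
qed

lemma red_const_eq: "red_const L S r = red_class S (%_. lft r)" by (simp add: red_const_def lft_def)

end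

section \<open>The coordinates as power-bounded functions\<close>

context lt_choice
begin

lemma Xaff_bpts: assumes "i \<in> comp_index L" "j \<in> S00 L i" shows "bpts (Xaff L i j)" unfolding bpts_def
proof
 fix P assume "P \<in> Xaff L i j"
 note p = Xaff_point[OF assms this]
 have k: "kap L ~= 0" "V 0 (kap L)" unfolding gam_eqs using kap1_nz U_V0[OF U_kap1] by auto
 have "V 0 (fst P)" using N_mult_left[OF k(2) p(4)] k(1) by (simp add: fx_def)
 moreover have "V 0 (fst (snd P))" using N_mult_left[OF k(2) p(5)] k(1) by (simp add: fy_def)
 moreover have "V 0 (snd (snd P))" by (rule N_mono[OF p(3)]) simp
 ultimately show "V 0 (fst P) & V 0 (fst (snd P)) & V 0 (snd (snd P))" by simp
qed

lemma coords_PB: assumes "i \<in> comp_index L" "j \<in> S00 L i"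
 shows "PB (Xaff L i j) (coord_a L i)" "PB (Xaff L i j) (coord_z1 L j)"
proof -
 note b = Xaff_bpts[OF assms]
 have xy: "apx (Xaff L i j) (%P. fx L P)" "apx (Xaff L i j) (%P. fy L P)"
  unfolding fx_def fy_def by (intro apx_divide apx_coords)+
 have "apx (Xaff L i j) (%P. coord_a L i P)" unfolding coord_a_eq acoord_def
  by (intro apx_divide apx_diff apx_mult[OF b] apx_power[OF b] xy apx_const)
 moreover have "apx (Xaff L i j) (%P. coord_z1 L j P)" unfolding coord_z1_eq zcoord_def
  by (intro apx_divide apx_diff xy apx_const)
 ultimately show "PB (Xaff L i j) (coord_a L i)" "PB (Xaff L i j) (coord_z1 L j)"
  using coords_V0[OF assms] by (simp_all add: PB_def)
qed

end

section \<open>The action on the coordinate rings of the reductions\<close>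

context lt_act
begin

lemma act_apx:
 shows "apx (Xaff L i j) (%P. fst (act P))" "apx (Xaff L i j) (%P. fst (snd (act P)))" "apx (Xaff L i j) (%P. snd (snd (act P)))"
proof -
 define S where "S = Xaff L i j"
 have b: "bpts S" unfolding S_def by (rule Xaff_bpts[OF i j])
 have u: "V th (snd (snd P))" if "P \<in> S" for P using Xaff_point(3)[OF i j] that by (simp add: S_def)
 note c = ab u
 have k: "kap L ~= 0" unfolding gam_eqs by (rule kap1_nz)
 have X: "V (real q * tt) (fst P)" "V (real q * tt) (fst (snd P))" if P: "P \<in> S" for P
 proof -
  note p = Xaff_point[OF i j P[unfolded S_def]]
  have "U (q + 0) (kap L * fx L P)" "U (q + 0) (kap L * fy L P)" unfolding gam_eqs
   using U_mult[OF U_kap1[of q], of 0] p(4,5) by (simp_all add: U_0)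
  thus "V (real q * tt) (fst P)" "V (real q * tt) (fst (snd P))" using k by (simp_all add: U_def fx_def fy_def)
 qed
 have xi: "0 < real q * tt" using tt(1) q3 by simp
 have e: "(peval (hnew w v (snd (snd P))) (fst P), peval (hnew w v (snd (snd P))) (fst (snd P)), unew w v (snd (snd P))) = act P"
  if "P \<in> S" for P using act_eq[OF u[OF that]] by simp
 show "apx (Xaff L i j) (%P. fst (act P))" unfolding S_def[symmetric]
  by (rule apx_cong[OF apx_peval_hnew[OF b c apx_coords(1) X(1) xi]]) (simp_all add: e[symmetric])
 show "apx (Xaff L i j) (%P. fst (snd (act P)))" unfolding S_def[symmetric]
  by (rule apx_cong[OF apx_peval_hnew[OF b c apx_coords(2) X(2) xi]]) (simp_all add: e[symmetric])
 show "apx (Xaff L i j) (%P. snd (snd (act P)))" unfolding S_def[symmetric]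
  by (rule apx_cong[OF apx_unew[OF b c]]) (simp_all add: e[symmetric])
qed

lemma action_on_reduction: assumes R: "R = reduction (Xaff L i j)"
 shows "\<exists>PP. induces_on_reduction (actD L b) (Xaff L i j) (Xaff L ib jb) PP &
  PP (red_class (Xaff L ib jb) (coord_a L ib)) =
   red_const L (Xaff L i j) (inverse (A0 ^ (q + 1))) \<otimes>\<^bsub>R\<^esub>
    ((red_class (Xaff L i j) (coord_a L i) \<ominus>\<^bsub>R\<^esub>
      (red_const L (Xaff L i j) (B0 / A0 * fst i) \<otimes>\<^bsub>R\<^esub> red_class (Xaff L i j) (coord_z1 L j)))
     \<oplus>\<^bsub>R\<^esub> red_const L (Xaff L i j) (A1 / A0 * fst i)) &
  PP (red_class (Xaff L ib jb) (coord_z1 L jb)) =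
   red_const L (Xaff L i j) (A0 ^ (q - 1)) \<otimes>\<^bsub>R\<^esub>
    (red_class (Xaff L i j) (coord_z1 L j) \<ominus>\<^bsub>R\<^esub> red_const L (Xaff L i j) ((B0 / A0) ^ q))"
proof -
 define S T where "S = Xaff L i j" "T = Xaff L ib jb"
 note ST = S_T_def
 have bS: "bpts S" and bT: "bpts T" unfolding ST by (rule Xaff_bpts[OF i j], rule Xaff_bpts[OF ib_facts(3) jb_S00])
 note pS = coords_PB[OF i j, folded ST] note pT = coords_PB[OF ib_facts(3) jb_S00, folded ST]
 obtain PP where PP: "induces_on_reduction act S T PP" "!!f. PB T f ==> PP (red_class T f) = red_class S (%P. f (act P))"
  "!!f. PB T f ==> PB S (%P. f (act P))"
  using induces_exists[OF bS bT act_point(1)[folded ST] act_apx[folded ST]] by blast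
 note pl = PB_const[OF lft(1)]
 define r1 r2 r3 where "r1 = inverse (A0 ^ (q + 1))" "r2 = B0 / A0 * fst i" "r3 = A1 / A0 * fst i"
 note r = r1_r2_r3_def
 define s1 s2 where "s1 = A0 ^ (q - 1)" "s2 = (B0 / A0) ^ q"
 note s = s1_s2_def
 \<comment> \<open>F and G are the asserted formulas with constants lifted to integral elements. The
   actual functions have other constants with the same residues, which changes the classes by small
   functions only.\<close>
 define F where "F P = lft r1 * ((coord_a L i P - lft r2 * coord_z1 L j P) + lft r3)" for P
 define G where "G P = lft s1 * (coord_z1 L j P - lft s2)" for P
 note PBi = PB_mult[OF bS] PB_add PB_diff pl pS
 have PF: "PB S F" "PB S G" unfolding F_def G_def by (intro PBi)+
 have aV: "V 0 (coord_a L i P)" "V 0 (coord_z1 L j P)" if "P \<in> S" for P using pS that by (auto simp: PB_def)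
 note rs = residues
 note sc = N_diff N_add N_mult_left kk_facts(1) lft rs rd_diff rd_add rd_mult r s
 have sml: "small S (%P. a' P - a P)" if "!!P. P \<in> S ==> U 1 (a' P - a P)" for a' a :: "'c fun3"
  unfolding small_def by (intro exI[of _ "real 1 * tt"]) (use that tt(1) in "auto simp: U_def")
 have 1: "small S (%P. coord_a L ib (act P) - (kk * coord_a L i P + c * v ^ q * t * coord_z1 L j P + Ma * t))"
  by (rule sml) (rule act_point(2), simp add: ST)
 have k1: "small S (%_. kk - lft r1)"
 by (rule small_const) (simp_all add: sc)
 have k2: "small S (%_. c * v ^ q * t + lft r1 * lft r2)"
 by (rule small_const) (simp_all add: sc)
 have k3: "small S (%_. Ma * t - lft r1 * lft r3)"
 by (rule small_const) (simp_all add: sc)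
 have "small S (%P. (kk - lft r1) * coord_a L i P + (c * v ^ q * t + lft r1 * lft r2) * coord_z1 L j P + (Ma * t - lft r1 * lft r3))"
  by (rule small_add[OF small_add[OF small_mult[OF k1 aV(1)] small_mult[OF k2 aV(2)]] k3])
 from small_add[OF 1 this] have "small S (%P. coord_a L ib (act P) - F P)"
  by (simp add: F_def algebra_simps)
 hence EF: "PP (red_class T (coord_a L ib)) = red_class S F"
  unfolding PP(2)[OF pT(1)] by (rule rc_eqI[OF bS PP(3)[OF pT(1)] PF(1)])
 have 2: "small S (%P. coord_z1 L jb (act P) - (c * coord_z1 L j P + v) / c ^ q)"
  by (rule sml) (rule act_point(3), simp add: ST)
 have k1: "small S (%_. c / c ^ q - lft s1)"
 by (rule small_const) (simp_all add: sc)
 have k2: "small S (%_. v / c ^ q + lft s1 * lft s2)"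
 by (rule small_const) (simp_all add: sc)
 have "small S (%P. (c / c ^ q - lft s1) * coord_z1 L j P + (v / c ^ q + lft s1 * lft s2))"
  by (rule small_add[OF small_mult[OF k1 aV(2)] k2])
 from small_add[OF 2 this] have "small S (%P. coord_z1 L jb (act P) - G P)"
  by (simp add: G_def algebra_simps add_divide_distrib)
 hence EG: "PP (red_class T (coord_z1 L jb)) = red_class S G"
  unfolding PP(2)[OF pT(2)] by (rule rc_eqI[OF bS PP(3)[OF pT(2)] PF(2)])
 have "red_class S F = red_const L S r1 \<otimes>\<^bsub>reduction S\<^esub> ((red_class S (coord_a L i) \<ominus>\<^bsub>reduction S\<^esub>
   (red_const L S r2 \<otimes>\<^bsub>reduction S\<^esub> red_class S (coord_z1 L j))) \<oplus>\<^bsub>reduction S\<^esub> red_const L S r3)"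
  unfolding red_const_eq F_def by (simp only: rc_mult[OF bS] rc_diff[OF bS] rc_add[OF bS] PBi)
 moreover have "red_class S G = red_const L S s1 \<otimes>\<^bsub>reduction S\<^esub> (red_class S (coord_z1 L j) \<ominus>\<^bsub>reduction S\<^esub> red_const L S s2)"
  unfolding red_const_eq G_def by (simp only: rc_mult[OF bS] rc_diff[OF bS] PBi)
 ultimately show ?thesis using PP(1) EF EG unfolding R ST[symmetric] r[symmetric] s[symmetric] act_def by auto
qed

end

theorem proposition4p4:
  fixes L :: "('c::{field, complete_space}, 'k::field) lt_data"
    and a0 b0 a1 :: 'c and b :: "'k fps" and i j :: "'k \<times> 'k"
  assumes "lt_setup L" and "lt_choices L"
    and "a0 \<in> muE L" and "b0 \<in> muE L \<union> {0}" and "a1 \<in> muE L \<union> {0}"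
    and "b \<in> OD_units L" and "eq_mod_phi3 L b (OD_elem L a0 b0 a1)"
    and "i \<in> comp_index L" and "j \<in> S00 L i"
  shows "let A0 = redn L a0; B0 = redn L b0; A1 = redn L a1; \<zeta> = fst i; q = qF L;
             ib = act_index L b i;
             jb = (fst j * inverse A0, snd j * inverse A0);
             S = Xaff L i j; T = Xaff L ib jb; R = reduction S;
             \<alpha> = red_class S (coord_a L i); z = red_class S (coord_z1 L j);
             k = red_const L S
         in jb \<in> S00 L ib \<and>
            (\<exists>\<Phi>. induces_on_reduction (actD L b) S T \<Phi> \<and>
               \<Phi> (red_class T (coord_a L ib)) =
                 k (inverse (A0 ^ (q + 1))) \<otimes>\<^bsub>R\<^esub>
                   ((\<alpha> \<ominus>\<^bsub>R\<^esub> (k (B0 / A0 * \<zeta>) \<otimes>\<^bsub>R\<^esub> z)) \<oplus>\<^bsub>R\<^esub> k (A1 / A0 * \<zeta>)) \<and>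
               \<Phi> (red_class T (coord_z1 L jb)) =
                 k (A0 ^ (q - 1)) \<otimes>\<^bsub>R\<^esub> (z \<ominus>\<^bsub>R\<^esub> k ((B0 / A0) ^ q)))"
proof -
 interpret lt_choice L by unfold_locales (rule assms(1), rule assms(2))
 \<comment> \<open>b0 and a1 may be 0, and 0 also satisfies the fixed point equation of the roots of
   unity.\<close>
 have q0: "(0::'c) ^ q ^ 2 = 0" using q3 by simp
 have mu: "a0 ^ q ^ 2 = a0" "b0 ^ q ^ 2 = b0" "a1 ^ q ^ 2 = a1" "a0 ~= 0"
 proof -
  show "a0 ^ q ^ 2 = a0" "a0 ~= 0" using assms(3) unfolding muE_iff by blast+
  have "z ^ q ^ 2 = z" if "z \<in> muE L \<union> {0}" for z
   using that by (elim UnE) (simp_all only: muE_iff q0 singleton_iff)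
  thus "b0 ^ q ^ 2 = b0" "a1 ^ q ^ 2 = a1" using assms(4,5) by blast+
 qed
 have bD: "b \<in> OD L" using assms(6) by (simp add: OD_units_def)
 obtain \<alpha>1 \<beta>1 where ud: "unit_data b a0 b0 a1 \<alpha>1 \<beta>1" by (rule unit_form[OF bD assms(7) mu(1-3)])
 obtain \<alpha> \<beta> where inv: "KO \<alpha>" "KO \<beta>" "fps_inv b = sbar \<alpha> \<beta>" "rd \<alpha> = inverse (rd a0)"
   "rd \<beta> = - (rd b0 ^ q / rd a0 ^ (q + 1))"
   "sbar \<alpha> \<beta> $ (q ^ 2) = rd b0 ^ (q + 1) / rd a0 ^ (q + 2) - rd a1 / rd a0 ^ 2"
  by (rule inverse_form[OF assms(6,7) mu])
 interpret lt_act L a0 b0 a1 \<alpha> \<beta> \<alpha>1 \<beta>1 b i j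
  by unfold_locales (rule mu ud inv assms)+
 show ?thesis using jb_S00 action_on_reduction[OF refl] unfolding Let_def ib_def jb_def by blast
qed

end
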